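(* Let $\omega$ be a pure, split, $\alpha$-invariant and translation invariant state on $\mathcal A$. Suppose that the graded $W^*$-$(G,\mathfrak p)$-dynamical system $(\pi_\omega(\mathcal A_R)'',\mathrm{Ad}_{\hat\Gamma_\omega},\hat\alpha_\omega)$ is equivalent to $(\mathcal R_{1,\mathcal K},\mathrm{Ad}_{\Gamma_{\mathcal K}},\mathrm{Ad}_{V_g})\in\mathcal S_1$ (with associated homomorphism $\mathfrak q:G\to\mathbb Z_2$ and associated projective representation $V^{(0)}$ on $\mathcal K$) via a $*$-isomorphism $\iota:\pi_\omega(\mathcal A_R)''\to\mathcal R_{1,\mathcal K}$. Let $\rho=\iota\circ\hat\beta_{S_1}|_{\pi_\omega(\mathcal A_R)''}\circ\iota^{-1}$ be the $*$-endomorphism of $\mathcal R_{1,\mathcal K}$ induced by translation, so that $\iota\circ\pi_\omega\circ\beta_{S_1}(A)=\rho\circ\iota\circ\pi_\omega(A)$ for $A\in\mathcal A_R$. Then there is $\sigma_0\in\{0,1\}$ such that $$\rho(1_{\mathcal K}\otimes\sigma_x)=(-1)^{\sigma_0}\,\iota\circ\pi_\omega\big(\boldsymbol\Gamma(-1)\big)\,(1_{\mathcal K}\otimes\sigma_x),$$ and there are isometries $\{S_\mu\}_{\mu\in\mathcal P}$ on $\mathcal K$ with $S_\nu^*S_\mu=\delta_{\mu,\nu}1_{\mathcal K}$ such that, with $\hat S_\mu:=S_\mu\otimes\sigma_z^{\sigma_0+|\mu|}$, $$\rho\circ\iota\circ\pi_\omega(A)=\sum_{\mu\in\mathcal P}\mathrm{Ad}_{\hat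 S_\mu}\circ\iota\circ\pi_\omega(A),\qquad A\in\mathcal A_R,$$ and $$\iota\circ\pi_\omega\big(E^{(0)}_{\mu_0,\nu_0}E^{(1)}_{\mu_1,\nu_1}\cdots E^{(N)}_{\mu_N,\nu_N}\big)=(-1)^{\sum_{k=1}^N(|\mu_k|+|\nu_k|)\sum_{j=0}^{k-1}(\sigma_0+|\nu_j|)}S_{\mu_0}\cdots S_{\mu_N}S_{\nu_N}^*\cdots S_{\nu_0}^*\otimes\sigma_x^{\sum_{i=0}^N(|\mu_i|+|\nu_i|)}$$ for all $N\in\mathbb N\cup\{0\}$ and $\mu_0,\dots,\mu_N,\nu_0,\dots,\nu_N\in\mathcal P$. Furthermore, with $T_{\hat{\mathbf S}}(x)=\sum_{\mu\in\mathcal P}\hat S_\mu x\hat S_\mu^*$, $$\sigma\text{-weak-}\lim_{N\to\infty}T_{\hat{\mathbf S}}^N\circ\iota(x)=\langle\Omega_\omega,x\Omega_\omega\rangle\,1_{\mathcal K\otimes\mathbb C^2},\qquad x\in\pi_\omega(\mathcal A_R)''.$$ For each $g\in G$ there is $c_g\in\mathbb T$ such that for all $\nu\in\mathcal P$ $$(-1)^{\mathfrak q(g)|\nu|}\sum_{\mu\in\mathcal P}\langle\psi_\mu,\boldsymbol\Gamma(U_g)\psi_\nu\rangle S_\mu=c_gV_g^{(0)}S_\nu(V_g^{(0)})^*.$$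
   Context: **CAR algebra and symmetry.** Fix $d\in\mathbb N$, a finite group $G$ and a homomorphism $\mathfrak p:G\to\mathbb Z_2=\{0,1\}$ (additive). $\mathcal A$ is the CAR algebra over $l^2(\mathbb Z)\otimes\mathbb C^d$, generated by $a(f)$ (antilinear in $f$), $\{a(f_1),a(f_2)\}=0$, $\{a(f_1),a(f_2)^*\}=\langle f_1,f_2\rangle$. For $X\subset\mathbb Z$, $\mathcal A_X\subset\mathcal A$ is the CAR algebra over $l^2(X)\otimes\mathbb C^d$; $\mathcal A_R=\mathcal A_{\mathbb Z_{\ge0}}$. For a unitary/anti-unitary $w$, $\beta_w$ is the linear/anti-linear $*$-automorphism with $\beta_w(a(f))=a(wf)$; $\Theta=\beta_{-1}$ is the parity; $\beta_{S_x}$ ($x\in\mathbb Z$) is translation by $x$, where here $S_x$ denotes the shift by $x$ on $l^2(\mathbb Z)$ tensored with $1_{\mathbb C^d}$ (not to be confused with the isometries $S_\mu$, $\mu\in\mathcal P$). A projective unitary/anti-unitary representation of $G$ relative to $\mathfrak p$ is a family $V_g$, unitary if $\mathfrak p(g)=0$, anti-unitary if $\mathfrak p(g)=1$, with $V_gV_h=\upsilon(g,h)V_{gh}$, $\upsilon(g,h)\in U(1)$, $\upsilon(e,g)=\upsilon(g,e)=1$. Fix such a representation $U$ on $\mathbb C^d$ and let $\alpha_g=\beta_{\bigoplus_{\mathbb Z}U_g}$; $\alpha$ is taken to be an action of $G$, $\alpha_g\alpha_h=\alpha_{gh}$. A state $\varphi$ is $\alpha$-invariant if for all $A$: $\varphi(\alpha_g(A))=\varphi(A)$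 when $\mathfrak p(g)=0$, and $\varphi(\alpha_g(A^* ))=\varphi(A)$ when $\mathfrak p(g)=1$; translation invariant if $\varphi\circ\beta_{S_x}=\varphi$ for all $x$ (then it is $\Theta$-invariant). A pure $\Theta$-invariant state $\varphi$ is split if $\pi_{\varphi|_{\mathcal A_R}}(\mathcal A_R)''$ is type I. $(\mathcal H_\varphi,\pi_\varphi,\Omega_\varphi)$ is the GNS triple; $\hat\Gamma_\varphi\pi_\varphi(A)\Omega_\varphi=\pi_\varphi(\Theta(A))\Omega_\varphi$; $\hat\alpha_\varphi$ is the extension of $\alpha|_{\mathcal A_R}$ to $\pi_\varphi(\mathcal A_R)''$. For translation invariant $\omega$, $\hat\beta_{S_1}$ is the automorphism of $\pi_\omega(\mathcal A)''$ with $\hat\beta_{S_1}\circ\pi_\omega=\pi_\omega\circ\beta_{S_1}$; it maps $\pi_\omega(\mathcal A_R)''$ into itself. **Fock basis.** $\boldsymbol\Gamma(w)$ is the (unitary/anti-unitary) second quantization of a unitary/anti-unitary $w$ of $\mathbb C^d$ on the fermionic Fock space $\mathcal F(\mathbb C^d)$. $\mathcal P$ is the power set of $\{1,\dots,d\}$ and $|\mu|=\#\mu$ mod 2. $\{\psi_\mu\}_{\mu\in\mathcal P}$ is the standard orthonormal basis of $\mathcal F(\mathbb C^d)$: $\psi_\emptyset$ is the vacuum and, for $\mu=\{\mu_1<\dots<\mu_l\}$, $\psi_\mu\propto a^*(e_{\mu_1})\cdots a^*(e_{\mu_l})\psi_\emptyset$, normalized. $E^{(0)}_{\mu,\nu}$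 are the matrix units of $\mathcal A_{\{0\}}\simeq\mathcal B(\mathcal F(\mathbb C^d))$ for this basis, $E^{(x)}_{\mu,\nu}=\beta_{S_x}(E^{(0)}_{\mu,\nu})$, and $\boldsymbol\Gamma(-1)=\sum_\mu(-1)^{|\mu|}E^{(0)}_{\mu,\mu}\in\mathcal A_{\{0\}}$. **Graded systems.** A graded $W^*$-$(G,\mathfrak p)$-dynamical system $(\mathcal M,\theta,\hat\alpha)$ is a von Neumann algebra $\mathcal M$ with an involutive automorphism $\theta$ and an action $\hat\alpha$ of $G$ commuting with $\theta$, $\hat\alpha_g$ being a linear (resp. anti-linear) $*$-automorphism if $\mathfrak p(g)=0$ (resp. $1$). Two systems are equivalent via $\iota$ if $\iota$ is a $*$-isomorphism intertwining gradings and actions. $\sigma_x,\sigma_y,\sigma_z$ are the Pauli matrices, $\mathfrak C=\mathrm{span}\{1,\sigma_x\}\subset M_2$. For a Hilbert space $\mathcal K$ let $\Gamma_{\mathcal K}=1_{\mathcal K}\otimes\sigma_z$ and $\mathcal R_{1,\mathcal K}=\mathcal B(\mathcal K)\otimes\mathfrak C$. $\mathcal S_1$ is the set of systems $(\mathcal R_{1,\mathcal K},\mathrm{Ad}_{\Gamma_{\mathcal K}},\mathrm{Ad}_{V_g})$ with $V$ a projective unitary/anti-unitary representation of $G$ on $\mathcal K\otimes\mathbb C^2$ relative to $\mathfrak p$ such that, for some homomorphism $\mathfrak q:G\to\mathbb Z_2$, $\mathrm{Ad}_{V_g}(1\otimes\sigma_x)=(-1)^{\mathfrak q(g)}1\otimes\sigma_x$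 and $\mathrm{Ad}_{V_g}(\Gamma_{\mathcal K})=(-1)^{\mathfrak q(g)}\Gamma_{\mathcal K}$. Then there is a unique projective unitary/anti-unitary representation $V^{(0)}$ of $G$ on $\mathcal K$ relative to $\mathfrak p$ with $V_g=V_g^{(0)}\otimes C^{\mathfrak p(g)}\sigma_y^{\mathfrak q(g)}$, $C$ being complex conjugation on $\mathbb C^2$ in the standard basis. For an operator $Y$, $\mathrm{Ad}_Y(x)=YxY^*$. *)

theory Defs
  imports "HOL-Analysis.Analysis" "HOL-Algebra.Elementary_Groups"
begin

section \<open>Complex normed spaces, Hilbert spaces and C*-algebras\<close>

class complex_normed_vector = real_normed_vector +
  fixes scaleC :: "complex \<Rightarrow> 'a \<Rightarrow> 'a"  (infixr "*\<^sub>C" 75)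
  assumes scaleC_add_right: "c *\<^sub>C (x + y) = c *\<^sub>C x + c *\<^sub>C y"
    and scaleC_add_left: "(b + c) *\<^sub>C x = b *\<^sub>C x + c *\<^sub>C x"
    and scaleC_scaleC: "b *\<^sub>C c *\<^sub>C x = (b * c) *\<^sub>C x"
    and scaleR_scaleC: "r *\<^sub>R x = of_real r *\<^sub>C x"
    and norm_scaleC: "norm (c *\<^sub>C x) = cmod c * norm x"

text \<open>The complex inner product is antilinear in the first argument.\<close>

class complex_hilbert = complex_normed_vector + real_inner + complete_space +
  fixes cinner :: "'a \<Rightarrow> 'a \<Rightarrow> complex"
  assumes cinner_commute: "cinner x y = cnj (cinner y x)"
    and cinner_add_right: "cinner x (y + z) = cinner x y + cinner x z"
    and cinner_scaleC_right: "cinner x (c *\<^sub>C y) = c * cinner x y"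
    and inner_eq_Re_cinner: "inner x y = Re (cinner x y)"

class cstar_algebra = complex_normed_vector + real_normed_algebra_1 + complete_space +
  fixes star :: "'a \<Rightarrow> 'a"
  assumes mult_scaleC_left: "(c *\<^sub>C x) * y = c *\<^sub>C (x * y)"
    and mult_scaleC_right: "x * (c *\<^sub>C y) = c *\<^sub>C (x * y)"
    and star_star: "star (star x) = x"
    and star_add: "star (x + y) = star x + star y"
    and star_scaleC: "star (c *\<^sub>C x) = cnj c *\<^sub>C star x"
    and star_mult: "star (x * y) = star y * star x"
    and cstar_identity: "norm (star x * x) = (norm x)\<^sup>2"

lemma bounded_linear_scaleC: "bounded_linear (scaleC c)"
proof
  show "c *\<^sub>C (x + y) = c *\<^sub>C x + c *\<^sub>C y" for x y :: 'a
    by (rule scaleC_add_right)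
  show "c *\<^sub>C (r *\<^sub>R x) = r *\<^sub>R (c *\<^sub>C x)" for r and x :: 'a
    by (simp add: scaleR_scaleC scaleC_scaleC mult.commute)
  show "\<exists>K. \<forall>x::'a. norm (c *\<^sub>C x) \<le> norm x * K"
    by (rule exI[of _ "cmod c"]) (simp add: norm_scaleC mult.commute)
qed

instantiation complex :: complex_hilbert
begin
definition scaleC_complex :: "complex \<Rightarrow> complex \<Rightarrow> complex"
  where "scaleC_complex c z = c * z"
definition cinner_complex :: "complex \<Rightarrow> complex \<Rightarrow> complex"
  where "cinner_complex x y = cnj x * y"
instance
  by standard (auto simp: scaleC_complex_def cinner_complex_def algebra_simps norm_mult
      scaleR_conv_of_real inner_complex_def)
end

instantiation vec :: (complex_hilbert, finite) complex_hilbert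
begin
definition scaleC_vec :: "complex \<Rightarrow> 'a ^ 'b \<Rightarrow> 'a ^ 'b"
  where "scaleC_vec c v = (\<chi> i. c *\<^sub>C (v $ i))"
definition cinner_vec :: "'a ^ 'b \<Rightarrow> 'a ^ 'b \<Rightarrow> complex"
  where "cinner_vec v w = (\<Sum>i\<in>UNIV. cinner (v $ i) (w $ i))"
instance
proof
  fix b c :: complex and r :: real and x y z :: "'a ^ 'b"
  show "c *\<^sub>C (x + y) = c *\<^sub>C x + c *\<^sub>C y"
    by (simp add: scaleC_vec_def vec_eq_iff scaleC_add_right)
  show "(b + c) *\<^sub>C x = b *\<^sub>C x + c *\<^sub>C x"
    by (simp add: scaleC_vec_def vec_eq_iff scaleC_add_left)
  show "b *\<^sub>C c *\<^sub>C x = (b * c) *\<^sub>C x"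
    by (simp add: scaleC_vec_def vec_eq_iff scaleC_scaleC)
  show "r *\<^sub>R x = of_real r *\<^sub>C x"
    by (simp add: scaleC_vec_def vec_eq_iff scaleR_scaleC)
  show "norm (c *\<^sub>C x) = cmod c * norm x"
    by (simp add: scaleC_vec_def norm_vec_def norm_scaleC L2_set_right_distrib)
  show "cinner x y = cnj (cinner y x)"
    by (auto simp: cinner_vec_def intro!: sum.cong intro: cinner_commute)
  show "cinner x (y + z) = cinner x y + cinner x z"
    by (simp add: cinner_vec_def cinner_add_right sum.distrib)
  show "cinner x (c *\<^sub>C y) = c * cinner x y"
    by (simp add: cinner_vec_def scaleC_vec_def cinner_scaleC_right sum_distrib_left)
  show "inner x y = Re (cinner x y)"
    by (simp add: cinner_vec_def inner_vec_def inner_eq_Re_cinner)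
qed
end

instantiation blinfun :: (real_normed_vector, complex_normed_vector) complex_normed_vector
begin
lift_definition scaleC_blinfun :: "complex \<Rightarrow> ('a \<Rightarrow>\<^sub>L 'b) \<Rightarrow> ('a \<Rightarrow>\<^sub>L 'b)"
  is "\<lambda>c T x. c *\<^sub>C T x"
  by (rule bounded_linear_compose[OF bounded_linear_scaleC])
instance
proof
  fix b c :: complex and r :: real and S T :: "'a \<Rightarrow>\<^sub>L 'b"
  show "c *\<^sub>C (S + T) = c *\<^sub>C S + c *\<^sub>C T"
    by transfer (simp add: fun_eq_iff scaleC_add_right)
  show "(b + c) *\<^sub>C T = b *\<^sub>C T + c *\<^sub>C T"
    by transfer (simp add: fun_eq_iff scaleC_add_left)
  show "b *\<^sub>C c *\<^sub>C T = (b * c) *\<^sub>C T"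
    by transfer (simp add: fun_eq_iff scaleC_scaleC)
  show "r *\<^sub>R T = of_real r *\<^sub>C T"
    by transfer (simp add: fun_eq_iff scaleR_scaleC)
  show "norm (c *\<^sub>C T) = cmod c * norm T"
  proof transfer
    fix c :: complex and T :: "'a \<Rightarrow> 'b"
    assume T: "bounded_linear T"
    have "onorm (\<lambda>x. c *\<^sub>C T x) = onorm (\<lambda>x. cmod c *\<^sub>R T x)"
      by (simp add: onorm_def norm_scaleC)
    then show "onorm (\<lambda>x. c *\<^sub>C T x) = cmod c * onorm T"
      by (simp add: onorm_scaleR[OF T])
  qed
qed
end

section \<open>Operators\<close>

text \<open>\<open>'h \<Rightarrow>\<^sub>L 'h\<close> consists of the real-linear bounded operators; it contains both the bounded
  complex-linear and the bounded antilinear ones.\<close>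

definition bounded_ops :: "('h::complex_hilbert \<Rightarrow>\<^sub>L 'h) set"
  where "bounded_ops = {T :: 'h \<Rightarrow>\<^sub>L 'h. \<forall>c x. T (c *\<^sub>C x) = c *\<^sub>C T x}"

definition antilinear_ops :: "('h::complex_hilbert \<Rightarrow>\<^sub>L 'h) set"
  where "antilinear_ops = {T :: 'h \<Rightarrow>\<^sub>L 'h. \<forall>c x. T (c *\<^sub>C x) = cnj c *\<^sub>C T x}"

text \<open>The adjoint for the real inner product is the usual adjoint of a complex-linear operator and
  the antilinear adjoint \<open>\<langle>T x, y\<rangle> = cnj \<langle>x, T* y\<rangle>\<close> of an antilinear one; see the two lemmas below.
  In particular the adjoint of an antiunitary is its inverse.\<close>

definition op_adj :: "('h::complex_hilbert \<Rightarrow>\<^sub>L 'h) \<Rightarrow> ('h \<Rightarrow>\<^sub>L 'h)"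
  where "op_adj T = Blinfun (adjoint (blinfun_apply T))"

lemma op_adj_eqI:
  fixes T S :: "'h::complex_hilbert \<Rightarrow>\<^sub>L 'h"
  assumes "\<And>x y. cinner (T x) y = cinner x (S y)"
  shows "op_adj T = S"
proof -
  have "adjoint (blinfun_apply T) = blinfun_apply S"
    by (rule adjoint_unique) (simp add: inner_eq_Re_cinner assms)
  then show ?thesis
    by (simp add: op_adj_def blinfun_apply_inverse)
qed

lemma op_adj_antilinear_eqI:
  fixes T S :: "'h::complex_hilbert \<Rightarrow>\<^sub>L 'h"
  assumes "\<And>x y. cinner (T x) y = cnj (cinner x (S y))"
  shows "op_adj T = S"
proof -
  have "adjoint (blinfun_apply T) = blinfun_apply S"
    by (rule adjoint_unique) (simp add: inner_eq_Re_cinner assms)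
  then show ?thesis
    by (simp add: op_adj_def blinfun_apply_inverse)
qed

definition is_unitary :: "('h::complex_hilbert \<Rightarrow>\<^sub>L 'h) \<Rightarrow> bool"
  where "is_unitary T \<longleftrightarrow> T \<in> bounded_ops \<and>
    op_adj T o\<^sub>L T = id_blinfun \<and> T o\<^sub>L op_adj T = id_blinfun"

definition is_antiunitary :: "('h::complex_hilbert \<Rightarrow>\<^sub>L 'h) \<Rightarrow> bool"
  where "is_antiunitary T \<longleftrightarrow> T \<in> antilinear_ops \<and>
    op_adj T o\<^sub>L T = id_blinfun \<and> T o\<^sub>L op_adj T = id_blinfun"

definition Ad :: "('h::complex_hilbert \<Rightarrow>\<^sub>L 'h) \<Rightarrow> ('h \<Rightarrow>\<^sub>L 'h) \<Rightarrow> ('h \<Rightarrow>\<^sub>L 'h)"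
  where "Ad Y x = Y o\<^sub>L x o\<^sub>L op_adj Y"

definition op_prod :: "('h::complex_hilbert \<Rightarrow>\<^sub>L 'h) list \<Rightarrow> ('h \<Rightarrow>\<^sub>L 'h)"
  where "op_prod Ts = foldr (o\<^sub>L) Ts id_blinfun"

definition op_pow :: "('h::complex_hilbert \<Rightarrow>\<^sub>L 'h) \<Rightarrow> nat \<Rightarrow> ('h \<Rightarrow>\<^sub>L 'h)"
  where "op_pow T n = ((o\<^sub>L) T ^^ n) id_blinfun"

lift_definition ketbra :: "'h::complex_hilbert \<Rightarrow> 'h \<Rightarrow> ('h \<Rightarrow>\<^sub>L 'h)"
  is "\<lambda>x y z. cinner y z *\<^sub>C x"
proof -
  fix x y :: 'h
  have eq: "cinner y z = Complex (inner y z) (inner y (- \<i> *\<^sub>C z))" for z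
    by (simp add: complex_eq_iff inner_eq_Re_cinner cinner_scaleC_right)
  have 1: "bounded_linear (\<lambda>z. inner y z *\<^sub>R x)"
    by (rule bounded_linear_compose[OF bounded_linear_scaleR_left bounded_linear_inner_right])
  have 2: "bounded_linear (\<lambda>z. inner y (- \<i> *\<^sub>C z) *\<^sub>R (\<i> *\<^sub>C x))"
    by (rule bounded_linear_compose[OF bounded_linear_scaleR_left
          bounded_linear_compose[OF bounded_linear_inner_right bounded_linear_scaleC]])
  have "cinner y z *\<^sub>C x = inner y z *\<^sub>R x + inner y (- \<i> *\<^sub>C z) *\<^sub>R (\<i> *\<^sub>C x)" for z
  proof -
    have "cinner y z = of_real (inner y z) + of_real (inner y (- \<i> *\<^sub>C z)) * \<i>"
      by (subst eq) (simp add: complex_eq_iff)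
    then show ?thesis
      by (simp only: scaleC_add_left scaleR_scaleC scaleC_scaleC)
  qed
  then show "bounded_linear (\<lambda>z. cinner y z *\<^sub>C x)"
    using bounded_linear_add[OF 1 2] by simp
qed

text \<open>\<open>'k ^ 'n\<close> is the Hilbert space tensor product of \<open>'k\<close> and \<open>complex ^ 'n\<close>, a vector \<open>v\<close> being
  the sum over \<open>j\<close> of \<open>v $ j\<close> tensor \<open>axis j 1\<close>. The following is the tensor product
  of two linear or of two antilinear operators.\<close>

lift_definition op_tensor ::
  "('k::complex_hilbert \<Rightarrow>\<^sub>L 'k) \<Rightarrow> ((complex ^ 'n::finite) \<Rightarrow>\<^sub>L (complex ^ 'n)) \<Rightarrow> (('k ^ 'n) \<Rightarrow>\<^sub>L ('k ^ 'n))"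
    (infixr "\<otimes>\<^sub>o" 70)
  is "\<lambda>T W v. \<chi> i. \<Sum>j\<in>UNIV. (W (axis j 1) $ i) *\<^sub>C T (v $ j)"
proof -
  fix T :: "'k \<Rightarrow> 'k" and W :: "complex ^ 'n \<Rightarrow> complex ^ 'n"
  assume T: "bounded_linear T"
  have comp: "bounded_linear (\<lambda>v. \<Sum>j\<in>UNIV. (W (axis j 1) $ i) *\<^sub>C T (v $ j))" for i
    by (intro bounded_linear_sum bounded_linear_compose[OF bounded_linear_scaleC]
        bounded_linear_compose[OF T] bounded_linear_vec_nth)
  have "\<forall>i. \<exists>K. \<forall>v. norm (\<Sum>j\<in>UNIV. (W (axis j 1) $ i) *\<^sub>C T (v $ j)) \<le> norm v * K"
    using bounded_linear.bounded[OF comp] by blast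
  from choice[OF this] obtain K where
    K: "norm (\<Sum>j\<in>UNIV. (W (axis j 1) $ i) *\<^sub>C T (v $ j)) \<le> norm v * K i" for i v
    by blast
  show "bounded_linear (\<lambda>v. \<chi> i. \<Sum>j\<in>UNIV. (W (axis j 1) $ i) *\<^sub>C T (v $ j))"
  proof (rule bounded_linear_intro)
    fix v w :: "'k ^ 'n" and r :: real
    show "(\<chi> i. \<Sum>j\<in>UNIV. (W (axis j 1) $ i) *\<^sub>C T ((v + w) $ j)) =
        (\<chi> i. \<Sum>j\<in>UNIV. (W (axis j 1) $ i) *\<^sub>C T (v $ j)) +
        (\<chi> i. \<Sum>j\<in>UNIV. (W (axis j 1) $ i) *\<^sub>C T (w $ j))"
      using linear_add[OF bounded_linear.linear[OF comp]] by (simp add: vec_eq_iff)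
    show "(\<chi> i. \<Sum>j\<in>UNIV. (W (axis j 1) $ i) *\<^sub>C T ((r *\<^sub>R v) $ j)) =
        r *\<^sub>R (\<chi> i. \<Sum>j\<in>UNIV. (W (axis j 1) $ i) *\<^sub>C T (v $ j))"
      using linear_scale[OF bounded_linear.linear[OF comp]] by (simp add: vec_eq_iff)
    have "norm (\<chi> i. \<Sum>j\<in>UNIV. (W (axis j 1) $ i) *\<^sub>C T (v $ j))
        \<le> (\<Sum>i\<in>UNIV. norm (\<Sum>j\<in>UNIV. (W (axis j 1) $ i) *\<^sub>C T (v $ j)))"
      unfolding norm_vec_def by (rule order_trans[OF L2_set_le_sum]) auto
    also have "\<dots> \<le> (\<Sum>i\<in>UNIV. norm v * K i)"
      by (intro sum_mono K)
    finally show "norm (\<chi> i. \<Sum>j\<in>UNIV. (W (axis j 1) $ i) *\<^sub>C T (v $ j))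
        \<le> norm v * (\<Sum>i\<in>UNIV. K i)"
      by (simp add: sum_distrib_left)
  qed
qed

lift_definition mat_op :: "complex ^ 2 ^ 2 \<Rightarrow> ((complex ^ 2) \<Rightarrow>\<^sub>L (complex ^ 2))" is "(*v)"
  by (rule matrix_vector_mul_bounded_linear)

definition \<sigma>x :: "(complex ^ 2) \<Rightarrow>\<^sub>L (complex ^ 2)"
  where "\<sigma>x = mat_op (vector [vector [0, 1], vector [1, 0]])"

definition \<sigma>y :: "(complex ^ 2) \<Rightarrow>\<^sub>L (complex ^ 2)"
  where "\<sigma>y = mat_op (vector [vector [0, - \<i>], vector [\<i>, 0]])"

definition \<sigma>z :: "(complex ^ 2) \<Rightarrow>\<^sub>L (complex ^ 2)"
  where "\<sigma>z = mat_op (vector [vector [1, 0], vector [0, - 1]])"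

lift_definition complex_conj :: "(complex ^ 2) \<Rightarrow>\<^sub>L (complex ^ 2)" is "\<lambda>v. \<chi> i. cnj (v $ i)"
  by (simp add: linear_conv_bounded_linear[symmetric] linear_iff vec_eq_iff)

definition sigma_weak_lim ::
  "(nat \<Rightarrow> ('h::complex_hilbert \<Rightarrow>\<^sub>L 'h)) \<Rightarrow> ('h \<Rightarrow>\<^sub>L 'h) \<Rightarrow> bool"
  where "sigma_weak_lim X L \<longleftrightarrow> (\<forall>\<xi> \<eta> :: nat \<Rightarrow> 'h.
    summable (\<lambda>i. (norm (\<xi> i))\<^sup>2) \<longrightarrow> summable (\<lambda>i. (norm (\<eta> i))\<^sup>2) \<longrightarrow>
    (\<lambda>n. \<Sum>i. cinner (\<xi> i) (X n (\<eta> i))) \<longlonglongrightarrow> (\<Sum>i. cinner (\<xi> i) (L (\<eta> i))))"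

section \<open>Morphisms and symmetries\<close>

text \<open>Elements of \<open>\<int>\<^sub>2\<close> are the integers 0 and 1, as in the library's \<open>integer_mod_group 2\<close>. The value
  1 marks antilinear maps.\<close>

definition conj_if :: "int \<Rightarrow> complex \<Rightarrow> complex"
  where "conj_if s c = (if s = 0 then c else cnj c)"

text \<open>The multiplication and involution of source and target are arguments, because operators are
  multiplied with \<open>o\<^sub>L\<close> and elements of an abstract C*-algebra with \<open>*\<close>.\<close>

definition star_hom_on ::
  "int \<Rightarrow> ('a \<Rightarrow> 'a \<Rightarrow> 'a) \<Rightarrow> ('a \<Rightarrow> 'a) \<Rightarrow> ('b \<Rightarrow> 'b \<Rightarrow> 'b) \<Rightarrow> ('b \<Rightarrow> 'b) \<Rightarrow>
    'a::complex_normed_vector set \<Rightarrow> ('a \<Rightarrow> 'b::complex_normed_vector) \<Rightarrow> bool"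
  where "star_hom_on s m st m' st' B f \<longleftrightarrow> (\<forall>x\<in>B. \<forall>y\<in>B. \<forall>c.
    f (x + y) = f x + f y \<and> f (c *\<^sub>C x) = conj_if s c *\<^sub>C f x \<and>
    f (m x y) = m' (f x) (f y) \<and> f (st x) = st' (f x))"

definition op_star_iso ::
  "int \<Rightarrow> ('h::complex_hilbert \<Rightarrow>\<^sub>L 'h) set \<Rightarrow> ('k::complex_hilbert \<Rightarrow>\<^sub>L 'k) set \<Rightarrow>
    (('h \<Rightarrow>\<^sub>L 'h) \<Rightarrow> ('k \<Rightarrow>\<^sub>L 'k)) \<Rightarrow> bool"
  where "op_star_iso s M N f \<longleftrightarrow>
    star_hom_on s (o\<^sub>L) op_adj (o\<^sub>L) op_adj M f \<and> bij_betw f M N"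

definition proj_rep ::
  "('g, 'z) monoid_scheme \<Rightarrow> ('g \<Rightarrow> int) \<Rightarrow> ('g \<Rightarrow> ('h::complex_hilbert \<Rightarrow>\<^sub>L 'h)) \<Rightarrow> bool"
  where "proj_rep G p V \<longleftrightarrow>
    (\<forall>g\<in>carrier G. if p g = 0 then is_unitary (V g) else is_antiunitary (V g)) \<and>
    (\<exists>\<upsilon> :: 'g \<Rightarrow> 'g \<Rightarrow> complex.
      (\<forall>g\<in>carrier G. \<upsilon> \<one>\<^bsub>G\<^esub> g = 1 \<and> \<upsilon> g \<one>\<^bsub>G\<^esub> = 1) \<and>
      (\<forall>g\<in>carrier G. \<forall>h\<in>carrier G.
        cmod (\<upsilon> g h) = 1 \<and> V g o\<^sub>L V h = \<upsilon> g h *\<^sub>C V (g \<otimes>\<^bsub>G\<^esub> h)))"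

section \<open>Von Neumann algebras and graded systems\<close>

definition commutant :: "('h::complex_hilbert \<Rightarrow>\<^sub>L 'h) set \<Rightarrow> ('h \<Rightarrow>\<^sub>L 'h) set"
  where "commutant M = {T \<in> bounded_ops. \<forall>A\<in>M. T o\<^sub>L A = A o\<^sub>L T}"

definition von_neumann_algebra :: "('h::complex_hilbert \<Rightarrow>\<^sub>L 'h) set \<Rightarrow> bool"
  where "von_neumann_algebra M \<longleftrightarrow>
    M \<subseteq> bounded_ops \<and> op_adj ` M \<subseteq> M \<and> commutant (commutant M) = M"

definition projections :: "('h::complex_hilbert \<Rightarrow>\<^sub>L 'h) set \<Rightarrow> ('h \<Rightarrow>\<^sub>L 'h) set"
  where "projections M = {e \<in> M. e o\<^sub>L e = e \<and> op_adj e = e}"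

text \<open>Type I: every nonzero central projection majorizes a nonzero abelian projection.\<close>

definition type_I :: "('h::complex_hilbert \<Rightarrow>\<^sub>L 'h) set \<Rightarrow> bool"
  where "type_I M \<longleftrightarrow> von_neumann_algebra M \<and>
    (\<forall>z \<in> projections M \<inter> commutant M. z \<noteq> 0 \<longrightarrow>
      (\<exists>e \<in> projections M. e \<noteq> 0 \<and> z o\<^sub>L e = e \<and>
        (\<forall>x\<in>M. \<forall>y\<in>M. (e o\<^sub>L x o\<^sub>L e) o\<^sub>L (e o\<^sub>L y o\<^sub>L e) = (e o\<^sub>L y o\<^sub>L e) o\<^sub>L (e o\<^sub>L x o\<^sub>L e))))"

definition graded_system ::
  "('g, 'z) monoid_scheme \<Rightarrow> ('g \<Rightarrow> int) \<Rightarrow> ('h::complex_hilbert \<Rightarrow>\<^sub>L 'h) set \<Rightarrow>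
    (('h \<Rightarrow>\<^sub>L 'h) \<Rightarrow> ('h \<Rightarrow>\<^sub>L 'h)) \<Rightarrow> ('g \<Rightarrow> ('h \<Rightarrow>\<^sub>L 'h) \<Rightarrow> ('h \<Rightarrow>\<^sub>L 'h)) \<Rightarrow> bool"
  where "graded_system G p M \<theta> \<alpha> \<longleftrightarrow> von_neumann_algebra M \<and>
    op_star_iso 0 M M \<theta> \<and> (\<forall>x\<in>M. \<theta> (\<theta> x) = x) \<and>
    (\<forall>g\<in>carrier G. op_star_iso (p g) M M (\<alpha> g) \<and> (\<forall>x\<in>M. \<alpha> g (\<theta> x) = \<theta> (\<alpha> g x))) \<and>
    (\<forall>g\<in>carrier G. \<forall>h\<in>carrier G. \<forall>x\<in>M. \<alpha> g (\<alpha> h x) = \<alpha> (g \<otimes>\<^bsub>G\<^esub> h) x)"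

definition equivalent_via ::
  "('g, 'z) monoid_scheme \<Rightarrow> ('g \<Rightarrow> int) \<Rightarrow>
    ('h::complex_hilbert \<Rightarrow>\<^sub>L 'h) set \<Rightarrow> (('h \<Rightarrow>\<^sub>L 'h) \<Rightarrow> ('h \<Rightarrow>\<^sub>L 'h)) \<Rightarrow>
    ('g \<Rightarrow> ('h \<Rightarrow>\<^sub>L 'h) \<Rightarrow> ('h \<Rightarrow>\<^sub>L 'h)) \<Rightarrow>
    ('k::complex_hilbert \<Rightarrow>\<^sub>L 'k) set \<Rightarrow> (('k \<Rightarrow>\<^sub>L 'k) \<Rightarrow> ('k \<Rightarrow>\<^sub>L 'k)) \<Rightarrow>
    ('g \<Rightarrow> ('k \<Rightarrow>\<^sub>L 'k) \<Rightarrow> ('k \<Rightarrow>\<^sub>L 'k)) \<Rightarrow>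
    (('h \<Rightarrow>\<^sub>L 'h) \<Rightarrow> ('k \<Rightarrow>\<^sub>L 'k)) \<Rightarrow> bool"
  where "equivalent_via G p M \<theta> \<alpha> N \<theta>' \<alpha>' \<iota> \<longleftrightarrow>
    graded_system G p M \<theta> \<alpha> \<and> graded_system G p N \<theta>' \<alpha>' \<and> op_star_iso 0 M N \<iota> \<and>
    (\<forall>x\<in>M. \<iota> (\<theta> x) = \<theta>' (\<iota> x)) \<and> (\<forall>g\<in>carrier G. \<forall>x\<in>M. \<iota> (\<alpha> g x) = \<alpha>' g (\<iota> x))"

definition grading_op :: "('k::complex_hilbert ^ 2) \<Rightarrow>\<^sub>L ('k ^ 2)"
  where "grading_op = id_blinfun \<otimes>\<^sub>o \<sigma>z"

definition R1 :: "(('k::complex_hilbert ^ 2) \<Rightarrow>\<^sub>L ('k ^ 2)) set"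
  where "R1 = {b \<otimes>\<^sub>o id_blinfun + c \<otimes>\<^sub>o \<sigma>x | b c. b \<in> bounded_ops \<and> c \<in> bounded_ops}"

definition in_S1 ::
  "('g, 'z) monoid_scheme \<Rightarrow> ('g \<Rightarrow> int) \<Rightarrow> ('g \<Rightarrow> int) \<Rightarrow>
    ('g \<Rightarrow> (('k::complex_hilbert ^ 2) \<Rightarrow>\<^sub>L ('k ^ 2))) \<Rightarrow> bool"
  where "in_S1 G p q V \<longleftrightarrow> proj_rep G p V \<and> q \<in> hom G (integer_mod_group 2) \<and>
    (\<forall>g\<in>carrier G.
      Ad (V g) (id_blinfun \<otimes>\<^sub>o \<sigma>x) = (- 1) ^ nat (q g) *\<^sub>C (id_blinfun \<otimes>\<^sub>o \<sigma>x) \<and>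
      Ad (V g) grading_op = (- 1) ^ nat (q g) *\<^sub>C grading_op)"

definition associated_rep ::
  "('g, 'z) monoid_scheme \<Rightarrow> ('g \<Rightarrow> int) \<Rightarrow> ('g \<Rightarrow> int) \<Rightarrow>
    ('g \<Rightarrow> (('k::complex_hilbert ^ 2) \<Rightarrow>\<^sub>L ('k ^ 2))) \<Rightarrow> ('g \<Rightarrow> ('k \<Rightarrow>\<^sub>L 'k)) \<Rightarrow> bool"
  where "associated_rep G p q V V0 \<longleftrightarrow> proj_rep G p V0 \<and>
    (\<forall>g\<in>carrier G.
      V g = V0 g \<otimes>\<^sub>o (op_pow complex_conj (nat (p g)) o\<^sub>L op_pow \<sigma>y (nat (q g))))"

section \<open>The CAR algebra\<close>

text \<open>The space \<open>l\<^sup>2(\<int>)\<close> tensor \<open>\<complex>\<^sup>d\<close>; the index type \<open>'d\<close> stands for \<open>{1,\<dots>,d}\<close> with its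
  order, so that its power set is the type \<open>'d set\<close>.\<close>

type_synonym 'd cvec = "complex ^ 'd"

definition l2 :: "(int \<Rightarrow> 'd::finite cvec) set"
  where "l2 = {f. (\<lambda>x. (norm (f x))\<^sup>2) summable_on UNIV}"

definition l2_inner :: "(int \<Rightarrow> 'd::finite cvec) \<Rightarrow> (int \<Rightarrow> 'd cvec) \<Rightarrow> complex"
  where "l2_inner f g = (\<Sum>\<^sub>\<infinity>x. cinner (f x) (g x))"

definition delta0 :: "'d::finite cvec \<Rightarrow> (int \<Rightarrow> 'd cvec)"
  where "delta0 v = (\<lambda>x. if x = 0 then v else 0)"

definition shift :: "int \<Rightarrow> (int \<Rightarrow> 'd::finite cvec) \<Rightarrow> (int \<Rightarrow> 'd cvec)"
  where "shift x f = (\<lambda>y. f (y - x))"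

definition cstar_subalgebra :: "'a::cstar_algebra set \<Rightarrow> bool"
  where "cstar_subalgebra B \<longleftrightarrow> closed B \<and> 1 \<in> B \<and>
    (\<forall>x\<in>B. \<forall>y\<in>B. \<forall>c. x + y \<in> B \<and> x * y \<in> B \<and> c *\<^sub>C x \<in> B \<and> star x \<in> B)"

definition local_alg ::
  "((int \<Rightarrow> 'd::finite cvec) \<Rightarrow> 'a::cstar_algebra) \<Rightarrow> int set \<Rightarrow> 'a set"
  where "local_alg a X = cstar_subalgebra hull (a ` {f \<in> l2. \<forall>x. x \<notin> X \<longrightarrow> f x = 0})"

abbreviation right_alg ::
  "((int \<Rightarrow> 'd::finite cvec) \<Rightarrow> 'a::cstar_algebra) \<Rightarrow> 'a set"
  where "right_alg a \<equiv> local_alg a {0..}"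

text \<open>The whole type \<open>'a\<close> is the CAR algebra with annihilators \<open>a f\<close>; this determines it up to
  isomorphism.\<close>

definition car_algebra :: "((int \<Rightarrow> 'd::finite cvec) \<Rightarrow> 'a::cstar_algebra) \<Rightarrow> bool"
  where "car_algebra a \<longleftrightarrow>
    (\<forall>f\<in>l2. \<forall>g\<in>l2. a (\<lambda>x. f x + g x) = a f + a g) \<and>
    (\<forall>f\<in>l2. \<forall>c. a (\<lambda>x. c *\<^sub>C f x) = cnj c *\<^sub>C a f) \<and>
    (\<forall>f\<in>l2. \<forall>g\<in>l2. a f * a g + a g * a f = 0) \<and>
    (\<forall>f\<in>l2. \<forall>g\<in>l2. a f * star (a g) + star (a g) * a f = l2_inner f g *\<^sub>C 1) \<and>
    local_alg a UNIV = UNIV"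

text \<open>\<open>\<beta>\<close> is the linear (\<open>s = 0\<close>) or antilinear (\<open>s = 1\<close>) *-automorphism with \<open>\<beta> (a f) = a (w f)\<close>;
  it is unique because the \<open>a f\<close> generate.\<close>

definition bogoliubov ::
  "((int \<Rightarrow> 'd::finite cvec) \<Rightarrow> 'a::cstar_algebra) \<Rightarrow> int \<Rightarrow>
    ((int \<Rightarrow> 'd cvec) \<Rightarrow> (int \<Rightarrow> 'd cvec)) \<Rightarrow> ('a \<Rightarrow> 'a) \<Rightarrow> bool"
  where "bogoliubov a s w \<beta> \<longleftrightarrow>
    star_hom_on s (*) star (*) star UNIV \<beta> \<and> bij \<beta> \<and> (\<forall>f\<in>l2. \<beta> (a f) = a (w f))"

section \<open>States and GNS representations\<close>

definition is_state :: "('a::cstar_algebra \<Rightarrow> complex) \<Rightarrow> bool"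
  where "is_state \<phi> \<longleftrightarrow> (\<forall>x y. \<phi> (x + y) = \<phi> x + \<phi> y) \<and> (\<forall>c x. \<phi> (c *\<^sub>C x) = c * \<phi> x) \<and>
    (\<forall>x. \<phi> (star x * x) \<in> \<real>\<^sub>\<ge>\<^sub>0) \<and> \<phi> 1 = 1"

definition pure_state :: "('a::cstar_algebra \<Rightarrow> complex) \<Rightarrow> bool"
  where "pure_state \<phi> \<longleftrightarrow> is_state \<phi> \<and>
    (\<forall>\<psi>\<^sub>1 \<psi>\<^sub>2. \<forall>t::real. is_state \<psi>\<^sub>1 \<and> is_state \<psi>\<^sub>2 \<and> 0 < t \<and> t < 1 \<and>
      (\<forall>x. \<phi> x = of_real t * \<psi>\<^sub>1 x + of_real (1 - t) * \<psi>\<^sub>2 x) \<longrightarrow> \<psi>\<^sub>1 = \<phi> \<and> \<psi>\<^sub>2 = \<phi>)"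

text \<open>\<open>(\<pi>, \<Omega>)\<close> on the Hilbert space \<open>'h\<close> is a GNS representation of the restriction of \<open>\<phi>\<close> to the
  subalgebra \<open>B\<close>; it is unique up to unitary equivalence.\<close>

definition gns_triple ::
  "'a::cstar_algebra set \<Rightarrow> ('a \<Rightarrow> complex) \<Rightarrow> ('a \<Rightarrow> ('h::complex_hilbert \<Rightarrow>\<^sub>L 'h)) \<Rightarrow> 'h \<Rightarrow> bool"
  where "gns_triple B \<phi> \<pi> \<Omega> \<longleftrightarrow>
    star_hom_on 0 (*) star (o\<^sub>L) op_adj B \<pi> \<and> \<pi> 1 = id_blinfun \<and> \<pi> ` B \<subseteq> bounded_ops \<and>
    (\<forall>x\<in>B. \<phi> x = cinner \<Omega> (\<pi> x \<Omega>)) \<and> closure ((\<lambda>x. \<pi> x \<Omega>) ` B) = UNIV"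

definition vN_closure ::
  "('a \<Rightarrow> ('h::complex_hilbert \<Rightarrow>\<^sub>L 'h)) \<Rightarrow> 'a set \<Rightarrow> ('h \<Rightarrow>\<^sub>L 'h) set"
  where "vN_closure \<pi> B = commutant (commutant (\<pi> ` B))"

section \<open>Fermionic Fock space over \<open>\<complex>\<^sup>d\<close>\<close>

text \<open>Occupation number model: the coordinates of \<open>complex ^ ('d set)\<close> are the subsets of \<open>'d\<close>, and
  \<open>a*(e\<^sub>i)\<close> adds \<open>i\<close> to a subset not containing it, with the sign given by the
  number of smaller elements. The lemma \<open>fock_basis_eq_axis\<close> identifies the coordinate
  vectors with the ordered products \<open>a*(e\<^sub>\<mu>\<^sub>1) \<cdots> a*(e\<^sub>\<mu>\<^sub>l)\<close> applied to the vacuum.\<close>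

type_synonym 'd fock = "complex ^ ('d set)"

lift_definition creation ::
  "'d::{finite, linorder} cvec \<Rightarrow> ('d fock \<Rightarrow>\<^sub>L 'd fock)"
  is "\<lambda>v \<psi>. \<chi> \<mu>. \<Sum>i\<in>\<mu>. (- 1) ^ card {j \<in> \<mu>. j < i} * (v $ i) * (\<psi> $ (\<mu> - {i}))"
  unfolding linear_conv_bounded_linear[symmetric]
  by (rule linearI) (simp_all add: vec_eq_iff distrib_left sum.distrib scaleR_sum_right)

definition vacuum :: "'d::{finite, linorder} fock"
  where "vacuum = axis {} 1"

definition fock_basis :: "'d::{finite, linorder} set \<Rightarrow> 'd fock"
  where "fock_basis \<mu> = foldr (\<lambda>i. creation (axis i 1)) (sorted_list_of_set \<mu>) vacuum"

text \<open>Second quantization of the linear (\<open>s = 0\<close>) or antilinear (\<open>s = 1\<close>) operator \<open>w\<close>: it fixes the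
  vacuum and intertwines \<open>a*(v)\<close> with \<open>a*(w v)\<close>.\<close>

definition second_quant ::
  "int \<Rightarrow> ('d::{finite, linorder} cvec \<Rightarrow>\<^sub>L 'd cvec) \<Rightarrow> 'd fock \<Rightarrow> 'd fock"
  where "second_quant s w \<psi> = (\<Sum>\<mu>\<in>UNIV. conj_if s (cinner (fock_basis \<mu>) \<psi>) *\<^sub>C
    foldr (\<lambda>i. creation (w (axis i 1))) (sorted_list_of_set \<mu>) vacuum)"

text \<open>\<open>\<kappa>\<close> is determined by its values on the annihilators, which generate the one-site algebra.\<close>

definition fock_identification ::
  "((int \<Rightarrow> 'd::{finite, linorder} cvec) \<Rightarrow> 'a::cstar_algebra) \<Rightarrow>
    ('a \<Rightarrow> ('d fock \<Rightarrow>\<^sub>L 'd fock)) \<Rightarrow> bool"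
  where "fock_identification a \<kappa> \<longleftrightarrow>
    star_hom_on 0 (*) star (o\<^sub>L) op_adj (local_alg a {0}) \<kappa> \<and>
    bij_betw \<kappa> (local_alg a {0}) bounded_ops \<and>
    (\<forall>v. \<kappa> (a (delta0 v)) = op_adj (creation v))"

definition matrix_unit ::
  "((int \<Rightarrow> 'd::{finite, linorder} cvec) \<Rightarrow> 'a::cstar_algebra) \<Rightarrow>
    ('a \<Rightarrow> ('d fock \<Rightarrow>\<^sub>L 'd fock)) \<Rightarrow> 'd set \<Rightarrow> 'd set \<Rightarrow> 'a"
  where "matrix_unit a \<kappa> \<mu> \<nu> =
    inv_into (local_alg a {0}) \<kappa> (ketbra (fock_basis \<mu>) (fock_basis \<nu>))"

definition parity :: "'d::finite set \<Rightarrow> nat"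
  where "parity \<mu> = card \<mu> mod 2"

lemma fock_basis_eq_axis:
  fixes \<mu> :: "'d::{finite, linorder} set"
  shows "fock_basis \<mu> = axis \<mu> 1"
proof -
  have step: "creation (axis i 1) (axis \<mu> 1) = (axis (insert i \<mu>) 1 :: 'd fock)"
    if "\<forall>j\<in>\<mu>. i < j" for i :: 'd and \<mu> :: "'d set"
  proof -
    have "(\<Sum>k\<in>\<nu>. (- 1) ^ card {j \<in> \<nu>. j < k} * (axis i 1 $ k) * (axis \<mu> 1 $ (\<nu> - {k})))
        = (axis (insert i \<mu>) 1 $ \<nu> :: complex)" for \<nu> :: "'d set"
    proof -
      have "(\<Sum>k\<in>\<nu>. (- 1) ^ card {j \<in> \<nu>. j < k} * (axis i 1 $ k) * (axis \<mu> 1 $ (\<nu> - {k})))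
          = (\<Sum>k\<in>\<nu>. if k = i then (- 1) ^ card {j \<in> \<nu>. j < i} * (axis \<mu> 1 $ (\<nu> - {i})) else (0::complex))"
        by (intro sum.cong) (auto simp: axis_def)
      also have "\<dots> = (if i \<in> \<nu> then (- 1) ^ card {j \<in> \<nu>. j < i} * (axis \<mu> 1 $ (\<nu> - {i})) else 0)"
        by (simp add: sum.delta)
      also have "\<dots> = axis (insert i \<mu>) 1 $ \<nu>"
      proof (cases "\<nu> = insert i \<mu>")
        case True
        then have *: "{j \<in> \<nu>. j < i} = {}" and "i \<notin> \<mu>"
          using that by force+
        then have "card {j \<in> \<nu>. j < i} = 0"
          by simp
        moreover have "\<nu> - {i} = \<mu>" "i \<in> \<nu>"
          using True \<open>i \<notin> \<mu>\<close> by auto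
        ultimately show ?thesis
          using True by (simp only: axis_nth if_True power_0 mult_1)
      next
        case False
        then show ?thesis
          by (auto simp: axis_def)
      qed
      finally show ?thesis .
    qed
    then show ?thesis
      by (simp add: creation.rep_eq vec_eq_iff)
  qed
  have "foldr (\<lambda>i. creation (axis i 1)) xs vacuum = (axis (set xs) 1 :: 'd fock)"
    if "sorted xs" "distinct xs" for xs :: "'d list"
    using that
  proof (induction xs)
    case Nil
    then show ?case by (simp add: vacuum_def)
  next
    case (Cons x xs)
    then have "\<forall>j\<in>set xs. x < j"
      by (auto simp: less_le)
    with Cons show ?case
      by (simp add: step)
  qed
  from this[of "sorted_list_of_set \<mu>"] show ?thesis
    by (simp add: fock_basis_def)
qed

end

theory Submission
  imports Defs
begin

text \<open>Write \<open>f_\<mu>\<nu> \<otimes> \<sigma>\<^sub>x^(|\<mu>| + |\<nu>|)\<close> for the image under \<open>\<iota> \<circ> \<pi>\<close> of the matrix unit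
  \<open>E_\<mu>\<nu>\<close> of the site 0 and \<open>\<rho>\<^sub>0\<close> for the restriction of \<open>\<rho>\<close> to \<open>B(K) \<otimes> 1\<close>. The even part of
  \<open>\<rho>(R1)\<close> commutes with the even part of the site 0, so \<open>f_\<emptyset>\<emptyset>\<close> commutes with \<open>\<rho>\<^sub>0\<close>; applying
  \<open>\<rho>\<^sub>0\<close> to rank-one operators below a vector in the range of \<open>f_\<emptyset>\<emptyset>\<close> gives an isometry \<open>S_\<emptyset>\<close> that
  intertwines the identity and \<open>\<rho>\<^sub>0\<close>, and \<open>S_\<mu> = f_\<mu>\<emptyset> S_\<emptyset>\<close>. Since the half-chain algebra is
  generated by the site 0 and its own translate, the sum of the \<open>S_\<mu> S_\<mu>*\<close> is central and even,
  hence 1.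

  The translation is implemented on the GNS space by a unitary. Far translates of an element of
  the half-chain algebra asymptotically (graded) commute with every \<open>\<pi>(A)\<close>, and \<open>\<pi>\<close> is
  irreducible, so they converge weakly to their vacuum expectation.

  Let \<open>S''_\<mu>\<close> be the conjugate of \<open>S_\<mu>\<close> by \<open>V0\<close> and \<open>S'_\<mu>\<close> the transform of \<open>S_\<mu>\<close> by the second
  quantization of \<open>U\<close>. The symmetry commutes with \<open>\<rho>\<close>, so every \<open>S_\<nu>* S''_\<mu>\<close> is a scalar, and it
  maps the matrix units of the site 0 to their transforms, so \<open>S'_\<mu> S'_\<nu>* = S''_\<mu> S''_\<nu>*\<close>. Hence \<open>S'\<close> and
  \<open>S''\<close> differ by one common phase.\<close>

\<comment> \<open>The obstacle is the grading. Operators of disjoint regions commute only up to a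
  sign, and the centre of \<open>R1\<close> is spanned by 1 and the odd element
  \<open>flip_op\<close>, so irreducibility and centrality yield scalars only after parity has been
  settled. Two devices do this. Multiplying an odd operator by the implementer
  \<open>\<Gamma>\<close> of the parity turns anticommutation with odd generators into commutation,
  which makes odd elements accessible to commutant arguments. And central elements are pinned down
  by their parity: the translate of the odd central involution times Gamma(-1) is again odd, central
  and of square 1, hence plus or minus \<open>flip_op\<close>; this sign is the origin of
  \<open>\<sigma>\<^sub>0\<close>.

  \<open>\<iota>\<close> enters as an algebraic isomorphism, without continuity in a weak topology.
  Weak limits on K are therefore read off from the GNS space through an isometry that intertwines
  B(K) with its image there, built from rank-one operators. In the limit itself, transitivity of
  irreducible representations is replaced by an approximation that controls \<open>\<pi> A\<close>
  on the cyclic vector and its adjoint on one further vector at the same time.\<close>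
subclass (in cstar_algebra) banach ..
subclass (in complex_hilbert) banach ..

section \<open>Hilbert spaces\<close>

lemma scaleC_one [simp]: "1 *\<^sub>C x = x"
  using scaleR_scaleC[of 1 x] by simp

lemma scaleC_zero_left [simp]: "0 *\<^sub>C x = 0"
  using norm_scaleC[of 0 x] by simp

lemma scaleC_zero_right [simp]: "c *\<^sub>C 0 = 0"
  using norm_scaleC[of c 0] by simp

lemma scaleC_minus_right [simp]: "c *\<^sub>C (- x) = - (c *\<^sub>C x)"
  using scaleC_add_right[of c x "- x"] by (simp add: eq_neg_iff_add_eq_0 add.commute)

lemma scaleC_minus_left [simp]: "(- c) *\<^sub>C x = - (c *\<^sub>C x)"
  using scaleC_add_left[of c "- c" x] by (simp add: eq_neg_iff_add_eq_0 add.commute)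

lemma scaleC_diff_right: "c *\<^sub>C (x - y) = c *\<^sub>C x - c *\<^sub>C y"
  using scaleC_add_right[of c x "- y"] by simp

lemma scaleC_diff_left: "(b - c) *\<^sub>C x = b *\<^sub>C x - c *\<^sub>C x"
  using scaleC_add_left[of b "- c" x] by simp

lemma scaleC_sum_right: "c *\<^sub>C (\<Sum>i\<in>I. f i) = (\<Sum>i\<in>I. c *\<^sub>C f i)"
  by (induction I rule: infinite_finite_induct) (simp_all add: scaleC_add_right)

lemma scaleC_sum_left: "(\<Sum>i\<in>I. c i) *\<^sub>C x = (\<Sum>i\<in>I. c i *\<^sub>C x)"
  by (induction I rule: infinite_finite_induct) (simp_all add: scaleC_add_left)

lemma scaleC_eq_0_iff [simp]: "c *\<^sub>C x = 0 \<longleftrightarrow> c = 0 \<or> x = 0"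
  by (metis mult_eq_0_iff norm_eq_zero norm_scaleC)

lemma scaleC_cancel_left: "c *\<^sub>C x = c *\<^sub>C y \<longleftrightarrow> c = 0 \<or> x = y"
  using scaleC_eq_0_iff[of c "x - y"] by (auto simp: scaleC_diff_right simp del: scaleC_eq_0_iff)

lemma scaleC_cancel_right: "b *\<^sub>C x = c *\<^sub>C x \<longleftrightarrow> b = c \<or> x = 0"
  using scaleC_eq_0_iff[of "b - c" x] by (auto simp: scaleC_diff_left simp del: scaleC_eq_0_iff)

lemma cinner_add_left: "cinner (x + y) z = cinner x z + cinner y z"
  by (metis cinner_add_right cinner_commute complex_cnj_add)

lemma cinner_scaleC_left: "cinner (c *\<^sub>C x) y = cnj c * cinner x y"
  by (metis cinner_scaleC_right cinner_commute complex_cnj_mult)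

lemma cinner_zero_right [simp]: "cinner x 0 = 0"
  using cinner_scaleC_right[of x 0 0] by simp

lemma cinner_zero_left [simp]: "cinner 0 x = 0"
  using cinner_scaleC_left[of 0 0 x] by simp

lemma cinner_minus_right [simp]: "cinner x (- y) = - cinner x y"
  using cinner_scaleC_right[of x "-1" y] by simp

lemma cinner_minus_left [simp]: "cinner (- x) y = - cinner x y"
  using cinner_scaleC_left[of "-1" x y] by simp

lemma cinner_diff_right: "cinner x (y - z) = cinner x y - cinner x z"
  using cinner_add_right[of x y "- z"] by simp

lemma cinner_diff_left: "cinner (x - y) z = cinner x z - cinner y z"
  using cinner_add_left[of x "- y" z] by simp

lemma Im_cinner: "Im (cinner x y) = inner (\<i> *\<^sub>C x) y"
  by (simp add: inner_eq_Re_cinner cinner_scaleC_left)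

text \<open>Real and imaginary part of \<open>cinner x y\<close> are the real inner products of
  \<open>x\<close> and of \<open>\<i> *\<^sub>C x\<close> with \<open>y\<close>. Facts about the
  adjoint for the real inner product become facts about \<open>cinner\<close> in this way.\<close>

lemma cinner_eqI:
  assumes "\<And>c. inner (c *\<^sub>C x) y = inner (c *\<^sub>C x') y'"
  shows "cinner x y = cinner x' y'"
  using assms[of 1] assms[of \<i>] by (intro complex_eqI) (simp_all add: Im_cinner flip: inner_eq_Re_cinner)

lemma cinner_self: "cinner x x = of_real ((norm x)\<^sup>2)"
proof (rule complex_eqI)
  show "Re (cinner x x) = Re (complex_of_real ((norm x)\<^sup>2))"
    by (simp add: power2_norm_eq_inner inner_eq_Re_cinner)
  show "Im (cinner x x) = Im (complex_of_real ((norm x)\<^sup>2))"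
    using cinner_commute[of x x] by (metis Im_complex_of_real Reals_cnj_iff complex_is_Real_iff)
qed

lemma cinner_eq_0_iff [simp]: "cinner x x = 0 \<longleftrightarrow> x = 0"
  by (simp add: cinner_self)

lemma cinner_ext:
  assumes "\<And>z. cinner z x = cinner z y"
  shows "x = y"
  using assms[of "x - y"] by (metis cinner_diff_right cinner_eq_0_iff eq_iff_diff_eq_0)

lemma norm_cinner_le: "cmod (cinner x y) \<le> norm x * norm y"
proof (cases "cinner x y = 0")
  case False
  \<comment> \<open>A phase that rotates \<open>cinner x y\<close> onto its modulus, so that the
    real Cauchy-Schwarz inequality applies.\<close>
  define c where "c = cnj (cinner x y) / cmod (cinner x y)"
  have c: "cmod c = 1" "c * cinner x y = cmod (cinner x y)"
    using False by (simp_all add: c_def norm_divide complex_norm_square[symmetric] power2_eq_square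
        mult.commute[of "cnj _"])
  have "cmod (cinner x y) = inner x (c *\<^sub>C y)"
    by (simp add: inner_eq_Re_cinner cinner_scaleC_right c)
  also have "\<dots> \<le> norm x * norm y"
    using norm_cauchy_schwarz[of x "c *\<^sub>C y"] by (simp add: norm_scaleC c)
  finally show ?thesis .
qed simp

lemma tendsto_cinner:
  fixes x y :: "'h::complex_hilbert"
  assumes "(f \<longlongrightarrow> x) F" "(g \<longlongrightarrow> y) F"
  shows "((\<lambda>t. cinner (f t) (g t)) \<longlongrightarrow> cinner x y) F"
proof -
  have eq: "cinner x y = Complex (inner x y) (inner (\<i> *\<^sub>C x) y)" for x y :: 'h
    by (simp add: complex_eq_iff Im_cinner inner_eq_Re_cinner)
  have "((\<lambda>t. \<i> *\<^sub>C f t) \<longlongrightarrow> \<i> *\<^sub>C x) F"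
    by (rule bounded_linear.tendsto[OF bounded_linear_scaleC assms(1)])
  then show ?thesis
    unfolding eq by (intro tendsto_Complex tendsto_inner assms)
qed

text \<open>A minimizing sequence for the distance from \<open>x\<close> to \<open>S\<close> is Cauchy by the parallelogram law.\<close>

lemma orthogonal_projection_exists:
  fixes S :: "'a::{real_inner, complete_space} set"
  assumes S: "subspace S" "closed S"
  shows "\<exists>y\<in>S. \<forall>z\<in>S. inner (x - y) z = 0"
proof -
  define d where "d = infdist x S"
  have ne: "S \<noteq> {}" using S(1) subspace_0 by blast
  have d_le: "d \<le> norm (x - y)" if "y \<in> S" for y
    using infdist_le[OF that, of x] by (simp add: d_def dist_norm)
  have d0: "0 \<le> d" by (simp add: d_def infdist_nonneg)
  have "\<exists>y\<in>S. norm (x - y) < d + inverse (real (Suc n))" for n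
  proof (rule ccontr)
    assume "\<not> ?thesis"
    then have "d + inverse (real (Suc n)) \<le> infdist x S"
      unfolding infdist_def using ne by (auto intro!: cINF_greatest simp: dist_norm not_less)
    then show False by (simp add: d_def)
  qed
  then obtain y where y: "\<And>n. y n \<in> S" "\<And>n. norm (x - y n) < d + inverse (real (Suc n))"
    by metis
  have lim: "(\<lambda>n. norm (x - y n)) \<longlonglongrightarrow> d"
  proof (rule real_tendsto_sandwich[of "\<lambda>_. d" _ _ "\<lambda>n. d + inverse (real (Suc n))"])
    show "(\<lambda>n. d + inverse (real (Suc n))) \<longlonglongrightarrow> d"
      using tendsto_add[OF tendsto_const LIMSEQ_inverse_real_of_nat, of d] by simp
  qed (auto simp: d_le y less_imp_le simp del: of_nat_Suc intro!: always_eventually tendsto_const)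
  have par: "(norm (y m - y n))\<^sup>2 \<le> 2 * (norm (x - y m))\<^sup>2 + 2 * (norm (x - y n))\<^sup>2 - 4 * d\<^sup>2" for m n
  proof -
    have "(1/2) *\<^sub>R (y m + y n) \<in> S"
      using S(1) y(1) by (intro subspace_scale subspace_add)
    then have "d\<^sup>2 \<le> (norm (x - (1/2) *\<^sub>R (y m + y n)))\<^sup>2"
      using d_le d0 by (intro power_mono) auto
    moreover have "4 * (norm (x - (1/2) *\<^sub>R (y m + y n)))\<^sup>2 =
       2 * (norm (x - y m))\<^sup>2 + 2 * (norm (x - y n))\<^sup>2 - (norm (y m - y n))\<^sup>2"
      unfolding power2_norm_eq_inner by (simp add: inner_simps inner_commute algebra_simps)
    ultimately show ?thesis by simp
  qed
  have "Cauchy y"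
  proof (rule metric_CauchyI)
    fix e :: real assume e: "0 < e"
    have "(\<lambda>n. (norm (x - y n))\<^sup>2) \<longlonglongrightarrow> d\<^sup>2"
      by (intro tendsto_intros lim)
    then have "\<forall>\<^sub>F n in sequentially. (norm (x - y n))\<^sup>2 < d\<^sup>2 + e\<^sup>2/4"
      using e by (intro order_tendstoD) auto
    then obtain N where N: "\<And>n. n \<ge> N \<Longrightarrow> (norm (x - y n))\<^sup>2 < d\<^sup>2 + e\<^sup>2/4"
      by (auto simp: eventually_sequentially)
    show "\<exists>M. \<forall>m\<ge>M. \<forall>n\<ge>M. dist (y m) (y n) < e"
    proof (intro exI allI impI)
      fix m n assume "N \<le> m" "N \<le> n"
      then have "(norm (y m - y n))\<^sup>2 < e\<^sup>2"
        using par[of m n] N[of m] N[of n] by simp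
      then show "dist (y m) (y n) < e"
        using e by (auto simp: dist_norm intro: power2_less_imp_less)
    qed
  qed
  then obtain l where l: "y \<longlonglongrightarrow> l"
    using Cauchy_convergent convergent_def by blast
  have lS: "l \<in> S"
    using closed_sequentially[OF S(2) y(1) l] .
  have nl: "norm (x - l) = d"
    by (rule LIMSEQ_unique[OF _ lim]) (intro tendsto_intros l)
  have "inner (x - l) z = 0" if z: "z \<in> S" for z
  proof (cases "z = 0")
    case False
    \<comment> \<open>The minimiser of the quadratic in \<open>t\<close> given by the squared
      distance from \<open>x\<close> to \<open>l + t z\<close>; minimality of \<open>l\<close> then
      forces the subtracted term to vanish.\<close>
    define t where "t = inner (x - l) z / (norm z)\<^sup>2"
    have "l + t *\<^sub>R z \<in> S" using S(1) lS z by (intro subspace_add subspace_scale)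
    then have "d\<^sup>2 \<le> (norm (x - (l + t *\<^sub>R z)))\<^sup>2"
      using d_le d0 by (intro power_mono) auto
    also have "\<dots> = (norm (x - l))\<^sup>2 - 2 * t * inner (x - l) z + t\<^sup>2 * (norm z)\<^sup>2"
      unfolding power2_norm_eq_inner by (simp add: inner_simps inner_commute algebra_simps power2_eq_square)
    also have "\<dots> = d\<^sup>2 - (inner (x - l) z)\<^sup>2 / (norm z)\<^sup>2"
      using False by (simp add: nl t_def field_simps power2_eq_square)
    finally show ?thesis
      using False by (simp add: divide_le_0_iff)
  qed simp
  then show ?thesis using lS by blast
qed

text \<open>Real scalars only, because the rule is applied to \<open>'h \<times> 'h\<close>, which
  has a real inner product but no instance of \<open>complex_hilbert\<close>. Uniqueness, the third
  property, is what shows that the projection commutes with maps that preserve \<open>S\<close>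
  together with their adjoints.\<close>

lemma orthogonal_projection:
  fixes S :: "'a::{real_inner, complete_space} set"
  assumes S: "subspace S" "closed S"
  obtains Q :: "'a \<Rightarrow>\<^sub>L 'a" where "\<And>x. Q x \<in> S" "\<And>x z. z \<in> S \<Longrightarrow> inner (x - Q x) z = 0"
    "\<And>x y. y \<in> S \<Longrightarrow> (\<And>z. z \<in> S \<Longrightarrow> inner (x - y) z = 0) \<Longrightarrow> Q x = y"
proof -
  obtain f where f: "\<And>x. f x \<in> S" "\<And>x z. z \<in> S \<Longrightarrow> inner (x - f x) z = 0"
    using orthogonal_projection_exists[OF S] by metis
  have uniq: "f x = y" if "y \<in> S" "\<And>z. z \<in> S \<Longrightarrow> inner (x - y) z = 0" for x y
  proof -
    have "f x - y \<in> S" using S(1) f(1) that(1) by (rule subspace_diff)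
    then have "inner (x - y) (f x - y) - inner (x - f x) (f x - y) = 0"
      using that(2) f(2) by simp
    then show ?thesis by (simp add: inner_diff_left[symmetric])
  qed
  have "bounded_linear f"
  proof (rule bounded_linear_intro[of _ 1])
    show "f (x + y) = f x + f y" for x y
      using f(2)[of _ x] f(2)[of _ y] by (intro uniq subspace_add[OF S(1)] f) (simp add: inner_simps)
    show "f (r *\<^sub>R x) = r *\<^sub>R f x" for r x
      using f(2)[of _ x] by (intro uniq subspace_scale[OF S(1)] f) (simp add: inner_simps)
    show "norm (f x) \<le> norm x * 1" for x
    proof -
      have "(norm (f x))\<^sup>2 = inner x (f x)"
        using f(2)[OF f(1), of x x] by (simp add: inner_diff_left power2_norm_eq_inner)
      also have "\<dots> \<le> norm x * norm (f x)" by (rule norm_cauchy_schwarz)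
      finally show ?thesis by (cases "f x = 0") (auto simp: power2_eq_square)
    qed
  qed
  then show ?thesis
    using that[of "Blinfun f"] f uniq by (simp add: bounded_linear_Blinfun_apply)
qed

lemma riesz_representation:
  fixes f :: "'a::{real_inner, complete_space} \<Rightarrow> real"
  assumes f: "bounded_linear f"
  shows "\<exists>y. \<forall>x. f x = inner x y"
proof (cases "\<forall>x. f x = 0")
  case True
  then show ?thesis by (intro exI[of _ 0]) simp
next
  case False
  then obtain x where x: "f x \<noteq> 0" by blast
  interpret bounded_linear f by (rule f)
  define S where "S = {x. f x = 0}"
  have "subspace S" by (auto simp: S_def subspace_def zero add scale)
  moreover have "closed S"
    unfolding S_def by (intro closed_Collect_eq continuous_intros continuous_on)
  ultimately obtain y where y: "y \<in> S" "\<And>z. z \<in> S \<Longrightarrow> inner (x - y) z = 0"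
    using orthogonal_projection_exists by meson
  define w where "w = x - y"
  have fw: "f w = f x" using y(1) by (simp add: w_def diff S_def)
  then have w: "inner w w \<noteq> 0" using x zero by auto
  \<comment> \<open>\<open>w\<close> is orthogonal to the kernel, and subtracting a suitable
    multiple of \<open>w\<close> moves any \<open>v\<close> into the kernel.\<close>
  have "f v = inner v ((f w / inner w w) *\<^sub>R w)" for v
  proof -
    have "v - (f v / f w) *\<^sub>R w \<in> S" using x fw by (simp add: S_def diff scale)
    then have "inner w (v - (f v / f w) *\<^sub>R w) = 0" using y(2) w_def by blast
    then show ?thesis using w x fw by (simp add: inner_simps inner_commute field_simps)
  qed
  then show ?thesis by blast
qed

section \<open>Adjoints\<close>

text \<open>\<open>adjoint\<close> is a choice, so \<open>op_adj\<close> is meaningful only once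
  some bounded real adjoint is exhibited; Riesz supplies it pointwise. The argument is real linear
  and thus covers antilinear operators as well.\<close>

lemma adjoint_exists:
  fixes T :: "'h::{real_inner, complete_space} \<Rightarrow>\<^sub>L 'h"
  shows "\<exists>S :: 'h \<Rightarrow>\<^sub>L 'h. \<forall>x y. inner (T x) y = inner x (S y)"
proof -
  have "\<exists>z. \<forall>x. inner (T x) y = inner x z" for y
    by (intro riesz_representation bounded_linear_compose[OF bounded_linear_inner_left] blinfun.bounded_linear_right)
  then obtain g where g: "\<And>x y. inner (T x) y = inner x (g y)" by metis
  have "bounded_linear g"
  proof (rule bounded_linear_intro[of _ "norm T"])
    show "g (x + y) = g x + g y" for x y
      by (rule vector_eq_ldot[THEN iffD1]) (simp add: g[symmetric] inner_simps)
    show "g (r *\<^sub>R x) = r *\<^sub>R g x" for r x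
      by (rule vector_eq_ldot[THEN iffD1]) (simp add: g[symmetric] inner_simps)
    show "norm (g y) \<le> norm y * norm T" for y
    proof -
      have "(norm (g y))\<^sup>2 = inner (T (g y)) y" by (simp add: g power2_norm_eq_inner)
      also have "\<dots> \<le> norm (T (g y)) * norm y" by (rule norm_cauchy_schwarz)
      also have "\<dots> \<le> norm T * norm (g y) * norm y"
        by (intro mult_right_mono norm_blinfun) simp
      finally show ?thesis by (cases "g y = 0") (auto simp: power2_eq_square algebra_simps)
    qed
  qed
  then show ?thesis using g by (intro exI[of _ "Blinfun g"]) (simp add: bounded_linear_Blinfun_apply)
qed

lemma inner_op_adj:
  fixes T :: "'h::complex_hilbert \<Rightarrow>\<^sub>L 'h"
  shows "inner (T x) y = inner x (op_adj T y)"
proof -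
  obtain S :: "'h \<Rightarrow>\<^sub>L 'h" where S: "\<And>x y. inner (T x) y = inner x (S y)"
    using adjoint_exists by blast
  have "op_adj T = S"
    unfolding op_adj_def using adjoint_unique[of T S] S by (simp add: blinfun_apply_inverse)
  then show ?thesis using S by simp
qed

lemma op_adj_unique:
  fixes S T :: "'h::complex_hilbert \<Rightarrow>\<^sub>L 'h"
  assumes "\<And>x y. inner (T x) y = inner x (S y)"
  shows "op_adj T = S"
  by (rule blinfun_eqI, rule vector_eq_ldot[THEN iffD1]) (simp add: assms inner_op_adj[symmetric])

lemma op_adj_op_adj [simp]: "op_adj (op_adj T) = T"
  by (rule op_adj_unique) (metis inner_commute inner_op_adj)

lemma op_adj_compose [simp]: "op_adj (S o\<^sub>L T) = op_adj T o\<^sub>L op_adj S"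
  by (rule op_adj_unique) (simp add: inner_op_adj)

lemma op_adj_id [simp]: "op_adj id_blinfun = id_blinfun"
  by (rule op_adj_unique) simp

lemma op_adj_zero [simp]: "op_adj 0 = 0"
  by (rule op_adj_unique) simp

lemma op_adj_add: "op_adj (S + T) = op_adj S + op_adj T"
  by (rule op_adj_unique) (simp add: inner_op_adj blinfun.add_left inner_simps)

lemma op_adj_minus [simp]: "op_adj (- T) = - op_adj T"
  by (rule op_adj_unique) (simp add: inner_op_adj blinfun.minus_left inner_simps)

lemma op_adj_diff: "op_adj (S - T) = op_adj S - op_adj T"
  using op_adj_add[of S "- T"] by simp

lemma op_adj_scaleR: "op_adj (r *\<^sub>R T) = r *\<^sub>R op_adj T"
  by (rule op_adj_unique) (simp add: inner_op_adj blinfun.scaleR_left inner_simps)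

lemma op_adj_sum: "op_adj (\<Sum>i\<in>I. T i) = (\<Sum>i\<in>I. op_adj (T i))"
  by (induction I rule: infinite_finite_induct) (simp_all add: op_adj_add)

lemma bounded_opsD: "T \<in> bounded_ops \<Longrightarrow> T (c *\<^sub>C x) = c *\<^sub>C T x"
  by (simp add: bounded_ops_def)

lemma cinner_op_adj:
  assumes "T \<in> bounded_ops"
  shows "cinner (T x) y = cinner x (op_adj T y)"
  by (rule cinner_eqI) (simp add: bounded_opsD[OF assms, symmetric] inner_op_adj)

lemma bounded_ops_adj [simp]:
  assumes "T \<in> bounded_ops" shows "op_adj T \<in> bounded_ops"
  unfolding bounded_ops_def mem_Collect_eq
proof (intro allI)
  fix c x
  show "op_adj T (c *\<^sub>C x) = c *\<^sub>C op_adj T x"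
    by (rule cinner_ext) (simp add: cinner_op_adj[OF assms, symmetric] cinner_scaleC_right)
qed

lemma cinner_op_adj':
  assumes "T \<in> bounded_ops"
  shows "cinner x (T y) = cinner (op_adj T x) y"
  using cinner_op_adj[OF bounded_ops_adj[OF assms], of x y] by simp

lemma bounded_ops_id [simp]: "id_blinfun \<in> bounded_ops"
  by (simp add: bounded_ops_def)

lemma bounded_ops_zero [simp]: "0 \<in> bounded_ops"
  by (simp add: bounded_ops_def)

lemma bounded_ops_compose [simp]: "S \<in> bounded_ops \<Longrightarrow> T \<in> bounded_ops \<Longrightarrow> S o\<^sub>L T \<in> bounded_ops"
  by (simp add: bounded_ops_def)

lemma bounded_ops_add [simp]: "S \<in> bounded_ops \<Longrightarrow> T \<in> bounded_ops \<Longrightarrow> S + T \<in> bounded_ops"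
  by (simp add: bounded_ops_def blinfun.add_left scaleC_add_right)

lemma bounded_ops_minus [simp]: "T \<in> bounded_ops \<Longrightarrow> - T \<in> bounded_ops"
  by (simp add: bounded_ops_def blinfun.minus_left)

lemma bounded_ops_diff [simp]: "S \<in> bounded_ops \<Longrightarrow> T \<in> bounded_ops \<Longrightarrow> S - T \<in> bounded_ops"
  by (simp add: bounded_ops_def blinfun.diff_left scaleC_diff_right)

lemma bounded_ops_scaleC [simp]: "T \<in> bounded_ops \<Longrightarrow> c *\<^sub>C T \<in> bounded_ops"
  by (simp add: bounded_ops_def scaleC_blinfun.rep_eq scaleC_scaleC mult.commute)

lemma bounded_ops_sum [simp]: "(\<And>i. i \<in> I \<Longrightarrow> T i \<in> bounded_ops) \<Longrightarrow> (\<Sum>i\<in>I. T i) \<in> bounded_ops"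
  by (induction I rule: infinite_finite_induct) simp_all

lemma bounded_ops_ketbra [simp]: "ketbra x y \<in> bounded_ops"
  by (simp add: bounded_ops_def ketbra.rep_eq cinner_scaleC_right scaleC_scaleC)

lemma op_adj_scaleC: "T \<in> bounded_ops \<Longrightarrow> op_adj (c *\<^sub>C T) = cnj c *\<^sub>C op_adj T"
  by (rule op_adj_eqI) (simp add: scaleC_blinfun.rep_eq cinner_scaleC_left cinner_scaleC_right cinner_op_adj)

lemma op_adj_ketbra [simp]: "op_adj (ketbra x y) = ketbra y x"
proof (rule op_adj_eqI)
  show "cinner (ketbra x y u) v = cinner u (ketbra y x v)" for u v
    using cinner_commute[of u y] by (simp add: ketbra.rep_eq cinner_scaleC_left cinner_scaleC_right)
qed

lemma blinfun_compose_add_left: "(S + T) o\<^sub>L R = (S o\<^sub>L R) + (T o\<^sub>L R)"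
  by (rule blinfun_eqI) (simp add: blinfun.add_left)

lemma blinfun_compose_add_right: "R o\<^sub>L (S + T) = (R o\<^sub>L S) + (R o\<^sub>L T)"
  by (rule blinfun_eqI) (simp add: blinfun.add_left blinfun.add_right)

lemma blinfun_compose_minus_left [simp]: "(- T) o\<^sub>L R = - (T o\<^sub>L R)"
  by (rule blinfun_eqI) (simp add: blinfun.minus_left)

lemma blinfun_compose_minus_right [simp]: "R o\<^sub>L (- T) = - (R o\<^sub>L T)"
  by (rule blinfun_eqI) (simp add: blinfun.minus_left blinfun.minus_right)

lemma blinfun_compose_diff_left: "(S - T) o\<^sub>L R = (S o\<^sub>L R) - (T o\<^sub>L R)"
  by (rule blinfun_eqI) (simp add: blinfun.diff_left)

lemma blinfun_compose_diff_right: "R o\<^sub>L (S - T) = (R o\<^sub>L S) - (R o\<^sub>L T)"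
  by (rule blinfun_eqI) (simp add: blinfun.diff_left blinfun.diff_right)

lemma blinfun_compose_sum_left: "(\<Sum>i\<in>I. T i) o\<^sub>L R = (\<Sum>i\<in>I. T i o\<^sub>L R)"
  by (rule blinfun_eqI) (simp add: blinfun.sum_left)

lemma blinfun_compose_sum_right: "R o\<^sub>L (\<Sum>i\<in>I. T i) = (\<Sum>i\<in>I. R o\<^sub>L T i)"
  by (rule blinfun_eqI) (simp add: blinfun.sum_left blinfun.sum_right)

lemma blinfun_compose_scaleC_left [simp]: "(c *\<^sub>C T) o\<^sub>L R = c *\<^sub>C (T o\<^sub>L R)"
  by (rule blinfun_eqI) (simp add: scaleC_blinfun.rep_eq)

lemma blinfun_compose_scaleC_right: "R \<in> bounded_ops \<Longrightarrow> R o\<^sub>L (c *\<^sub>C T) = c *\<^sub>C (R o\<^sub>L T)"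
  by (rule blinfun_eqI) (simp add: scaleC_blinfun.rep_eq bounded_opsD)

lemma blinfun_compose_assoc: "(R o\<^sub>L S) o\<^sub>L T = R o\<^sub>L (S o\<^sub>L T)"
  by (rule blinfun_eqI) simp

lemma blinfun_compose_id [simp]: "id_blinfun o\<^sub>L T = T" "T o\<^sub>L id_blinfun = T"
  by (rule blinfun_eqI; simp)+

lemma compose_ketbra: "T \<in> bounded_ops \<Longrightarrow> T o\<^sub>L ketbra x y = ketbra (T x) y"
  by (rule blinfun_eqI) (simp add: ketbra.rep_eq bounded_opsD)

lemma ketbra_compose_ketbra: "ketbra x y o\<^sub>L ketbra z w = cinner y z *\<^sub>C ketbra x w"
  by (rule blinfun_eqI) (simp add: ketbra.rep_eq scaleC_blinfun.rep_eq cinner_scaleC_right scaleC_scaleC mult.commute)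

lemma ketbra_add_left: "ketbra (x + y) z = ketbra x z + ketbra y z"
  by (rule blinfun_eqI) (simp add: ketbra.rep_eq blinfun.add_left scaleC_add_right)

lemma ketbra_scaleC_left: "ketbra (c *\<^sub>C x) z = c *\<^sub>C ketbra x z"
  by (rule blinfun_eqI) (simp add: ketbra.rep_eq scaleC_blinfun.rep_eq scaleC_scaleC mult.commute)

lemma norm_isometry:
  assumes "op_adj T o\<^sub>L T = id_blinfun"
  shows "norm (T x) = norm x"
proof -
  have "inner (T x) (T x) = inner x x"
    using assms by (simp add: inner_op_adj flip: blinfun_apply_blinfun_compose)
  then show ?thesis by (simp add: norm_eq_sqrt_inner)
qed

section \<open>C*-algebras\<close>

lemma star_zero [simp]: "star 0 = 0"
  using star_scaleC[of 0 0] by simp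

lemma star_one [simp]: "star 1 = 1"
  by (metis mult_1_left mult_1_right star_mult star_star)

lemma star_minus [simp]: "star (- x) = - star x"
  using star_scaleC[of "-1" x] by simp

lemma star_scaleR: "star (r *\<^sub>R x) = r *\<^sub>R star x"
  by (simp add: scaleR_scaleC star_scaleC)

lemma star_power: "star (x ^ n) = star x ^ n"
  by (induction n) (simp_all add: star_mult power_commutes)

lemma norm_star [simp]: "norm (star x) = norm x"
proof -
  have le: "norm y \<le> norm (star y)" for y :: 'a
    using norm_mult_ineq[of "star y" y] by (cases "y = 0") (auto simp: cstar_identity power2_eq_square)
  show ?thesis using le[of x] le[of "star x"] by (simp add: star_star)
qed

lemma bounded_linear_star: "bounded_linear star"
  by (rule bounded_linear_intro[of _ 1]) (simp_all add: star_add star_scaleR)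

text \<open>The square root is the binomial series for \<open>(1 - h)^(1/2)\<close>.\<close>

lemma selfadjoint_sqrt_exists:
  fixes h :: "'a::cstar_algebra"
  assumes h: "norm h < 1" "star h = h"
  obtains y where "star y = y" "y * y = 1 - h"
proof -
  \<comment> \<open>The series has radius of convergence 1, whence the strict bound on the norm of
    \<open>h\<close>.\<close>
  define c where "c n = ((1/2 :: real) gchoose n)" for n
  define f where "f n = c n *\<^sub>R (- h) ^ n" for n
  define y where "y = (\<Sum>n. f n)"
  have "summable (\<lambda>n. norm (c n * norm h ^ n))"
    unfolding c_def using h(1) by (intro abs_summable_in_conv_radius) (auto simp: conv_radius_gchoose)
  then have sumf: "summable (\<lambda>n. norm (f n))"
    using norm_power_ineq[of "- h"]
    by (elim summable_comparison_test_ev[rotated])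
       (auto simp: f_def abs_mult intro!: always_eventually mult_left_mono)
  have "star y = (\<Sum>n. star (f n))"
    unfolding y_def by (rule bounded_linear.suminf[OF bounded_linear_star summable_norm_cancel[OF sumf]])
  then have "star y = y"
    by (simp add: y_def f_def star_scaleR star_power h(2))
  moreover have "y * y = 1 - h"
  proof -
    \<comment> \<open>Vandermonde's identity for 1/2 + 1/2 = 1: the Cauchy square of the series is
      the binomial series with exponent 1, which stops after two terms.\<close>
    have "(\<Sum>i\<le>n. f i * f (n - i)) = (1 gchoose n) *\<^sub>R (- h) ^ n" for n
    proof -
      have "(\<Sum>i\<le>n. f i * f (n - i)) = (\<Sum>i\<le>n. (c i * c (n - i)) *\<^sub>R (- h) ^ n)"
        by (intro sum.cong) (auto simp: f_def simp flip: power_add)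
      also have "\<dots> = (\<Sum>i\<in>{0..n}. c i * c (n - i)) *\<^sub>R (- h) ^ n"
        by (simp add: scaleR_sum_left atMost_atLeast0)
      also have "\<dots> = (1 gchoose n) *\<^sub>R (- h) ^ n"
        unfolding c_def by (subst gbinomial_Vandermonde) simp
      finally show ?thesis .
    qed
    then have "(\<lambda>n. (1 gchoose n) *\<^sub>R (- h) ^ n) sums (y * y)"
      using Cauchy_product_sums[OF sumf sumf] by (simp add: y_def)
    moreover have "(\<lambda>n. (1 gchoose n) *\<^sub>R (- h) ^ n) sums (\<Sum>n\<in>{0, 1}. (1 gchoose n) *\<^sub>R (- h) ^ n)"
    proof (rule sums_finite)
      fix n :: nat assume "n \<notin> {0, 1}"
      then have "1 gchoose n = (0::real)"
        using binomial_gbinomial[of 1 n, where 'a = real] by (simp add: binomial_eq_0)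
      then show "(1 gchoose n) *\<^sub>R (- h) ^ n = 0" by simp
    qed simp
    ultimately show ?thesis
      by (simp add: sums_unique2)
  qed
  ultimately show ?thesis by (rule that)
qed

section \<open>Representations: automatic contractivity\<close>

definition unital_rep :: "int \<Rightarrow> ('a::cstar_algebra \<Rightarrow> ('h::complex_hilbert \<Rightarrow>\<^sub>L 'h)) \<Rightarrow> bool"
  where "unital_rep s \<phi> \<longleftrightarrow>
    star_hom_on s (*) star (o\<^sub>L) op_adj UNIV \<phi> \<and> \<phi> 1 = id_blinfun \<and> range \<phi> \<subseteq> bounded_ops"

context
  fixes s and \<phi> :: "'a::cstar_algebra \<Rightarrow> ('h::complex_hilbert \<Rightarrow>\<^sub>L 'h)"
  assumes rep: "unital_rep s \<phi>"
begin

lemma unital_rep_add: "\<phi> (x + y) = \<phi> x + \<phi> y"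
  and unital_rep_scaleC: "\<phi> (c *\<^sub>C x) = conj_if s c *\<^sub>C \<phi> x"
  and unital_rep_mult: "\<phi> (x * y) = \<phi> x o\<^sub>L \<phi> y"
  and unital_rep_star: "\<phi> (star x) = op_adj (\<phi> x)"
  and unital_rep_one: "\<phi> 1 = id_blinfun"
  and unital_rep_bounded_ops: "\<phi> x \<in> bounded_ops"
  using rep by (auto simp: unital_rep_def star_hom_on_def)

lemma unital_rep_scaleR: "\<phi> (r *\<^sub>R x) = r *\<^sub>R \<phi> x"
  by (simp add: scaleR_scaleC unital_rep_scaleC conj_if_def)

lemma unital_rep_zero: "\<phi> 0 = 0"
  using unital_rep_scaleR[of 0 0] by simp

lemma unital_rep_minus: "\<phi> (- x) = - \<phi> x"
  using unital_rep_scaleR[of "-1" x] by simp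

lemma unital_rep_diff: "\<phi> (x - y) = \<phi> x - \<phi> y"
  using unital_rep_add[of x "- y"] by (simp add: unital_rep_minus)

lemma unital_rep_sum: "\<phi> (\<Sum>i\<in>I. f i) = (\<Sum>i\<in>I. \<phi> (f i))"
  by (induction I rule: infinite_finite_induct) (simp_all add: unital_rep_zero unital_rep_add)

lemma unital_rep_prod_list: "\<phi> (prod_list xs) = op_prod (map \<phi> xs)"
  by (induction xs) (simp_all add: op_prod_def unital_rep_one unital_rep_mult)

lemma inner_op_adj_self: "inner v ((op_adj T o\<^sub>L T) v) = (norm (T v))\<^sup>2" for T :: "'h \<Rightarrow>\<^sub>L 'h"
  by (simp add: power2_norm_eq_inner inner_op_adj)

text \<open>If \<open>norm x < 1\<close>, then \<open>1 - x* x\<close> is of the form \<open>y* y\<close>.\<close>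

lemma norm_unital_rep_le: "norm (\<phi> x) \<le> norm x"
proof (rule field_le_epsilon)
  fix e :: real assume e: "0 < e"
  \<comment> \<open>The slack \<open>e\<close> makes the rescaled element a strict contraction, as
    the square root requires.\<close>
  define r where "r = norm x + e"
  have r: "0 < r" "norm x < r" using e by (simp_all add: r_def add_nonneg_pos)
  define x' where "x' = (1 / r) *\<^sub>R x"
  have "norm x' < 1" using r by (simp add: x'_def)
  then have "norm (star x' * x') < 1"
    by (simp only: cstar_identity abs_square_less_1) simp
  then obtain y where y: "star y = y" "y * y = 1 - star x' * x'"
    by (rule selfadjoint_sqrt_exists) (simp add: star_mult star_star)
  have "\<phi> (star y * y) = \<phi> (1 - star x' * x')" using y by simp
  then have eq: "op_adj (\<phi> y) o\<^sub>L \<phi> y = id_blinfun - (op_adj (\<phi> x') o\<^sub>L \<phi> x')"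
    by (simp add: unital_rep_diff unital_rep_mult unital_rep_star unital_rep_one)
  have "norm (\<phi> x v) \<le> r * norm v" for v
  proof -
    have "0 \<le> inner v ((op_adj (\<phi> y) o\<^sub>L \<phi> y) v)" by (simp only: inner_op_adj_self) simp
    also have "\<dots> = (norm v)\<^sup>2 - (norm (\<phi> x' v))\<^sup>2"
      unfolding eq by (simp add: blinfun.diff_left inner_simps power2_norm_eq_inner inner_op_adj)
    finally have "norm (\<phi> x' v) \<le> norm v" by (simp add: power2_le_iff_abs_le)
    then show ?thesis
      using r by (simp add: x'_def unital_rep_scaleR blinfun.scaleR_left field_simps)
  qed
  then show "norm (\<phi> x) \<le> norm x + e"
    using r by (intro norm_blinfun_bound) (auto simp: r_def)
qed

lemma bounded_linear_unital_rep: "bounded_linear \<phi>"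
  by (rule bounded_linear_intro[of _ 1]) (simp_all add: unital_rep_add unital_rep_scaleR norm_unital_rep_le)

lemma continuous_on_unital_rep: "continuous_on S \<phi>"
  by (rule linear_continuous_on[OF bounded_linear_unital_rep])

end

section \<open>Bogoliubov automorphisms and arguments on generators\<close>

lemma bogoliubovD:
  assumes "bogoliubov a s w \<beta>"
  shows "\<beta> (x + y) = \<beta> x + \<beta> y" "\<beta> (c *\<^sub>C x) = conj_if s c *\<^sub>C \<beta> x" "\<beta> (x * y) = \<beta> x * \<beta> y"
    "\<beta> (star x) = star (\<beta> x)" "bij \<beta>" "f \<in> l2 \<Longrightarrow> \<beta> (a f) = a (w f)" "\<beta> 1 = 1" "\<beta> 0 = 0"
proof -
  show *: "\<beta> (x + y) = \<beta> x + \<beta> y" "\<beta> (c *\<^sub>C x) = conj_if s c *\<^sub>C \<beta> x" "\<beta> (x * y) = \<beta> x * \<beta> y"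
    "\<beta> (star x) = star (\<beta> x)" "bij \<beta>" "f \<in> l2 \<Longrightarrow> \<beta> (a f) = a (w f)" for x y c
    using assms by (auto simp: bogoliubov_def star_hom_on_def)
  \<comment> \<open>\<open>star_hom_on\<close> does not contain unitality; a preimage
    \<open>e\<close> of 1 gives it, because \<open>\<beta> (1 * e)\<close> is both
    \<open>\<beta> 1 * 1\<close> and 1.\<close>
  obtain e where "\<beta> e = 1" using *(5) by (metis bij_pointE)
  then show "\<beta> 1 = 1" using *(3)[of 1 e] by simp
  show "\<beta> 0 = 0" using *(1)[of 0 0] by simp
qed

lemma unital_rep_comp_bogoliubov:
  assumes "unital_rep s \<phi>" "bogoliubov a t w \<beta>"
  shows "unital_rep (if t = 0 then s else if s = 0 then 1 else 0) (\<phi> \<circ> \<beta>)"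
  unfolding unital_rep_def star_hom_on_def
  using bogoliubovD[OF assms(2)] unital_rep_add[OF assms(1)] unital_rep_scaleC[OF assms(1)]
    unital_rep_mult[OF assms(1)] unital_rep_star[OF assms(1)] unital_rep_one[OF assms(1)]
    unital_rep_bounded_ops[OF assms(1)]
  by (auto simp: conj_if_def)

text \<open>Minimality of the hull as an induction rule. Norm closedness is part of
  \<open>cstar_subalgebra\<close>, so each application owes a continuity argument, typically
  contractivity of representations.\<close>

lemma local_alg_induct:
  assumes "x \<in> local_alg a X" "cstar_subalgebra S"
    "\<And>f. f \<in> l2 \<Longrightarrow> (\<And>y. y \<notin> X \<Longrightarrow> f y = 0) \<Longrightarrow> a f \<in> S"
  shows "x \<in> S"
proof -
  have "local_alg a X \<subseteq> S"
    unfolding local_alg_def using assms(2,3) by (intro hull_minimal) auto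
  then show ?thesis using assms(1) by blast
qed

lemma cstar_subalgebra_local_alg: "cstar_subalgebra (local_alg a X)"
  unfolding local_alg_def by (rule hull_in) (auto simp: cstar_subalgebra_def)

lemma local_alg_closed:
  shows "1 \<in> local_alg a X"
    and "x \<in> local_alg a X \<Longrightarrow> y \<in> local_alg a X \<Longrightarrow> x + y \<in> local_alg a X"
    and "x \<in> local_alg a X \<Longrightarrow> y \<in> local_alg a X \<Longrightarrow> x * y \<in> local_alg a X"
    and "x \<in> local_alg a X \<Longrightarrow> c *\<^sub>C x \<in> local_alg a X"
    and "x \<in> local_alg a X \<Longrightarrow> star x \<in> local_alg a X"
  using cstar_subalgebra_local_alg[of a X] unfolding cstar_subalgebra_def by blast+

lemma local_alg_generator: "f \<in> l2 \<Longrightarrow> (\<And>y. y \<notin> X \<Longrightarrow> f y = 0) \<Longrightarrow> a f \<in> local_alg a X"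
  unfolding local_alg_def by (intro hull_inc) auto

lemma local_alg_mono: "X \<subseteq> Y \<Longrightarrow> local_alg a X \<subseteq> local_alg a Y"
  unfolding local_alg_def by (intro hull_mono) auto

lemma local_alg_eqI:
  assumes "unital_rep s \<phi>" "unital_rep s \<psi>" "x \<in> local_alg a X"
    and "\<And>f. f \<in> l2 \<Longrightarrow> (\<And>y. y \<notin> X \<Longrightarrow> f y = 0) \<Longrightarrow> \<phi> (a f) = \<psi> (a f)"
  shows "\<phi> x = \<psi> x"
proof -
  have "x \<in> {x. \<phi> x = \<psi> x}"
  proof (rule local_alg_induct[OF assms(3)])
    show "cstar_subalgebra {x. \<phi> x = \<psi> x}"
      unfolding cstar_subalgebra_def
      using unital_rep_add[OF assms(1)] unital_rep_scaleC[OF assms(1)] unital_rep_mult[OF assms(1)]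
        unital_rep_star[OF assms(1)] unital_rep_one[OF assms(1)]
        unital_rep_add[OF assms(2)] unital_rep_scaleC[OF assms(2)] unital_rep_mult[OF assms(2)]
        unital_rep_star[OF assms(2)] unital_rep_one[OF assms(2)]
      by (auto intro!: closed_Collect_eq continuous_on_unital_rep[OF assms(1)] continuous_on_unital_rep[OF assms(2)])
  qed (use assms(4) in auto)
  then show ?thesis by simp
qed

lemma unital_rep_eqI:
  assumes "car_algebra a" "unital_rep s \<phi>" "unital_rep s \<psi>" "\<And>f. f \<in> l2 \<Longrightarrow> \<phi> (a f) = \<psi> (a f)"
  shows "\<phi> = \<psi>"
  using local_alg_eqI[OF assms(2,3), of _ a UNIV] assms(1,4) by (auto simp: car_algebra_def)

lemma commute_local_alg:
  assumes rep: "unital_rep s \<phi>" and T: "T \<in> bounded_ops" and A: "A \<in> local_alg a X"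
    and gen: "\<And>f. f \<in> l2 \<Longrightarrow> (\<And>y. y \<notin> X \<Longrightarrow> f y = 0) \<Longrightarrow> T o\<^sub>L \<phi> (a f) = \<phi> (a f) o\<^sub>L T"
    and gen': "\<And>f. f \<in> l2 \<Longrightarrow> (\<And>y. y \<notin> X \<Longrightarrow> f y = 0) \<Longrightarrow> T o\<^sub>L op_adj (\<phi> (a f)) = op_adj (\<phi> (a f)) o\<^sub>L T"
  shows "T o\<^sub>L \<phi> A = \<phi> A o\<^sub>L T"
proof -
  \<comment> \<open>\<open>T\<close> need not be selfadjoint, so commuting with
    \<open>\<phi> A\<close> alone is not preserved by \<open>star\<close>; both conditions together
    are.\<close>
  define S where "S = {A. T o\<^sub>L \<phi> A = \<phi> A o\<^sub>L T \<and> T o\<^sub>L \<phi> (star A) = \<phi> (star A) o\<^sub>L T}"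
  have "A \<in> S"
  proof (rule local_alg_induct[OF A])
    have cont: "continuous_on UNIV (\<lambda>A. T o\<^sub>L \<phi> (f A))" "continuous_on UNIV (\<lambda>A. \<phi> (f A) o\<^sub>L T)"
      if "continuous_on UNIV f" for f
      using that continuous_on_compose2[OF continuous_on_unital_rep[OF rep] that]
      by (auto intro!: bounded_bilinear.continuous_on[OF bounded_bilinear_blinfun_compose] continuous_on_const)
    have "closed S"
      unfolding S_def Collect_conj_eq
      by (intro closed_Int closed_Collect_eq cont[of "\<lambda>A. A", simplified] cont[of star]
          linear_continuous_on[OF bounded_linear_star])
    moreover have "x * y \<in> S" if "x \<in> S" "y \<in> S" for x y
      using that unfolding S_def mem_Collect_eq star_mult unital_rep_mult[OF rep]
      by (metis blinfun_compose_assoc)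
    ultimately show "cstar_subalgebra S"
      using T unfolding cstar_subalgebra_def S_def
      by (auto simp: unital_rep_add[OF rep] unital_rep_scaleC[OF rep] unital_rep_one[OF rep] star_add star_scaleC
          star_star blinfun_compose_add_left blinfun_compose_add_right blinfun_compose_scaleC_right)
  qed (use gen gen' in \<open>auto simp: S_def unital_rep_star[OF rep]\<close>)
  then show ?thesis by (simp add: S_def)
qed

section \<open>Irreducibility of pure states\<close>

lemma dense_eqI:
  fixes S T :: "'h::real_normed_vector \<Rightarrow>\<^sub>L 'k::real_normed_vector"
  assumes "closure D = UNIV" "\<And>x. x \<in> D \<Longrightarrow> S x = T x"
  shows "S = T"
proof -
  have "closed {x. S x = T x}"
    by (intro closed_Collect_eq linear_continuous_on blinfun.bounded_linear_right)
  then have "closure D \<subseteq> {x. S x = T x}"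
    using assms(2) by (intro closure_minimal) auto
  then show ?thesis using assms(1) by (intro blinfun_eqI) auto
qed

lemma dense_orthogonal:
  fixes z :: "'h::real_inner"
  assumes "closure D = UNIV" "\<And>x. x \<in> D \<Longrightarrow> inner z x = 0"
  shows "z = 0"
proof -
  have "closed {x. inner z x = 0}"
    by (intro closed_Collect_eq continuous_intros)
  then have "closure D \<subseteq> {x. inner z x = 0}"
    using assms(2) by (intro closure_minimal) auto
  then have "inner z z = 0" using assms(1) by blast
  then show ?thesis by simp
qed

lemma closure_subspace:
  fixes S :: "'h::real_normed_vector set"
  assumes "subspace S"
  shows "subspace (closure S)"
  unfolding subspace_def
proof (intro conjI ballI allI)
  show "0 \<in> closure S" using assms closure_subset subspace_0 by blast
  fix x assume "x \<in> closure S"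
  then obtain f where f: "\<And>n. f n \<in> S" "f \<longlonglongrightarrow> x" unfolding closure_sequential by blast
  show "c *\<^sub>R x \<in> closure S" for c
    unfolding closure_sequential
    using f assms by (intro exI[of _ "\<lambda>n. c *\<^sub>R f n"]) (auto intro!: tendsto_intros subspace_scale)
  fix y assume "y \<in> closure S"
  then obtain g where g: "\<And>n. g n \<in> S" "g \<longlonglongrightarrow> y" unfolding closure_sequential by blast
  show "x + y \<in> closure S"
    unfolding closure_sequential
    using f g assms by (intro exI[of _ "\<lambda>n. f n + g n"]) (auto intro!: tendsto_intros subspace_add)
qed

lemma commutantD: "T \<in> commutant M \<Longrightarrow> T \<in> bounded_ops" "T \<in> commutant M \<Longrightarrow> A \<in> M \<Longrightarrow> T o\<^sub>L A = A o\<^sub>L T"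
  by (auto simp: commutant_def)

lemma gns_unital_rep: "gns_triple UNIV \<phi> \<pi> \<Omega> \<Longrightarrow> unital_rep 0 \<pi>"
  by (auto simp: gns_triple_def unital_rep_def)

lemma gns_state: "gns_triple UNIV \<phi> \<pi> \<Omega> \<Longrightarrow> \<phi> x = cinner \<Omega> (\<pi> x \<Omega>)"
  by (auto simp: gns_triple_def)

lemma gns_cyclic: "gns_triple UNIV \<phi> \<pi> \<Omega> \<Longrightarrow> closure (range (\<lambda>x. \<pi> x \<Omega>)) = UNIV"
  by (auto simp: gns_triple_def)

lemma cinner_selfadjoint:
  assumes "P \<in> bounded_ops" "op_adj P = P"
  shows "cinner v (P v) = of_real (inner v (P v))"
proof -
  have "cinner v (P v) = cnj (cinner v (P v))"
    using cinner_op_adj[OF assms(1), of v v] cinner_commute[of v "P v"] assms(2) by simp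
  then show ?thesis
    by (metis Reals_cnj_iff inner_eq_Re_cinner complex_is_Real_iff of_real_Re)
qed

text \<open>Positivity: \<open>P\<close> commutes with the representation, so the functional at
  \<open>star x * x\<close> is the quadratic form of \<open>P\<close> at the vector
  \<open>\<pi> x \<Omega>\<close>, up to the normalisation by its value at 1.\<close>

lemma is_state_of_commutant:
  assumes rep: "unital_rep 0 \<pi>" and P: "P \<in> commutant (range \<pi>)" "op_adj P = P"
    and pos: "\<And>v. 0 \<le> inner v (P v)" "0 < inner \<Omega> (P \<Omega>)"
  shows "is_state (\<lambda>x. cinner \<Omega> (P (\<pi> x \<Omega>)) / of_real (inner \<Omega> (P \<Omega>)))"
proof -
  note Pb = commutantD(1)[OF P(1)]
  have comm: "P (\<pi> x v) = \<pi> x (P v)" for x v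
    using commutantD(2)[OF P(1), of "\<pi> x"] by (metis blinfun_apply_blinfun_compose rangeI)
  have "cinner \<Omega> (P (\<pi> (star x * x) \<Omega>)) / of_real (inner \<Omega> (P \<Omega>)) \<in> \<real>\<^sub>\<ge>\<^sub>0" for x
  proof -
    have "cinner \<Omega> (P (\<pi> (star x * x) \<Omega>)) = cinner (\<pi> x \<Omega>) (P (\<pi> x \<Omega>))"
      by (simp only: comm) (simp add: unital_rep_mult[OF rep] unital_rep_star[OF rep]
          cinner_op_adj[OF unital_rep_bounded_ops[OF rep]])
    also have "\<dots> = of_real (inner (\<pi> x \<Omega>) (P (\<pi> x \<Omega>)))"
      by (rule cinner_selfadjoint[OF Pb P(2)])
    finally show ?thesis
      using pos by (simp add: nonneg_Reals_of_real_iff flip: of_real_divide)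
  qed
  then show ?thesis
    using pos(2) by (auto simp: is_state_def unital_rep_add[OF rep] unital_rep_scaleC[OF rep] unital_rep_one[OF rep]
        conj_if_def blinfun.add_left blinfun.add_right scaleC_blinfun.rep_eq bounded_opsD[OF Pb] cinner_add_right
        cinner_scaleC_right add_divide_distrib cinner_selfadjoint[OF Pb P(2)])
qed

text \<open>A nontrivial \<open>P\<close> between 0 and 1 in the commutant would decompose the state
  into multiples of \<open>x \<mapsto> \<langle>\<Omega>, P \<pi>(x) \<Omega>\<rangle>\<close> and \<open>x \<mapsto> \<langle>\<Omega>, (1 - P) \<pi>(x) \<Omega>\<rangle>\<close>.\<close>

lemma pure_commutant_selfadjoint:
  assumes pure: "pure_state \<phi>" and gns: "gns_triple UNIV \<phi> \<pi> \<Omega>"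
    and T: "T \<in> commutant (range \<pi>)" "op_adj T = T"
  shows "\<exists>r::real. T = r *\<^sub>R id_blinfun"
proof -
  note rep = gns_unital_rep[OF gns]
  have norm\<Omega>: "inner \<Omega> \<Omega> = 1"
  proof -
    have "cinner \<Omega> (\<pi> 1 \<Omega>) = 1" using gns_state[OF gns, of 1] pure by (simp add: pure_state_def is_state_def)
    then show ?thesis by (simp add: unital_rep_one[OF rep] inner_eq_Re_cinner)
  qed
  \<comment> \<open>Makes \<open>P\<close> below lie between 1/4 and 3/4, so that \<open>P\<close>
    and its complement both give nonzero positive functionals without any spectral theory; the added
    1 covers \<open>T = 0\<close>.\<close>
  define e where "e = 1 / (4 * (norm T + 1))"
  have e: "0 < e" "e * norm T \<le> 1 / 4"
    using norm_ge_zero[of T] by (simp_all add: e_def add_nonneg_pos divide_simps del: norm_ge_zero)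
  define P where "P = (1/2) *\<^sub>R id_blinfun + e *\<^sub>R T"
  define s where "s = inner \<Omega> (P \<Omega>)"
  have bnd: "\<bar>inner v (P v) - inner v v / 2\<bar> \<le> inner v v / 4" for v
  proof -
    have "\<bar>inner v (T v)\<bar> \<le> norm v * norm (T v)" by (rule Cauchy_Schwarz_ineq2)
    also have "\<dots> \<le> norm v * (norm T * norm v)" by (intro mult_left_mono norm_blinfun) simp
    finally have "e * \<bar>inner v (T v)\<bar> \<le> e * (norm v * (norm T * norm v))"
      using e(1) by (intro mult_left_mono) simp_all
    also have "\<dots> = (e * norm T) * (norm v)\<^sup>2" by (simp add: power2_eq_square)
    also have "\<dots> \<le> 1/4 * (norm v)\<^sup>2" using e(2) by (intro mult_right_mono) simp_all
    finally show ?thesis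
      using e(1) by (simp add: P_def blinfun.add_left blinfun.scaleR_left inner_simps abs_mult power2_norm_eq_inner)
  qed
  have s: "0 < s" "s < 1" using bnd[of \<Omega>] unfolding s_def[symmetric] norm\<Omega> by (auto simp: abs_if split: if_splits)
  have P: "P \<in> commutant (range \<pi>)" "op_adj P = P"
  proof -
    have "P = of_real (1/2) *\<^sub>C id_blinfun + of_real e *\<^sub>C T" by (simp only: P_def scaleR_scaleC)
    then show "P \<in> commutant (range \<pi>)" "op_adj P = P"
      using commutantD[OF T(1)] T(2)
      by (auto simp: commutant_def op_adj_add op_adj_scaleC blinfun_compose_add_left blinfun_compose_add_right
          blinfun_compose_scaleC_right unital_rep_bounded_ops[OF rep])
  qed
  have P': "id_blinfun - P \<in> commutant (range \<pi>)" "op_adj (id_blinfun - P) = id_blinfun - P"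
    using P by (auto simp: commutant_def op_adj_diff blinfun_compose_diff_left blinfun_compose_diff_right)
  have s': "inner \<Omega> ((id_blinfun - P) \<Omega>) = 1 - s"
    by (simp add: s_def blinfun.diff_left inner_simps norm\<Omega>)
  have nonneg: "0 \<le> inner v (P v)" "0 \<le> inner v ((id_blinfun - P) v)" for v
    using bnd[of v] inner_ge_zero[of v]
    by (auto simp: abs_if blinfun.diff_left inner_simps simp del: inner_ge_zero split: if_splits)
  define \<psi>\<^sub>1 where "\<psi>\<^sub>1 x = cinner \<Omega> (P (\<pi> x \<Omega>)) / of_real s" for x
  define \<psi>\<^sub>2 where "\<psi>\<^sub>2 x = cinner \<Omega> ((id_blinfun - P) (\<pi> x \<Omega>)) / of_real (1 - s)" for x
  have "is_state \<psi>\<^sub>1"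
    using is_state_of_commutant[OF rep P nonneg(1), of \<Omega>] s by (simp add: \<psi>\<^sub>1_def[abs_def] s_def)
  moreover have "is_state \<psi>\<^sub>2"
    using is_state_of_commutant[OF rep P' nonneg(2), of \<Omega>] s by (simp add: \<psi>\<^sub>2_def[abs_def] s')
  moreover have "\<phi> x = of_real s * \<psi>\<^sub>1 x + of_real (1 - s) * \<psi>\<^sub>2 x" for x
    using s by (simp add: \<psi>\<^sub>1_def \<psi>\<^sub>2_def gns_state[OF gns] blinfun.diff_left cinner_diff_right del: of_real_diff)
  ultimately have "\<psi>\<^sub>1 = \<phi>"
    using pure s unfolding pure_state_def by blast
  then have eq: "cinner \<Omega> (P (\<pi> x \<Omega>)) = of_real s * cinner \<Omega> (\<pi> x \<Omega>)" for x
  proof -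
    have "cinner \<Omega> (P (\<pi> x \<Omega>)) = of_real s * \<psi>\<^sub>1 x" using s by (simp add: \<psi>\<^sub>1_def)
    then show ?thesis by (simp add: \<open>\<psi>\<^sub>1 = \<phi>\<close> gns_state[OF gns])
  qed
  \<comment> \<open>Proportionality of the functionals and cyclicity make \<open>\<Omega>\<close> an
    eigenvector of \<open>P\<close>; commutation then carries the eigenvalue to every
    \<open>\<pi> x \<Omega>\<close>.\<close>
  have "P \<Omega> - s *\<^sub>R \<Omega> = 0"
  proof (rule dense_orthogonal[OF gns_cyclic[OF gns]])
    fix v assume "v \<in> range (\<lambda>x. \<pi> x \<Omega>)"
    then obtain x where v: "v = \<pi> x \<Omega>" by blast
    show "inner (P \<Omega> - s *\<^sub>R \<Omega>) v = 0"
      using arg_cong[OF eq[of x], of Re] by (simp add: v inner_simps inner_op_adj P(2) inner_eq_Re_cinner[symmetric])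
  qed
  have "P = s *\<^sub>R id_blinfun"
  proof (rule dense_eqI[OF gns_cyclic[OF gns]])
    fix v assume "v \<in> range (\<lambda>x. \<pi> x \<Omega>)"
    then obtain x where v: "v = \<pi> x \<Omega>" by blast
    have "P v = \<pi> x (P \<Omega>)"
      using commutantD(2)[OF P(1), of "\<pi> x"] by (metis v blinfun_apply_blinfun_compose rangeI)
    then show "P v = (s *\<^sub>R id_blinfun) v"
      using \<open>P \<Omega> - s *\<^sub>R \<Omega> = 0\<close> by (simp add: v blinfun.scaleR_left blinfun.scaleR_right)
  qed
  then have "e *\<^sub>R T = (s - 1/2) *\<^sub>R id_blinfun"
    by (simp add: P_def scaleR_left_diff_distrib algebra_simps)
  then have "(1 / e) *\<^sub>R (e *\<^sub>R T) = ((s - 1/2) / e) *\<^sub>R id_blinfun" by simp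
  then show ?thesis using e(1) by auto
qed

text \<open>The commutant is closed under adjoints, so the selfadjoint case applies to the
  \<open>A\<close> and \<open>B\<close> below, and \<open>T\<close> is half of
  \<open>A - \<i> B\<close>.\<close>

lemma pure_irreducible:
  assumes pure: "pure_state \<phi>" and gns: "gns_triple UNIV \<phi> \<pi> \<Omega>"
    and T: "T \<in> commutant (range \<pi>)"
  shows "\<exists>c. T = c *\<^sub>C id_blinfun"
proof -
  note rep = gns_unital_rep[OF gns]
  note Tb = commutantD(1)[OF T]
  have T': "op_adj T \<in> commutant (range \<pi>)"
    unfolding commutant_def
  proof safe
    show "op_adj T \<in> bounded_ops" using Tb by simp
    fix x
    have "op_adj (T o\<^sub>L \<pi> (star x)) = op_adj (\<pi> (star x) o\<^sub>L T)"
      using commutantD(2)[OF T] by simp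
    then show "op_adj T o\<^sub>L \<pi> x = \<pi> x o\<^sub>L op_adj T" by (simp add: unital_rep_star[OF rep])
  qed
  define A where "A = T + op_adj T"
  define B where "B = \<i> *\<^sub>C (T - op_adj T)"
  have "A \<in> commutant (range \<pi>)" "op_adj A = A"
    using commutantD[OF T] commutantD[OF T']
    by (auto simp: A_def commutant_def op_adj_add blinfun_compose_add_left blinfun_compose_add_right)
  then obtain r where r: "A = r *\<^sub>R id_blinfun"
    using pure_commutant_selfadjoint[OF pure gns] by blast
  have "B \<in> commutant (range \<pi>)" "op_adj B = B"
    using commutantD[OF T] commutantD[OF T']
    by (auto simp: B_def commutant_def op_adj_diff op_adj_scaleC blinfun_compose_diff_left blinfun_compose_diff_right
        blinfun_compose_scaleC_right unital_rep_bounded_ops[OF rep] scaleC_diff_right)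
  then obtain r' where r': "B = r' *\<^sub>R id_blinfun"
    using pure_commutant_selfadjoint[OF pure gns] by blast
  have "(1/2) *\<^sub>C (A - \<i> *\<^sub>C B) = T"
    by (simp add: A_def B_def scaleC_scaleC scaleC_add_right scaleC_diff_right)
       (simp flip: scaleC_add_left)
  then have "T = (1/2) *\<^sub>C (r *\<^sub>R id_blinfun - \<i> *\<^sub>C (r' *\<^sub>R id_blinfun))"
    by (simp only: r r')
  also have "\<dots> = ((1/2) * (of_real r - \<i> * of_real r')) *\<^sub>C id_blinfun"
    by (simp only: scaleR_scaleC scaleC_scaleC scaleC_diff_left[symmetric])
  finally show ?thesis by blast
qed

section \<open>Intertwiners\<close>

definition is_isometry_intertwining ::
  "(('k::complex_hilbert \<Rightarrow>\<^sub>L 'k) \<Rightarrow> ('h::complex_hilbert \<Rightarrow>\<^sub>L 'h)) \<Rightarrow> ('k \<Rightarrow>\<^sub>L 'h) \<Rightarrow> bool"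
  where "is_isometry_intertwining \<phi> J \<longleftrightarrow> (\<forall>c x. J (c *\<^sub>C x) = c *\<^sub>C J x) \<and>
    (\<forall>x y. cinner (J x) (J y) = cinner x y) \<and> (\<forall>b\<in>bounded_ops. \<forall>x. \<phi> b (J x) = J (b x))"

text \<open>The intertwiner maps \<open>x\<close> to \<open>\<phi>(|x\<rangle>\<langle>z|) u\<close> for a unit vector \<open>u\<close> in the range of
  \<open>\<phi>(|z\<rangle>\<langle>z|) F\<close>.\<close>

lemma intertwiner_exists:
  fixes \<phi> :: "('k::complex_hilbert \<Rightarrow>\<^sub>L 'k) \<Rightarrow> ('h::complex_hilbert \<Rightarrow>\<^sub>L 'h)"
  assumes hom: "star_hom_on 0 (o\<^sub>L) op_adj (o\<^sub>L) op_adj bounded_ops \<phi>"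
    and into: "\<And>b. b \<in> bounded_ops \<Longrightarrow> \<phi> b \<in> bounded_ops"
    and F: "F o\<^sub>L F = F" "\<And>b. b \<in> bounded_ops \<Longrightarrow> F o\<^sub>L \<phi> b = \<phi> b o\<^sub>L F"
    and z: "norm z = 1" "F o\<^sub>L \<phi> (ketbra z z) \<noteq> 0"
  obtains J where "is_isometry_intertwining \<phi> J" "\<And>x. F (J x) = J x"
proof -
  have h: "\<And>x y. x \<in> bounded_ops \<Longrightarrow> y \<in> bounded_ops \<Longrightarrow> \<phi> (x + y) = \<phi> x + \<phi> y"
    "\<And>x c. x \<in> bounded_ops \<Longrightarrow> \<phi> (c *\<^sub>C x) = c *\<^sub>C \<phi> x"
    "\<And>x y. x \<in> bounded_ops \<Longrightarrow> y \<in> bounded_ops \<Longrightarrow> \<phi> (x o\<^sub>L y) = \<phi> x o\<^sub>L \<phi> y"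
    "\<And>x. x \<in> bounded_ops \<Longrightarrow> \<phi> (op_adj x) = op_adj (\<phi> x)"
    using hom by (auto simp: star_hom_on_def conj_if_def)
  have zz: "cinner z z = 1" by (simp add: cinner_self z)
  define e where "e = \<phi> (ketbra z z)"
  have ee: "e o\<^sub>L e = e"
    unfolding e_def by (simp add: h(3)[symmetric] ketbra_compose_ketbra zz)
  obtain v where v: "(F o\<^sub>L e) v \<noteq> 0"
    using z(2) unfolding e_def by (metis blinfun_eqI zero_blinfun.rep_eq)
  define w where "w = (F o\<^sub>L e) v"
  define u where "u = (1 / norm w) *\<^sub>R w"
  have "e w = w" unfolding w_def
    using F(2)[of "ketbra z z"] ee by (simp add: e_def[symmetric] flip: blinfun_compose_assoc blinfun_apply_blinfun_compose)
  then have eu: "e u = u" by (simp add: u_def blinfun.scaleR_right)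
  have "F w = w" unfolding w_def using F(1) by (metis blinfun_apply_blinfun_compose)
  then have Fu: "F u = u" by (simp add: u_def blinfun.scaleR_right)
  have "w \<noteq> 0" using v by (simp add: w_def)
  then have uu: "cinner u u = 1" by (simp add: cinner_self u_def)
  define f where "f x = \<phi> (ketbra x z) u" for x
  have ip: "cinner (f x) (f y) = cinner x y" for x y
  proof -
    have "cinner (f x) (f y) = cinner u ((op_adj (\<phi> (ketbra x z)) o\<^sub>L \<phi> (ketbra y z)) u)"
      by (simp add: f_def cinner_op_adj into)
    \<comment> \<open>The product collapses to a multiple of \<open>e\<close>, and \<open>e\<close>
      fixes the unit vector \<open>u\<close>; hence \<open>f\<close> preserves inner
      products.\<close>
    also have "op_adj (\<phi> (ketbra x z)) o\<^sub>L \<phi> (ketbra y z) = cinner x y *\<^sub>C e"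
    proof -
      have "op_adj (\<phi> (ketbra x z)) o\<^sub>L \<phi> (ketbra y z) = \<phi> (op_adj (ketbra x z) o\<^sub>L ketbra y z)"
        by (simp only: h bounded_ops_ketbra bounded_ops_adj)
      then show ?thesis
        by (simp add: e_def h(2) ketbra_compose_ketbra)
    qed
    finally show ?thesis by (simp add: scaleC_blinfun.rep_eq eu cinner_scaleC_right uu)
  qed
  have f_scaleC: "f (c *\<^sub>C x) = c *\<^sub>C f x" for c x
    by (simp add: f_def ketbra_scaleC_left h scaleC_blinfun.rep_eq)
  have nf: "norm (f x) = norm x" for x
    using ip[of x x] by (simp add: cinner_self flip: of_real_power)
  have "bounded_linear f"
  proof (rule bounded_linear_intro[of _ 1])
    show "f (x + y) = f x + f y" for x y
      by (simp add: f_def ketbra_add_left h blinfun.add_left)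
    show "f (r *\<^sub>R x) = r *\<^sub>R f x" for r x
      by (simp add: scaleR_scaleC f_scaleC)
  qed (simp add: nf)
  then have J: "Blinfun f x = f x" for x by (simp add: bounded_linear_Blinfun_apply)
  have "\<phi> b (f x) = f (b x)" if "b \<in> bounded_ops" for b x
    using that by (simp add: f_def h(3)[symmetric] compose_ketbra flip: blinfun_apply_blinfun_compose)
  moreover have "F (f x) = f x" for x
    unfolding f_def using F(2)[of "ketbra x z"] Fu by (metis blinfun_apply_blinfun_compose bounded_ops_ketbra)
  ultimately show ?thesis
    using that[of "Blinfun f"] by (simp add: is_isometry_intertwining_def J f_scaleC ip)
qed

section \<open>Approximation by an irreducible representation\<close>

locale irreducible_rep =
  fixes \<pi> :: "'a::cstar_algebra \<Rightarrow> ('h::complex_hilbert \<Rightarrow>\<^sub>L 'h)" and \<Omega> :: 'h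
  assumes rep: "unital_rep 0 \<pi>"
    and irreducible: "T \<in> commutant (range \<pi>) \<Longrightarrow> \<exists>c. T = c *\<^sub>C id_blinfun"
    and cyclic: "closure (range (\<lambda>x. \<pi> x \<Omega>)) = UNIV"
    and norm_\<Omega>: "norm \<Omega> = 1"
begin

text \<open>The projection onto the closure of the \<open>(\<pi>(A)\<Omega>, \<pi>(A)\<beta>)\<close> commutes with \<open>\<pi>(A) \<oplus> \<pi>(A)\<close>,
  so its matrix entries are scalars.\<close>

lemma closure_orthogonal_orbit:
  assumes "cinner \<Omega> \<beta> = 0"
  shows "(v, 0) \<in> closure (range (\<lambda>A. (\<pi> A \<Omega>, \<pi> A \<beta>)))"
proof -
  define S where "S = closure (range (\<lambda>A. (\<pi> A \<Omega>, \<pi> A \<beta>)))"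
  have "subspace (range (\<lambda>A. (\<pi> A \<Omega>, \<pi> A \<beta>)))"
  proof (rule linear_subspace_image[OF _ subspace_UNIV])
    show "linear (\<lambda>A. (\<pi> A \<Omega>, \<pi> A \<beta>))"
      by (rule linearI) (simp_all add: unital_rep_add[OF rep] unital_rep_scaleR[OF rep] blinfun.add_left blinfun.scaleR_left)
  qed
  then have S: "subspace S" "closed S"
    by (auto simp: S_def intro: closure_subspace)
  have S_map: "(fst (f p), snd (f p)) \<in> S"
    if p: "p \<in> S" and f: "bounded_linear f" "\<And>A. \<exists>B. f (\<pi> A \<Omega>, \<pi> A \<beta>) = (\<pi> B \<Omega>, \<pi> B \<beta>)" for f p
  proof -
    have "f ` S \<subseteq> S"
      unfolding S_def
    proof (rule image_closure_subset[OF linear_continuous_on[OF f(1)] closed_closure])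
      show "f ` range (\<lambda>A. (\<pi> A \<Omega>, \<pi> A \<beta>)) \<subseteq> closure (range (\<lambda>A. (\<pi> A \<Omega>, \<pi> A \<beta>)))"
        by (rule order_trans[OF _ closure_subset]) (use f(2) in blast)
    qed
    then show ?thesis using p by auto
  qed
  have bl: "bounded_linear (\<lambda>p::'h \<times> 'h. (T (fst p), T (snd p)))" if "bounded_linear T" for T :: "'h \<Rightarrow> 'h"
    by (intro bounded_linear_Pair bounded_linear_compose[OF that] bounded_linear_fst bounded_linear_snd)
  have S_scaleC: "(c *\<^sub>C x, c *\<^sub>C y) \<in> S" if "(x, y) \<in> S" for c x y
  proof -
    have "\<exists>C. (\<lambda>p. (c *\<^sub>C fst p, c *\<^sub>C snd p)) (\<pi> A \<Omega>, \<pi> A \<beta>) = (\<pi> C \<Omega>, \<pi> C \<beta>)" for A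
      by (rule exI[of _ "c *\<^sub>C A"]) (simp add: unital_rep_scaleC[OF rep] conj_if_def scaleC_blinfun.rep_eq)
    from S_map[OF that bl[OF bounded_linear_scaleC] this] show ?thesis by simp
  qed
  have S_\<pi>: "(\<pi> B x, \<pi> B y) \<in> S" if "(x, y) \<in> S" for B x y
  proof -
    have "\<exists>C. (\<lambda>p. (\<pi> B (fst p), \<pi> B (snd p))) (\<pi> A \<Omega>, \<pi> A \<beta>) = (\<pi> C \<Omega>, \<pi> C \<beta>)" for A
      by (rule exI[of _ "B * A"]) (simp add: unital_rep_mult[OF rep])
    from S_map[OF that bl[OF blinfun.bounded_linear_right] this] show ?thesis by simp
  qed
  obtain Q :: "('h \<times> 'h) \<Rightarrow>\<^sub>L ('h \<times> 'h)" where Q: "\<And>x. Q x \<in> S" "\<And>x z. z \<in> S \<Longrightarrow> inner (x - Q x) z = 0"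
    "\<And>x y. y \<in> S \<Longrightarrow> (\<And>z. z \<in> S \<Longrightarrow> inner (x - y) z = 0) \<Longrightarrow> Q x = y"
    by (rule orthogonal_projection[OF S]) blast
  \<comment> \<open>By uniqueness of the projection: \<open>S\<close> is stable under the scalar and
    under its conjugate, which is the adjoint. The fact about \<open>\<pi> B\<close> uses
    \<open>star B\<close> in the same way.\<close>
  have Q_scaleC: "Q (c *\<^sub>C x, c *\<^sub>C y) = (c *\<^sub>C fst (Q (x, y)), c *\<^sub>C snd (Q (x, y)))" for c x y
  proof (rule Q(3))
    show "(c *\<^sub>C fst (Q (x, y)), c *\<^sub>C snd (Q (x, y))) \<in> S"
      by (rule S_scaleC) (simp add: Q(1))
    fix z assume "z \<in> S"
    then have "(cnj c *\<^sub>C fst z, cnj c *\<^sub>C snd z) \<in> S" by (intro S_scaleC) simp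
    from Q(2)[OF this, of "(x, y)"]
    show "inner ((c *\<^sub>C x, c *\<^sub>C y) - (c *\<^sub>C fst (Q (x, y)), c *\<^sub>C snd (Q (x, y)))) z = 0"
      by (simp add: inner_prod_def inner_eq_Re_cinner cinner_scaleC_left cinner_scaleC_right
          scaleC_diff_right[symmetric])
  qed
  have Q_\<pi>: "Q (\<pi> B x, \<pi> B y) = (\<pi> B (fst (Q (x, y))), \<pi> B (snd (Q (x, y))))" for B x y
  proof (rule Q(3))
    show "(\<pi> B (fst (Q (x, y))), \<pi> B (snd (Q (x, y)))) \<in> S"
      by (rule S_\<pi>) (simp add: Q(1))
    fix z assume "z \<in> S"
    then have "(\<pi> (star B) (fst z), \<pi> (star B) (snd z)) \<in> S" by (intro S_\<pi>) simp
    from Q(2)[OF this, of "(x, y)"]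
    show "inner ((\<pi> B x, \<pi> B y) - (\<pi> B (fst (Q (x, y))), \<pi> B (snd (Q (x, y))))) z = 0"
      by (simp add: inner_prod_def unital_rep_star[OF rep] inner_op_adj[symmetric] blinfun.diff_right)
  qed
  \<comment> \<open>\<open>g\<close> stands for \<open>fst\<close> or \<open>snd\<close>: these are
    the two entries in the first column of the operator matrix of \<open>Q\<close>.\<close>
  have scalar: "\<exists>c. \<forall>v. g (Q (v, 0)) = c *\<^sub>C v"
    if g: "bounded_linear g" "\<And>T p. g (T (fst p), T (snd p)) = (T (g p) :: 'h)" for g
  proof -
    have "bounded_linear (\<lambda>v. g (Q (v, 0)))"
      by (intro bounded_linear_compose[OF g(1)] bounded_linear_compose[OF blinfun.bounded_linear_right]
          bounded_linear_Pair bounded_linear_ident bounded_linear_zero)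
    then have T: "Blinfun (\<lambda>v. g (Q (v, 0))) v = g (Q (v, 0))" for v
      by (simp add: bounded_linear_Blinfun_apply)
    have "Blinfun (\<lambda>v. g (Q (v, 0))) \<in> commutant (range \<pi>)"
    proof -
      have "g (Q (c *\<^sub>C v, 0)) = c *\<^sub>C g (Q (v, 0))" for c v
        using Q_scaleC[of c v 0] g(2)[of "scaleC c" "Q (v, 0)"] by simp
      moreover have "g (Q (\<pi> B v, 0)) = \<pi> B (g (Q (v, 0)))" for B v
        using Q_\<pi>[of B v 0] g(2)[of "\<pi> B" "Q (v, 0)"] by simp
      ultimately show ?thesis
        by (auto simp: commutant_def bounded_ops_def T intro!: blinfun_eqI)
    qed
    then obtain c where c: "Blinfun (\<lambda>v. g (Q (v, 0))) = c *\<^sub>C id_blinfun" using irreducible by blast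
    have "g (Q (v, 0)) = c *\<^sub>C v" for v
      using T[of v] unfolding c by (simp add: scaleC_blinfun.rep_eq)
    then show ?thesis by blast
  qed
  have "\<exists>c. \<forall>v. fst (Q (v, 0)) = c *\<^sub>C v" by (rule scalar[OF bounded_linear_fst]) simp
  then obtain c where c: "\<forall>v. fst (Q (v, 0)) = c *\<^sub>C v" ..
  have "\<exists>c. \<forall>v. snd (Q (v, 0)) = c *\<^sub>C v" by (rule scalar[OF bounded_linear_snd]) simp
  then obtain d where d: "\<forall>v. snd (Q (v, 0)) = d *\<^sub>C v" ..
  have Qv: "Q (v, 0) = (c *\<^sub>C v, d *\<^sub>C v)" for v by (simp add: prod_eq_iff c d)
  have mem: "(\<Omega>, \<beta>) \<in> S"
  proof -
    have "(\<pi> 1 \<Omega>, \<pi> 1 \<beta>) \<in> S" unfolding S_def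
      by (intro subsetD[OF closure_subset] range_eqI[of _ _ 1]) simp
    then show ?thesis by (simp add: unital_rep_one[OF rep])
  qed
  \<comment> \<open>The pair of \<Omega> and \<beta> lies in \<open>S\<close>, hence is orthogonal
    to the residue of (v, 0). Orthogonality of \<Omega> and \<beta> then yields c = 1.\<close>
  have "inner v (\<Omega> - cnj c *\<^sub>C \<Omega> - cnj d *\<^sub>C \<beta>) = 0" for v
    using Q(2)[OF mem, of "(v, 0)"]
    by (simp add: Qv inner_prod_def inner_eq_Re_cinner cinner_diff_right cinner_diff_left cinner_scaleC_left cinner_scaleC_right)
  then have eq: "\<Omega> - cnj c *\<^sub>C \<Omega> - cnj d *\<^sub>C \<beta> = 0"
    using inner_eq_zero_iff by blast
  have "cinner \<Omega> (\<Omega> - cnj c *\<^sub>C \<Omega> - cnj d *\<^sub>C \<beta>) = 0" unfolding eq by simp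
  then have c1: "c = 1"
    using assms by (simp add: cinner_diff_right cinner_scaleC_right cinner_self norm_\<Omega>)
  \<comment> \<open>With c = 1 the residue is (0, - d v). It is orthogonal to Q (v, 0) = (v, d v),
    so d v = 0.\<close>
  have "Q (v, 0) = (v, 0)"
  proof -
    have "inner ((v, 0) - Q (v, 0)) (Q (v, 0)) = 0" by (rule Q(2)[OF Q(1)])
    then have "Re (cinner (d *\<^sub>C v) (d *\<^sub>C v)) = 0"
      by (simp add: Qv c1 inner_prod_def inner_eq_Re_cinner)
    then have "d *\<^sub>C v = 0" by (simp add: cinner_self)
    then show ?thesis by (simp add: Qv c1)
  qed
  with Q(1)[of "(v, 0)"] have "(v, 0) \<in> S" by metis
  then show ?thesis unfolding S_def .
qed

text \<open>A substitute for transitivity of irreducible representations. The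
  \<open>\<Omega>\<close> component of the second target is forced by the first one, both being
  governed by the matrix element \<open>cinner (\<pi> A \<Omega>) \<zeta>\<close>. The norm of
  \<open>A\<close> is not controlled.\<close>

lemma approximation:
  assumes "0 < \<epsilon>"
  shows "\<exists>A. norm (\<pi> A \<Omega> - \<eta>) < \<epsilon> \<and> norm (op_adj (\<pi> A) \<zeta> - cinner \<eta> \<zeta> *\<^sub>C \<Omega>) < \<epsilon>"
proof -
  \<comment> \<open>Only a real subspace: the first coordinate is linear and the second antilinear
    in \<open>A\<close>. The task is to show that the target \<open>p\<close> lies in its
    closure.\<close>
  define L where "L = range (\<lambda>A. (\<pi> A \<Omega>, op_adj (\<pi> A) \<zeta>))"
  have "linear (\<lambda>A. (\<pi> A \<Omega>, op_adj (\<pi> A) \<zeta>))"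
    by (rule linearI) (simp_all add: unital_rep_add[OF rep] unital_rep_scaleR[OF rep] op_adj_add op_adj_scaleR
       blinfun.add_left blinfun.scaleR_left)
  then have L: "subspace (closure L)"
    unfolding L_def by (intro closure_subspace linear_subspace_image[OF _ subspace_UNIV])
  define p where "p = (\<eta>, cinner \<eta> \<zeta> *\<^sub>C \<Omega>)"
  obtain y where y: "y \<in> closure L" "\<And>z. z \<in> closure L \<Longrightarrow> inner (p - y) z = 0"
    using orthogonal_projection_exists[OF L closed_closure] by blast
  obtain \<alpha> \<beta> where \<alpha>\<beta>: "p - y = (\<alpha>, \<beta>)" by (cases "p - y")
  have zero: "cinner \<alpha> (\<pi> A \<Omega>) + cinner \<zeta> (\<pi> A \<beta>) = 0" for A
  proof -
    have "Re (cinner \<alpha> (\<pi> B \<Omega>) + cinner \<zeta> (\<pi> B \<beta>)) = 0" for B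
    proof -
      have "(\<pi> B \<Omega>, op_adj (\<pi> B) \<zeta>) \<in> closure L"
        unfolding L_def by (intro subsetD[OF closure_subset] range_eqI[of _ _ B]) simp
      from y(2)[OF this] show ?thesis
        using inner_op_adj[of "\<pi> B" \<beta> \<zeta>]
        by (simp add: \<alpha>\<beta> inner_prod_def inner_commute flip: inner_eq_Re_cinner)
    qed
    from this[of A] this[of "- \<i> *\<^sub>C A"] show ?thesis
      by (intro complex_eqI) (simp_all add: unital_rep_scaleC[OF rep] unital_rep_minus[OF rep] conj_if_def
        scaleC_blinfun.rep_eq blinfun.minus_left cinner_scaleC_right)
  qed
  \<comment> \<open>The component of \<open>\<beta>\<close> along \<open>\<Omega>\<close> is moved
    into the first slot. The remainder is orthogonal to \<open>\<Omega>\<close>, so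
    \<open>\<pi> A \<Omega>\<close> can be steered to \<open>\<alpha>'\<close> while
    \<open>\<pi> A \<beta>'\<close> tends to 0; this forces \<open>\<alpha>' = 0\<close>.\<close>
  define \<beta>' where "\<beta>' = \<beta> - cinner \<Omega> \<beta> *\<^sub>C \<Omega>"
  define \<alpha>' where "\<alpha>' = \<alpha> + cnj (cinner \<Omega> \<beta>) *\<^sub>C \<zeta>"
  have "cinner \<Omega> \<beta>' = 0"
    by (simp add: \<beta>'_def cinner_diff_right cinner_scaleC_right cinner_self norm_\<Omega>)
  then have mem: "(v, 0) \<in> closure (range (\<lambda>A. (\<pi> A \<Omega>, \<pi> A \<beta>')))" for v
    by (rule closure_orthogonal_orbit)
  have "closure (range (\<lambda>A. (\<pi> A \<Omega>, \<pi> A \<beta>'))) \<subseteq> {p. inner (\<alpha>', \<zeta>) p = 0}"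
  proof (rule closure_minimal)
    show "closed {p. inner (\<alpha>', \<zeta>) p = 0}" by (intro closed_Collect_eq continuous_intros)
    have "Re (cinner \<alpha>' (\<pi> A \<Omega>) + cinner \<zeta> (\<pi> A \<beta>')) = 0" for A
      using arg_cong[OF zero[of A], of Re]
      by (simp add: \<alpha>'_def \<beta>'_def cinner_add_left cinner_scaleC_left blinfun.diff_right cinner_diff_right
          bounded_opsD[OF unital_rep_bounded_ops[OF rep]] cinner_scaleC_right)
    then show "range (\<lambda>A. (\<pi> A \<Omega>, \<pi> A \<beta>')) \<subseteq> {p. inner (\<alpha>', \<zeta>) p = 0}"
      by (auto simp: inner_prod_def inner_eq_Re_cinner)
  qed
  with mem[of \<alpha>'] have "\<alpha>' = 0" by (auto simp: inner_prod_def)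
  then have \<alpha>: "\<alpha> = - (cnj (cinner \<Omega> \<beta>) *\<^sub>C \<zeta>)" by (simp add: \<alpha>'_def eq_neg_iff_add_eq_0)
  have "inner (p - y) p = 0"
    using cinner_commute[of \<Omega> \<beta>] cinner_commute[of \<zeta> \<eta>] unfolding \<alpha>\<beta>
    by (simp add: \<alpha> p_def inner_prod_def inner_eq_Re_cinner cinner_scaleC_left cinner_scaleC_right)
  moreover have "inner (p - y) y = 0" by (rule y(2)[OF y(1)])
  ultimately have "inner (p - y) (p - y) = 0" by (simp add: inner_diff_right)
  then have "p \<in> closure L" using y(1) by simp
  then obtain l where "l \<in> L" "dist l p < \<epsilon>" using assms closure_approachable by blast
  then obtain A where A: "dist (\<pi> A \<Omega>, op_adj (\<pi> A) \<zeta>) p < \<epsilon>" by (auto simp: L_def)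
  then have "dist (\<pi> A \<Omega>) \<eta> < \<epsilon>" "dist (op_adj (\<pi> A) \<zeta>) (cinner \<eta> \<zeta> *\<^sub>C \<Omega>) < \<epsilon>"
    using dist_fst_le[of "(\<pi> A \<Omega>, op_adj (\<pi> A) \<zeta>)" p] dist_snd_le[of "(\<pi> A \<Omega>, op_adj (\<pi> A) \<zeta>)" p]
    by (auto simp: p_def)
  then show ?thesis by (auto simp: dist_norm)
qed

end

section \<open>The one-site algebra\<close>

lemma minus_one_power_parity: "(- 1) ^ parity \<mu> = (- 1 :: complex) ^ card \<mu>"
  by (simp add: parity_def minus_one_power_iff)

lemma creation_nth: "creation v \<psi> $ \<mu> = (\<Sum>i\<in>\<mu>. (- 1) ^ card {j \<in> \<mu>. j < i} * (v $ i) * (\<psi> $ (\<mu> - {i})))"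
  by (simp add: creation.rep_eq)

lemma creation_bounded_ops [simp]: "creation v \<in> bounded_ops"
  by (simp add: bounded_ops_def vec_eq_iff creation_nth scaleC_vec_def scaleC_complex_def sum_distrib_left mult_ac)

lemma creation_minus: "creation (- v) = - creation v"
  by (rule blinfun_eqI) (simp add: vec_eq_iff creation_nth blinfun.minus_left sum_negf)

lemma cinner_axis: "cinner (axis i 1) v = v $ i" for v :: "complex ^ 'n"
proof -
  have "cinner (axis i 1) v = (\<Sum>j\<in>UNIV. if j = i then v $ j else 0)"
    unfolding cinner_vec_def by (intro sum.cong) (auto simp: cinner_complex_def axis_def)
  then show ?thesis by simp
qed

lemma cinner_fock_basis: "cinner (fock_basis \<mu>) \<psi> = \<psi> $ \<mu>"
  by (simp add: fock_basis_eq_axis cinner_axis)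

lemma cinner_fock_basis_fock_basis: "cinner (fock_basis \<mu>) (fock_basis \<nu>) = (if \<mu> = \<nu> then 1 else 0)"
  by (simp add: cinner_fock_basis) (auto simp: fock_basis_eq_axis axis_def)

lemma fock_expand: "(\<Sum>\<mu>\<in>UNIV. (\<psi> $ \<mu>) *\<^sub>C fock_basis \<mu>) = \<psi>"
proof -
  have "(\<Sum>\<mu>\<in>UNIV. (\<psi> $ \<mu>) *\<^sub>C fock_basis \<mu>) $ \<nu> = (\<Sum>\<mu>\<in>UNIV. if \<mu> = \<nu> then \<psi> $ \<mu> else 0)" for \<nu>
    unfolding sum_component by (intro sum.cong) (auto simp: fock_basis_eq_axis scaleC_vec_def scaleC_complex_def axis_def)
  then show ?thesis by (simp add: vec_eq_iff)
qed

lemma sum_fock_basis: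
  "(\<Sum>\<mu>\<in>UNIV. (fock_basis \<nu> $ \<mu>) *\<^sub>C f \<mu>) = f \<nu>" "(\<Sum>\<mu>\<in>UNIV. cnj (fock_basis \<nu> $ \<mu>) *\<^sub>C f \<mu>) = f \<nu>"
proof -
  have "(\<Sum>\<mu>\<in>UNIV. (fock_basis \<nu> $ \<mu>) *\<^sub>C f \<mu>) = (\<Sum>\<mu>\<in>UNIV. if \<mu> = \<nu> then f \<mu> else 0)"
    "(\<Sum>\<mu>\<in>UNIV. cnj (fock_basis \<nu> $ \<mu>) *\<^sub>C f \<mu>) = (\<Sum>\<mu>\<in>UNIV. if \<mu> = \<nu> then f \<mu> else 0)"
    by (intro sum.cong refl; simp add: fock_basis_eq_axis axis_def)+
  then show "(\<Sum>\<mu>\<in>UNIV. (fock_basis \<nu> $ \<mu>) *\<^sub>C f \<mu>) = f \<nu>" "(\<Sum>\<mu>\<in>UNIV. cnj (fock_basis \<nu> $ \<mu>) *\<^sub>C f \<mu>) = f \<nu>"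
    by simp_all
qed

lemma sum_ketbra_fock_basis: "(\<Sum>\<mu>\<in>UNIV. ketbra (fock_basis \<mu>) (fock_basis \<mu>)) = id_blinfun"
  by (rule blinfun_eqI) (simp add: blinfun.sum_left ketbra.rep_eq cinner_fock_basis fock_expand)

section \<open>Second quantization on product vectors\<close>

definition product_state :: "('d::{finite, linorder} \<Rightarrow> 'd cvec) \<Rightarrow> 'd set \<Rightarrow> 'd fock"
  where "product_state u \<mu> = foldr (\<lambda>i. creation (u i)) (sorted_list_of_set \<mu>) vacuum"

lemma product_state_empty [simp]: "product_state u {} = vacuum"
  by (simp add: product_state_def)

text \<open>The smallest index is the outermost creation operator. This is why the inductions over
  subsets below insert a new minimum.\<close>

lemma product_state_insert:
  assumes "\<forall>j\<in>\<mu>. i < j"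
  shows "product_state u (insert i \<mu>) = creation (u i) (product_state u \<mu>)"
proof -
  have "sorted_list_of_set (insert i \<mu>) = i # sorted_list_of_set \<mu>"
    using assms by (subst sorted_list_of_set_insert) (auto simp: insort_is_Cons less_imp_le)
  then show ?thesis by (simp add: product_state_def)
qed

lemma fock_basis_conv_product_state: "fock_basis \<mu> = product_state (\<lambda>i. axis i 1) \<mu>"
  by (simp add: fock_basis_def product_state_def)

text \<open>The coefficients of a basis vector are 0 and 1, so the conjugation attached to an
  antilinear \<open>w\<close> does not show.\<close>

lemma second_quant_fock_basis:
  "second_quant s w (fock_basis \<nu>) = product_state (\<lambda>i. w (axis i 1)) \<nu>"
proof -
  have "second_quant s w (fock_basis \<nu>) =
      (\<Sum>\<mu>\<in>UNIV. if \<mu> = \<nu> then product_state (\<lambda>i. w (axis i 1)) \<mu> else 0)"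
    unfolding second_quant_def product_state_def[symmetric]
    by (intro sum.cong) (auto simp: cinner_fock_basis_fock_basis conj_if_def)
  then show ?thesis by simp
qed

lemma vacuum_eq_fock_basis: "vacuum = fock_basis {}"
  by (simp add: fock_basis_conv_product_state)

lemma product_state_minus:
  "product_state (\<lambda>i. - axis i 1) \<mu> = (- 1) ^ card \<mu> *\<^sub>C fock_basis \<mu>"
proof (induction rule: finite_linorder_min_induct[OF finite[of \<mu>]])
  case (2 i \<mu>)
  then have "i \<notin> \<mu>" by auto
  with 2 show ?case
    by (simp add: product_state_insert fock_basis_conv_product_state creation_minus blinfun.minus_left
        bounded_opsD)
qed (simp add: vacuum_eq_fock_basis)

text \<open>Particle number: each creation operator raises the cardinality by exactly one. Second
  quantized symmetries therefore preserve parity.\<close>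

lemma product_state_nth_eq_0:
  assumes "card \<nu> \<noteq> card \<mu>"
  shows "product_state u \<mu> $ \<nu> = 0"
  using assms
proof (induction arbitrary: \<nu> rule: finite_linorder_min_induct[OF finite[of \<mu>]])
  case 1
  then show ?case by (auto simp: vacuum_def axis_def)
next
  case (2 i \<mu>)
  then have "i \<notin> \<mu>" by auto
  with 2(4) have card: "card \<nu> \<noteq> Suc (card \<mu>)" by simp
  have "product_state u \<mu> $ (\<nu> - {k}) = 0" if "k \<in> \<nu>" for k
  proof (rule 2(3))
    have "card \<nu> = Suc (card (\<nu> - {k}))" using that by (intro card.remove) simp_all
    then show "card (\<nu> - {k}) \<noteq> card \<mu>" using card by simp
  qed
  then show ?case by (simp add: product_state_insert[OF 2(2)] creation_nth)
qed

lemma delta0_l2 [simp]: "delta0 v \<in> l2"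
  unfolding l2_def mem_Collect_eq
  by (rule finite_nonzero_values_imp_summable_on, rule finite_subset[of _ "{0}"]) (auto simp: delta0_def)

lemma l2_inner_delta0: "f 0 = 0 \<Longrightarrow> l2_inner f (delta0 v) = 0"
  unfolding l2_inner_def by (rule infsum_0) (auto simp: delta0_def)

lemma car_algebraD:
  assumes "car_algebra a" "f \<in> l2" "g \<in> l2"
  shows "a (\<lambda>x. f x + g x) = a f + a g" "a f * a g = - (a g * a f)"
    "a f * star (a g) + star (a g) * a f = l2_inner f g *\<^sub>C 1"
  using assms by (auto simp: car_algebra_def eq_neg_iff_add_eq_0)

lemma cstar_hom_add: "star_hom_on 0 m st m' st' B f \<Longrightarrow> x \<in> B \<Longrightarrow> y \<in> B \<Longrightarrow> f (x + y) = f x + f y"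
  and cstar_hom_scaleC: "star_hom_on 0 m st m' st' B f \<Longrightarrow> x \<in> B \<Longrightarrow> f (c *\<^sub>C x) = c *\<^sub>C f x"
  and cstar_hom_mult: "star_hom_on 0 m st m' st' B f \<Longrightarrow> x \<in> B \<Longrightarrow> y \<in> B \<Longrightarrow> f (m x y) = m' (f x) (f y)"
  and cstar_hom_star: "star_hom_on 0 m st m' st' B f \<Longrightarrow> x \<in> B \<Longrightarrow> f (st x) = st' (f x)"
  by (auto simp: star_hom_on_def conj_if_def)

section \<open>Matrix units of a single site\<close>

locale one_site =
  fixes a :: "(int \<Rightarrow> 'd::{finite, linorder} cvec) \<Rightarrow> 'a::cstar_algebra"
    and \<kappa> :: "'a \<Rightarrow> ('d fock \<Rightarrow>\<^sub>L 'd fock)"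
  assumes car: "car_algebra a" and fock: "fock_identification a \<kappa>"
begin

abbreviation m :: "'d set \<Rightarrow> 'd set \<Rightarrow> 'a" where "m \<equiv> matrix_unit a \<kappa>"

abbreviation e :: "'d \<Rightarrow> 'a" where "e i \<equiv> a (delta0 (axis i 1))"

lemma \<kappa>_hom: "star_hom_on 0 (*) star (o\<^sub>L) op_adj (local_alg a {0}) \<kappa>"
  and \<kappa>_bij: "bij_betw \<kappa> (local_alg a {0}) bounded_ops"
  and \<kappa>_a: "\<kappa> (a (delta0 v)) = op_adj (creation v)"
  using fock by (auto simp: fock_identification_def)

lemma a_delta0_local: "a (delta0 v) \<in> local_alg a {0}"
  by (rule local_alg_generator[OF delta0_l2]) (simp add: delta0_def)

lemma \<kappa>_inj: "x \<in> local_alg a {0} \<Longrightarrow> y \<in> local_alg a {0} \<Longrightarrow> \<kappa> x = \<kappa> y \<Longrightarrow> x = y"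
  using \<kappa>_bij by (auto simp: bij_betw_def inj_on_def)

lemma \<kappa>_bounded_ops: "x \<in> local_alg a {0} \<Longrightarrow> \<kappa> x \<in> bounded_ops"
  using \<kappa>_bij by (auto simp: bij_betw_def)

lemma m_local: "m \<mu> \<nu> \<in> local_alg a {0}"
  and \<kappa>_m: "\<kappa> (m \<mu> \<nu>) = ketbra (fock_basis \<mu>) (fock_basis \<nu>)"
proof -
  have "ketbra (fock_basis \<mu>) (fock_basis \<nu>) \<in> \<kappa> ` local_alg a {0}"
    using \<kappa>_bij by (simp add: bij_betw_def)
  then show "m \<mu> \<nu> \<in> local_alg a {0}" "\<kappa> (m \<mu> \<nu>) = ketbra (fock_basis \<mu>) (fock_basis \<nu>)"
    by (auto simp: matrix_unit_def inv_into_into f_inv_into_f)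
qed

lemma local_zero: "0 \<in> local_alg a {0}" "\<kappa> 0 = 0"
proof -
  show "0 \<in> local_alg a {0}"
    using local_alg_closed(4)[OF local_alg_closed(1), where c = 0 and a = a and X = "{0}"] by simp
  then show "\<kappa> 0 = 0" using cstar_hom_scaleC[OF \<kappa>_hom, where c = 0 and x = 0] by simp
qed

lemma local_sum: "(\<And>i. i \<in> I \<Longrightarrow> x i \<in> local_alg a {0}) \<Longrightarrow>
    (\<Sum>i\<in>I. x i) \<in> local_alg a {0} \<and> \<kappa> (\<Sum>i\<in>I. x i) = (\<Sum>i\<in>I. \<kappa> (x i))"
  by (induction I rule: infinite_finite_induct)
     (auto simp: local_zero local_alg_closed cstar_hom_add[OF \<kappa>_hom])

lemma \<kappa>_one: "\<kappa> 1 = id_blinfun"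
proof -
  obtain x where x: "x \<in> local_alg a {0}" "\<kappa> x = id_blinfun"
    using \<kappa>_bij unfolding bij_betw_def by (metis bounded_ops_id imageE)
  then show ?thesis
    using cstar_hom_mult[OF \<kappa>_hom local_alg_closed(1) x(1)] by simp
qed

lemma m_mult: "m \<mu> \<nu> * m \<mu>' \<nu>' = (if \<nu> = \<mu>' then m \<mu> \<nu>' else 0)"
  by (rule \<kappa>_inj) (auto simp: local_alg_closed m_local local_zero cstar_hom_mult[OF \<kappa>_hom] \<kappa>_m
      ketbra_compose_ketbra cinner_fock_basis_fock_basis)

lemma m_star: "star (m \<mu> \<nu>) = m \<nu> \<mu>"
  by (rule \<kappa>_inj) (auto simp: local_alg_closed m_local cstar_hom_star[OF \<kappa>_hom] \<kappa>_m)

lemma m_sum: "(\<Sum>\<mu>\<in>UNIV. m \<mu> \<mu>) = 1"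
  by (rule \<kappa>_inj) (auto simp: local_alg_closed m_local local_sum \<kappa>_m sum_ketbra_fock_basis \<kappa>_one)

lemma m_expand:
  assumes "x \<in> local_alg a {0}"
  shows "x = (\<Sum>\<mu>\<in>UNIV. \<Sum>\<nu>\<in>UNIV. (\<kappa> x (fock_basis \<nu>) $ \<mu>) *\<^sub>C m \<mu> \<nu>)"
proof (rule \<kappa>_inj[OF assms])
  have loc: "(\<Sum>\<nu>\<in>UNIV. (\<kappa> x (fock_basis \<nu>) $ \<mu>) *\<^sub>C m \<mu> \<nu>) \<in> local_alg a {0}"
    "\<kappa> (\<Sum>\<nu>\<in>UNIV. (\<kappa> x (fock_basis \<nu>) $ \<mu>) *\<^sub>C m \<mu> \<nu>) =
     (\<Sum>\<nu>\<in>UNIV. (\<kappa> x (fock_basis \<nu>) $ \<mu>) *\<^sub>C ketbra (fock_basis \<mu>) (fock_basis \<nu>))" for \<mu>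
    using local_sum[of UNIV "\<lambda>\<nu>. (\<kappa> x (fock_basis \<nu>) $ \<mu>) *\<^sub>C m \<mu> \<nu>"]
    by (auto simp: local_alg_closed m_local cstar_hom_scaleC[OF \<kappa>_hom] \<kappa>_m)
  show "(\<Sum>\<mu>\<in>UNIV. \<Sum>\<nu>\<in>UNIV. (\<kappa> x (fock_basis \<nu>) $ \<mu>) *\<^sub>C m \<mu> \<nu>) \<in> local_alg a {0}"
    by (rule conjunct1[OF local_sum]) (rule loc)
  have "\<kappa> x = (\<Sum>\<mu>\<in>UNIV. ketbra (fock_basis \<mu>) (fock_basis \<mu>)) o\<^sub>L \<kappa> x o\<^sub>L
      (\<Sum>\<nu>\<in>UNIV. ketbra (fock_basis \<nu>) (fock_basis \<nu>))"
    by (simp add: sum_ketbra_fock_basis)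
  also have "\<dots> = (\<Sum>\<mu>\<in>UNIV. \<Sum>\<nu>\<in>UNIV. (\<kappa> x (fock_basis \<nu>) $ \<mu>) *\<^sub>C ketbra (fock_basis \<mu>) (fock_basis \<nu>))"
    using \<kappa>_bounded_ops[OF assms]
    by (simp add: blinfun_compose_sum_left blinfun_compose_sum_right blinfun_compose_assoc compose_ketbra
        ketbra_compose_ketbra cinner_fock_basis)
       (rule sum.swap)
  finally show "\<kappa> x = \<kappa> (\<Sum>\<mu>\<in>UNIV. \<Sum>\<nu>\<in>UNIV. (\<kappa> x (fock_basis \<nu>) $ \<mu>) *\<^sub>C m \<mu> \<nu>)"
    using local_sum[of UNIV "\<lambda>\<mu>. \<Sum>\<nu>\<in>UNIV. (\<kappa> x (fock_basis \<nu>) $ \<mu>) *\<^sub>C m \<mu> \<nu>"] loc by simp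
qed

lemma a_m_empty: "a (delta0 v) * m {} \<nu> = 0"
proof (rule \<kappa>_inj)
  have "cinner z (op_adj (creation v) (fock_basis {})) = cinner z 0" for z
  proof -
    have "cinner z (op_adj (creation v) (fock_basis {})) = cnj (cinner (fock_basis {}) (creation v z))"
      by (subst cinner_op_adj[OF creation_bounded_ops, symmetric]) (rule cinner_commute)
    then show ?thesis by (simp add: cinner_fock_basis creation_nth)
  qed
  then have "op_adj (creation v) (fock_basis {}) = 0" by (rule cinner_ext)
  then have "op_adj (creation v) o\<^sub>L ketbra (fock_basis {}) (fock_basis \<nu>) = 0"
    by (intro blinfun_eqI) (simp add: compose_ketbra ketbra.rep_eq)
  then show "\<kappa> (a (delta0 v) * m {} \<nu>) = \<kappa> 0"
    by (simp add: cstar_hom_mult[OF \<kappa>_hom] a_delta0_local m_local \<kappa>_a \<kappa>_m local_zero)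
qed (auto simp: local_alg_closed m_local a_delta0_local local_zero)

lemma m_insert_left:
  assumes "\<forall>j\<in>\<mu>. i < j"
  shows "m (insert i \<mu>) \<nu> = star (e i) * m \<mu> \<nu>"
  by (rule \<kappa>_inj) (simp_all add: local_alg_closed m_local a_delta0_local cstar_hom_mult[OF \<kappa>_hom]
      cstar_hom_star[OF \<kappa>_hom] \<kappa>_a \<kappa>_m compose_ketbra fock_basis_conv_product_state product_state_insert[OF assms])

text \<open>With \<open>i\<close> the minimum of \<open>\<mu>\<close>, \<open>m \<mu> \<mu>\<close>
  factors through \<open>m (\<mu> - {i}) \<mu>\<close>, the adjoint of a unit that begins with the
  creator of \<open>i\<close>; hence an annihilator stands on the right.\<close>

lemma m_eq_mult_e:
  assumes "\<mu> \<noteq> {}"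
  obtains i x where "m \<mu> \<mu> = x * e i"
proof -
  define i where "i = Min \<mu>"
  have "i \<in> \<mu>" unfolding i_def by (rule Min_in[OF finite assms])
  then have i: "insert i (\<mu> - {i}) = \<mu>" by blast
  have less: "\<forall>j\<in>\<mu> - {i}. i < j" by (auto simp: i_def less_le)
  have "m \<mu> (\<mu> - {i}) = star (e i) * m (\<mu> - {i}) (\<mu> - {i})"
    using m_insert_left[OF less] unfolding i .
  then have "star (m \<mu> (\<mu> - {i})) = star (star (e i) * m (\<mu> - {i}) (\<mu> - {i}))" by simp
  then have "m (\<mu> - {i}) \<mu> = m (\<mu> - {i}) (\<mu> - {i}) * e i"
    by (simp add: star_mult star_star m_star)
  then have "m \<mu> (\<mu> - {i}) * m (\<mu> - {i}) \<mu> = m \<mu> (\<mu> - {i}) * e i"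
    by (simp add: m_mult flip: mult.assoc)
  then have "m \<mu> \<mu> = m \<mu> (\<mu> - {i}) * e i"
    by (simp add: m_mult)
  then show ?thesis by (rule that)
qed

text \<open>In the resolution of 1 by diagonal units, all terms but the vacuum one end in an
  annihilator. The vacuum projection is thus characterised by the annihilators alone, which is how
  automorphisms are seen to fix it.\<close>

lemma vacuum_projection_absorbs:
  assumes "\<And>i. e i * x = 0"
  shows "m {} {} * x = x"
proof -
  have "m \<mu> \<mu> * x = 0" if "\<mu> \<noteq> {}" for \<mu>
    by (rule m_eq_mult_e[OF that]) (simp add: mult.assoc assms)
  then have "(\<Sum>\<mu>\<in>UNIV. m \<mu> \<mu>) * x = (\<Sum>\<mu>\<in>(UNIV :: 'd set set). if \<mu> = {} then m {} {} * x else 0)"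
    unfolding sum_distrib_right by (intro sum.cong) auto
  then show ?thesis by (simp add: m_sum)
qed

text \<open>\<open>u\<close> is surjective, so \<open>\<beta>\<close> maps the annihilators of the
  site onto themselves and fixes the vacuum projection; creators then build the images of the
  columns \<open>m \<mu> {}\<close>. Linear and antilinear \<open>\<beta>\<close> are treated alike
  because the units are products of generators and vacuum projection without scalars.\<close>

lemma bogoliubov_matrix_unit:
  assumes \<beta>: "bogoliubov a s w \<beta>" and w: "\<And>v. w (delta0 v) = delta0 (u v)" and u: "surj u"
  shows "\<beta> (m \<mu> \<nu>) = (\<Sum>\<mu>'\<in>UNIV. \<Sum>\<nu>'\<in>UNIV. (product_state (\<lambda>i. u (axis i 1)) \<mu> $ \<mu>' *
    cnj (product_state (\<lambda>i. u (axis i 1)) \<nu> $ \<nu>')) *\<^sub>C m \<mu>' \<nu>')"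
proof -
  note h = bogoliubovD[OF \<beta>]
  have \<beta>_a: "\<beta> (a (delta0 v)) = a (delta0 (u v))" for v by (simp add: h(6) w)
  have \<beta>_sum: "\<beta> (\<Sum>i\<in>I. f i) = (\<Sum>i\<in>I. \<beta> (f i))" for f and I :: "'d set set"
    by (induction I rule: infinite_finite_induct) (simp_all add: h)
  define q where "q = \<beta> (m {} {})"
  have "a (delta0 v) * q = 0" for v
  proof -
    obtain v' where "v = u v'" using u by (metis surjD)
    then show ?thesis using arg_cong[OF a_m_empty[of v' "{}"], of \<beta>] by (simp add: h \<beta>_a q_def)
  qed
  then have 1: "m {} {} * q = q" by (rule vacuum_projection_absorbs)
  have "\<beta> (m \<mu> \<mu>) * m {} {} = 0" if "\<mu> \<noteq> {}" for \<mu>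
    by (rule m_eq_mult_e[OF that]) (simp add: h \<beta>_a mult.assoc a_m_empty)
  then have "(\<Sum>\<mu>\<in>UNIV. \<beta> (m \<mu> \<mu>)) * m {} {} = (\<Sum>\<mu>\<in>(UNIV :: 'd set set). if \<mu> = {} then q * m {} {} else 0)"
    unfolding sum_distrib_right q_def by (intro sum.cong) auto
  then have 2: "q * m {} {} = m {} {}"
    by (simp add: \<beta>_sum[symmetric] m_sum h)
  have "star q = q" by (simp add: q_def h(4)[symmetric] m_star)
  then have q: "q = m {} {}"
    using 1 arg_cong[OF 2, of star] by (simp add: star_mult m_star)
  have step: "\<beta> (m \<mu> {}) \<in> local_alg a {0} \<and> \<kappa> (\<beta> (m \<mu> {})) = ketbra (product_state (\<lambda>i. u (axis i 1)) \<mu>) vacuum" for \<mu>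
  proof (induction rule: finite_linorder_min_induct[OF finite[of \<mu>]])
    case 1
    then show ?case using q by (simp add: q_def m_local \<kappa>_m vacuum_eq_fock_basis)
  next
    case (2 i \<mu>)
    then show ?case
      by (simp add: m_insert_left product_state_insert h \<beta>_a local_alg_closed a_delta0_local cstar_hom_mult[OF \<kappa>_hom]
        cstar_hom_star[OF \<kappa>_hom] \<kappa>_a compose_ketbra)
  qed
  have eq: "\<beta> (m \<mu> \<nu>) = \<beta> (m \<mu> {}) * star (\<beta> (m \<nu> {}))"
    by (simp add: h(3,4)[symmetric] m_star m_mult)
  have loc: "\<beta> (m \<mu> \<nu>) \<in> local_alg a {0}"
    unfolding eq using step by (intro local_alg_closed) auto
  have "\<kappa> (\<beta> (m \<mu> \<nu>)) = ketbra (product_state (\<lambda>i. u (axis i 1)) \<mu>) (product_state (\<lambda>i. u (axis i 1)) \<nu>)"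
    unfolding eq using step[of \<mu>] step[of \<nu>]
    by (simp add: cstar_hom_mult[OF \<kappa>_hom] cstar_hom_star[OF \<kappa>_hom] local_alg_closed ketbra_compose_ketbra
        vacuum_eq_fock_basis cinner_fock_basis_fock_basis)
  then show ?thesis
    by (subst m_expand[OF loc])
       (auto intro!: sum.cong simp: ketbra.rep_eq scaleC_vec_def scaleC_complex_def mult.commute
         cinner_commute[of _ "fock_basis _"] cinner_fock_basis)
qed

lemma parity_matrix_unit:
  assumes "bogoliubov a 0 (\<lambda>f x. - f x) \<beta>"
  shows "\<beta> (m \<mu> \<nu>) = (- 1) ^ (card \<mu> + card \<nu>) *\<^sub>C m \<mu> \<nu>"
proof -
  have "\<beta> (m \<mu> \<nu>) = (\<Sum>\<mu>'\<in>UNIV. \<Sum>\<nu>'\<in>UNIV. (((- 1) ^ card \<mu> *\<^sub>C fock_basis \<mu>) $ \<mu>' *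
      cnj (((- 1) ^ card \<nu> *\<^sub>C fock_basis \<nu>) $ \<nu>')) *\<^sub>C m \<mu>' \<nu>')"
    unfolding product_state_minus[symmetric]
    by (rule bogoliubov_matrix_unit[OF assms, of uminus]) (auto simp: delta0_def intro: surjI[of uminus uminus])
  then show ?thesis
    by (simp add: scaleC_vec_def scaleC_complex_def scaleC_scaleC[symmetric] scaleC_sum_right[symmetric] sum_fock_basis
        power_add)
qed

lemma anticommute_vacuum_projection:
  assumes "\<And>i. b * e i = - (e i * b)"
  shows "m {} {} * b * m {} {} = b * m {} {}"
proof -
  have "e i * (b * m {} {}) = 0" for i
  proof -
    have "e i * b = - (b * e i)" using assms[of i] by simp
    then have "e i * (b * m {} {}) = - (b * (e i * m {} {}))" by (simp flip: mult.assoc)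
    then show ?thesis by (simp add: a_m_empty)
  qed
  then show ?thesis using vacuum_projection_absorbs[of "b * m {} {}"] by (simp add: mult.assoc)
qed

text \<open>The base case says that \<open>b\<close> commutes with the vacuum projection; it comes
  from one-sided absorption for \<open>b\<close> and for \<open>star b\<close>. Each creator added
  to \<open>\<mu>\<close> contributes one sign.\<close>

lemma anticommute_m_empty:
  assumes e: "\<And>i. b * e i = - (e i * b)" "\<And>i. b * star (e i) = - (star (e i) * b)"
  shows "b * m \<mu> {} = (- 1) ^ card \<mu> *\<^sub>C (m \<mu> {} * b)"
proof (induction rule: finite_linorder_min_induct[OF finite[of \<mu>]])
  case 1
  have "star b * e i = - (e i * star b)" for i
    using arg_cong[OF e(2)[of i], of star] by (simp add: star_mult star_star)
  then have "m {} {} * star b * m {} {} = star b * m {} {}"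
    by (rule anticommute_vacuum_projection)
  from arg_cong[OF this, of star] anticommute_vacuum_projection[OF e(1)]
  show ?case by (simp add: star_mult star_star m_star mult.assoc)
next
  case (2 i \<mu>)
  then have "i \<notin> \<mu>" by auto
  have "b * m (insert i \<mu>) {} = - (star (e i) * (b * m \<mu> {}))"
    using e(2)[of i] by (simp add: m_insert_left[OF 2(2)] flip: mult.assoc)
  then show ?case
    using \<open>i \<notin> \<mu>\<close> by (simp add: 2(3) m_insert_left[OF 2(2)] mult_scaleC_right mult.assoc)
qed

lemma anticommute_m:
  assumes e: "\<And>i. b * e i = - (e i * b)" "\<And>i. b * star (e i) = - (star (e i) * b)"
  shows "b * m \<mu> \<nu> = (- 1) ^ (card \<mu> + card \<nu>) *\<^sub>C (m \<mu> \<nu> * b)"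
proof -
  have "star b * e i = - (e i * star b)" "star b * star (e i) = - (star (e i) * star b)" for i
    using arg_cong[OF e(2)[of i], of star] arg_cong[OF e(1)[of i], of star]
    by (simp_all add: star_mult star_star)
  from arg_cong[OF anticommute_m_empty[OF this, of \<nu>], of star]
  have "m {} \<nu> * b = (- 1) ^ card \<nu> *\<^sub>C (b * m {} \<nu>)"
    by (simp add: star_mult star_star star_scaleC m_star)
  then have 2: "b * m {} \<nu> = (- 1) ^ card \<nu> *\<^sub>C (m {} \<nu> * b)"
    by (simp add: scaleC_scaleC flip: power_mult_distrib)
  have eq: "m \<mu> \<nu> = m \<mu> {} * m {} \<nu>" by (simp add: m_mult)
  have "b * m \<mu> \<nu> = (b * m \<mu> {}) * m {} \<nu>" by (simp add: eq mult.assoc)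
  also have "\<dots> = (- 1) ^ card \<mu> *\<^sub>C (m \<mu> {} * (b * m {} \<nu>))"
    by (simp add: anticommute_m_empty[OF e] mult_scaleC_left mult.assoc)
  also have "\<dots> = (- 1) ^ (card \<mu> + card \<nu>) *\<^sub>C (m \<mu> \<nu> * b)"
    by (simp only: 2 eq mult_scaleC_right scaleC_scaleC power_add mult.assoc)
  finally show ?thesis .
qed

lemma a_matrix_unit:
  assumes f: "f \<in> l2" "f 0 = 0"
  shows "a f * m \<mu> \<nu> = (- 1) ^ (card \<mu> + card \<nu>) *\<^sub>C (m \<mu> \<nu> * a f)"
proof (rule anticommute_m)
  show "a f * e i = - (e i * a f)" for i
    by (rule car_algebraD(2)[OF car f(1) delta0_l2])
  show "a f * star (e i) = - (star (e i) * a f)" for i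
    using car_algebraD(3)[OF car f(1) delta0_l2[of "axis i 1"]]
    by (simp add: l2_inner_delta0 f eq_neg_iff_add_eq_0)
qed

end

section \<open>The algebra \<open>R1\<close>\<close>

lemma vec2_eqI: "v $ 1 = w $ 1 \<Longrightarrow> v $ 2 = w $ 2 \<Longrightarrow> v = w" for v w :: "'a ^ 2"
  by (simp add: vec_eq_iff forall_2)

lemma cinner_vec2: "cinner v w = cinner (v $ 1) (w $ 1) + cinner (v $ 2) (w $ 2)" for v w :: "'k::complex_hilbert ^ 2"
  by (simp add: cinner_vec_def sum_2)

lemma op_tensor_nth:
  fixes W :: "(complex ^ 2) \<Rightarrow>\<^sub>L (complex ^ 2)"
  shows "(T \<otimes>\<^sub>o W) v $ i = (W (axis 1 1) $ i) *\<^sub>C T (v $ 1) + (W (axis 2 1) $ i) *\<^sub>C T (v $ 2)"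
  by (simp add: op_tensor.rep_eq sum_2)

lemma pauli_nth:
  "\<sigma>x v $ 1 = v $ 2" "\<sigma>x v $ 2 = v $ 1" "\<sigma>z v $ 1 = v $ 1" "\<sigma>z v $ 2 = - (v $ 2)"
  by (simp_all add: \<sigma>x_def \<sigma>z_def mat_op.rep_eq matrix_vector_mult_def sum_2)

text \<open>Together with \<open>flip_op\<close> and \<open>grading_op\<close> this replaces tensors
  by operator products with simple exchange rules.\<close>

definition amp :: "('k::complex_hilbert \<Rightarrow>\<^sub>L 'k) \<Rightarrow> (('k ^ 2) \<Rightarrow>\<^sub>L ('k ^ 2))"
  where "amp b = b \<otimes>\<^sub>o id_blinfun"

definition flip_op :: "('k::complex_hilbert ^ 2) \<Rightarrow>\<^sub>L ('k ^ 2)"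
  where "flip_op = id_blinfun \<otimes>\<^sub>o \<sigma>x"

lemma amp_nth [simp]: "amp b v $ i = b (v $ i)"
  using exhaust_2[of i] by (auto simp: amp_def op_tensor_nth axis_def)

lemma flip_op_nth [simp]: "flip_op v $ 1 = v $ 2" "flip_op v $ 2 = v $ 1"
  by (simp_all add: flip_op_def op_tensor_nth pauli_nth axis_def)

lemma grading_op_nth [simp]: "grading_op v $ 1 = v $ 1" "grading_op v $ 2 = - (v $ 2)"
  by (simp_all add: grading_op_def op_tensor_nth pauli_nth axis_def)

lemma tensor_eqs:
  "b \<otimes>\<^sub>o id_blinfun = amp b" "b \<otimes>\<^sub>o \<sigma>x = amp b o\<^sub>L flip_op" "b \<otimes>\<^sub>o \<sigma>z = amp b o\<^sub>L grading_op"
  by (rule blinfun_eqI, rule vec2_eqI; simp add: op_tensor_nth pauli_nth axis_def amp_def blinfun.minus_right)+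

lemma op_pow_0 [simp]: "op_pow T 0 = id_blinfun"
  and op_pow_Suc: "op_pow T (Suc n) = T o\<^sub>L op_pow T n"
  by (simp_all add: op_pow_def)

lemma op_pow_involution:
  assumes "T o\<^sub>L T = id_blinfun"
  shows "op_pow T n = (if even n then id_blinfun else T)"
  by (induction n) (simp_all add: op_pow_Suc assms)

lemma pauli_involutions: "\<sigma>x o\<^sub>L \<sigma>x = id_blinfun" "\<sigma>z o\<^sub>L \<sigma>z = id_blinfun"
  by (rule blinfun_eqI, rule vec2_eqI; simp add: pauli_nth)+

lemma flip_op_flip_op [simp]: "flip_op o\<^sub>L flip_op = id_blinfun"
  by (rule blinfun_eqI, rule vec2_eqI) simp_all

lemma grading_op_grading_op [simp]: "grading_op o\<^sub>L grading_op = id_blinfun"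
  by (rule blinfun_eqI, rule vec2_eqI) simp_all

lemma tensor_op_pow:
  "b \<otimes>\<^sub>o op_pow \<sigma>x n = amp b o\<^sub>L op_pow flip_op n" "b \<otimes>\<^sub>o op_pow \<sigma>z n = amp b o\<^sub>L op_pow grading_op n"
  by (simp_all add: op_pow_involution pauli_involutions tensor_eqs)

lemma amp_compose [simp]: "amp b o\<^sub>L amp c = amp (b o\<^sub>L c)"
  by (rule blinfun_eqI, rule vec2_eqI) simp_all

lemma amp_id [simp]: "amp id_blinfun = id_blinfun"
  by (rule blinfun_eqI, rule vec2_eqI) simp_all

lemma amp_zero [simp]: "amp 0 = 0"
  by (rule blinfun_eqI, rule vec2_eqI) simp_all

lemma amp_add: "amp (b + c) = amp b + amp c"
  by (rule blinfun_eqI, rule vec2_eqI) (simp_all add: blinfun.add_left)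

lemma amp_minus: "amp (- b) = - amp b"
  by (rule blinfun_eqI, rule vec2_eqI) (simp_all add: blinfun.minus_left)

lemma amp_scaleC: "amp (c *\<^sub>C b) = c *\<^sub>C amp b"
  by (rule blinfun_eqI, rule vec2_eqI) (simp_all add: scaleC_blinfun.rep_eq scaleC_vec_def)

lemma amp_sum: "amp (\<Sum>i\<in>I. f i) = (\<Sum>i\<in>I. amp (f i))"
  by (induction I rule: infinite_finite_induct) (simp_all add: amp_add)

lemma amp_bounded_ops [simp]: "b \<in> bounded_ops \<Longrightarrow> amp b \<in> bounded_ops"
  by (auto simp: bounded_ops_def scaleC_vec_def intro!: vec2_eqI)

lemma flip_op_bounded_ops [simp]: "flip_op \<in> bounded_ops"
  by (auto simp: bounded_ops_def scaleC_vec_def intro!: vec2_eqI)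

lemma op_adj_amp [simp]: "op_adj (amp b) = amp (op_adj b)"
  by (rule op_adj_unique) (simp add: inner_vec_def sum_2 inner_op_adj)

lemma op_adj_flip_op [simp]: "op_adj flip_op = flip_op"
  by (rule op_adj_unique) (simp add: inner_vec_def sum_2)

lemma op_adj_grading_op [simp]: "op_adj grading_op = grading_op"
  by (rule op_adj_unique) (simp add: inner_vec_def sum_2)

lemma flip_amp: "flip_op o\<^sub>L amp b = amp b o\<^sub>L flip_op"
  by (rule blinfun_eqI, rule vec2_eqI) simp_all

lemma grading_amp: "grading_op o\<^sub>L amp b = amp b o\<^sub>L grading_op"
  by (rule blinfun_eqI, rule vec2_eqI) (simp_all add: blinfun.minus_right)

lemma grading_flip: "grading_op o\<^sub>L flip_op = - (flip_op o\<^sub>L grading_op)"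
  by (rule blinfun_eqI, rule vec2_eqI) (simp_all add: blinfun.minus_left)

text \<open>The operator is a 2 by 2 block matrix with diagonal blocks \<open>b\<close> and
  off-diagonal blocks \<open>c\<close>. This gives uniqueness of the decomposition of elements of
  \<open>R1\<close>.\<close>

lemma amp_flip_zero:
  fixes b c :: "'k::complex_hilbert \<Rightarrow>\<^sub>L 'k"
  assumes "amp b + (amp c o\<^sub>L flip_op) = 0"
  shows "b = 0" "c = 0"
proof -
  have *: "b (v $ 1) + c (v $ 2) = 0" for v :: "'k ^ 2"
    using arg_cong[OF assms, of "\<lambda>T. blinfun_apply T v $ 1"] by (simp add: blinfun.add_left)
  show "b = 0" by (rule blinfun_eqI) (use *[of "axis 1 x" for x] in \<open>simp add: axis_def\<close>)
  show "c = 0" by (rule blinfun_eqI) (use *[of "axis 2 x" for x] in \<open>simp add: axis_def\<close>)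
qed

lemma amp_eq_iff [simp]: "amp b = amp c \<longleftrightarrow> b = c"
  using amp_flip_zero(1)[of "b - c" 0] amp_add[of "b - c" c] by auto

lemma R1_eq: "R1 = {amp b + (amp c o\<^sub>L flip_op) | b c. b \<in> bounded_ops \<and> c \<in> bounded_ops}"
  by (simp add: R1_def tensor_eqs)

lemma R1E:
  assumes "y \<in> R1"
  obtains b c where "b \<in> bounded_ops" "c \<in> bounded_ops" "y = amp b + (amp c o\<^sub>L flip_op)"
  using assms by (auto simp: R1_eq)

lemma R1I: "b \<in> bounded_ops \<Longrightarrow> c \<in> bounded_ops \<Longrightarrow> amp b + (amp c o\<^sub>L flip_op) \<in> R1"
  by (auto simp: R1_eq)

lemma amp_R1 [simp]: "b \<in> bounded_ops \<Longrightarrow> amp b \<in> R1"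
  using R1I[of b 0] by simp

lemma amp_flip_R1 [simp]: "b \<in> bounded_ops \<Longrightarrow> amp b o\<^sub>L flip_op \<in> R1"
  using R1I[of 0 b] by simp

lemma flip_R1 [simp]: "flip_op \<in> R1"
  using amp_flip_R1[of id_blinfun] by simp

lemma R1_bounded_ops: "y \<in> R1 \<Longrightarrow> y \<in> bounded_ops"
  by (auto simp: R1_eq)

lemma flip_commute_R1: "y \<in> R1 \<Longrightarrow> flip_op o\<^sub>L y = y o\<^sub>L flip_op"
  by (auto simp: R1_eq blinfun_compose_add_left blinfun_compose_add_right flip_amp blinfun_compose_assoc
      blinfun_compose_assoc[of flip_op, symmetric])

lemma Ad_grading_R1:
  "Ad grading_op (amp b + (amp c o\<^sub>L flip_op)) = amp b - (amp c o\<^sub>L flip_op)"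
proof -
  have "Ad grading_op (amp b + (amp c o\<^sub>L flip_op)) =
     ((grading_op o\<^sub>L amp b) o\<^sub>L grading_op) + ((grading_op o\<^sub>L amp c) o\<^sub>L (flip_op o\<^sub>L grading_op))"
    by (simp add: Ad_def blinfun_compose_add_left blinfun_compose_add_right blinfun_compose_assoc)
  also have "\<dots> = (amp b o\<^sub>L (grading_op o\<^sub>L grading_op)) + (amp c o\<^sub>L ((grading_op o\<^sub>L flip_op) o\<^sub>L grading_op))"
    by (simp only: grading_amp blinfun_compose_assoc)
  also have "\<dots> = amp b - (amp c o\<^sub>L flip_op)"
    by (simp add: grading_flip blinfun_compose_assoc)
  finally show ?thesis .
qed

lemma R1_even:
  assumes "y \<in> R1" "Ad grading_op y = y"
  obtains b where "b \<in> bounded_ops" "y = amp b"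
proof -
  obtain b c where bc: "b \<in> bounded_ops" "c \<in> bounded_ops" "y = amp b + (amp c o\<^sub>L flip_op)"
    using assms(1) by (rule R1E)
  have "amp 0 + (amp (c + c) o\<^sub>L flip_op) = 0"
    using assms(2) unfolding bc(3) Ad_grading_R1
    by (simp add: amp_add blinfun_compose_add_left algebra_simps diff_eq_eq)
  then have "c + c = 0" by (rule amp_flip_zero)
  then have "c = 0" by (metis double_zero scaleR_2 scaleR_eq_0_iff zero_neq_numeral)
  then show ?thesis using that[of b] bc by simp
qed

lemma R1_odd:
  assumes "y \<in> R1" "Ad grading_op y = - y"
  obtains c where "c \<in> bounded_ops" "y = amp c o\<^sub>L flip_op"
proof -
  obtain b c where bc: "b \<in> bounded_ops" "c \<in> bounded_ops" "y = amp b + (amp c o\<^sub>L flip_op)"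
    using assms(1) by (rule R1E)
  have "amp (b + b) + (amp 0 o\<^sub>L flip_op) = 0"
    using assms(2) unfolding bc(3) Ad_grading_R1 by (simp add: amp_add algebra_simps eq_neg_iff_add_eq_0)
  then have "b + b = 0" by (rule amp_flip_zero)
  then have "b = 0" by (metis double_zero scaleR_2 scaleR_eq_0_iff zero_neq_numeral)
  then show ?thesis using that[of c] bc by simp
qed

text \<open>Commutation with \<open>ketbra x y\<close>, evaluated at \<open>y\<close>, exhibits
  \<open>T x\<close> as a multiple of \<open>x\<close> with a ratio independent of
  \<open>x\<close>.\<close>

lemma commute_ketbra_scalar:
  assumes T: "T \<in> bounded_ops" "\<And>b. b \<in> bounded_ops \<Longrightarrow> T o\<^sub>L b = b o\<^sub>L T"
  shows "\<exists>c. T = c *\<^sub>C id_blinfun"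
proof (cases "\<exists>y::'a. y \<noteq> 0")
  case True
  then obtain y :: 'a where y: "y \<noteq> 0" by blast
  have eq: "cinner y y *\<^sub>C T x = cinner y (T y) *\<^sub>C x" for x
    using arg_cong[OF T(2)[of "ketbra x y"], of "\<lambda>S. blinfun_apply S y"]
    by (simp add: ketbra.rep_eq bounded_opsD[OF T(1)])
  define r where "r = cinner y (T y) / cinner y y"
  have "T x = r *\<^sub>C x" for x
    using arg_cong[OF eq[of x], of "scaleC (1 / cinner y y)"] y by (simp add: scaleC_scaleC r_def)
  then have "T = r *\<^sub>C id_blinfun"
    by (intro blinfun_eqI) (simp add: scaleC_blinfun.rep_eq)
  then show ?thesis by blast
next
  case False
  then show ?thesis by (intro exI[of _ 0] blinfun_eqI) metis
qed

text \<open>Comparing components reduces the claim to the centre of B(K). The second generator of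
  the centre is odd, so parity has to be checked wherever a scalar is wanted.\<close>

lemma R1_center:
  assumes "y \<in> R1" "\<And>b. b \<in> bounded_ops \<Longrightarrow> y o\<^sub>L amp b = amp b o\<^sub>L y"
  obtains c d where "y = c *\<^sub>C id_blinfun + d *\<^sub>C flip_op"
proof -
  obtain b c where bc: "b \<in> bounded_ops" "c \<in> bounded_ops" "y = amp b + (amp c o\<^sub>L flip_op)"
    using assms(1) by (rule R1E)
  have "b o\<^sub>L x = x o\<^sub>L b \<and> c o\<^sub>L x = x o\<^sub>L c" if "x \<in> bounded_ops" for x
  proof -
    have "((amp b + (amp c o\<^sub>L flip_op)) o\<^sub>L amp x) - (amp x o\<^sub>L (amp b + (amp c o\<^sub>L flip_op))) = 0"
      using assms(2)[OF that] bc(3) by simp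
    then have "amp ((b o\<^sub>L x) - (x o\<^sub>L b)) + (amp ((c o\<^sub>L x) - (x o\<^sub>L c)) o\<^sub>L flip_op) = 0"
      using amp_add[of "(b o\<^sub>L x) - (x o\<^sub>L b)" "x o\<^sub>L b"] amp_add[of "(c o\<^sub>L x) - (x o\<^sub>L c)" "x o\<^sub>L c"]
      by (simp add: blinfun_compose_add_left blinfun_compose_add_right blinfun_compose_assoc flip_amp algebra_simps
          blinfun_compose_assoc[of "amp _" "amp _", symmetric])
    from amp_flip_zero[OF this] show ?thesis by simp
  qed
  then obtain r s where "b = r *\<^sub>C id_blinfun" "c = s *\<^sub>C id_blinfun"
    using commute_ketbra_scalar bc by metis
  then show ?thesis using that[of r s] bc by (simp add: amp_scaleC)
qed

text \<open>Valid for antilinear \<open>V\<close> too. Together with \<open>amp_tensor\<close> it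
  shows that conjugating \<open>amp b\<close> by a tensor product sees only the first
  factor.\<close>

lemma tensor_amp: "(V \<otimes>\<^sub>o W) o\<^sub>L amp b = (V o\<^sub>L b) \<otimes>\<^sub>o W"
  by (rule blinfun_eqI, rule vec2_eqI) (simp_all add: op_tensor_nth)

lemma amp_tensor: "b \<in> bounded_ops \<Longrightarrow> amp b o\<^sub>L (V \<otimes>\<^sub>o W) = (b o\<^sub>L V) \<otimes>\<^sub>o W"
  by (rule blinfun_eqI, rule vec2_eqI) (simp_all add: op_tensor_nth blinfun.add_right bounded_opsD)

section \<open>The half-chain algebra and the translation\<close>

lemma op_star_isoD:
  assumes "op_star_iso 0 M N f"
  shows "x \<in> M \<Longrightarrow> y \<in> M \<Longrightarrow> f (x + y) = f x + f y" "x \<in> M \<Longrightarrow> f (c *\<^sub>C x) = c *\<^sub>C f x"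
    "x \<in> M \<Longrightarrow> y \<in> M \<Longrightarrow> f (x o\<^sub>L y) = f x o\<^sub>L f y" "x \<in> M \<Longrightarrow> f (op_adj x) = op_adj (f x)"
    "bij_betw f M N"
  using assms by (auto simp: op_star_iso_def star_hom_on_def conj_if_def)

lemma op_star_iso_one:
  assumes "op_star_iso 0 M N f" "id_blinfun \<in> M" "id_blinfun \<in> N"
  shows "f id_blinfun = id_blinfun"
proof -
  note h = op_star_isoD[OF assms(1)]
  obtain x where "x \<in> M" "f x = id_blinfun" using h(5) assms(3) by (auto simp: bij_betw_def)
  then show ?thesis using h(3)[of x id_blinfun] assms(2) by simp
qed

lemma shift_shift: "shift x (shift y f) = shift (x + y) f"
  by (simp add: shift_def fun_eq_iff algebra_simps)

lemma shift_l2: "f \<in> l2 \<Longrightarrow> shift x f \<in> l2"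
proof -
  assume f: "f \<in> l2"
  have "bij_betw (\<lambda>y. y - x) UNIV UNIV"
    by (rule bij_betw_byWitness[of _ "\<lambda>y. y + x"]) auto
  from summable_on_reindex_bij_betw[OF this, of "\<lambda>y. (norm (f y))\<^sup>2"] f
  show ?thesis by (simp add: l2_def shift_def)
qed

lemma l2_restrict: "f \<in> l2 \<Longrightarrow> (\<lambda>x. if P x then f x else 0) \<in> l2"
  unfolding l2_def mem_Collect_eq by (rule summable_on_comparison_test) auto

lemma is_unitaryD:
  assumes "is_unitary W"
  shows "W \<in> bounded_ops" "op_adj W o\<^sub>L W = id_blinfun" "W o\<^sub>L op_adj W = id_blinfun"
    "op_adj W (W x) = x" "W (op_adj W x) = x"
proof -
  show *: "W \<in> bounded_ops" "op_adj W o\<^sub>L W = id_blinfun" "W o\<^sub>L op_adj W = id_blinfun"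
    using assms by (auto simp: is_unitary_def)
  show "op_adj W (W x) = x" "W (op_adj W x) = x"
    using arg_cong[OF *(2), of "\<lambda>T. blinfun_apply T x"] arg_cong[OF *(3), of "\<lambda>T. blinfun_apply T x"] by simp_all
qed

lemma is_unitary_id: "is_unitary id_blinfun"
  by (simp add: is_unitary_def)

lemma is_unitary_compose:
  assumes V: "is_unitary V" and W: "is_unitary W"
  shows "is_unitary (V o\<^sub>L W)"
  unfolding is_unitary_def
  by (intro conjI blinfun_eqI) (simp_all add: is_unitaryD[OF V] is_unitaryD[OF W])

lemma is_unitary_op_pow: "is_unitary W \<Longrightarrow> is_unitary (op_pow W n)"
  by (induction n) (simp_all add: is_unitary_id is_unitary_compose op_pow_Suc)

text \<open>\<open>intertwiner_exists\<close> with the identity for \<open>F\<close> yields an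
  isometry \<open>W\<close>. Its range projection commutes with the image of \<open>\<beta>\<close>,
  which is all of B(H), so it is scalar and equals 1.\<close>

lemma star_iso_bounded_ops_spatial:
  assumes \<beta>: "op_star_iso 0 bounded_ops bounded_ops \<beta>" and z: "norm (z :: 'h::complex_hilbert) = 1"
  shows "\<exists>W :: 'h \<Rightarrow>\<^sub>L 'h. is_unitary W \<and> (\<forall>T\<in>bounded_ops. \<beta> T = W o\<^sub>L T o\<^sub>L op_adj W)"
proof -
  note h = op_star_isoD[OF \<beta>]
  have into: "\<beta> b \<in> bounded_ops" if "b \<in> bounded_ops" for b
    using h(5) that by (auto simp: bij_betw_def)
  have "\<beta> 0 = 0" using h(2)[of 0 0] by simp
  moreover have "ketbra z z \<noteq> 0"
  proof
    assume "ketbra z z = 0"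
    then have "ketbra z z z = 0" by simp
    then show False using z by (simp add: ketbra.rep_eq cinner_self)
  qed
  ultimately have "\<beta> (ketbra z z) \<noteq> 0"
    using h(5) unfolding bij_betw_def inj_on_def by (metis bounded_ops_ketbra bounded_ops_zero)
  then obtain W where W: "is_isometry_intertwining \<beta> W"
    using intertwiner_exists[of \<beta> id_blinfun z] \<beta> into z by (auto simp: op_star_iso_def)
  then have lin: "W \<in> bounded_ops" by (simp add: is_isometry_intertwining_def bounded_ops_def)
  have WW: "op_adj W o\<^sub>L W = id_blinfun"
    by (rule blinfun_eqI, rule cinner_ext)
       (use W in \<open>simp add: is_isometry_intertwining_def cinner_op_adj[OF lin, symmetric]\<close>)
  have int: "\<beta> b o\<^sub>L W = W o\<^sub>L b" if "b \<in> bounded_ops" for b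
    using W that by (intro blinfun_eqI) (simp add: is_isometry_intertwining_def)
  have int': "op_adj W o\<^sub>L \<beta> b = b o\<^sub>L op_adj W" if "b \<in> bounded_ops" for b
    using arg_cong[OF int[of "op_adj b"], of op_adj] that by (simp add: h(4)[symmetric])
  have "(W o\<^sub>L op_adj W) o\<^sub>L c = c o\<^sub>L (W o\<^sub>L op_adj W)" if c: "c \<in> bounded_ops" for c
  proof -
    obtain b where b: "b \<in> bounded_ops" "c = \<beta> b" using h(5) c by (auto simp: bij_betw_def)
    show ?thesis
      using int[OF b(1)] int'[OF b(1)] unfolding b(2) by (metis blinfun_compose_assoc)
  qed
  then obtain r where r: "W o\<^sub>L op_adj W = r *\<^sub>C id_blinfun"
    using commute_ketbra_scalar[of "W o\<^sub>L op_adj W"] lin by auto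
  have "r *\<^sub>C W = (W o\<^sub>L op_adj W) o\<^sub>L W" unfolding r by simp
  also have "\<dots> = 1 *\<^sub>C W" by (simp add: blinfun_compose_assoc WW)
  finally have "r = 1 \<or> W = 0" using scaleC_cancel_right[of r W 1] by simp
  moreover have "W \<noteq> 0"
  proof
    assume "W = 0"
    then show False using arg_cong[OF WW, of "\<lambda>T. blinfun_apply T z"] z by auto
  qed
  ultimately have "W o\<^sub>L op_adj W = id_blinfun" using r by simp
  then have "is_unitary W" using lin WW by (simp add: is_unitary_def)
  moreover have "\<beta> T = W o\<^sub>L T o\<^sub>L op_adj W" if "T \<in> bounded_ops" for T
    using int[OF that] \<open>W o\<^sub>L op_adj W = id_blinfun\<close>
    by (metis blinfun_compose_assoc blinfun_compose_id(2))
  ultimately show ?thesis by blast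
qed

section \<open>Parity and shift on the GNS space\<close>

locale translation_rep = one_site a \<kappa>
  for a :: "(int \<Rightarrow> 'd::{finite, linorder} cvec) \<Rightarrow> 'a::cstar_algebra" and \<kappa> +
  fixes \<Theta> :: "'a \<Rightarrow> 'a" and \<tau> :: "int \<Rightarrow> 'a \<Rightarrow> 'a" and \<omega> :: "'a \<Rightarrow> complex"
    and \<pi> :: "'a \<Rightarrow> ('h::complex_hilbert \<Rightarrow>\<^sub>L 'h)" and \<Omega> :: 'h
    and \<Gamma> :: "'h \<Rightarrow>\<^sub>L 'h" and \<beta> :: "('h \<Rightarrow>\<^sub>L 'h) \<Rightarrow> ('h \<Rightarrow>\<^sub>L 'h)"
    and \<iota> :: "('h \<Rightarrow>\<^sub>L 'h) \<Rightarrow> (('k::complex_hilbert ^ 2) \<Rightarrow>\<^sub>L ('k ^ 2))"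
  assumes parity_aut: "bogoliubov a 0 (\<lambda>f x. - f x) \<Theta>"
    and shift_aut: "\<And>x. bogoliubov a 0 (shift x) (\<tau> x)"
    and pure: "pure_state \<omega>"
    and translation_invariant: "\<And>x A. \<omega> (\<tau> x A) = \<omega> A"
    and gns: "gns_triple UNIV \<omega> \<pi> \<Omega>"
    and \<Gamma>: "\<And>A. \<Gamma> (\<pi> A \<Omega>) = \<pi> (\<Theta> A) \<Omega>"
    and \<beta>_iso: "op_star_iso 0 (vN_closure \<pi> UNIV) (vN_closure \<pi> UNIV) \<beta>"
    and \<beta>: "\<And>A. \<beta> (\<pi> A) = \<pi> (\<tau> 1 A)"
    and Ad_\<Gamma>_iso: "op_star_iso 0 (vN_closure \<pi> (right_alg a)) (vN_closure \<pi> (right_alg a)) (Ad \<Gamma>)"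
    and \<iota>_iso: "op_star_iso 0 (vN_closure \<pi> (right_alg a)) R1 \<iota>"
    and \<iota>_grading: "\<And>x. x \<in> vN_closure \<pi> (right_alg a) \<Longrightarrow> \<iota> (Ad \<Gamma> x) = Ad grading_op (\<iota> x)"
begin

abbreviation "M \<equiv> vN_closure \<pi> (right_alg a)"

lemma norm_cyclic_vector: "norm \<Omega> = 1"
proof -
  have "cinner \<Omega> (\<pi> 1 \<Omega>) = 1"
    using gns_state[OF gns, of 1] pure by (simp add: pure_state_def is_state_def)
  then have "complex_of_real ((norm \<Omega>)\<^sup>2) = 1"
    by (simp add: unital_rep_one[OF gns_unital_rep[OF gns]] cinner_self)
  then have "(norm \<Omega>)\<^sup>2 = 1" using of_real_eq_1_iff by blast
  then show ?thesis by (simp add: power2_eq_1_iff) (use norm_ge_zero[of \<Omega>] in linarith)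
qed

sublocale irreducible_rep \<pi> \<Omega>
  using gns_unital_rep[OF gns] pure_irreducible[OF pure gns] gns_cyclic[OF gns] norm_cyclic_vector
  by unfold_locales auto

lemmas \<pi>_add = unital_rep_add[OF rep]
  and \<pi>_mult = unital_rep_mult[OF rep]
  and \<pi>_star = unital_rep_star[OF rep]
  and \<pi>_one = unital_rep_one[OF rep]
  and \<pi>_bounded_ops = unital_rep_bounded_ops[OF rep]
  and \<pi>_minus = unital_rep_minus[OF rep]
  and \<pi>_sum = unital_rep_sum[OF rep]

lemma \<pi>_scaleC: "\<pi> (c *\<^sub>C A) = c *\<^sub>C \<pi> A"
  by (simp add: unital_rep_scaleC[OF rep] conj_if_def)

lemma M_iff: "x \<in> M \<longleftrightarrow> x \<in> bounded_ops \<and> (\<forall>T\<in>commutant (\<pi> ` right_alg a). x o\<^sub>L T = T o\<^sub>L x)"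
  by (simp add: vN_closure_def commutant_def)

lemma M_bounded_ops: "x \<in> M \<Longrightarrow> x \<in> bounded_ops"
  by (simp add: M_iff)

lemma M_commute: "x \<in> M \<Longrightarrow> T \<in> commutant (\<pi> ` right_alg a) \<Longrightarrow> x o\<^sub>L T = T o\<^sub>L x"
  by (simp add: M_iff)

lemma commutant_\<pi>_adj: "T \<in> commutant (\<pi> ` right_alg a) \<Longrightarrow> op_adj T \<in> commutant (\<pi> ` right_alg a)"
  unfolding commutant_def
proof safe
  fix A assume A: "A \<in> right_alg a" and T: "T \<in> bounded_ops" "\<forall>A\<in>\<pi> ` right_alg a. T o\<^sub>L A = A o\<^sub>L T"
  have "star A \<in> right_alg a" using A by (rule local_alg_closed)
  with T(2) have "T o\<^sub>L \<pi> (star A) = \<pi> (star A) o\<^sub>L T" by blast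
  from arg_cong[OF this, of op_adj] show "op_adj T o\<^sub>L \<pi> A = \<pi> A o\<^sub>L op_adj T"
    by (simp add: \<pi>_star)
qed simp

lemma M_closed:
  shows "id_blinfun \<in> M" "0 \<in> M"
    and "x \<in> M \<Longrightarrow> y \<in> M \<Longrightarrow> x + y \<in> M"
    and "x \<in> M \<Longrightarrow> y \<in> M \<Longrightarrow> x o\<^sub>L y \<in> M"
    and "x \<in> M \<Longrightarrow> c *\<^sub>C x \<in> M"
    and "x \<in> M \<Longrightarrow> - x \<in> M"
    and "x \<in> M \<Longrightarrow> op_adj x \<in> M"
proof -
  show "x \<in> M \<Longrightarrow> y \<in> M \<Longrightarrow> x o\<^sub>L y \<in> M"
    by (simp add: M_iff) (metis blinfun_compose_assoc)
  show "op_adj x \<in> M" if x: "x \<in> M"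
    unfolding M_iff
  proof (intro conjI ballI)
    fix T assume "T \<in> commutant (\<pi> ` right_alg a)"
    from arg_cong[OF M_commute[OF x commutant_\<pi>_adj[OF this]], of op_adj]
    show "op_adj x o\<^sub>L T = T o\<^sub>L op_adj x" by simp
  qed (use M_bounded_ops[OF x] in simp)
qed (auto simp: M_iff blinfun_compose_add_left blinfun_compose_add_right blinfun_compose_scaleC_right commutant_def)

lemma \<pi>_M: "A \<in> right_alg a \<Longrightarrow> \<pi> A \<in> M"
  by (auto simp: M_iff \<pi>_bounded_ops commutant_def)

lemma right_alg_generator: "f \<in> l2 \<Longrightarrow> (\<And>y. y < 0 \<Longrightarrow> f y = 0) \<Longrightarrow> a f \<in> right_alg a"
  by (rule local_alg_generator) auto

lemma in_commutant_right:
  assumes "T \<in> bounded_ops"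
    and "\<And>f. f \<in> l2 \<Longrightarrow> (\<And>y. y < 0 \<Longrightarrow> f y = 0) \<Longrightarrow> T o\<^sub>L \<pi> (a f) = \<pi> (a f) o\<^sub>L T"
    and "\<And>f. f \<in> l2 \<Longrightarrow> (\<And>y. y < 0 \<Longrightarrow> f y = 0) \<Longrightarrow> T o\<^sub>L op_adj (\<pi> (a f)) = op_adj (\<pi> (a f)) o\<^sub>L T"
  shows "T \<in> commutant (\<pi> ` right_alg a)"
  unfolding commutant_def
proof (intro CollectI conjI ballI)
  fix B assume "B \<in> \<pi> ` right_alg a"
  then obtain A where A: "A \<in> right_alg a" "B = \<pi> A" by blast
  show "T o\<^sub>L B = B o\<^sub>L T"
    unfolding A(2) by (rule commute_local_alg[OF rep assms(1) A(1)]) (use assms in auto)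
qed (rule assms(1))

text \<open>By irreducibility the commutant consists of scalars. The translation automorphism
  therefore acts on all bounded operators and is spatial.\<close>

lemma vN_closure_UNIV: "vN_closure \<pi> UNIV = bounded_ops"
proof (intro equalityI subsetI)
  fix x :: "'h \<Rightarrow>\<^sub>L 'h" assume x: "x \<in> bounded_ops"
  have "x o\<^sub>L T = T o\<^sub>L x" if T: "T \<in> commutant (range \<pi>)" for T
    using irreducible[OF T] x by (auto simp: blinfun_compose_scaleC_right)
  then show "x \<in> vN_closure \<pi> UNIV" using x by (auto simp: vN_closure_def commutant_def[of "commutant _"])
qed (auto simp: vN_closure_def commutant_def)

lemma \<beta>_bounded_iso: "op_star_iso 0 bounded_ops bounded_ops \<beta>"
  using \<beta>_iso by (simp add: vN_closure_UNIV)

text \<open>Determined only up to a phase, which is why \<open>\<Omega>\<close> is merely an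
  eigenvector of its adjoint.\<close>

definition W where "W = (SOME W. is_unitary W \<and> (\<forall>T\<in>bounded_ops. \<beta> T = W o\<^sub>L T o\<^sub>L op_adj W))"

lemma W_unitary: "is_unitary W" and \<beta>_spatial: "T \<in> bounded_ops \<Longrightarrow> \<beta> T = W o\<^sub>L T o\<^sub>L op_adj W"
  using someI_ex[OF star_iso_bounded_ops_spatial[OF \<beta>_bounded_iso norm_\<Omega>]] unfolding W_def by blast+

lemmas \<beta>_hom = op_star_isoD[OF \<beta>_bounded_iso]
lemmas \<iota>_hom = op_star_isoD[OF \<iota>_iso]

lemma \<beta>_power_spatial:
  assumes T: "T \<in> bounded_ops"
  shows "(\<beta> ^^ n) T = op_pow W n o\<^sub>L T o\<^sub>L op_adj (op_pow W n)"
proof (induction n)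
  case (Suc n)
  have "op_pow W n o\<^sub>L T o\<^sub>L op_adj (op_pow W n) \<in> bounded_ops"
    using is_unitaryD(1)[OF is_unitary_op_pow[OF W_unitary]] T by simp
  then show ?case
    by (simp add: Suc \<beta>_spatial op_pow_Suc blinfun_compose_assoc)
qed simp

lemma \<beta>_power_bounded_ops: "T \<in> bounded_ops \<Longrightarrow> (\<beta> ^^ n) T \<in> bounded_ops"
  using is_unitaryD(1)[OF is_unitary_op_pow[OF W_unitary]] by (simp add: \<beta>_power_spatial)

lemma \<beta>_power_mult:
  assumes "S \<in> bounded_ops" "T \<in> bounded_ops"
  shows "(\<beta> ^^ n) (S o\<^sub>L T) = (\<beta> ^^ n) S o\<^sub>L (\<beta> ^^ n) T"
  using assms is_unitaryD(4)[OF is_unitary_op_pow[OF W_unitary]]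
  by (intro blinfun_eqI) (simp add: \<beta>_power_spatial)

lemma \<beta>_power_\<pi>: "(\<beta> ^^ n) (\<pi> A) = \<pi> ((\<tau> 1 ^^ n) A)"
  by (induction n) (simp_all add: \<beta>)

lemma \<tau>_power_a: "f \<in> l2 \<Longrightarrow> (\<tau> 1 ^^ n) (a f) = a (shift (int n) f)"
proof (induction n)
  case 0
  then show ?case by (simp add: shift_def)
next
  case (Suc n)
  then show ?case
    using bogoliubovD(6)[OF shift_aut shift_l2[OF Suc.prems], of 1 "int n"] by (simp add: shift_shift)
qed

text \<open>\<open>x\<close> lies in a bicommutant and is in general no norm limit of local
  elements, so \<open>T\<close> is moved instead: conjugated back by the n-th power of
  \<open>W\<close> it commutes with the generators of the half-chain, hence with
  \<open>x\<close>.\<close>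

lemma commute_\<beta>_power:
  assumes T: "T \<in> bounded_ops" and x: "x \<in> M"
    and gen: "\<And>f. f \<in> l2 \<Longrightarrow> (\<And>y. y < int n \<Longrightarrow> f y = 0) \<Longrightarrow> T o\<^sub>L \<pi> (a f) = \<pi> (a f) o\<^sub>L T"
      "\<And>f. f \<in> l2 \<Longrightarrow> (\<And>y. y < int n \<Longrightarrow> f y = 0) \<Longrightarrow> T o\<^sub>L op_adj (\<pi> (a f)) = op_adj (\<pi> (a f)) o\<^sub>L T"
  shows "T o\<^sub>L (\<beta> ^^ n) x = (\<beta> ^^ n) x o\<^sub>L T"
proof -
  define V where "V = op_pow W n"
  have V: "is_unitary V" unfolding V_def by (rule is_unitary_op_pow[OF W_unitary])
  note Vs = is_unitaryD[OF V]
  define S where "S = op_adj V o\<^sub>L T o\<^sub>L V"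
  have sh: "V (\<pi> (a f) v) = \<pi> (a (shift (int n) f)) (V v)"
    "V (op_adj (\<pi> (a f)) v) = op_adj (\<pi> (a (shift (int n) f))) (V v)" if f: "f \<in> l2" for f v
  proof -
    have eq: "V o\<^sub>L \<pi> (a f) o\<^sub>L op_adj V = \<pi> (a (shift (int n) f))"
      using \<beta>_power_spatial[OF \<pi>_bounded_ops, of n "a f"] f by (simp add: V_def \<beta>_power_\<pi> \<tau>_power_a)
    have eq': "V o\<^sub>L op_adj (\<pi> (a f)) o\<^sub>L op_adj V = op_adj (\<pi> (a (shift (int n) f)))"
      using arg_cong[OF eq, of op_adj] by (simp add: blinfun_compose_assoc)
    show "V (\<pi> (a f) v) = \<pi> (a (shift (int n) f)) (V v)"
      "V (op_adj (\<pi> (a f)) v) = op_adj (\<pi> (a (shift (int n) f))) (V v)"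
      unfolding eq[symmetric] eq'[symmetric] by (simp_all add: Vs)
  qed
  have "S \<in> commutant (\<pi> ` right_alg a)"
  proof (rule in_commutant_right)
    show "S \<in> bounded_ops" using T Vs(1) by (simp add: S_def)
    fix f :: "int \<Rightarrow> 'd cvec" assume f: "f \<in> l2" "\<And>y. y < 0 \<Longrightarrow> f y = 0"
    have z: "shift (int n) f y = 0" if "y < int n" for y using f(2)[of "y - int n"] that by (simp add: shift_def)
    have g: "T o\<^sub>L \<pi> (a (shift (int n) f)) = \<pi> (a (shift (int n) f)) o\<^sub>L T"
      "T o\<^sub>L op_adj (\<pi> (a (shift (int n) f))) = op_adj (\<pi> (a (shift (int n) f))) o\<^sub>L T"
      by (rule gen, rule shift_l2, rule f(1), erule z)+
    have inv: "op_adj V w = v" if "w = V v" for v w using that Vs(4) by simp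
    show "S o\<^sub>L \<pi> (a f) = \<pi> (a f) o\<^sub>L S"
    proof (rule blinfun_eqI)
      fix v
      have "T (V (\<pi> (a f) v)) = \<pi> (a (shift (int n) f)) (T (V v))"
        using arg_cong[OF g(1), of "\<lambda>S. blinfun_apply S (V v)"] by (simp add: sh[OF f(1)])
      also have "\<dots> = V (\<pi> (a f) (op_adj V (T (V v))))" by (simp add: sh[OF f(1)] Vs)
      finally show "(S o\<^sub>L \<pi> (a f)) v = (\<pi> (a f) o\<^sub>L S) v" by (simp add: S_def Vs)
    qed
    show "S o\<^sub>L op_adj (\<pi> (a f)) = op_adj (\<pi> (a f)) o\<^sub>L S"
    proof (rule blinfun_eqI)
      fix v
      have "T (V (op_adj (\<pi> (a f)) v)) = op_adj (\<pi> (a (shift (int n) f))) (T (V v))"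
        using arg_cong[OF g(2), of "\<lambda>S. blinfun_apply S (V v)"] by (simp add: sh[OF f(1)])
      also have "\<dots> = V (op_adj (\<pi> (a f)) (op_adj V (T (V v))))" by (simp add: sh[OF f(1)] Vs)
      finally show "(S o\<^sub>L op_adj (\<pi> (a f))) v = (op_adj (\<pi> (a f)) o\<^sub>L S) v" by (simp add: S_def Vs)
    qed
  qed
  then have c: "x (S v) = S (x v)" for v
    using M_commute[OF x] by (metis blinfun_apply_blinfun_compose)
  show ?thesis
  proof (rule blinfun_eqI)
    fix v
    have "V (x (S (op_adj V v))) = V (S (x (op_adj V v)))" by (simp add: c)
    then show "(T o\<^sub>L (\<beta> ^^ n) x) v = ((\<beta> ^^ n) x o\<^sub>L T) v"
      by (simp add: \<beta>_power_spatial[OF M_bounded_ops[OF x]] V_def[symmetric] S_def Vs)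
  qed
qed

lemma \<beta>_M: "x \<in> M \<Longrightarrow> \<beta> x \<in> M"
  unfolding M_iff[of "\<beta> x"]
proof (intro conjI ballI)
  assume x: "x \<in> M"
  show "\<beta> x \<in> bounded_ops"
    using \<beta>_power_bounded_ops[OF M_bounded_ops[OF x], of 1] by simp
  fix T assume T: "T \<in> commutant (\<pi> ` right_alg a)"
  have "T o\<^sub>L (\<beta> ^^ 1) x = (\<beta> ^^ 1) x o\<^sub>L T"
  proof (rule commute_\<beta>_power[OF commutantD(1)[OF T] x])
    fix f :: "int \<Rightarrow> 'd cvec" assume "f \<in> l2" "\<And>y. y < int 1 \<Longrightarrow> f y = 0"
    then have "\<pi> (a f) \<in> \<pi> ` right_alg a" "\<pi> (star (a f)) \<in> \<pi> ` right_alg a"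
      by (auto intro!: imageI right_alg_generator local_alg_closed)
    then show "T o\<^sub>L \<pi> (a f) = \<pi> (a f) o\<^sub>L T" "T o\<^sub>L op_adj (\<pi> (a f)) = op_adj (\<pi> (a f)) o\<^sub>L T"
      using commutantD(2)[OF T] by (auto simp: \<pi>_star)
  qed
  then show "\<beta> x o\<^sub>L T = T o\<^sub>L \<beta> x" by simp
qed

lemma \<Gamma>_\<pi>: "\<Gamma> o\<^sub>L \<pi> A = \<pi> (\<Theta> A) o\<^sub>L \<Gamma>"
proof (rule dense_eqI[OF cyclic])
  fix v assume "v \<in> range (\<lambda>B. \<pi> B \<Omega>)"
  then obtain B where v: "v = \<pi> B \<Omega>" by blast
  have "\<Gamma> (\<pi> (A * B) \<Omega>) = \<pi> (\<Theta> A) (\<Gamma> (\<pi> B \<Omega>))"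
    unfolding \<Gamma> by (simp add: bogoliubovD(3)[OF parity_aut] \<pi>_mult)
  then show "(\<Gamma> o\<^sub>L \<pi> A) v = (\<pi> (\<Theta> A) o\<^sub>L \<Gamma>) v" by (simp add: v \<pi>_mult)
qed

lemma \<Gamma>_bounded_ops: "\<Gamma> \<in> bounded_ops"
  unfolding bounded_ops_def mem_Collect_eq
proof (intro allI)
  fix c x
  have "\<Gamma> o\<^sub>L (c *\<^sub>C id_blinfun) = c *\<^sub>C \<Gamma>"
  proof (rule dense_eqI[OF cyclic])
    fix v assume "v \<in> range (\<lambda>A. \<pi> A \<Omega>)"
    then obtain A where v: "v = \<pi> A \<Omega>" by blast
    have "\<Gamma> (\<pi> (c *\<^sub>C A) \<Omega>) = c *\<^sub>C \<Gamma> (\<pi> A \<Omega>)"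
      unfolding \<Gamma> by (simp add: bogoliubovD(2)[OF parity_aut] conj_if_def \<pi>_scaleC scaleC_blinfun.rep_eq)
    then show "(\<Gamma> o\<^sub>L (c *\<^sub>C id_blinfun)) v = (c *\<^sub>C \<Gamma>) v"
      by (simp add: v scaleC_blinfun.rep_eq \<pi>_scaleC)
  qed
  from arg_cong[OF this, of "\<lambda>T. blinfun_apply T x"] show "\<Gamma> (c *\<^sub>C x) = c *\<^sub>C \<Gamma> x"
    by (simp add: scaleC_blinfun.rep_eq)
qed

lemma \<Theta>_\<Theta>: "\<pi> (\<Theta> (\<Theta> A)) = \<pi> A"
proof -
  have "\<pi> \<circ> \<Theta> \<circ> \<Theta> = \<pi>"
  proof (rule unital_rep_eqI[OF car _ rep])
    show "unital_rep 0 (\<pi> \<circ> \<Theta> \<circ> \<Theta>)"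
      using unital_rep_comp_bogoliubov[OF unital_rep_comp_bogoliubov[OF rep parity_aut] parity_aut] by simp
    fix f :: "int \<Rightarrow> 'd cvec" assume f: "f \<in> l2"
    then have "(\<lambda>x. - f x) \<in> l2" by (simp add: l2_def)
    then show "(\<pi> \<circ> \<Theta> \<circ> \<Theta>) (a f) = \<pi> (a f)"
      using f by (simp add: bogoliubovD(6)[OF parity_aut])
  qed
  then show ?thesis by (metis comp_apply)
qed

lemma \<Gamma>_\<Gamma>: "\<Gamma> o\<^sub>L \<Gamma> = id_blinfun"
  by (rule dense_eqI[OF cyclic]) (auto simp: \<Gamma> \<Theta>_\<Theta>)

lemma \<Gamma>_\<Gamma>_apply: "\<Gamma> (\<Gamma> v) = v"
  using arg_cong[OF \<Gamma>_\<Gamma>, of "\<lambda>T. blinfun_apply T v"] by simp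

text \<open>Unitality of the isomorphism \<open>Ad \<Gamma>\<close> makes the adjoint a right
  inverse of \<open>\<Gamma>\<close>, and \<open>\<Gamma>\<close> is its own inverse.\<close>

lemma op_adj_\<Gamma>: "op_adj \<Gamma> = \<Gamma>"
proof -
  have "Ad \<Gamma> id_blinfun = id_blinfun"
    by (rule op_star_iso_one[OF Ad_\<Gamma>_iso M_closed(1) M_closed(1)])
  then have "\<Gamma> o\<^sub>L (\<Gamma> o\<^sub>L op_adj \<Gamma>) = \<Gamma>" by (simp add: Ad_def)
  then show ?thesis by (simp add: \<Gamma>_\<Gamma> flip: blinfun_compose_assoc)
qed

lemma \<Gamma>_\<Omega>: "\<Gamma> \<Omega> = \<Omega>"
  using \<Gamma>[of 1] by (simp add: bogoliubovD[OF parity_aut] \<pi>_one)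

lemma \<Gamma>_a: "f \<in> l2 \<Longrightarrow> \<Gamma> o\<^sub>L \<pi> (a f) = - (\<pi> (a f) o\<^sub>L \<Gamma>)"
proof -
  assume f: "f \<in> l2"
  have "a (\<lambda>x. - f x) = a (\<lambda>x. (-1) *\<^sub>C f x)" by simp
  also have "\<dots> = - a f" using car f unfolding car_algebra_def by (metis complex_cnj_minus complex_cnj_one scaleC_minus_left scaleC_one)
  finally show ?thesis using f by (simp add: \<Gamma>_\<pi> bogoliubovD(6)[OF parity_aut] \<pi>_minus)
qed

lemma \<Gamma>_adj_a: "f \<in> l2 \<Longrightarrow> \<Gamma> o\<^sub>L op_adj (\<pi> (a f)) = - (op_adj (\<pi> (a f)) o\<^sub>L \<Gamma>)"
  using arg_cong[OF \<Gamma>_a, of f op_adj] by (simp add: op_adj_\<Gamma> minus_equation_iff)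

text \<open>Shift and parity commute on generators, so \<open>\<Gamma>\<close> and
  \<open>\<beta> \<Gamma>\<close> implement the same automorphism and differ by a scalar. Only the
  square of the scalar is determined, and later uses rely on the square alone.\<close>

lemma \<beta>_\<Gamma>: obtains c where "c * c = 1" "\<beta> \<Gamma> = c *\<^sub>C \<Gamma>"
proof -
  have \<tau>\<Theta>: "\<pi> (\<tau> 1 (\<Theta> A)) = \<pi> (\<Theta> (\<tau> 1 A))" for A
  proof -
    have "\<pi> \<circ> \<tau> 1 \<circ> \<Theta> = \<pi> \<circ> \<Theta> \<circ> \<tau> 1"
    proof (rule unital_rep_eqI[OF car])
      show "unital_rep 0 (\<pi> \<circ> \<tau> 1 \<circ> \<Theta>)" "unital_rep 0 (\<pi> \<circ> \<Theta> \<circ> \<tau> 1)"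
        using unital_rep_comp_bogoliubov[OF unital_rep_comp_bogoliubov[OF rep parity_aut] shift_aut]
          unital_rep_comp_bogoliubov[OF unital_rep_comp_bogoliubov[OF rep shift_aut] parity_aut] by simp_all
      fix f :: "int \<Rightarrow> 'd cvec" assume f: "f \<in> l2"
      then have "(\<lambda>x. - f x) \<in> l2" by (simp add: l2_def)
      then show "(\<pi> \<circ> \<tau> 1 \<circ> \<Theta>) (a f) = (\<pi> \<circ> \<Theta> \<circ> \<tau> 1) (a f)"
        using f by (simp add: bogoliubovD(6)[OF parity_aut] bogoliubovD(6)[OF shift_aut] shift_l2) (simp add: shift_def)
    qed
    then show ?thesis by (metis comp_apply)
  qed
  have \<beta>\<Gamma>: "\<beta> \<Gamma> \<in> bounded_ops" using \<beta>_power_bounded_ops[OF \<Gamma>_bounded_ops, of 1] by simp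
  have "\<Gamma> o\<^sub>L \<beta> \<Gamma> \<in> commutant (range \<pi>)"
    unfolding commutant_def
  proof (intro CollectI conjI ballI)
    fix B assume "B \<in> range \<pi>"
    then obtain A' where "B = \<pi> A'" by blast
    moreover obtain A where "A' = \<tau> 1 A" using bogoliubovD(5)[OF shift_aut, of 1] by (metis bij_pointE)
    ultimately have B: "B = \<beta> (\<pi> A)" by (simp add: \<beta>)
    have "\<beta> \<Gamma> o\<^sub>L B = \<beta> (\<pi> (\<Theta> A) o\<^sub>L \<Gamma>)"
      by (simp add: B \<beta>_hom(3)[symmetric] \<Gamma>_bounded_ops \<pi>_bounded_ops \<Gamma>_\<pi>)
    also have "\<dots> = \<pi> (\<Theta> (\<tau> 1 A)) o\<^sub>L \<beta> \<Gamma>"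
      by (simp add: \<beta>_hom(3) \<Gamma>_bounded_ops \<pi>_bounded_ops \<beta> \<tau>\<Theta>)
    finally have "\<Gamma> o\<^sub>L \<beta> \<Gamma> o\<^sub>L B = (\<Gamma> o\<^sub>L \<pi> (\<Theta> (\<tau> 1 A))) o\<^sub>L \<beta> \<Gamma>" by (simp add: blinfun_compose_assoc)
    also have "\<dots> = B o\<^sub>L (\<Gamma> o\<^sub>L \<beta> \<Gamma>)"
      by (simp add: \<Gamma>_\<pi> \<Theta>_\<Theta> B \<beta> blinfun_compose_assoc)
    finally show "\<Gamma> o\<^sub>L \<beta> \<Gamma> o\<^sub>L B = B o\<^sub>L (\<Gamma> o\<^sub>L \<beta> \<Gamma>)" .
  qed (simp add: \<Gamma>_bounded_ops \<beta>\<Gamma>)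
  then obtain c where c: "\<Gamma> o\<^sub>L \<beta> \<Gamma> = c *\<^sub>C id_blinfun" using irreducible by blast
  have "\<Gamma> o\<^sub>L (\<Gamma> o\<^sub>L \<beta> \<Gamma>) = c *\<^sub>C \<Gamma>" unfolding c by (simp add: blinfun_compose_scaleC_right \<Gamma>_bounded_ops)
  then have eq: "\<beta> \<Gamma> = c *\<^sub>C \<Gamma>" by (simp add: \<Gamma>_\<Gamma> flip: blinfun_compose_assoc)
  have "\<beta> \<Gamma> o\<^sub>L \<beta> \<Gamma> = id_blinfun"
    using op_star_iso_one[OF \<beta>_bounded_iso] by (simp add: \<beta>_hom(3)[symmetric] \<Gamma>_bounded_ops \<Gamma>_\<Gamma>)
  then have "(c * c) *\<^sub>C id_blinfun = (1::complex) *\<^sub>C (id_blinfun :: 'h \<Rightarrow>\<^sub>L 'h)"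
    by (simp add: eq blinfun_compose_scaleC_right \<Gamma>_bounded_ops \<Gamma>_\<Gamma> scaleC_scaleC)
  moreover have "(id_blinfun :: 'h \<Rightarrow>\<^sub>L 'h) \<noteq> 0"
    using norm_\<Omega> by (metis id_apply id_blinfun.rep_eq norm_zero zero_blinfun.rep_eq zero_neq_one)
  ultimately have "c * c = 1" by (simp add: scaleC_cancel_right del: scaleC_one)
  then show ?thesis using eq that by blast
qed

lemma \<Gamma>_commute_\<beta>:
  assumes x: "x \<in> bounded_ops" and s: "\<Gamma> o\<^sub>L x = s *\<^sub>C (x o\<^sub>L \<Gamma>)"
  shows "\<Gamma> o\<^sub>L \<beta> x = s *\<^sub>C (\<beta> x o\<^sub>L \<Gamma>)"
proof -
  obtain c where c: "c * c = 1" "\<beta> \<Gamma> = c *\<^sub>C \<Gamma>" by (rule \<beta>_\<Gamma>)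
  have \<beta>x: "\<beta> x \<in> bounded_ops" using \<beta>_power_bounded_ops[OF x, of 1] by simp
  have "\<beta> (\<Gamma> o\<^sub>L x) = \<beta> (s *\<^sub>C (x o\<^sub>L \<Gamma>))" by (simp add: s)
  then have "c *\<^sub>C (\<Gamma> o\<^sub>L \<beta> x) = c *\<^sub>C (s *\<^sub>C (\<beta> x o\<^sub>L \<Gamma>))"
    by (simp add: \<beta>_hom x \<Gamma>_bounded_ops c(2) blinfun_compose_scaleC_right \<beta>x scaleC_scaleC mult.commute)
  then show ?thesis using c(1) by (subst (asm) scaleC_cancel_left) auto
qed

lemma Ad_\<Gamma>_eq_iff: "Ad \<Gamma> x = s *\<^sub>C x \<longleftrightarrow> \<Gamma> o\<^sub>L x = s *\<^sub>C (x o\<^sub>L \<Gamma>)"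
proof -
  have *: "x o\<^sub>L \<Gamma> o\<^sub>L \<Gamma> = x" for x by (simp add: blinfun_compose_assoc \<Gamma>_\<Gamma>)
  show ?thesis unfolding Ad_def op_adj_\<Gamma> by (metis * blinfun_compose_scaleC_left)
qed

end

section \<open>The isometries\<close>

lemma op_pow_add: "op_pow T m o\<^sub>L op_pow T n = op_pow T (m + n)"
  by (induction m) (simp_all add: op_pow_Suc blinfun_compose_assoc)

lemma op_pow_flip: "op_pow flip_op n = (if even n then id_blinfun else flip_op)"
  by (simp add: op_pow_involution)

lemma op_pow_grading: "op_pow grading_op n = (if even n then id_blinfun else grading_op)"
  by (simp add: op_pow_involution)

lemma op_pow_flip_self [simp]: "op_pow flip_op n o\<^sub>L op_pow flip_op n = id_blinfun"
  by (simp add: op_pow_flip)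

lemma op_pow_grading_self [simp]: "op_pow grading_op n o\<^sub>L op_pow grading_op n = id_blinfun"
  by (simp add: op_pow_grading)

lemma op_pow_flip_amp: "op_pow flip_op n o\<^sub>L amp b = amp b o\<^sub>L op_pow flip_op n"
  by (simp add: op_pow_flip flip_amp)

lemma op_pow_grading_amp: "op_pow grading_op n o\<^sub>L amp b = amp b o\<^sub>L op_pow grading_op n"
  by (simp add: op_pow_grading grading_amp)

lemma op_pow_grading_flip: "op_pow grading_op n o\<^sub>L flip_op o\<^sub>L op_pow grading_op n = (- 1) ^ n *\<^sub>C flip_op"
  by (simp add: op_pow_grading grading_flip) (simp add: blinfun_compose_assoc)

lemma op_adj_op_pow_flip [simp]: "op_adj (op_pow flip_op n) = op_pow flip_op n"
  by (simp add: op_pow_flip)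

lemma op_adj_op_pow_grading [simp]: "op_adj (op_pow grading_op n) = op_pow grading_op n"
  by (simp add: op_pow_grading)

lemma amp_flip_pow_eq: "amp b o\<^sub>L op_pow flip_op n = amp c o\<^sub>L op_pow flip_op n \<longleftrightarrow> b = c"
proof
  assume "amp b o\<^sub>L op_pow flip_op n = amp c o\<^sub>L op_pow flip_op n"
  then have "(amp b o\<^sub>L op_pow flip_op n) o\<^sub>L op_pow flip_op n = (amp c o\<^sub>L op_pow flip_op n) o\<^sub>L op_pow flip_op n"
    by simp
  then show "b = c" by (simp add: blinfun_compose_assoc)
qed simp

lemma amp_flip_pow_mult:
  "(amp b o\<^sub>L op_pow flip_op m) o\<^sub>L (amp c o\<^sub>L op_pow flip_op n) = amp (b o\<^sub>L c) o\<^sub>L op_pow flip_op (m + n)"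
proof -
  have "(amp b o\<^sub>L op_pow flip_op m) o\<^sub>L (amp c o\<^sub>L op_pow flip_op n)
      = amp b o\<^sub>L (op_pow flip_op m o\<^sub>L amp c) o\<^sub>L op_pow flip_op n"
    by (simp only: blinfun_compose_assoc)
  also have "\<dots> = (amp b o\<^sub>L amp c) o\<^sub>L (op_pow flip_op m o\<^sub>L op_pow flip_op n)"
    by (simp only: op_pow_flip_amp blinfun_compose_assoc)
  finally show ?thesis by (simp only: amp_compose op_pow_add)
qed

lemma op_pow_flip_cong: "even m = even n \<Longrightarrow> op_pow flip_op m = op_pow flip_op n"
  by (simp add: op_pow_flip)

lemma minus_one_card_parity: "(- 1) ^ (card \<mu> + card \<nu>) = (- 1 :: complex) ^ (parity \<mu> + parity \<nu>)"
  by (simp add: power_add minus_one_power_parity)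

section \<open>Site 0 against the translated half-chain\<close>

context translation_rep
begin

abbreviation j where "j \<equiv> inv_into M \<iota>"

lemma \<iota>_R1: "x \<in> M \<Longrightarrow> \<iota> x \<in> R1"
  and j_M: "y \<in> R1 \<Longrightarrow> j y \<in> M"
  and \<iota>_j: "y \<in> R1 \<Longrightarrow> \<iota> (j y) = y"
  and \<iota>_inj: "x \<in> M \<Longrightarrow> x' \<in> M \<Longrightarrow> \<iota> x = \<iota> x' \<Longrightarrow> x = x'"
  and j_\<iota>: "x \<in> M \<Longrightarrow> j (\<iota> x) = x"
  using \<iota>_hom(5) by (auto simp: bij_betw_def inv_into_into f_inv_into_f inj_on_eq_iff)

lemma \<iota>_id: "\<iota> id_blinfun = id_blinfun"
  using op_star_iso_one[OF \<iota>_iso M_closed(1)] amp_R1[of id_blinfun] by simp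

lemma \<iota>_zero: "\<iota> 0 = 0"
  using \<iota>_hom(2)[OF M_closed(2), of 0] by simp

lemma \<iota>_sum: "(\<And>i. i \<in> I \<Longrightarrow> x i \<in> M) \<Longrightarrow> (\<Sum>i\<in>I. x i) \<in> M \<and> \<iota> (\<Sum>i\<in>I. x i) = (\<Sum>i\<in>I. \<iota> (x i))"
  by (induction I rule: infinite_finite_induct) (auto simp: \<iota>_zero M_closed \<iota>_hom(1))

lemma \<iota>_\<Gamma>:
  assumes "x \<in> M" "\<Gamma> o\<^sub>L x = s *\<^sub>C (x o\<^sub>L \<Gamma>)"
  shows "Ad grading_op (\<iota> x) = s *\<^sub>C \<iota> x"
proof -
  have "Ad \<Gamma> x = s *\<^sub>C x" using assms(2) by (simp add: Ad_\<Gamma>_eq_iff)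
  then show ?thesis using \<iota>_grading[OF assms(1)] \<iota>_hom(2)[OF assms(1)] by simp
qed

lemma j_\<Gamma>:
  assumes "y \<in> R1" "Ad grading_op y = s *\<^sub>C y"
  shows "\<Gamma> o\<^sub>L j y = s *\<^sub>C (j y o\<^sub>L \<Gamma>)"
proof -
  have AdM: "Ad \<Gamma> (j y) \<in> M"
    using op_star_isoD(5)[OF Ad_\<Gamma>_iso] j_M[OF assms(1)] by (auto simp: bij_betw_def)
  have "\<iota> (Ad \<Gamma> (j y)) = \<iota> (s *\<^sub>C j y)"
    using assms by (simp add: \<iota>_grading j_M \<iota>_j \<iota>_hom(2))
  then have "Ad \<Gamma> (j y) = s *\<^sub>C j y"
    by (intro \<iota>_inj AdM M_closed j_M assms)
  then show ?thesis by (simp add: Ad_\<Gamma>_eq_iff)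
qed

lemma \<Gamma>_j_amp: "b \<in> bounded_ops \<Longrightarrow> \<Gamma> o\<^sub>L j (amp b) = 1 *\<^sub>C (j (amp b) o\<^sub>L \<Gamma>)"
  by (rule j_\<Gamma>) (use Ad_grading_R1[of b 0] in simp_all)

lemma \<Gamma>_j_flip: "b \<in> bounded_ops \<Longrightarrow> \<Gamma> o\<^sub>L j (amp b o\<^sub>L flip_op) = (- 1) *\<^sub>C (j (amp b o\<^sub>L flip_op) o\<^sub>L \<Gamma>)"
  by (rule j_\<Gamma>) (use Ad_grading_R1[of 0 b] in simp_all)

definition mh :: "'d set \<Rightarrow> 'd set \<Rightarrow> ('h \<Rightarrow>\<^sub>L 'h)" where "mh \<mu> \<nu> = \<pi> (m \<mu> \<nu>)"

lemma mh_M: "mh \<mu> \<nu> \<in> M"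
  unfolding mh_def using m_local local_alg_mono[of "{0}" "{0..}" a] by (intro \<pi>_M) auto

lemma mh_bounded_ops: "mh \<mu> \<nu> \<in> bounded_ops"
  by (simp add: mh_def \<pi>_bounded_ops)

lemma mh_mult: "mh \<mu> \<nu> o\<^sub>L mh \<mu>' \<nu>' = (if \<nu> = \<mu>' then mh \<mu> \<nu>' else 0)"
  by (simp add: mh_def m_mult unital_rep_zero[OF rep] flip: \<pi>_mult)

lemma mh_adj: "op_adj (mh \<mu> \<nu>) = mh \<nu> \<mu>"
  by (simp add: mh_def m_star flip: \<pi>_star)

lemma mh_sum: "(\<Sum>\<mu>\<in>UNIV. mh \<mu> \<mu>) = id_blinfun"
  by (simp add: mh_def m_sum \<pi>_one flip: \<pi>_sum)

lemma \<Gamma>_mh: "\<Gamma> o\<^sub>L mh \<mu> \<nu> = (- 1) ^ (parity \<mu> + parity \<nu>) *\<^sub>C (mh \<mu> \<nu> o\<^sub>L \<Gamma>)"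
  by (simp add: mh_def \<Gamma>_\<pi> parity_matrix_unit[OF parity_aut] minus_one_card_parity \<pi>_scaleC)

lemma a_mh:
  assumes "f \<in> l2" "f 0 = 0"
  shows "\<pi> (a f) o\<^sub>L mh \<mu> \<nu> = (- 1) ^ (parity \<mu> + parity \<nu>) *\<^sub>C (mh \<mu> \<nu> o\<^sub>L \<pi> (a f))"
    and "op_adj (\<pi> (a f)) o\<^sub>L mh \<mu> \<nu> = (- 1) ^ (parity \<mu> + parity \<nu>) *\<^sub>C (mh \<mu> \<nu> o\<^sub>L op_adj (\<pi> (a f)))"
proof -
  show *: "\<pi> (a f) o\<^sub>L mh \<mu> \<nu> = (- 1) ^ (parity \<mu> + parity \<nu>) *\<^sub>C (mh \<mu> \<nu> o\<^sub>L \<pi> (a f))" for \<mu> \<nu>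
    using arg_cong[OF a_matrix_unit[OF assms], of \<pi>]
    by (simp add: mh_def \<pi>_mult \<pi>_scaleC minus_one_card_parity)
  have "mh \<mu> \<nu> o\<^sub>L op_adj (\<pi> (a f)) = (- 1) ^ (parity \<mu> + parity \<nu>) *\<^sub>C (op_adj (\<pi> (a f)) o\<^sub>L mh \<mu> \<nu>)"
    using arg_cong[OF *[of \<nu> \<mu>], of op_adj]
    by (simp add: op_adj_scaleC mh_bounded_ops \<pi>_bounded_ops mh_adj add.commute)
  then show "op_adj (\<pi> (a f)) o\<^sub>L mh \<mu> \<nu> = (- 1) ^ (parity \<mu> + parity \<nu>) *\<^sub>C (mh \<mu> \<nu> o\<^sub>L op_adj (\<pi> (a f)))"
    by (simp add: scaleC_scaleC flip: power_mult_distrib)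
qed

lemma mh_commute_\<beta>:
  assumes "even (parity \<mu> + parity \<nu>)" "x \<in> M"
  shows "mh \<mu> \<nu> o\<^sub>L \<beta> x = \<beta> x o\<^sub>L mh \<mu> \<nu>"
proof -
  have "mh \<mu> \<nu> o\<^sub>L (\<beta> ^^ 1) x = (\<beta> ^^ 1) x o\<^sub>L mh \<mu> \<nu>"
    by (rule commute_\<beta>_power[OF mh_bounded_ops assms(2)]) (use assms(1) in \<open>simp_all add: a_mh\<close>)
  then show ?thesis by simp
qed

text \<open>An odd unit and \<open>\<Gamma>\<close> both anticommute with the annihilators off the
  site 0, so their product commutes with them and hence with \<open>\<beta> x\<close>. Moving
  \<open>\<Gamma>\<close> across \<open>\<beta> x\<close> produces the factor
  \<open>s\<close>.\<close>

lemma mh_graded_commute_\<beta>: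
  assumes x: "x \<in> M" "\<Gamma> o\<^sub>L x = s *\<^sub>C (x o\<^sub>L \<Gamma>)" and s: "s * s = 1"
  shows "mh \<mu> \<nu> o\<^sub>L \<beta> x = s ^ (parity \<mu> + parity \<nu>) *\<^sub>C (\<beta> x o\<^sub>L mh \<mu> \<nu>)"
proof (cases "even (parity \<mu> + parity \<nu>)")
  case True
  then obtain k where k: "parity \<mu> + parity \<nu> = 2 * k" by blast
  have "s ^ (parity \<mu> + parity \<nu>) = 1" unfolding k power_mult using s by (simp add: power2_eq_square)
  then show ?thesis using mh_commute_\<beta>[OF True x(1)] by simp
next
  case False
  have "(mh \<mu> \<nu> o\<^sub>L \<Gamma>) o\<^sub>L (\<beta> ^^ 1) x = (\<beta> ^^ 1) x o\<^sub>L (mh \<mu> \<nu> o\<^sub>L \<Gamma>)"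
  proof (rule commute_\<beta>_power[OF _ x(1)])
    show "mh \<mu> \<nu> o\<^sub>L \<Gamma> \<in> bounded_ops" by (simp add: mh_bounded_ops \<Gamma>_bounded_ops)
    fix f :: "int \<Rightarrow> 'd cvec" assume f: "f \<in> l2" "\<And>y. y < int 1 \<Longrightarrow> f y = 0"
    have f0: "f 0 = 0" using f(2) by simp
    show "(mh \<mu> \<nu> o\<^sub>L \<Gamma>) o\<^sub>L \<pi> (a f) = \<pi> (a f) o\<^sub>L (mh \<mu> \<nu> o\<^sub>L \<Gamma>)"
      using False by (simp add: a_mh[OF f(1) f0] \<Gamma>_a[OF f(1)] blinfun_compose_assoc flip: blinfun_compose_assoc[of "\<pi> _" "mh _ _"])
    show "(mh \<mu> \<nu> o\<^sub>L \<Gamma>) o\<^sub>L op_adj (\<pi> (a f)) = op_adj (\<pi> (a f)) o\<^sub>L (mh \<mu> \<nu> o\<^sub>L \<Gamma>)"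
      using False by (simp add: a_mh[OF f(1) f0] \<Gamma>_adj_a[OF f(1)] blinfun_compose_assoc flip: blinfun_compose_assoc[of "op_adj _" "mh _ _"])
  qed
  then have "mh \<mu> \<nu> o\<^sub>L (\<Gamma> o\<^sub>L \<beta> x) = (\<beta> x o\<^sub>L mh \<mu> \<nu>) o\<^sub>L \<Gamma>" by (simp add: blinfun_compose_assoc)
  then have "s *\<^sub>C (mh \<mu> \<nu> o\<^sub>L \<beta> x) o\<^sub>L \<Gamma> = (\<beta> x o\<^sub>L mh \<mu> \<nu>) o\<^sub>L \<Gamma>"
    by (simp add: \<Gamma>_commute_\<beta>[OF M_bounded_ops[OF x(1)] x(2)] blinfun_compose_scaleC_right mh_bounded_ops blinfun_compose_assoc)
  then have "(s *\<^sub>C (mh \<mu> \<nu> o\<^sub>L \<beta> x) o\<^sub>L \<Gamma>) o\<^sub>L \<Gamma> = ((\<beta> x o\<^sub>L mh \<mu> \<nu>) o\<^sub>L \<Gamma>) o\<^sub>L \<Gamma>" by simp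
  then have eq: "s *\<^sub>C (mh \<mu> \<nu> o\<^sub>L \<beta> x) = \<beta> x o\<^sub>L mh \<mu> \<nu>"
    by (simp only: blinfun_compose_assoc \<Gamma>_\<Gamma> blinfun_compose_id)
  from False obtain k where k: "parity \<mu> + parity \<nu> = 2 * k + 1" by (blast elim: oddE)
  have "s ^ (parity \<mu> + parity \<nu>) = s" unfolding k power_add power_mult using s by (simp add: power2_eq_square)
  then show ?thesis unfolding eq[symmetric] by (simp add: scaleC_scaleC s)
qed

text \<open>A one-particle vector on the half line is its value at 0 plus a shifted vector on the
  half line. So the hypotheses put \<open>z\<close> into the commutant of the represented
  half-chain, and every element of \<open>M\<close> commutes with that commutant.\<close>

lemma commute_generators:
  assumes z: "z \<in> M" and 1: "\<And>\<mu> \<nu>. z o\<^sub>L mh \<mu> \<nu> = mh \<mu> \<nu> o\<^sub>L z"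
    and 2: "\<And>x. x \<in> M \<Longrightarrow> z o\<^sub>L \<beta> x = \<beta> x o\<^sub>L z" and x: "x \<in> M"
  shows "z o\<^sub>L x = x o\<^sub>L z"
proof -
  have delta: "z o\<^sub>L \<pi> A = \<pi> A o\<^sub>L z" if "A \<in> local_alg a {0}" for A
    by (subst (1 2) m_expand[OF that])
       (simp add: \<pi>_sum \<pi>_scaleC blinfun_compose_sum_left blinfun_compose_sum_right
         blinfun_compose_scaleC_right M_bounded_ops[OF z] 1[unfolded mh_def])
  have "z \<in> commutant (\<pi> ` right_alg a)"
  proof (rule in_commutant_right[OF M_bounded_ops[OF z]])
    fix f :: "int \<Rightarrow> 'd cvec" assume f: "f \<in> l2" "\<And>y. y < 0 \<Longrightarrow> f y = 0"
    define g where "g = (\<lambda>x. if x \<ge> 0 then f (x + 1) else 0)"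
    have g: "g \<in> l2"
      using l2_restrict[OF shift_l2[OF f(1), of "-1"], of "\<lambda>x. x \<ge> 0"] by (simp add: g_def shift_def cong: if_cong)
    have "a f = a (\<lambda>x. delta0 (f 0) x + shift 1 g x)"
      by (rule arg_cong[of _ _ a]) (use f(2) in \<open>auto simp: delta0_def shift_def g_def fun_eq_iff\<close>)
    also have "\<dots> = a (delta0 (f 0)) + \<tau> 1 (a g)"
      using g by (simp add: car_algebraD(1)[OF car] shift_l2 bogoliubovD(6)[OF shift_aut])
    finally have eq: "\<pi> (a f) = \<pi> (a (delta0 (f 0))) + \<beta> (\<pi> (a g))" by (simp add: \<pi>_add \<beta>)
    have ag: "\<pi> (a g) \<in> M" by (intro \<pi>_M right_alg_generator g) (simp add: g_def)
    then show "z o\<^sub>L \<pi> (a f) = \<pi> (a f) o\<^sub>L z"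
      by (simp add: eq blinfun_compose_add_left blinfun_compose_add_right 2 delta a_delta0_local)
    have "op_adj (\<pi> (a f)) = \<pi> (star (a (delta0 (f 0)))) + \<beta> (op_adj (\<pi> (a g)))"
      by (simp add: eq op_adj_add \<pi>_star \<beta>_hom(4)[symmetric] \<pi>_bounded_ops)
    then show "z o\<^sub>L op_adj (\<pi> (a f)) = op_adj (\<pi> (a f)) o\<^sub>L z"
      using ag by (simp add: blinfun_compose_add_left blinfun_compose_add_right 2 delta a_delta0_local local_alg_closed M_closed)
  qed
  from M_commute[OF x this] show ?thesis by simp
qed

text \<open>Despite the name, both terms may be present; each use removes one of the two by
  parity.\<close>

lemma center_scalar:
  assumes z: "z \<in> M" and comm: "\<And>x. x \<in> M \<Longrightarrow> z o\<^sub>L x = x o\<^sub>L z"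
  obtains c d where "\<iota> z = c *\<^sub>C id_blinfun + d *\<^sub>C flip_op"
proof (rule R1_center[OF \<iota>_R1[OF z]])
  fix b :: "'k \<Rightarrow>\<^sub>L 'k" assume b: "b \<in> bounded_ops"
  have "\<iota> (z o\<^sub>L j (amp b)) = \<iota> (j (amp b) o\<^sub>L z)" using b by (simp add: comm j_M)
  then show "\<iota> z o\<^sub>L amp b = amp b o\<^sub>L \<iota> z" using b by (simp add: \<iota>_hom(3) z j_M \<iota>_j)
qed (rule that)

text \<open>\<open>M\<close> contains the identity, nonzero because of the unit vector
  \<open>\<Omega>\<close>, and injectivity of \<open>\<iota>\<close> excludes K = 0.\<close>

lemma exists_unit_vector: obtains z :: 'k where "norm z = 1"
proof -
  have "\<exists>x::'k. x \<noteq> 0"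
  proof (rule ccontr)
    assume "\<not> ?thesis"
    then have "v = w" for v w :: "'k ^ 2" by (simp add: vec_eq_iff) metis
    then have "\<iota> id_blinfun = \<iota> 0" by (intro blinfun_eqI)
    then have "(id_blinfun :: 'h \<Rightarrow>\<^sub>L 'h) = 0" by (intro \<iota>_inj M_closed)
    from arg_cong[OF this, of "\<lambda>T. blinfun_apply T \<Omega>"] show False using norm_\<Omega> by auto
  qed
  then obtain x :: 'k where "x \<noteq> 0" by blast
  then show ?thesis using that[of "(1 / norm x) *\<^sub>R x"] by simp
qed

section \<open>The induced endomorphism and the reduced matrix units\<close>

definition \<rho> where "\<rho> y = \<iota> (\<beta> (j y))"

lemma \<rho>_R1: "y \<in> R1 \<Longrightarrow> \<rho> y \<in> R1"
  by (simp add: \<rho>_def \<iota>_R1 \<beta>_M j_M)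

lemma \<rho>_\<iota>: "x \<in> M \<Longrightarrow> \<rho> (\<iota> x) = \<iota> (\<beta> x)"
  by (simp add: \<rho>_def j_\<iota>)

lemma R1_via_\<iota>:
  assumes "y \<in> R1" obtains x where "x \<in> M" "y = \<iota> x"
  using assms \<iota>_j j_M by metis

lemma \<rho>_hom:
  shows "y \<in> R1 \<Longrightarrow> y' \<in> R1 \<Longrightarrow> \<rho> (y + y') = \<rho> y + \<rho> y'"
    and "y \<in> R1 \<Longrightarrow> \<rho> (c *\<^sub>C y) = c *\<^sub>C \<rho> y"
    and "y \<in> R1 \<Longrightarrow> y' \<in> R1 \<Longrightarrow> \<rho> (y o\<^sub>L y') = \<rho> y o\<^sub>L \<rho> y'"
    and "y \<in> R1 \<Longrightarrow> \<rho> (op_adj y) = op_adj (\<rho> y)"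
proof -
  show "y \<in> R1 \<Longrightarrow> y' \<in> R1 \<Longrightarrow> \<rho> (y + y') = \<rho> y + \<rho> y'"
    by (elim R1_via_\<iota>) (simp add: \<iota>_hom(1)[symmetric] \<rho>_\<iota> M_closed \<beta>_hom(1) M_bounded_ops \<beta>_M)
  show "y \<in> R1 \<Longrightarrow> y' \<in> R1 \<Longrightarrow> \<rho> (y o\<^sub>L y') = \<rho> y o\<^sub>L \<rho> y'"
    by (elim R1_via_\<iota>) (simp add: \<iota>_hom(3)[symmetric] \<rho>_\<iota> M_closed \<beta>_hom(3) M_bounded_ops \<beta>_M)
  show "y \<in> R1 \<Longrightarrow> \<rho> (c *\<^sub>C y) = c *\<^sub>C \<rho> y"
    by (elim R1_via_\<iota>) (simp add: \<iota>_hom(2)[symmetric] \<rho>_\<iota> M_closed \<beta>_hom(2) M_bounded_ops \<beta>_M)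
  show "y \<in> R1 \<Longrightarrow> \<rho> (op_adj y) = op_adj (\<rho> y)"
    by (elim R1_via_\<iota>) (simp add: \<iota>_hom(4)[symmetric] \<rho>_\<iota> M_closed \<beta>_hom(4) M_bounded_ops \<beta>_M)
qed

lemma \<rho>_zero_iff: "y \<in> R1 \<Longrightarrow> \<rho> y = 0 \<longleftrightarrow> y = 0"
proof (elim R1_via_\<iota>, safe)
  fix x assume x: "x \<in> M" and "\<rho> (\<iota> x) = 0"
  then have "\<iota> (\<beta> x) = \<iota> 0" by (simp add: \<rho>_\<iota> \<iota>_zero)
  then have "\<beta> x = 0" by (intro \<iota>_inj \<beta>_M M_closed x)
  then have "\<beta> x = \<beta> 0" using \<beta>_hom(2)[of 0 0] by simp
  then have "x = 0" using \<beta>_hom(5) M_bounded_ops[OF x] unfolding bij_betw_def inj_on_def by (metis bounded_ops_zero)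
  then show "\<iota> x = 0" by (simp add: \<iota>_zero)
next
  fix x assume "x \<in> M" "\<iota> x = 0"
  then show "\<rho> (\<iota> x) = 0" using \<rho>_hom(2)[OF \<iota>_R1, of x 0] by simp
qed

end

lemma compose_swap: "A o\<^sub>L B = C o\<^sub>L D \<Longrightarrow> A o\<^sub>L (B o\<^sub>L T) = C o\<^sub>L (D o\<^sub>L T)"
  by (simp flip: blinfun_compose_assoc)

context translation_rep
begin

definition f where
  "f \<mu> \<nu> = (SOME b. b \<in> bounded_ops \<and> \<iota> (mh \<mu> \<nu>) = amp b o\<^sub>L op_pow flip_op (parity \<mu> + parity \<nu>))"

lemma f: "f \<mu> \<nu> \<in> bounded_ops" "\<iota> (mh \<mu> \<nu>) = amp (f \<mu> \<nu>) o\<^sub>L op_pow flip_op (parity \<mu> + parity \<nu>)"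
proof -
  have ex: "\<exists>b. b \<in> bounded_ops \<and> \<iota> (mh \<mu> \<nu>) = amp b o\<^sub>L op_pow flip_op (parity \<mu> + parity \<nu>)"
  proof (cases "even (parity \<mu> + parity \<nu>)")
    case True
    then have "Ad grading_op (\<iota> (mh \<mu> \<nu>)) = \<iota> (mh \<mu> \<nu>)"
      using \<iota>_\<Gamma>[OF mh_M \<Gamma>_mh, of \<mu> \<nu>] by simp
    then obtain b where "b \<in> bounded_ops" "\<iota> (mh \<mu> \<nu>) = amp b"
      by (rule R1_even[OF \<iota>_R1[OF mh_M]])
    then show ?thesis using True by (auto simp: op_pow_flip)
  next
    case False
    then have "Ad grading_op (\<iota> (mh \<mu> \<nu>)) = - \<iota> (mh \<mu> \<nu>)"
      using \<iota>_\<Gamma>[OF mh_M \<Gamma>_mh, of \<mu> \<nu>] by simp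
    then obtain b where "b \<in> bounded_ops" "\<iota> (mh \<mu> \<nu>) = amp b o\<^sub>L flip_op"
      by (rule R1_odd[OF \<iota>_R1[OF mh_M]])
    then show ?thesis using False by (auto simp: op_pow_flip)
  qed
  show "f \<mu> \<nu> \<in> bounded_ops" "\<iota> (mh \<mu> \<nu>) = amp (f \<mu> \<nu>) o\<^sub>L op_pow flip_op (parity \<mu> + parity \<nu>)"
    using someI_ex[OF ex] unfolding f_def by blast+
qed

text \<open>Powers of \<open>flip_op\<close> commute with \<open>amp\<close> and count modulo 2, so
  in a product the parity of the inner index cancels and the matrix unit relations descend to
  \<open>f\<close>.\<close>

lemma f_mult: "f \<mu> \<nu> o\<^sub>L f \<mu>' \<nu>' = (if \<nu> = \<mu>' then f \<mu> \<nu>' else 0)"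
proof -
  have "\<iota> (mh \<mu> \<nu>) o\<^sub>L \<iota> (mh \<mu>' \<nu>') = \<iota> (if \<nu> = \<mu>' then mh \<mu> \<nu>' else 0)"
    by (simp add: \<iota>_hom(3)[symmetric] mh_M mh_mult)
  then have *: "amp (f \<mu> \<nu> o\<^sub>L f \<mu>' \<nu>') o\<^sub>L op_pow flip_op (parity \<mu> + parity \<nu> + (parity \<mu>' + parity \<nu>')) =
      \<iota> (if \<nu> = \<mu>' then mh \<mu> \<nu>' else 0)"
    unfolding f(2) amp_flip_pow_mult .
  show ?thesis
  proof (cases "\<nu> = \<mu>'")
    case True
    have "op_pow (flip_op :: ('k ^ 2) \<Rightarrow>\<^sub>L ('k ^ 2)) (parity \<mu> + parity \<nu> + (parity \<nu> + parity \<nu>')) = op_pow flip_op (parity \<mu> + parity \<nu>')"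
      by (rule op_pow_flip_cong) auto
    then show ?thesis using * True by (simp add: f(2) amp_flip_pow_eq)
  next
    case False
    with * have "amp (f \<mu> \<nu> o\<^sub>L f \<mu>' \<nu>') o\<^sub>L op_pow flip_op (parity \<mu> + parity \<nu> + (parity \<mu>' + parity \<nu>'))
       = amp 0 o\<^sub>L op_pow flip_op (parity \<mu> + parity \<nu> + (parity \<mu>' + parity \<nu>'))"
      by (simp add: \<iota>_zero)
    then show ?thesis unfolding amp_flip_pow_eq using False by simp
  qed
qed

lemma f_adj: "op_adj (f \<mu> \<nu>) = f \<nu> \<mu>"
proof -
  have "op_adj (\<iota> (mh \<mu> \<nu>)) = \<iota> (mh \<nu> \<mu>)" by (simp add: \<iota>_hom(4)[symmetric] mh_M mh_adj)
  then have "amp (op_adj (f \<mu> \<nu>)) o\<^sub>L op_pow flip_op (parity \<mu> + parity \<nu>) =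
      amp (f \<nu> \<mu>) o\<^sub>L op_pow flip_op (parity \<mu> + parity \<nu>)"
    unfolding f(2) by (simp add: op_pow_flip_amp add.commute)
  then show ?thesis by (simp only: amp_flip_pow_eq)
qed

lemma \<iota>_mh_diag: "\<iota> (mh \<mu> \<mu>) = amp (f \<mu> \<mu>)"
  by (simp add: f(2) op_pow_flip)

lemma f_sum: "(\<Sum>\<mu>\<in>UNIV. f \<mu> \<mu>) = id_blinfun"
proof -
  have "amp (\<Sum>\<mu>\<in>UNIV. f \<mu> \<mu>) = \<iota> (\<Sum>\<mu>\<in>UNIV. mh \<mu> \<mu>)"
    using \<iota>_sum[of UNIV "\<lambda>\<mu>. mh \<mu> \<mu>"] by (simp add: mh_M \<iota>_mh_diag amp_sum)
  also have "\<dots> = amp id_blinfun" by (simp add: mh_sum \<iota>_id)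
  finally show ?thesis by (simp only: amp_eq_iff)
qed

definition \<rho>\<^sub>0 where "\<rho>\<^sub>0 b = (SOME c. c \<in> bounded_ops \<and> \<rho> (amp b) = amp c)"

lemma \<rho>\<^sub>0:
  assumes b: "b \<in> bounded_ops"
  shows "\<rho>\<^sub>0 b \<in> bounded_ops" "\<rho> (amp b) = amp (\<rho>\<^sub>0 b)"
proof -
  have "\<Gamma> o\<^sub>L \<beta> (j (amp b)) = 1 *\<^sub>C (\<beta> (j (amp b)) o\<^sub>L \<Gamma>)"
    by (rule \<Gamma>_commute_\<beta>[OF M_bounded_ops[OF j_M] \<Gamma>_j_amp[OF b]]) (simp add: b)
  from \<iota>_\<Gamma>[OF \<beta>_M[OF j_M] this] have "Ad grading_op (\<rho> (amp b)) = \<rho> (amp b)"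
    using b by (simp add: \<rho>_def)
  then obtain c where "c \<in> bounded_ops" "\<rho> (amp b) = amp c"
    by (rule R1_even[OF \<rho>_R1[OF amp_R1[OF b]]])
  then have ex: "\<exists>c. c \<in> bounded_ops \<and> \<rho> (amp b) = amp c" by blast
  show "\<rho>\<^sub>0 b \<in> bounded_ops" "\<rho> (amp b) = amp (\<rho>\<^sub>0 b)"
    using someI_ex[OF ex] unfolding \<rho>\<^sub>0_def by blast+
qed

lemma \<rho>\<^sub>0_hom: "star_hom_on 0 (o\<^sub>L) op_adj (o\<^sub>L) op_adj bounded_ops \<rho>\<^sub>0"
  unfolding star_hom_on_def
proof (intro ballI allI conjI)
  fix b c :: "'k \<Rightarrow>\<^sub>L 'k" and r assume bc: "b \<in> bounded_ops" "c \<in> bounded_ops"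
  note simps = \<rho>_hom \<rho>\<^sub>0(2)[symmetric] bc
  have "amp (\<rho>\<^sub>0 (b + c)) = amp (\<rho>\<^sub>0 b + \<rho>\<^sub>0 c)" by (simp add: amp_add simps)
  then show "\<rho>\<^sub>0 (b + c) = \<rho>\<^sub>0 b + \<rho>\<^sub>0 c" by simp
  have "amp (\<rho>\<^sub>0 (r *\<^sub>C b)) = amp (r *\<^sub>C \<rho>\<^sub>0 b)" by (simp add: amp_scaleC simps)
  then show "\<rho>\<^sub>0 (r *\<^sub>C b) = conj_if 0 r *\<^sub>C \<rho>\<^sub>0 b" by (simp add: conj_if_def)
  have "amp (\<rho>\<^sub>0 (b o\<^sub>L c)) = amp (\<rho>\<^sub>0 b) o\<^sub>L amp (\<rho>\<^sub>0 c)"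
    by (simp only: \<rho>\<^sub>0(2)[symmetric] bc bounded_ops_compose \<rho>_hom(3)[symmetric] amp_R1 amp_compose)
  then show "\<rho>\<^sub>0 (b o\<^sub>L c) = \<rho>\<^sub>0 b o\<^sub>L \<rho>\<^sub>0 c" by simp
  have "amp (\<rho>\<^sub>0 (op_adj b)) = op_adj (amp (\<rho>\<^sub>0 b))"
    by (simp only: \<rho>\<^sub>0(2)[symmetric] bc bounded_ops_adj \<rho>_hom(4)[symmetric] amp_R1 op_adj_amp)
  then show "\<rho>\<^sub>0 (op_adj b) = op_adj (\<rho>\<^sub>0 b)" by simp
qed

text \<open>\<open>amp b\<close> is even, so the graded commutation carries no sign even for odd
  units, and the power of \<open>flip_op\<close> drops out on both sides.\<close>

lemma f_commute_\<rho>\<^sub>0: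
  assumes b: "b \<in> bounded_ops"
  shows "f \<mu> \<nu> o\<^sub>L \<rho>\<^sub>0 b = \<rho>\<^sub>0 b o\<^sub>L f \<mu> \<nu>"
proof -
  have "mh \<mu> \<nu> o\<^sub>L \<beta> (j (amp b)) = 1 ^ (parity \<mu> + parity \<nu>) *\<^sub>C (\<beta> (j (amp b)) o\<^sub>L mh \<mu> \<nu>)"
    by (rule mh_graded_commute_\<beta>[OF j_M \<Gamma>_j_amp[OF b]]) (simp_all add: b)
  from arg_cong[OF this, of \<iota>] have "\<iota> (mh \<mu> \<nu>) o\<^sub>L \<rho> (amp b) = \<rho> (amp b) o\<^sub>L \<iota> (mh \<mu> \<nu>)"
    using b by (simp add: \<iota>_hom(3) mh_M \<beta>_M j_M \<rho>_def)
  then have "(amp (f \<mu> \<nu>) o\<^sub>L op_pow flip_op (parity \<mu> + parity \<nu>)) o\<^sub>L (amp (\<rho>\<^sub>0 b) o\<^sub>L op_pow flip_op 0) =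
     (amp (\<rho>\<^sub>0 b) o\<^sub>L op_pow flip_op 0) o\<^sub>L (amp (f \<mu> \<nu>) o\<^sub>L op_pow flip_op (parity \<mu> + parity \<nu>))"
    by (simp add: f(2) \<rho>\<^sub>0(2)[OF b])
  then show ?thesis unfolding amp_flip_pow_mult by (simp add: amp_flip_pow_eq)
qed

text \<open>The represented one-site parity Gamma(-1).\<close>

definition gh where "gh = (\<Sum>\<mu>\<in>UNIV. (- 1) ^ parity \<mu> *\<^sub>C mh \<mu> \<mu>)"

lemma gh_M: "gh \<in> M"
  unfolding gh_def using \<iota>_sum[of UNIV "\<lambda>\<mu>. (- 1) ^ parity \<mu> *\<^sub>C mh \<mu> \<mu>"] by (simp add: M_closed mh_M)

lemma \<iota>_gh: "\<iota> gh = amp (\<Sum>\<mu>\<in>UNIV. (- 1) ^ parity \<mu> *\<^sub>C f \<mu> \<mu>)"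
  unfolding gh_def using \<iota>_sum[of UNIV "\<lambda>\<mu>. (- 1) ^ parity \<mu> *\<^sub>C mh \<mu> \<mu>"]
  by (simp add: M_closed mh_M \<iota>_hom(2) \<iota>_mh_diag amp_sum amp_scaleC)

lemma gh_mh: "gh o\<^sub>L mh \<mu> \<nu> = (- 1) ^ parity \<mu> *\<^sub>C mh \<mu> \<nu>" "mh \<mu> \<nu> o\<^sub>L gh = (- 1) ^ parity \<nu> *\<^sub>C mh \<mu> \<nu>"
proof -
  have "gh o\<^sub>L mh \<mu> \<nu> = (\<Sum>\<mu>'\<in>UNIV. if \<mu>' = \<mu> then (- 1) ^ parity \<mu> *\<^sub>C mh \<mu> \<nu> else 0)"
    unfolding gh_def blinfun_compose_sum_left by (intro sum.cong) (auto simp: mh_mult)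
  then show "gh o\<^sub>L mh \<mu> \<nu> = (- 1) ^ parity \<mu> *\<^sub>C mh \<mu> \<nu>" by simp
  have "mh \<mu> \<nu> o\<^sub>L gh = (\<Sum>\<mu>'\<in>UNIV. if \<mu>' = \<nu> then (- 1) ^ parity \<nu> *\<^sub>C mh \<mu> \<nu> else 0)"
    unfolding gh_def blinfun_compose_sum_right
    by (intro sum.cong) (auto simp: mh_mult blinfun_compose_scaleC_right mh_bounded_ops)
  then show "mh \<mu> \<nu> o\<^sub>L gh = (- 1) ^ parity \<nu> *\<^sub>C mh \<mu> \<nu>" by simp
qed

lemma gh_gh: "gh o\<^sub>L gh = id_blinfun"
proof -
  have "gh o\<^sub>L gh = (\<Sum>\<mu>\<in>UNIV. (- 1) ^ parity \<mu> *\<^sub>C (gh o\<^sub>L mh \<mu> \<mu>))"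
    by (subst (2) gh_def) (simp add: blinfun_compose_sum_right blinfun_compose_scaleC_right M_bounded_ops[OF gh_M])
  also have "\<dots> = (\<Sum>\<mu>\<in>UNIV. mh \<mu> \<mu>)"
    by (simp add: gh_mh scaleC_scaleC flip: power_mult_distrib)
  finally show ?thesis by (simp add: mh_sum)
qed

lemma gh_commute_\<beta>: "x \<in> M \<Longrightarrow> gh o\<^sub>L \<beta> x = \<beta> x o\<^sub>L gh"
  unfolding gh_def
  by (simp add: blinfun_compose_sum_left blinfun_compose_sum_right blinfun_compose_scaleC_right
      M_bounded_ops[OF \<beta>_M] mh_commute_\<beta>)

text \<open>\<open>\<beta>(j \<sigma>\<^sub>x) \<Gamma>(-1)\<close> is central and odd.\<close>

lemma \<rho>_flip: obtains s :: nat where "s \<in> {0, 1}" "\<rho> flip_op = (- 1) ^ s *\<^sub>C (\<iota> gh o\<^sub>L flip_op)"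
proof -
  define u where "u = j flip_op"
  have u: "u \<in> M" "\<iota> u = flip_op" by (simp_all add: u_def j_M \<iota>_j)
  have u_central: "u o\<^sub>L x = x o\<^sub>L u" if "x \<in> M" for x
    using that u by (intro \<iota>_inj M_closed) (simp_all add: \<iota>_hom(3) flip_commute_R1 \<iota>_R1)
  have uu: "u o\<^sub>L u = id_blinfun"
    using u by (intro \<iota>_inj M_closed) (simp_all add: \<iota>_hom(3) \<iota>_id)
  have \<Gamma>u: "\<Gamma> o\<^sub>L u = (- 1) *\<^sub>C (u o\<^sub>L \<Gamma>)"
    using \<Gamma>_j_flip[of id_blinfun] by (simp add: u_def)
  define z where "z = \<beta> u o\<^sub>L gh"
  have z: "z \<in> M" unfolding z_def by (intro M_closed \<beta>_M u gh_M)
  \<comment> \<open>Moving the odd \<open>\<beta> u\<close> past a matrix unit costs the sign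
    (-1)^(|\<mu>| + |\<nu>|); \<open>gh\<close> to the left and to the right of the unit differ by
    the same sign.\<close>
  have z_mh: "z o\<^sub>L mh \<mu> \<nu> = mh \<mu> \<nu> o\<^sub>L z" for \<mu> \<nu>
  proof -
    have "mh \<mu> \<nu> o\<^sub>L z = (mh \<mu> \<nu> o\<^sub>L \<beta> u) o\<^sub>L gh" by (simp add: z_def blinfun_compose_assoc)
    also have "\<dots> = (- 1) ^ (parity \<mu> + parity \<nu>) *\<^sub>C (\<beta> u o\<^sub>L (mh \<mu> \<nu> o\<^sub>L gh))"
      by (simp add: mh_graded_commute_\<beta>[OF u(1) \<Gamma>u] blinfun_compose_assoc)
    also have "\<dots> = (- 1) ^ parity \<mu> *\<^sub>C (\<beta> u o\<^sub>L mh \<mu> \<nu>)"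
      by (simp add: gh_mh blinfun_compose_scaleC_right M_bounded_ops[OF \<beta>_M[OF u(1)]] scaleC_scaleC power_add)
         (simp add: mult.assoc flip: power_mult_distrib)
    also have "\<dots> = z o\<^sub>L mh \<mu> \<nu>"
      by (simp add: z_def blinfun_compose_assoc gh_mh blinfun_compose_scaleC_right M_bounded_ops[OF \<beta>_M[OF u(1)]])
    finally show ?thesis by simp
  qed
  have z_\<beta>: "z o\<^sub>L \<beta> x = \<beta> x o\<^sub>L z" if x: "x \<in> M" for x
  proof -
    have "\<beta> u o\<^sub>L \<beta> x = \<beta> x o\<^sub>L \<beta> u"
      using x u(1) by (simp add: \<beta>_hom(3)[symmetric] M_bounded_ops u_central)
    then show ?thesis unfolding z_def using gh_commute_\<beta>[OF x] by (metis blinfun_compose_assoc)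
  qed
  obtain c d where cd: "\<iota> z = c *\<^sub>C id_blinfun + d *\<^sub>C flip_op"
    by (rule center_scalar[OF z commute_generators[OF z z_mh z_\<beta>]])
  have "\<Gamma> o\<^sub>L gh = gh o\<^sub>L \<Gamma>"
    by (simp add: gh_def blinfun_compose_sum_left blinfun_compose_sum_right blinfun_compose_scaleC_right \<Gamma>_bounded_ops \<Gamma>_mh)
  then have "\<Gamma> o\<^sub>L z = (- 1) *\<^sub>C (z o\<^sub>L \<Gamma>)"
    using \<Gamma>_commute_\<beta>[OF M_bounded_ops[OF u(1)] \<Gamma>u] unfolding z_def
    by (metis blinfun_compose_assoc blinfun_compose_scaleC_left)
  \<comment> \<open>Oddness removes the multiple of 1 from the central element.\<close>
  from \<iota>_\<Gamma>[OF z this] have odd: "Ad grading_op (\<iota> z) = - \<iota> z" by simp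
  have \<iota>z': "\<iota> z = amp (c *\<^sub>C id_blinfun) + (amp (d *\<^sub>C id_blinfun) o\<^sub>L flip_op)"
    by (simp add: cd amp_scaleC)
  have Ad_z: "Ad grading_op (\<iota> z) = amp (c *\<^sub>C id_blinfun) - (amp (d *\<^sub>C id_blinfun) o\<^sub>L flip_op)"
    unfolding \<iota>z' by (rule Ad_grading_R1)
  have eq: "amp (c *\<^sub>C (id_blinfun :: 'k \<Rightarrow>\<^sub>L 'k)) - (amp (d *\<^sub>C id_blinfun) o\<^sub>L flip_op) = - (amp (c *\<^sub>C id_blinfun) + (amp (d *\<^sub>C id_blinfun) o\<^sub>L flip_op))"
    unfolding \<iota>z'[symmetric] Ad_z[symmetric] by (rule odd)
  have "amp (c *\<^sub>C id_blinfun) + amp (c *\<^sub>C id_blinfun) = (0 :: ('k ^ 2) \<Rightarrow>\<^sub>L ('k ^ 2))"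
  proof -
    have "A + A = 0" if "A - D = - (A + D)" for A D :: "('k ^ 2) \<Rightarrow>\<^sub>L ('k ^ 2)"
    proof -
      have "A + A = (A - D) + (A + D)" by simp
      then show ?thesis unfolding that by (simp only: left_minus)
    qed
    from this[OF eq] show ?thesis .
  qed
  then have "amp ((2 * c) *\<^sub>C id_blinfun) + (amp 0 o\<^sub>L flip_op) = (0 :: ('k ^ 2) \<Rightarrow>\<^sub>L ('k ^ 2))"
    by (simp only: mult_2 scaleC_add_left amp_add amp_zero) simp
  then have "(2 * c) *\<^sub>C (id_blinfun :: 'k \<Rightarrow>\<^sub>L 'k) = 0" by (rule amp_flip_zero)
  moreover have id: "(id_blinfun :: 'k \<Rightarrow>\<^sub>L 'k) \<noteq> 0"
    by (metis exists_unit_vector id_apply id_blinfun.rep_eq norm_zero zero_blinfun.rep_eq zero_neq_one)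
  ultimately have "c = 0" by simp
  then have \<iota>z: "\<iota> z = d *\<^sub>C flip_op" using cd by simp
  \<comment> \<open>\<open>\<beta> u\<close> and \<open>gh\<close> are commuting involutions, so
    \<open>z\<close> is an involution as well: its coefficient squares to 1 and is the sign
    sought.\<close>
  have "z o\<^sub>L z = (\<beta> u o\<^sub>L \<beta> u) o\<^sub>L (gh o\<^sub>L gh)"
    unfolding z_def using gh_commute_\<beta>[OF u(1)] by (metis blinfun_compose_assoc)
  also have "\<dots> = id_blinfun"
    using op_star_iso_one[OF \<beta>_bounded_iso] by (simp add: gh_gh \<beta>_hom(3)[symmetric] M_bounded_ops u(1) uu)
  finally have "\<iota> z o\<^sub>L \<iota> z = id_blinfun" by (simp add: \<iota>_hom(3)[symmetric] z \<iota>_id)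
  then have "amp ((d * d) *\<^sub>C id_blinfun) = (amp id_blinfun :: ('k ^ 2) \<Rightarrow>\<^sub>L ('k ^ 2))"
    by (simp add: \<iota>z blinfun_compose_scaleC_right scaleC_scaleC amp_scaleC)
  then have "(d * d) *\<^sub>C (id_blinfun :: 'k \<Rightarrow>\<^sub>L 'k) = 1 *\<^sub>C id_blinfun" by (simp only: amp_eq_iff scaleC_one)
  then have "d * d = 1" using id by (simp add: scaleC_cancel_right del: scaleC_one)
  then have "d = 1 \<or> d = - 1" by (simp add: square_eq_1_iff)
  then obtain s :: nat where s: "s \<in> {0, 1}" "d = (- 1) ^ s"
    by (metis insertCI power_0 power_one_right)
  have "\<beta> u = z o\<^sub>L gh" by (simp add: z_def blinfun_compose_assoc gh_gh)
  then have "\<rho> flip_op = d *\<^sub>C (flip_op o\<^sub>L \<iota> gh)"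
    by (simp add: \<rho>_def u_def[symmetric] \<iota>_hom(3) z gh_M \<iota>z)
  then have "\<rho> flip_op = (- 1) ^ s *\<^sub>C (\<iota> gh o\<^sub>L flip_op)"
    by (simp add: s flip_commute_R1 \<iota>_R1 gh_M)
  with s(1) show ?thesis by (rule that)
qed

lemma isometries_exist:
  obtains S :: "'d set \<Rightarrow> ('k \<Rightarrow>\<^sub>L 'k)"
  where "\<And>\<mu>. S \<mu> \<in> bounded_ops"
    "\<And>\<mu> \<nu>. op_adj (S \<nu>) o\<^sub>L S \<mu> = (if \<mu> = \<nu> then id_blinfun else 0)"
    "(\<Sum>\<mu>\<in>UNIV. S \<mu> o\<^sub>L op_adj (S \<mu>)) = id_blinfun"
    "\<And>\<mu> \<nu>. f \<mu> \<nu> = S \<mu> o\<^sub>L op_adj (S \<nu>)"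
    "\<And>b \<mu>. b \<in> bounded_ops \<Longrightarrow> \<rho>\<^sub>0 b o\<^sub>L S \<mu> = S \<mu> o\<^sub>L b"
proof -
  obtain z :: 'k where z: "norm z = 1" by (rule exists_unit_vector)
  define k where "k = \<rho>\<^sub>0 (ketbra z z)"
  have "f {} {} o\<^sub>L k \<noteq> 0"
  proof
    assume 0: "f {} {} o\<^sub>L k = 0"
    \<comment> \<open>The diagonal units are equivalent through units that commute with
      \<open>k\<close>, so vanishing under one of them spreads to all, and they sum to 1.\<close>
    have "f \<mu> \<mu> o\<^sub>L k = 0" for \<mu>
    proof -
      have "f \<mu> \<mu> o\<^sub>L k = f \<mu> {} o\<^sub>L f {} {} o\<^sub>L (f {} \<mu> o\<^sub>L k)"
        by (simp add: f_mult flip: blinfun_compose_assoc)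
      also have "\<dots> = f \<mu> {} o\<^sub>L (f {} {} o\<^sub>L k) o\<^sub>L f {} \<mu>"
        unfolding k_def f_commute_\<rho>\<^sub>0[OF bounded_ops_ketbra, of "{}" \<mu>] by (simp only: blinfun_compose_assoc)
      finally show ?thesis unfolding 0 by (simp add: blinfun_eqI)
    qed
    then have "(\<Sum>\<mu>\<in>UNIV. f \<mu> \<mu>) o\<^sub>L k = 0" by (simp add: blinfun_compose_sum_left)
    then have "\<rho> (amp (ketbra z z)) = 0" by (simp add: f_sum \<rho>\<^sub>0(2) flip: k_def)
    then have "amp (ketbra z z) = amp 0" by (simp add: \<rho>_zero_iff)
    then have "ketbra z z = 0" by (simp only: amp_eq_iff)
    from arg_cong[OF this, of "\<lambda>T. blinfun_apply T z"] show False
      using z by (auto simp: ketbra.rep_eq cinner_self)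
  qed
  then obtain J where J: "is_isometry_intertwining \<rho>\<^sub>0 J" "\<And>x. f {} {} (J x) = J x"
    using intertwiner_exists[OF \<rho>\<^sub>0_hom \<rho>\<^sub>0(1), of "f {} {}" z] f_mult f_commute_\<rho>\<^sub>0 z unfolding k_def by metis
  have Jb: "J \<in> bounded_ops" using J(1) by (simp add: is_isometry_intertwining_def bounded_ops_def)
  have JJ: "op_adj J o\<^sub>L J = id_blinfun"
    by (rule blinfun_eqI, rule cinner_ext)
       (use J(1) in \<open>simp add: is_isometry_intertwining_def cinner_op_adj[OF Jb, symmetric]\<close>)
  have int: "\<rho>\<^sub>0 b o\<^sub>L J = J o\<^sub>L b" if "b \<in> bounded_ops" for b
    using J(1) that by (intro blinfun_eqI) (simp add: is_isometry_intertwining_def)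
  have fJ: "f {} {} o\<^sub>L J = J" by (rule blinfun_eqI) (simp add: J(2))
  define S where "S \<mu> = f \<mu> {} o\<^sub>L J" for \<mu>
  have S: "S \<mu> \<in> bounded_ops" for \<mu> by (simp add: S_def Jb f)
  have fS: "f \<mu> \<nu> o\<^sub>L S \<kappa>' = (if \<nu> = \<kappa>' then S \<mu> else 0)" for \<mu> \<nu> \<kappa>'
    unfolding S_def blinfun_compose_assoc[symmetric] f_mult by (auto intro: blinfun_eqI)
  have S_orth: "op_adj (S \<nu>) o\<^sub>L S \<mu> = (if \<mu> = \<nu> then id_blinfun else 0)" for \<mu> \<nu>
  proof -
    have "op_adj (S \<nu>) o\<^sub>L S \<mu> = op_adj J o\<^sub>L (f {} \<nu> o\<^sub>L S \<mu>)"
      by (simp add: S_def f_adj blinfun_compose_assoc)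
    also have "\<dots> = (if \<mu> = \<nu> then op_adj J o\<^sub>L S {} else 0)" by (auto simp: fS intro: blinfun_eqI)
    also have "S {} = J" by (simp add: S_def fJ)
    finally show ?thesis by (simp add: JJ)
  qed
  have S_int: "\<rho>\<^sub>0 b o\<^sub>L S \<mu> = S \<mu> o\<^sub>L b" if b: "b \<in> bounded_ops" for b \<mu>
    by (simp only: S_def blinfun_compose_assoc compose_swap[OF f_commute_\<rho>\<^sub>0[OF b, symmetric]] int[OF b])
  have \<rho>\<^sub>0_adj: "\<rho>\<^sub>0 (op_adj b) = op_adj (\<rho>\<^sub>0 b)" if "b \<in> bounded_ops" for b
    using \<rho>\<^sub>0_hom that by (simp add: star_hom_on_def)
  have S_int': "op_adj (S \<mu>) o\<^sub>L \<rho>\<^sub>0 b = b o\<^sub>L op_adj (S \<mu>)" if b: "b \<in> bounded_ops" for b \<mu>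
    using arg_cong[OF S_int[of "op_adj b" \<mu>], of op_adj] b by (simp add: \<rho>\<^sub>0_adj)
  define P where "P = (\<Sum>\<mu>\<in>UNIV. S \<mu> o\<^sub>L op_adj (S \<mu>))"
  have Pb: "P \<in> bounded_ops" by (simp add: P_def S)
  \<comment> \<open>Before \<open>P = 1\<close> is known, taking adjoints here shows that
    \<open>P\<close> commutes with \<open>f\<close>; afterwards it is the factorisation of
    \<open>f\<close>.\<close>
  have fP: "f \<mu> \<nu> o\<^sub>L P = S \<mu> o\<^sub>L op_adj (S \<nu>)" for \<mu> \<nu>
  proof -
    have "f \<mu> \<nu> o\<^sub>L P = (\<Sum>\<kappa>'\<in>UNIV. (f \<mu> \<nu> o\<^sub>L S \<kappa>') o\<^sub>L op_adj (S \<kappa>'))"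
      by (simp add: P_def blinfun_compose_sum_right blinfun_compose_assoc)
    also have "\<dots> = (\<Sum>\<kappa>'\<in>UNIV. if \<kappa>' = \<nu> then S \<mu> o\<^sub>L op_adj (S \<nu>) else 0)"
      by (intro sum.cong) (auto simp: fS intro: blinfun_eqI)
    finally show ?thesis by simp
  qed
  have P_adj: "op_adj P = P" by (simp add: P_def op_adj_sum)
  have Pf: "P o\<^sub>L f \<mu> \<nu> = f \<mu> \<nu> o\<^sub>L P" for \<mu> \<nu>
    unfolding fP using arg_cong[OF fP[of \<nu> \<mu>], of op_adj] by (simp only: op_adj_compose op_adj_op_adj P_adj f_adj)
  have P\<rho>\<^sub>0: "P o\<^sub>L \<rho>\<^sub>0 b = \<rho>\<^sub>0 b o\<^sub>L P" if b: "b \<in> bounded_ops" for b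
  proof -
    have "(S \<mu> o\<^sub>L op_adj (S \<mu>)) o\<^sub>L \<rho>\<^sub>0 b = \<rho>\<^sub>0 b o\<^sub>L (S \<mu> o\<^sub>L op_adj (S \<mu>))" for \<mu>
      by (simp only: blinfun_compose_assoc S_int'[OF b] compose_swap[OF S_int[OF b]])
    then show ?thesis by (simp add: P_def blinfun_compose_sum_left blinfun_compose_sum_right)
  qed
  obtain s where s: "\<rho> flip_op = (- 1) ^ s *\<^sub>C (\<iota> gh o\<^sub>L flip_op)" using \<rho>_flip by blast
  define p where "p = j (amp P)"
  have p: "p \<in> M" "\<iota> p = amp P" using Pb by (simp_all add: p_def j_M \<iota>_j)
  have p_mh: "p o\<^sub>L mh \<mu> \<nu> = mh \<mu> \<nu> o\<^sub>L p" for \<mu> \<nu>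
  proof (intro \<iota>_inj M_closed p mh_M)
    have "(amp P o\<^sub>L op_pow flip_op 0) o\<^sub>L \<iota> (mh \<mu> \<nu>) = \<iota> (mh \<mu> \<nu>) o\<^sub>L (amp P o\<^sub>L op_pow flip_op 0)"
      unfolding f(2) amp_flip_pow_mult by (simp add: Pf)
    then show "\<iota> (p o\<^sub>L mh \<mu> \<nu>) = \<iota> (mh \<mu> \<nu> o\<^sub>L p)" by (simp add: \<iota>_hom(3) p mh_M)
  qed
  have P_gh: "amp P o\<^sub>L \<iota> gh = \<iota> gh o\<^sub>L amp P"
    by (simp add: \<iota>_gh blinfun_compose_sum_left blinfun_compose_sum_right blinfun_compose_scaleC_right Pb Pf f amp_sum amp_scaleC)
  \<comment> \<open>\<open>\<rho> flip_op\<close> is built from the image of \<open>gh\<close> and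
    \<open>flip_op\<close>, and both commute with \<open>amp P\<close>. Since \<open>amp b\<close>
    and \<open>flip_op\<close> generate \<open>R1\<close>, all of its image under
    \<open>\<rho>\<close> is covered.\<close>
  have P_flip: "amp P o\<^sub>L \<rho> flip_op = \<rho> flip_op o\<^sub>L amp P"
    unfolding s using Pb
    by (simp add: blinfun_compose_scaleC_right blinfun_compose_assoc flip_amp compose_swap[OF P_gh])
  have P_amp: "amp P o\<^sub>L \<rho> (amp b) = \<rho> (amp b) o\<^sub>L amp P" if "b \<in> bounded_ops" for b
    using that by (simp add: \<rho>\<^sub>0(2) P\<rho>\<^sub>0)
  have p_\<beta>: "p o\<^sub>L \<beta> x = \<beta> x o\<^sub>L p" if x: "x \<in> M" for x
  proof (intro \<iota>_inj M_closed p \<beta>_M x)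
    obtain b c where bc: "b \<in> bounded_ops" "c \<in> bounded_ops" "\<iota> x = amp b + (amp c o\<^sub>L flip_op)"
      using \<iota>_R1[OF x] by (rule R1E)
    have "\<iota> (\<beta> x) = \<rho> (amp b) + (\<rho> (amp c) o\<^sub>L \<rho> flip_op)"
      using bc by (simp add: \<rho>_\<iota>[OF x, symmetric] \<rho>_hom)
    then have "amp P o\<^sub>L \<iota> (\<beta> x) = \<iota> (\<beta> x) o\<^sub>L amp P"
      by (simp only: blinfun_compose_add_left blinfun_compose_add_right P_amp[OF bc(1)] blinfun_compose_assoc
          compose_swap[OF P_amp[OF bc(2)]] P_flip)
    then show "\<iota> (p o\<^sub>L \<beta> x) = \<iota> (\<beta> x o\<^sub>L p)" by (simp add: \<iota>_hom(3) p x \<beta>_M)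
  qed
  obtain c d where "\<iota> p = c *\<^sub>C id_blinfun + d *\<^sub>C flip_op"
    by (rule center_scalar[OF p(1) commute_generators[OF p(1) p_mh p_\<beta>]])
  \<comment> \<open>\<open>amp P\<close> has no \<open>flip_op\<close> component, so the comparison
    of components leaves a scalar.\<close>
  then have "amp (P - c *\<^sub>C id_blinfun) + (amp (- (d *\<^sub>C id_blinfun)) o\<^sub>L flip_op) = 0"
    using amp_add[of "P - c *\<^sub>C id_blinfun" "c *\<^sub>C id_blinfun"] by (simp add: p amp_minus amp_scaleC)
  then have "P - c *\<^sub>C id_blinfun = 0" by (rule amp_flip_zero)
  then have Pc: "P = c *\<^sub>C id_blinfun" by simp
  \<comment> \<open>The scalar is identified as 1 by evaluation on one of the isometries.\<close>
  have "P o\<^sub>L S {} = (\<Sum>\<mu>\<in>(UNIV :: 'd set set). if \<mu> = {} then S {} else 0)"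
    unfolding P_def blinfun_compose_sum_left blinfun_compose_assoc
    by (intro sum.cong) (auto simp: S_orth intro: blinfun_eqI)
  then have "c *\<^sub>C S {} = 1 *\<^sub>C S {}" by (simp add: Pc)
  moreover have "S {} \<noteq> 0"
  proof
    assume "S {} = 0"
    with S_orth[of "{}" "{}"] have "id_blinfun z = (0 :: 'k)" by (metis blinfun_apply_blinfun_compose blinfun.zero_left blinfun.zero_right)
    then show False using z by simp
  qed
  ultimately have "c = 1" by (simp add: scaleC_cancel_right del: scaleC_one)
  then have P1: "P = id_blinfun" using Pc by simp
  show ?thesis
    by (rule that[OF S S_orth _ _ S_int]) (use P1 fP in \<open>simp_all add: P_def\<close>)
qed

end

section \<open>Convergence to the state\<close>

lemma tendsto_zero_approx:
  fixes f :: "nat \<Rightarrow> 'a::real_normed_vector"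
  assumes "\<And>e. 0 < e \<Longrightarrow> \<exists>g. g \<longlonglongrightarrow> 0 \<and> (\<forall>n. norm (f n - g n) \<le> e)"
  shows "f \<longlonglongrightarrow> 0"
proof (rule tendstoI)
  fix e :: real assume e: "0 < e"
  then obtain g where g: "g \<longlonglongrightarrow> 0" "\<And>n. norm (f n - g n) \<le> e / 2"
    using assms[of "e / 2"] by auto
  have "\<forall>\<^sub>F n in sequentially. dist (g n) 0 < e / 2" using e g(1) by (intro tendstoD) auto
  then show "\<forall>\<^sub>F n in sequentially. dist (f n) 0 < e"
  proof eventually_elim
    case (elim n)
    have "norm (f n) \<le> norm (f n - g n) + norm (g n)" by (metis norm_triangle_sub add.commute)
    then show ?case using elim g(2)[of n] by simp
  qed
qed

text \<open>Dominated convergence for series (Tannery). The bound is put on the forms because for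
  operators on \<open>'k ^ 2\<close> the estimates come componentwise.\<close>

lemma sigma_weak_limI:
  fixes X :: "nat \<Rightarrow> ('h::complex_hilbert \<Rightarrow>\<^sub>L 'h)" and L :: "'h \<Rightarrow>\<^sub>L 'h"
  assumes bound: "\<And>n \<xi> \<eta>. cmod (cinner \<xi> (X n \<eta>)) \<le> C * (norm \<xi> * norm \<eta>)"
    and lim: "\<And>\<xi> \<eta>. (\<lambda>n. cinner \<xi> (X n \<eta>)) \<longlonglongrightarrow> cinner \<xi> (L \<eta>)"
  shows "sigma_weak_lim X L"
  unfolding sigma_weak_lim_def
proof (intro allI impI)
  fix \<xi> \<eta> :: "nat \<Rightarrow> 'h"
  assume sum: "summable (\<lambda>i. (norm (\<xi> i))\<^sup>2)" "summable (\<lambda>i. (norm (\<eta> i))\<^sup>2)"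
  have "summable (\<lambda>i. norm (\<xi> i) * norm (\<eta> i))"
  proof (rule summable_comparison_test)
    show "summable (\<lambda>i. (norm (\<xi> i))\<^sup>2 + (norm (\<eta> i))\<^sup>2)" by (rule summable_add[OF sum])
    show "\<exists>N. \<forall>n\<ge>N. norm (norm (\<xi> n) * norm (\<eta> n)) \<le> (norm (\<xi> n))\<^sup>2 + (norm (\<eta> n))\<^sup>2"
    proof (intro exI allI impI)
      fix n
      have "0 \<le> norm (\<xi> n) * norm (\<eta> n)" by simp
      then show "norm (norm (\<xi> n) * norm (\<eta> n)) \<le> (norm (\<xi> n))\<^sup>2 + (norm (\<eta> n))\<^sup>2"
        using sum_squares_bound[of "norm (\<xi> n)" "norm (\<eta> n)"]
          unfolding real_norm_def abs_of_nonneg[OF \<open>0 \<le> norm (\<xi> n) * norm (\<eta> n)\<close>] mult.assoc by linarith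
    qed
  qed
  then have S: "summable (\<lambda>i. C * (norm (\<xi> i) * norm (\<eta> i)))" by (rule summable_mult)
  show "(\<lambda>n. \<Sum>i. cinner (\<xi> i) (X n (\<eta> i))) \<longlonglongrightarrow> (\<Sum>i. cinner (\<xi> i) (L (\<eta> i)))"
    by (rule tannerys_theorem[OF lim _ S, THEN conjunct2, THEN conjunct2]) (auto simp: bound intro!: always_eventually)
qed

lemma norm_op_adj_le: "norm (op_adj T) \<le> norm T"
proof (rule norm_blinfun_bound)
  fix v
  have "(norm (op_adj T v))\<^sup>2 = inner (T (op_adj T v)) v"
    by (simp add: inner_op_adj power2_norm_eq_inner)
  also have "\<dots> \<le> norm (T (op_adj T v)) * norm v" by (rule norm_cauchy_schwarz)
  also have "\<dots> \<le> norm T * norm (op_adj T v) * norm v" by (intro mult_right_mono norm_blinfun) simp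
  finally show "norm (op_adj T v) \<le> norm T * norm v"
    by (cases "op_adj T v = 0") (auto simp: power2_eq_square algebra_simps)
qed simp

lemma l2_tail:
  assumes f: "f \<in> l2" and e: "0 < e"
  obtains n where "Re (l2_inner (\<lambda>x. if x < int n then 0 else f x) (\<lambda>x. if x < int n then 0 else f x)) \<le> e"
proof -
  define q where "q x = (norm (f x))\<^sup>2" for x
  have q: "q summable_on UNIV" "\<And>x. 0 \<le> q x" using f by (auto simp: q_def[abs_def] l2_def)
  obtain F where F: "finite F" "dist (sum q F) (infsum q UNIV) \<le> e"
    using has_sum_finite_approximation[OF has_sum_infsum[OF q(1)] e] by auto
  obtain n where n: "\<And>x. x \<in> F \<Longrightarrow> x < int n"
  proof -
    have "x < int (nat (Max F + 1))" if "x \<in> F" for x using Max_ge[OF F(1) that] by linarith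
    then show ?thesis using that by blast
  qed
  define h where "h x = (if x < int n then 0 else f x)" for x
  have q': "(\<lambda>x. if x < int n then 0 else q x) summable_on UNIV"
    by (rule summable_on_comparison_test[OF q(1)]) (use q(2) in auto)
  have "l2_inner h h = (\<Sum>\<^sub>\<infinity>x. of_real (if x < int n then 0 else q x))"
    unfolding l2_inner_def by (intro infsum_cong) (simp add: h_def q_def cinner_self)
  also have "\<dots> = of_real (\<Sum>\<^sub>\<infinity>x. if x < int n then 0 else q x)" 
    by (intro infsumI has_sum_bounded_linear[OF bounded_linear_of_real] has_sum_infsum q')
  finally have eq: "Re (l2_inner h h) = (\<Sum>\<^sub>\<infinity>x. if x < int n then 0 else q x)" by simp
  have "(\<Sum>\<^sub>\<infinity>x. if x < int n then 0 else q x) \<le> (\<Sum>\<^sub>\<infinity>x\<in>-F. q x)"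
  proof (rule infsum_mono_neutral)
    show "(\<lambda>x. if x < int n then 0 else q x) summable_on UNIV" by (rule q')
    show "q summable_on - F" using q(1) by (rule summable_on_subset_banach) simp
  qed (use n q(2) in auto)
  also have "\<dots> = infsum q UNIV - sum q F"
    using infsum_Diff[OF q(1) summable_on_finite[OF F(1)] subset_UNIV] F(1) by (simp add: Compl_eq_Diff_UNIV)
  also have "\<dots> \<le> e" using F(2) by (simp add: dist_real_def)
  finally show ?thesis using that[of n] eq by (simp add: h_def[abs_def])
qed

context translation_rep
begin

text \<open>By the anticommutation relation the squared norms of the images of \<open>v\<close>
  under the annihilator and its adjoint add up to \<open>l2_inner h h\<close> times the squared norm
  of \<open>v\<close>.\<close>

lemma norm_\<pi>_a_le:
  assumes h: "h \<in> l2" "Re (l2_inner h h) \<le> r\<^sup>2" "0 \<le> r"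
  shows "norm (\<pi> (a h)) \<le> r"
proof (rule norm_blinfun_bound[OF h(3)])
  fix v
  have "\<pi> (a h * star (a h) + star (a h) * a h) = \<pi> (l2_inner h h *\<^sub>C 1)"
    using car_algebraD(3)[OF car h(1) h(1)] by simp
  then have "(\<pi> (a h) o\<^sub>L op_adj (\<pi> (a h))) + (op_adj (\<pi> (a h)) o\<^sub>L \<pi> (a h)) = l2_inner h h *\<^sub>C id_blinfun"
    by (simp add: \<pi>_add \<pi>_mult \<pi>_star \<pi>_scaleC \<pi>_one)
  from arg_cong[OF this, of "\<lambda>T. Re (cinner v (blinfun_apply T v))"]
  have "(norm (op_adj (\<pi> (a h)) v))\<^sup>2 + (norm (\<pi> (a h) v))\<^sup>2 = Re (l2_inner h h) * (norm v)\<^sup>2"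
    by (simp add: blinfun.add_left cinner_add_right scaleC_blinfun.rep_eq cinner_scaleC_right
        cinner_op_adj'[OF \<pi>_bounded_ops] cinner_op_adj[OF \<pi>_bounded_ops, symmetric] cinner_self)
  also have "\<dots> \<le> r\<^sup>2 * (norm v)\<^sup>2" by (intro mult_right_mono h) simp
  finally have "(norm (\<pi> (a h) v))\<^sup>2 \<le> (r * norm v)\<^sup>2"
    using zero_le_power2[of "norm (op_adj (\<pi> (a h)) v)"] by (simp only: power_mult_distrib)
  then show "norm (\<pi> (a h) v) \<le> r * norm v" using h(3) by (simp add: power2_le_iff_abs_le)
qed

lemma norm_\<beta>_power_le: "T \<in> bounded_ops \<Longrightarrow> norm ((\<beta> ^^ n) T) \<le> norm T"
proof (rule norm_blinfun_bound)
  fix v assume T: "T \<in> bounded_ops"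
  define V where "V = op_pow W n"
  have V: "is_unitary V" unfolding V_def by (rule is_unitary_op_pow[OF W_unitary])
  have "norm ((\<beta> ^^ n) T v) = norm (T (op_adj V v))"
    by (simp add: \<beta>_power_spatial[OF T] V_def[symmetric] norm_isometry[OF is_unitaryD(2)[OF V]])
  also have "\<dots> \<le> norm T * norm (op_adj V v)" by (rule norm_blinfun)
  also have "norm (op_adj V v) = norm v"
    by (rule norm_isometry) (simp add: is_unitaryD(3)[OF V])
  finally show "norm ((\<beta> ^^ n) T v) \<le> norm T * norm v" .
qed simp

definition comm where "comm z A n = (\<pi> A o\<^sub>L (\<beta> ^^ n) z) - ((\<beta> ^^ n) z o\<^sub>L \<pi> A)"

lemma comm_add: "comm z (A + B) n = comm z A n + comm z B n"
  by (simp add: comm_def \<pi>_add blinfun_compose_add_left blinfun_compose_add_right)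

lemma comm_minus: "comm z (- A) n = - comm z A n"
  by (simp add: comm_def \<pi>_minus)

lemma norm_comm_le:
  assumes "z \<in> bounded_ops"
  shows "norm (comm z A n) \<le> 2 * norm (\<pi> A) * norm z"
proof -
  have "norm (comm z A n) \<le> norm (\<pi> A o\<^sub>L (\<beta> ^^ n) z) + norm ((\<beta> ^^ n) z o\<^sub>L \<pi> A)"
    unfolding comm_def by (rule norm_triangle_ineq4)
  also have "\<dots> \<le> norm (\<pi> A) * norm ((\<beta> ^^ n) z) + norm ((\<beta> ^^ n) z) * norm (\<pi> A)"
    by (intro add_mono norm_blinfun_compose)
  also have "\<dots> \<le> norm (\<pi> A) * norm z + norm z * norm (\<pi> A)"
    by (intro add_mono mult_left_mono mult_right_mono norm_\<beta>_power_le assms) simp_all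
  finally show ?thesis by (simp add: mult_ac)
qed

text \<open>For a generator supported below n the commutator vanishes exactly: translated back by n
  it lives on the left half line. Cutting an arbitrary vector far out leaves a tail whose commutator
  is small uniformly in n, and products and norm limits follow. \<open>z\<close> is any bounded
  operator, so \<open>x \<Gamma>\<close> with odd \<open>x\<close> is included.\<close>

lemma asymptotically_commute:
  assumes z: "z \<in> bounded_ops"
    and gen: "\<And>f. f \<in> l2 \<Longrightarrow> (\<And>y. 0 \<le> y \<Longrightarrow> f y = 0) \<Longrightarrow> z o\<^sub>L \<pi> (a f) = \<pi> (a f) o\<^sub>L z"
      "\<And>f. f \<in> l2 \<Longrightarrow> (\<And>y. 0 \<le> y \<Longrightarrow> f y = 0) \<Longrightarrow> z o\<^sub>L op_adj (\<pi> (a f)) = op_adj (\<pi> (a f)) o\<^sub>L z"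
  shows "comm z A \<longlonglongrightarrow> 0"
proof -
  have nz: "norm z + 1 \<noteq> 0" using norm_ge_zero[of z] by linarith
  have cancel: "2 * (r / (2 * c)) * c = r" if "c \<noteq> 0" for r c :: real using that by simp
  define D where "D = {A. comm z A \<longlonglongrightarrow> 0 \<and> comm z (star A) \<longlonglongrightarrow> 0}"
  have local: "comm z (a g) n = 0 \<and> comm z (star (a g)) n = 0"
    if g: "g \<in> l2" "\<And>y. int n \<le> y \<Longrightarrow> g y = 0" for g :: "int \<Rightarrow> 'd cvec" and n
  proof -
    define h where "h = shift (- int n) g"
    have h: "h \<in> l2" "\<And>y. 0 \<le> y \<Longrightarrow> h y = 0" "g = shift (int n) h"
      using g by (auto simp: h_def shift_l2 shift_shift) (auto simp: shift_def)
    have "\<pi> (a g) = (\<beta> ^^ n) (\<pi> (a h))" by (simp add: \<beta>_power_\<pi> \<tau>_power_a h)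
    moreover have "\<pi> (star (a g)) = (\<beta> ^^ n) (op_adj (\<pi> (a h)))"
      unfolding \<pi>_star calculation using is_unitaryD(1)[OF is_unitary_op_pow[OF W_unitary]]
      by (simp add: \<beta>_power_spatial \<pi>_bounded_ops blinfun_compose_assoc)
    ultimately show ?thesis
      using gen[OF h(1)] h(2) z by (simp add: comm_def \<pi>_bounded_ops flip: \<beta>_power_mult)
  qed
  have small: "2 * norm (\<pi> B) * norm z \<le> e" if "norm (\<pi> B) \<le> e / (2 * (norm z + 1))" "0 < e" for B e
  proof -
    have "2 * norm (\<pi> B) * norm z \<le> 2 * (e / (2 * (norm z + 1))) * (norm z + 1)"
      using that by (intro mult_mono) (auto intro!: divide_nonneg_nonneg)
    also have "\<dots> = e" by (rule cancel[OF nz])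
    finally show ?thesis .
  qed
  have "A \<in> local_alg a UNIV" using car by (simp add: car_algebra_def)
  then have "A \<in> D"
  proof (rule local_alg_induct)
    fix f :: "int \<Rightarrow> 'd cvec" assume f: "f \<in> l2"
    \<comment> \<open>Cut at a site beyond which the l2 mass of \<open>f\<close> is at most the
      square of \<open>e\<close>; the annihilator of the remainder then has norm at most
      \<open>e\<close>.\<close>
    have tail: "\<exists>g k. a f = a g + a k \<and> comm z (a g) \<longlonglongrightarrow> 0 \<and> comm z (star (a g)) \<longlonglongrightarrow> 0 \<and>
        norm (\<pi> (a k)) \<le> e \<and> norm (\<pi> (star (a k))) \<le> e" if e: "0 < e" for e
    proof -
      define k where "k n = (\<lambda>x. if x < int n then 0 else f x)" for n
      obtain n where n: "Re (l2_inner (k n) (k n)) \<le> e\<^sup>2"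
        using l2_tail[OF f, of "e\<^sup>2"] e unfolding k_def by auto
      define g where "g = (\<lambda>x. if x < int n then f x else 0)"
      have "k n = (\<lambda>x. if int n \<le> x then f x else 0)" by (auto simp: k_def fun_eq_iff)
      then have l2: "g \<in> l2" "k n \<in> l2"
        using l2_restrict[OF f, of "\<lambda>x. x < int n"] l2_restrict[OF f, of "\<lambda>x. int n \<le> x"]
        by (simp_all add: g_def)
      have "a f = a (\<lambda>x. g x + k n x)" by (rule arg_cong[of _ _ a]) (auto simp: g_def k_def)
      then have split: "a f = a g + a (k n)" using l2 by (simp add: car_algebraD(1)[OF car])
      have "comm z (a g) i = 0 \<and> comm z (star (a g)) i = 0" if "n \<le> i" for i
        by (rule local[OF l2(1)]) (use that in \<open>auto simp: g_def\<close>)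
      then have "comm z (a g) \<longlonglongrightarrow> 0" "comm z (star (a g)) \<longlonglongrightarrow> 0"
        by (auto intro!: tendsto_eventually eventually_sequentiallyI[of n])
      moreover have "norm (\<pi> (a (k n))) \<le> e" using norm_\<pi>_a_le[OF l2(2) n] e by simp
      moreover from this have "norm (\<pi> (star (a (k n)))) \<le> e"
        using norm_op_adj_le[of "\<pi> (a (k n))"] by (simp add: \<pi>_star)
      ultimately show ?thesis using split by blast
    qed
    have "comm z (a f) \<longlonglongrightarrow> 0"
    proof (rule tendsto_zero_approx)
      fix e :: real assume e: "0 < e"
      then have "0 < e / (2 * (norm z + 1))" by (simp add: add_nonneg_pos)
      from tail[OF this] obtain g k where gk: "a f = a g + a k" "comm z (a g) \<longlonglongrightarrow> 0" "norm (\<pi> (a k)) \<le> e / (2 * (norm z + 1))"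
        by blast
      have "norm (comm z (a f) n - comm z (a g) n) \<le> e" for n
        using norm_comm_le[OF z, of "a k" n] small[OF gk(3) e] by (simp add: gk(1) comm_add)
      then show "\<exists>g. g \<longlonglongrightarrow> 0 \<and> (\<forall>n. norm (comm z (a f) n - g n) \<le> e)" using gk(2) by blast
    qed
    moreover have "comm z (star (a f)) \<longlonglongrightarrow> 0"
    proof (rule tendsto_zero_approx)
      fix e :: real assume e: "0 < e"
      then have "0 < e / (2 * (norm z + 1))" by (simp add: add_nonneg_pos)
      from tail[OF this] obtain g k where gk: "a f = a g + a k" "comm z (star (a g)) \<longlonglongrightarrow> 0" "norm (\<pi> (star (a k))) \<le> e / (2 * (norm z + 1))"
        by blast
      have "norm (comm z (star (a f)) n - comm z (star (a g)) n) \<le> e" for n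
        using norm_comm_le[OF z, of "star (a k)" n] small[OF gk(3) e] by (simp add: gk(1) star_add comm_add)
      then show "\<exists>g. g \<longlonglongrightarrow> 0 \<and> (\<forall>n. norm (comm z (star (a f)) n - g n) \<le> e)" using gk(2) by blast
    qed
    ultimately show "a f \<in> D" by (simp add: D_def)
  next
    have mult: "comm z (A * B) \<longlonglongrightarrow> 0" if "comm z A \<longlonglongrightarrow> 0" "comm z B \<longlonglongrightarrow> 0" for A B
    proof -
      have "comm z (A * B) = (\<lambda>n. (comm z A n o\<^sub>L \<pi> B) + (\<pi> A o\<^sub>L comm z B n))"
        by (rule ext) (simp add: comm_def \<pi>_mult blinfun_compose_diff_left blinfun_compose_diff_right blinfun_compose_assoc)
      moreover have "\<dots> \<longlonglongrightarrow> (0 o\<^sub>L \<pi> B) + (\<pi> A o\<^sub>L 0)"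
        by (intro tendsto_add bounded_bilinear.tendsto[OF bounded_bilinear_blinfun_compose] that tendsto_const)
      ultimately show ?thesis by simp
    qed
    have add: "comm z (A + B) \<longlonglongrightarrow> 0" if "comm z A \<longlonglongrightarrow> 0" "comm z B \<longlonglongrightarrow> 0" for A B
      using tendsto_add[OF that] by (simp add: comm_add[abs_def])
    have scale: "comm z (c *\<^sub>C A) \<longlonglongrightarrow> 0" if "comm z A \<longlonglongrightarrow> 0" for A c
    proof -
      have "comm z (c *\<^sub>C A) = (\<lambda>n. c *\<^sub>C comm z A n)"
        by (rule ext) (simp add: comm_def \<pi>_scaleC blinfun_compose_scaleC_right \<beta>_power_bounded_ops z scaleC_diff_right)
      then show ?thesis using bounded_linear.tendsto[OF bounded_linear_scaleC that, of c] by simp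
    qed
    have "closed D"
    proof -
      have close: "comm z A \<longlonglongrightarrow> 0" if "\<And>e. 0 < e \<Longrightarrow> \<exists>B. comm z B \<longlonglongrightarrow> 0 \<and> norm (A - B) < e" for A
      proof (rule tendsto_zero_approx)
        fix e :: real assume e: "0 < e"
        then have "0 < e / (2 * (norm z + 1))" by (simp add: add_nonneg_pos)
        from that[OF this] obtain B where B: "comm z B \<longlonglongrightarrow> 0" "norm (A - B) < e / (2 * (norm z + 1))" by blast
        have "norm (comm z A n - comm z B n) \<le> e" for n
        proof -
          have "comm z A n - comm z B n = comm z (A - B) n"
            using comm_add[of z A "- B" n] by (simp add: comm_minus)
          then have "norm (comm z A n - comm z B n) \<le> 2 * norm (\<pi> (A - B)) * norm z"
            using norm_comm_le[OF z] by simp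
          also have "\<dots> \<le> e"
            by (rule small[OF _ e]) (use B(2) norm_unital_rep_le[OF rep, of "A - B"] in linarith)
          finally show ?thesis .
        qed
        then show "\<exists>g. g \<longlonglongrightarrow> 0 \<and> (\<forall>n. norm (comm z A n - g n) \<le> e)" using B(1) by blast
      qed
      have "closure D \<subseteq> D"
      proof
        fix A assume "A \<in> closure D"
        then have ap: "\<exists>B\<in>D. norm (A - B) < e" if "0 < e" for e
          using that by (metis closure_approachable dist_norm norm_minus_commute)
        have "comm z A \<longlonglongrightarrow> 0" by (rule close) (use ap in \<open>auto simp: D_def\<close>)
        moreover have "comm z (star A) \<longlonglongrightarrow> 0"
        proof (rule close)
          fix e :: real assume "0 < e"
          then obtain B where B: "B \<in> D" "norm (A - B) < e" using ap by blast
          have "star A - star B = star (A - B)" using star_add[of A "- B"] by simp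
          then have "norm (star A - star B) < e" using B(2) by simp
          then show "\<exists>B. comm z B \<longlonglongrightarrow> 0 \<and> norm (star A - B) < e" using B(1) by (auto simp: D_def)
        qed
        ultimately show "A \<in> D" by (simp add: D_def)
      qed
      then show ?thesis using closure_subset[of D] closed_closure[of D] by (metis subset_antisym)
    qed
    moreover have "comm z 1 = (\<lambda>n. 0)" by (rule ext) (simp add: comm_def \<pi>_one)
    ultimately show "cstar_subalgebra D"
      unfolding cstar_subalgebra_def by (auto simp: D_def star_add star_mult star_scaleC star_star mult add scale)
  qed
  then show ?thesis by (simp add: D_def)
qed

text \<open>The vector states of \<open>\<Omega>\<close> and \<open>W* \<Omega>\<close> agree on the irreducible \<open>\<pi>(A)\<close>.\<close>

lemma W_adj_\<Omega>: obtains c where "cmod c = 1" "op_adj W \<Omega> = c *\<^sub>C \<Omega>"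
proof -
  define \<xi> where "\<xi> = op_adj W \<Omega>"
  note Wb = is_unitaryD(1)[OF W_unitary]
  have n\<xi>: "norm \<xi> = 1"
    using norm_isometry[of "op_adj W" \<Omega>] is_unitaryD(3)[OF W_unitary] norm_\<Omega> by (simp add: \<xi>_def)
  have state: "cinner \<xi> (\<pi> A \<xi>) = cinner \<Omega> (\<pi> A \<Omega>)" for A
  proof -
    have "cinner \<Omega> (\<beta> (\<pi> A) \<Omega>) = cinner \<Omega> (\<pi> A \<Omega>)"
      using translation_invariant[of 1 A] by (simp add: \<beta> gns_state[OF gns])
    then show ?thesis
      by (simp add: \<beta>_spatial[OF \<pi>_bounded_ops] \<xi>_def cinner_op_adj'[OF Wb])
  qed
  define c where "c = cinner \<Omega> \<xi>"
  \<comment> \<open>With \<pi>(A) \<Omega> near \<Omega> and the adjoint of \<pi>(A) sending \<xi>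
    near c \<Omega>, the two equal expectations of \<pi>(A) are near 1 and near |c|^2.\<close>
  have bnd: "cmod (1 - cnj c * c) \<le> 2 * e" if e: "0 < e" for e
  proof -
    obtain A where A: "norm (\<pi> A \<Omega> - \<Omega>) < e" "norm (op_adj (\<pi> A) \<xi> - c *\<^sub>C \<Omega>) < e"
      using approximation[OF e, of \<Omega> \<xi>] by (auto simp: c_def)
    have "1 - cnj c * c = (cinner (op_adj (\<pi> A) \<xi>) \<xi> - cnj c * c) - (cinner \<Omega> (\<pi> A \<Omega>) - 1)"
      using state[of A] by (simp add: cinner_op_adj'[OF \<pi>_bounded_ops])
    also have "\<dots> = cinner (op_adj (\<pi> A) \<xi> - c *\<^sub>C \<Omega>) \<xi> - cinner \<Omega> (\<pi> A \<Omega> - \<Omega>)"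
      by (simp add: cinner_diff_left cinner_diff_right cinner_scaleC_left cinner_self norm_\<Omega> c_def)
    finally have "cmod (1 - cnj c * c) \<le> cmod (cinner (op_adj (\<pi> A) \<xi> - c *\<^sub>C \<Omega>) \<xi>) + cmod (cinner \<Omega> (\<pi> A \<Omega> - \<Omega>))"
      by (simp add: norm_triangle_ineq4)
    also have "\<dots> \<le> e * 1 + 1 * e"
      using norm_cinner_le[of "op_adj (\<pi> A) \<xi> - c *\<^sub>C \<Omega>" \<xi>] norm_cinner_le[of \<Omega> "\<pi> A \<Omega> - \<Omega>"] A
      by (simp add: n\<xi> norm_\<Omega>)
    finally show ?thesis by simp
  qed
  have "cmod (1 - cnj c * c) \<le> 0"
  proof (rule field_le_epsilon)
    fix r :: real assume "0 < r"
    then show "cmod (1 - cnj c * c) \<le> 0 + r" using bnd[of "r / 2"] by simp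
  qed
  then have cc: "cnj c * c = 1" by simp
  have c1: "cmod c = 1"
  proof -
    have "(cmod c)\<^sup>2 = 1" using arg_cong[OF cc, of cmod] by (simp add: norm_mult power2_eq_square)
    then show ?thesis using norm_ge_zero[of c] by (simp add: power2_eq_1_iff)
  qed
  \<comment> \<open>Equality case of Cauchy-Schwarz for two unit vectors.\<close>
  have "cinner (\<xi> - c *\<^sub>C \<Omega>) (\<xi> - c *\<^sub>C \<Omega>) = 0"
    using cc cinner_commute[of \<xi> \<Omega>]
    unfolding cinner_diff_left cinner_diff_right cinner_scaleC_left cinner_scaleC_right
    by (simp add: cinner_self norm_\<Omega> n\<xi> mult.commute flip: c_def)
  then have "\<xi> = c *\<^sub>C \<Omega>" by simp
  then show ?thesis using that c1 by (simp add: \<xi>_def)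
qed

lemma vacuum_\<beta>_power: "z \<in> bounded_ops \<Longrightarrow> cinner \<Omega> ((\<beta> ^^ n) z \<Omega>) = cinner \<Omega> (z \<Omega>)"
proof (induction n)
  case (Suc n)
  note Wb = is_unitaryD(1)[OF W_unitary]
  obtain c where c: "cmod c = 1" "op_adj W \<Omega> = c *\<^sub>C \<Omega>" by (rule W_adj_\<Omega>)
  have "cnj c * c = 1" using c(1) by (metis complex_norm_square mult.commute of_real_1 power_one)
  have zb: "(\<beta> ^^ n) z \<in> bounded_ops" by (rule \<beta>_power_bounded_ops[OF Suc.prems])
  have "cinner \<Omega> ((\<beta> ^^ Suc n) z \<Omega>) = cinner (op_adj W \<Omega>) ((\<beta> ^^ n) z (op_adj W \<Omega>))"
    by (simp add: \<beta>_spatial[OF zb] cinner_op_adj'[OF Wb])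
  also have "\<dots> = (cnj c * c) * cinner \<Omega> ((\<beta> ^^ n) z \<Omega>)"
    by (simp add: c bounded_opsD[OF zb] cinner_scaleC_left cinner_scaleC_right)
  finally show ?case using Suc \<open>cnj c * c = 1\<close> by simp
qed simp

text \<open>\<open>\<eta>\<close> is replaced by \<open>\<pi> A \<Omega>\<close>,
  \<open>\<pi> A\<close> is commuted to the left, and its adjoint sends \<open>\<zeta>\<close> close
  to a multiple of \<open>\<Omega>\<close>; what remains is the vacuum expectation, which
  translation preserves. \<open>A\<close> is fixed before n grows, so its norm is harmless.\<close>

lemma weak_limit:
  assumes z: "z \<in> bounded_ops" and comm: "\<And>A. comm z A \<longlonglongrightarrow> 0"
  shows "(\<lambda>n. cinner \<zeta> ((\<beta> ^^ n) z \<eta>)) \<longlonglongrightarrow> cinner \<Omega> (z \<Omega>) * cinner \<zeta> \<eta>"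
proof -
  have "(\<lambda>n. cinner \<zeta> ((\<beta> ^^ n) z \<eta>) - cinner \<Omega> (z \<Omega>) * cinner \<zeta> \<eta>) \<longlonglongrightarrow> 0"
  proof (rule tendsto_zero_approx)
    fix e :: real assume e: "0 < e"
    \<comment> \<open>\<open>B\<close> dominates the factor of \<open>d\<close> in the final
      estimate; the added ones keep it positive.\<close>
    define B where "B = (norm \<zeta> + 1) * (norm z + 1)"
    have B: "0 < B" by (simp add: B_def add_nonneg_pos)
    define d where "d = e / B"
    have d: "0 < d" using e B by (simp add: d_def)
    obtain A where A: "norm (\<pi> A \<Omega> - \<eta>) < d" "norm (op_adj (\<pi> A) \<zeta> - cinner \<eta> \<zeta> *\<^sub>C \<Omega>) < d"
      using approximation[OF d] by blast
    define g where "g n = - cinner \<zeta> (comm z A n \<Omega>)" for n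
    have "(\<lambda>n. - cinner \<zeta> (comm z A n \<Omega>)) \<longlonglongrightarrow> - cinner \<zeta> (blinfun_apply 0 \<Omega>)"
      by (intro tendsto_minus tendsto_cinner tendsto_const blinfun.tendsto comm)
    then have "g \<longlonglongrightarrow> 0" by (simp add: g_def[abs_def])
    moreover have "norm (cinner \<zeta> ((\<beta> ^^ n) z \<eta>) - cinner \<Omega> (z \<Omega>) * cinner \<zeta> \<eta> - g n) \<le> e" for n
    proof -
      define y where "y = (\<beta> ^^ n) z"
      have ny: "norm (y v) \<le> norm z * norm v" for v
        using norm_blinfun[of y v] norm_\<beta>_power_le[OF z, of n]
        by (metis y_def mult_right_mono norm_ge_zero order_trans)
      have "cinner \<zeta> (y \<eta>) - cinner \<Omega> (z \<Omega>) * cinner \<zeta> \<eta> - g n =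
          cinner (op_adj (\<pi> A) \<zeta> - cinner \<eta> \<zeta> *\<^sub>C \<Omega>) (y \<Omega>) - cinner \<zeta> (y (\<pi> A \<Omega> - \<eta>))"
        using vacuum_\<beta>_power[OF z, of n] cinner_commute[of \<zeta> \<eta>]
        by (simp add: g_def comm_def y_def blinfun.diff_left blinfun.diff_right cinner_diff_left cinner_diff_right
            cinner_scaleC_left cinner_op_adj'[OF \<pi>_bounded_ops] mult.commute)
      then have "norm (cinner \<zeta> (y \<eta>) - cinner \<Omega> (z \<Omega>) * cinner \<zeta> \<eta> - g n) \<le>
          cmod (cinner (op_adj (\<pi> A) \<zeta> - cinner \<eta> \<zeta> *\<^sub>C \<Omega>) (y \<Omega>)) + cmod (cinner \<zeta> (y (\<pi> A \<Omega> - \<eta>)))"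
        by (simp add: norm_triangle_ineq4)
      also have "\<dots> \<le> d * norm z + norm \<zeta> * (norm z * d)"
      proof (rule add_mono)
        have "cmod (cinner (op_adj (\<pi> A) \<zeta> - cinner \<eta> \<zeta> *\<^sub>C \<Omega>) (y \<Omega>))
            \<le> norm (op_adj (\<pi> A) \<zeta> - cinner \<eta> \<zeta> *\<^sub>C \<Omega>) * norm (y \<Omega>)" by (rule norm_cinner_le)
        also have "\<dots> \<le> d * norm z" using A(2) ny[of \<Omega>] d by (intro mult_mono) (auto simp: norm_\<Omega>)
        finally show "cmod (cinner (op_adj (\<pi> A) \<zeta> - cinner \<eta> \<zeta> *\<^sub>C \<Omega>) (y \<Omega>)) \<le> d * norm z" .
        have "cmod (cinner \<zeta> (y (\<pi> A \<Omega> - \<eta>))) \<le> norm \<zeta> * norm (y (\<pi> A \<Omega> - \<eta>))" by (rule norm_cinner_le)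
        also have "\<dots> \<le> norm \<zeta> * (norm z * norm (\<pi> A \<Omega> - \<eta>))" by (intro mult_left_mono ny) simp
        also have "\<dots> \<le> norm \<zeta> * (norm z * d)" using A(1) by (intro mult_left_mono) auto
        finally show "cmod (cinner \<zeta> (y (\<pi> A \<Omega> - \<eta>))) \<le> norm \<zeta> * (norm z * d)" .
      qed
      also have "\<dots> = d * ((norm \<zeta> + 1) * norm z)" by (simp add: algebra_simps)
      also have "\<dots> \<le> d * B" unfolding B_def using d by (intro mult_left_mono) auto
      also have "\<dots> = e" using B by (simp add: d_def)
      finally show ?thesis by (simp add: y_def)
    qed
    ultimately show "\<exists>g. g \<longlonglongrightarrow> 0 \<and> (\<forall>n. norm (cinner \<zeta> ((\<beta> ^^ n) z \<eta>) - cinner \<Omega> (z \<Omega>) * cinner \<zeta> \<eta> - g n) \<le> e)"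
      by blast
  qed
  then show ?thesis by (simp only: LIM_zero_iff)
qed

end

lemma cmod_cinner_vec2_le:
  fixes \<xi> \<eta> :: "'k::complex_hilbert ^ 2"
  assumes "\<And>x y. cmod (F x y) \<le> C * (norm x * norm y)" "0 \<le> C"
  shows "cmod (F (\<xi> $ i) (\<eta> $ i')) \<le> C * (norm \<xi> * norm \<eta>)"
proof -
  have "cmod (F (\<xi> $ i) (\<eta> $ i')) \<le> C * (norm (\<xi> $ i) * norm (\<eta> $ i'))" by (rule assms)
  also have "\<dots> \<le> C * (norm \<xi> * norm \<eta>)"
    by (intro mult_left_mono mult_mono Finite_Cartesian_Product.norm_nth_le assms) auto
  finally show ?thesis .
qed

section \<open>Separate limits for even and odd elements\<close>

context translation_rep
begin

lemma \<beta>_power_M: "x \<in> M \<Longrightarrow> (\<beta> ^^ n) x \<in> M"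
  by (induction n) (simp_all add: \<beta>_M)

lemma \<Gamma>_\<beta>_power:
  assumes "x \<in> M" "\<Gamma> o\<^sub>L x = s *\<^sub>C (x o\<^sub>L \<Gamma>)"
  shows "\<Gamma> o\<^sub>L (\<beta> ^^ n) x = s *\<^sub>C ((\<beta> ^^ n) x o\<^sub>L \<Gamma>)"
  by (induction n) (simp_all add: assms \<Gamma>_commute_\<beta> M_bounded_ops \<beta>_power_M)

text \<open>Klein transformation: annihilators of the left half line anticommute with the generators
  of the right half, and so does \<open>\<Gamma>\<close>; the product commutes with them.\<close>

lemma left_annihilator_\<Gamma>_commutant:
  fixes f :: "int \<Rightarrow> 'd cvec"
  assumes f: "f \<in> l2" "\<And>y. 0 \<le> y \<Longrightarrow> f y = 0"
  shows "\<pi> (a f) o\<^sub>L \<Gamma> \<in> commutant (\<pi> ` right_alg a)"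
proof (rule in_commutant_right)
  show "\<pi> (a f) o\<^sub>L \<Gamma> \<in> bounded_ops" by (simp add: \<pi>_bounded_ops \<Gamma>_bounded_ops)
  fix g :: "int \<Rightarrow> 'd cvec" assume g: "g \<in> l2" "\<And>y. y < 0 \<Longrightarrow> g y = 0"
  have "l2_inner f g = 0"
    unfolding l2_inner_def by (rule infsum_0) (metis f(2) g(2) cinner_zero_left cinner_zero_right not_le)
  then have "a f * star (a g) = - (star (a g) * a f)"
    using car_algebraD(3)[OF car f(1) g(1)] by (simp add: eq_neg_iff_add_eq_0)
  from arg_cong[OF this, of \<pi>] have 2: "\<pi> (a f) o\<^sub>L op_adj (\<pi> (a g)) = - (op_adj (\<pi> (a g)) o\<^sub>L \<pi> (a f))"
    by (simp add: \<pi>_mult \<pi>_star \<pi>_minus)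
  have 1: "\<pi> (a f) o\<^sub>L \<pi> (a g) = - (\<pi> (a g) o\<^sub>L \<pi> (a f))"
    using arg_cong[OF car_algebraD(2)[OF car f(1) g(1)], of \<pi>] by (simp add: \<pi>_mult \<pi>_minus)
  show "(\<pi> (a f) o\<^sub>L \<Gamma>) o\<^sub>L \<pi> (a g) = \<pi> (a g) o\<^sub>L (\<pi> (a f) o\<^sub>L \<Gamma>)"
    using 1 by (simp add: blinfun_compose_assoc \<Gamma>_a[OF g(1)]) (simp flip: blinfun_compose_assoc)
  show "(\<pi> (a f) o\<^sub>L \<Gamma>) o\<^sub>L op_adj (\<pi> (a g)) = op_adj (\<pi> (a g)) o\<^sub>L (\<pi> (a f) o\<^sub>L \<Gamma>)"
    using 2 by (simp add: blinfun_compose_assoc \<Gamma>_adj_a[OF g(1)]) (simp flip: blinfun_compose_assoc)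
qed

lemma compose_\<Gamma>_cancel: "A o\<^sub>L \<Gamma> = B o\<^sub>L \<Gamma> \<longleftrightarrow> A = B"
proof
  assume "A o\<^sub>L \<Gamma> = B o\<^sub>L \<Gamma>"
  then have "(A o\<^sub>L \<Gamma>) o\<^sub>L \<Gamma> = (B o\<^sub>L \<Gamma>) o\<^sub>L \<Gamma>" by simp
  then show "A = B" by (simp add: blinfun_compose_assoc \<Gamma>_\<Gamma>)
qed simp

lemma left_annihilator_graded_commute:
  fixes f :: "int \<Rightarrow> 'd cvec"
  assumes x: "x \<in> M" "\<Gamma> o\<^sub>L x = s *\<^sub>C (x o\<^sub>L \<Gamma>)" and f: "f \<in> l2" "\<And>y. 0 \<le> y \<Longrightarrow> f y = 0"
  shows "x o\<^sub>L \<pi> (a f) = s *\<^sub>C (\<pi> (a f) o\<^sub>L x)" "x o\<^sub>L op_adj (\<pi> (a f)) = s *\<^sub>C (op_adj (\<pi> (a f)) o\<^sub>L x)"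
proof -
  have T: "\<pi> (a f) o\<^sub>L \<Gamma> \<in> commutant (\<pi> ` right_alg a)"
    using f by (rule left_annihilator_\<Gamma>_commutant)
  have "op_adj (\<pi> (a f)) o\<^sub>L \<Gamma> = - op_adj (\<pi> (a f) o\<^sub>L \<Gamma>)"
    by (simp add: op_adj_\<Gamma> \<Gamma>_adj_a[OF f(1)])
  then have T': "op_adj (\<pi> (a f)) o\<^sub>L \<Gamma> \<in> commutant (\<pi> ` right_alg a)"
    using commutant_\<pi>_adj[OF T] by (simp add: commutant_def)
  have *: "x o\<^sub>L B = s *\<^sub>C (B o\<^sub>L x)" if B: "B o\<^sub>L \<Gamma> \<in> commutant (\<pi> ` right_alg a)" "B \<in> bounded_ops" for B
  proof -
    have "(x o\<^sub>L B) o\<^sub>L \<Gamma> = B o\<^sub>L (\<Gamma> o\<^sub>L x)" using M_commute[OF x(1) B(1)] by (simp add: blinfun_compose_assoc)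
    also have "\<dots> = (s *\<^sub>C (B o\<^sub>L x)) o\<^sub>L \<Gamma>" by (simp add: x(2) blinfun_compose_scaleC_right B(2) blinfun_compose_assoc)
    finally show ?thesis by (simp only: compose_\<Gamma>_cancel)
  qed
  show "x o\<^sub>L \<pi> (a f) = s *\<^sub>C (\<pi> (a f) o\<^sub>L x)" "x o\<^sub>L op_adj (\<pi> (a f)) = s *\<^sub>C (op_adj (\<pi> (a f)) o\<^sub>L x)"
    by (rule * T T', simp add: \<pi>_bounded_ops)+
qed

lemma weak_limit_even:
  assumes x: "x \<in> M" "\<Gamma> o\<^sub>L x = 1 *\<^sub>C (x o\<^sub>L \<Gamma>)"
  shows "(\<lambda>n. cinner \<zeta> ((\<beta> ^^ n) x \<eta>)) \<longlonglongrightarrow> cinner \<Omega> (x \<Omega>) * cinner \<zeta> \<eta>"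
  by (rule weak_limit[OF M_bounded_ops[OF x(1)] asymptotically_commute[OF M_bounded_ops[OF x(1)]]])
     (use left_annihilator_graded_commute[OF x] in simp_all)

lemma vacuum_odd:
  assumes "\<Gamma> o\<^sub>L x = (- 1) *\<^sub>C (x o\<^sub>L \<Gamma>)"
  shows "cinner \<Omega> (x \<Omega>) = 0"
proof -
  have "cinner \<Omega> (x \<Omega>) = cinner (\<Gamma> \<Omega>) (x \<Omega>)" by (simp add: \<Gamma>_\<Omega>)
  also have "\<dots> = cinner \<Omega> ((\<Gamma> o\<^sub>L x) \<Omega>)" by (simp add: cinner_op_adj[OF \<Gamma>_bounded_ops] op_adj_\<Gamma>)
  also have "\<dots> = - cinner \<Omega> (x \<Omega>)" by (simp add: assms blinfun.minus_left \<Gamma>_\<Omega>)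
  finally show ?thesis by simp
qed

text \<open>\<open>x\<close> anticommutes with the left annihilators, so \<open>x \<Gamma>\<close>
  commutes with them and has a weak limit, which is its vacuum expectation 0. Translating
  \<open>\<Gamma>\<close> only contributes \<open>c ^ n\<close>, of modulus 1, so the limit 0 passes
  to \<open>x\<close>.\<close>

lemma weak_limit_odd:
  assumes x: "x \<in> M" "\<Gamma> o\<^sub>L x = (- 1) *\<^sub>C (x o\<^sub>L \<Gamma>)"
  shows "(\<lambda>n. cinner \<zeta> ((\<beta> ^^ n) x \<eta>)) \<longlonglongrightarrow> 0"
proof -
  have zb: "x o\<^sub>L \<Gamma> \<in> bounded_ops" using M_bounded_ops[OF x(1)] \<Gamma>_bounded_ops by simp
  have "comm (x o\<^sub>L \<Gamma>) A \<longlonglongrightarrow> 0" for A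
  proof (rule asymptotically_commute[OF zb])
    fix f :: "int \<Rightarrow> 'd cvec" assume f: "f \<in> l2" "\<And>y. 0 \<le> y \<Longrightarrow> f y = 0"
    note c = left_annihilator_graded_commute[OF x f]
    show "(x o\<^sub>L \<Gamma>) o\<^sub>L \<pi> (a f) = \<pi> (a f) o\<^sub>L (x o\<^sub>L \<Gamma>)"
      using c(1) by (simp add: blinfun_compose_assoc \<Gamma>_a[OF f(1)]) (simp flip: blinfun_compose_assoc)
    show "(x o\<^sub>L \<Gamma>) o\<^sub>L op_adj (\<pi> (a f)) = op_adj (\<pi> (a f)) o\<^sub>L (x o\<^sub>L \<Gamma>)"
      using c(2) by (simp add: blinfun_compose_assoc \<Gamma>_adj_a[OF f(1)]) (simp flip: blinfun_compose_assoc)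
  qed
  from weak_limit[OF zb this, of \<zeta> "\<Gamma> \<eta>"]
  have lim: "(\<lambda>n. cinner \<zeta> ((\<beta> ^^ n) (x o\<^sub>L \<Gamma>) (\<Gamma> \<eta>))) \<longlonglongrightarrow> 0"
    by (simp add: \<Gamma>_\<Omega> vacuum_odd[OF x(2)])
  obtain c where c: "c * c = 1" "\<beta> \<Gamma> = c *\<^sub>C \<Gamma>" by (rule \<beta>_\<Gamma>)
  have \<beta>\<Gamma>: "(\<beta> ^^ n) \<Gamma> = c ^ n *\<^sub>C \<Gamma>" for n
    by (induction n) (simp_all add: \<beta>_hom(2)[OF \<Gamma>_bounded_ops] c(2) scaleC_scaleC mult.commute)
  have "cinner \<zeta> ((\<beta> ^^ n) (x o\<^sub>L \<Gamma>) (\<Gamma> \<eta>)) = c ^ n * cinner \<zeta> ((\<beta> ^^ n) x \<eta>)" for n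
    by (simp add: \<beta>_power_mult M_bounded_ops[OF x(1)] \<Gamma>_bounded_ops \<beta>\<Gamma> scaleC_blinfun.rep_eq \<Gamma>_\<Gamma>_apply
        bounded_opsD[OF M_bounded_ops[OF \<beta>_power_M[OF x(1)]]] cinner_scaleC_right)
  moreover have "cmod c = 1"
  proof -
    have "cmod c * cmod c = 1" using arg_cong[OF c(1), of cmod] by (simp add: norm_mult)
    then show ?thesis using norm_ge_zero[of c] by (simp add: square_eq_1_iff)
  qed
  ultimately have "(\<lambda>n. cmod (cinner \<zeta> ((\<beta> ^^ n) x \<eta>))) \<longlonglongrightarrow> 0"
    using tendsto_norm_zero[OF lim] by (simp add: norm_mult norm_power)
  then show ?thesis by (rule tendsto_norm_zero_cancel)
qed

lemma j_hom:
  shows "y \<in> R1 \<Longrightarrow> y' \<in> R1 \<Longrightarrow> y + y' \<in> R1 \<Longrightarrow> j (y + y') = j y + j y'"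
    and "y \<in> R1 \<Longrightarrow> c *\<^sub>C y \<in> R1 \<Longrightarrow> j (c *\<^sub>C y) = c *\<^sub>C j y"
    and "y \<in> R1 \<Longrightarrow> y' \<in> R1 \<Longrightarrow> y o\<^sub>L y' \<in> R1 \<Longrightarrow> j (y o\<^sub>L y') = j y o\<^sub>L j y'"
    and "y \<in> R1 \<Longrightarrow> op_adj y \<in> R1 \<Longrightarrow> j (op_adj y) = op_adj (j y)"
  by (rule \<iota>_inj; simp add: M_closed j_M \<iota>_hom \<iota>_j)+

text \<open>Realises the matrix elements of B(K) inside the GNS space, so that weak limits there can
  be read on K by purely algebraic means.\<close>

lemma j_amp_intertwiner:
  obtains J :: "'k \<Rightarrow>\<^sub>L 'h" where "\<And>x. norm (J x) = norm x"
    "\<And>b x y. b \<in> bounded_ops \<Longrightarrow> cinner (J x) (j (amp b) (J y)) = cinner x (b y)"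
proof -
  obtain z :: 'k where z: "norm z = 1" by (rule exists_unit_vector)
  have hom: "star_hom_on 0 (o\<^sub>L) op_adj (o\<^sub>L) op_adj bounded_ops (\<lambda>b. j (amp b))"
    unfolding star_hom_on_def
  proof (intro ballI allI conjI)
    fix b b' :: "'k \<Rightarrow>\<^sub>L 'k" and c assume b: "b \<in> bounded_ops" "b' \<in> bounded_ops"
    have "amp b + amp b' \<in> R1" "c *\<^sub>C amp b \<in> R1" "amp b o\<^sub>L amp b' \<in> R1" "op_adj (amp b) \<in> R1"
      using b by (simp_all flip: amp_add amp_scaleC)
    then show "j (amp (b + b')) = j (amp b) + j (amp b')" "j (amp (c *\<^sub>C b)) = conj_if 0 c *\<^sub>C j (amp b)"
      "j (amp (b o\<^sub>L b')) = j (amp b) o\<^sub>L j (amp b')" "j (amp (op_adj b)) = op_adj (j (amp b))"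
      using b j_hom(3)[of "amp b" "amp b'"] j_hom(4)[of "amp b"]
      by (simp_all add: amp_add amp_scaleC j_hom(1,2) conj_if_def)
  qed
  have "j (amp (ketbra z z)) \<noteq> 0"
  proof
    assume "j (amp (ketbra z z)) = 0"
    then have "\<iota> (j (amp (ketbra z z))) = 0" by (simp add: \<iota>_zero)
    then have "amp (ketbra z z) = amp 0" by (simp add: \<iota>_j)
    then have "ketbra z z = 0" by (simp only: amp_eq_iff)
    from arg_cong[OF this, of "\<lambda>T. blinfun_apply T z"] show False
      using z by (auto simp: ketbra.rep_eq cinner_self)
  qed
  then obtain J where J: "is_isometry_intertwining (\<lambda>b. j (amp b)) J"
    using intertwiner_exists[OF hom, of id_blinfun z] z by (auto simp: M_bounded_ops j_M)
  show ?thesis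
  proof (rule that)
    fix x show "norm (J x) = norm x"
      using J unfolding is_isometry_intertwining_def norm_eq_sqrt_inner inner_eq_Re_cinner by metis
  qed (use J in \<open>simp add: is_isometry_intertwining_def\<close>)
qed

lemma \<iota>_limit_even:
  assumes b: "b \<in> bounded_ops" and x: "x = j (amp b)"
  obtains B C where "\<And>n. \<iota> ((\<beta> ^^ n) x) = amp (B n)" "0 \<le> C" "\<And>n \<xi> \<eta>. cmod (cinner \<xi> (B n \<eta>)) \<le> C * (norm \<xi> * norm \<eta>)"
    "\<And>\<xi> \<eta>. (\<lambda>n. cinner \<xi> (B n \<eta>)) \<longlonglongrightarrow> cinner \<Omega> (x \<Omega>) * cinner \<xi> \<eta>"
proof -
  obtain J where J: "\<And>x. norm (J x) = norm x"
    "\<And>b x y. b \<in> bounded_ops \<Longrightarrow> cinner (J x) (j (amp b) (J y)) = cinner x (b y)"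
    by (rule j_amp_intertwiner) blast
  have xM: "x \<in> M" by (simp add: x b j_M)
  have \<Gamma>x: "\<Gamma> o\<^sub>L x = 1 *\<^sub>C (x o\<^sub>L \<Gamma>)" unfolding x by (rule \<Gamma>_j_amp[OF b])
  have "\<exists>B. B \<in> bounded_ops \<and> \<iota> ((\<beta> ^^ n) x) = amp B" for n
  proof -
    have "Ad grading_op (\<iota> ((\<beta> ^^ n) x)) = \<iota> ((\<beta> ^^ n) x)"
      using \<iota>_\<Gamma>[OF \<beta>_power_M[OF xM] \<Gamma>_\<beta>_power[OF xM \<Gamma>x]] by simp
    then show ?thesis using R1_even[OF \<iota>_R1[OF \<beta>_power_M[OF xM]]] by metis
  qed
  then obtain B where B: "\<And>n. B n \<in> bounded_ops" "\<And>n. \<iota> ((\<beta> ^^ n) x) = amp (B n)" by metis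
  have "(\<beta> ^^ n) x = j (amp (B n))" for n
    by (metis B(2) j_\<iota> \<beta>_power_M[OF xM])
  then have eq: "cinner \<xi> (B n \<eta>) = cinner (J \<xi>) ((\<beta> ^^ n) x (J \<eta>))" for n \<xi> \<eta>
    using J(2)[OF B(1)] by simp
  show ?thesis
  proof (rule that[OF B(2), of "norm x"])
    show "cmod (cinner \<xi> (B n \<eta>)) \<le> norm x * (norm \<xi> * norm \<eta>)" for n \<xi> \<eta>
    proof -
      have "cmod (cinner \<xi> (B n \<eta>)) \<le> norm (J \<xi>) * norm ((\<beta> ^^ n) x (J \<eta>))" unfolding eq by (rule norm_cinner_le)
      also have "\<dots> \<le> norm (J \<xi>) * (norm ((\<beta> ^^ n) x) * norm (J \<eta>))" by (intro mult_left_mono norm_blinfun) simp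
      also have "\<dots> \<le> norm \<xi> * (norm x * norm \<eta>)"
        unfolding J by (intro mult_left_mono mult_right_mono norm_\<beta>_power_le M_bounded_ops xM) simp_all
      finally show ?thesis by (simp add: mult_ac)
    qed
    show "(\<lambda>n. cinner \<xi> (B n \<eta>)) \<longlonglongrightarrow> cinner \<Omega> (x \<Omega>) * cinner \<xi> \<eta>" for \<xi> \<eta>
      using weak_limit_even[OF xM \<Gamma>x, of "J \<xi>" "J \<eta>"] J(2)[OF bounded_ops_id, of \<xi> \<eta>] \<iota>_id j_\<iota>[OF M_closed(1)]
      by (simp add: eq)
  qed simp
qed

text \<open>Multiplication by the selfadjoint unitary \<open>u = j flip_op\<close> removes the
  factor \<open>flip_op\<close>, which reduces the matrix elements to those of an element of the
  form \<open>j (amp b)\<close>.\<close>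

lemma \<iota>_limit_odd:
  assumes b: "b \<in> bounded_ops" and x: "x = j (amp b o\<^sub>L flip_op)"
  obtains B C where "\<And>n. \<iota> ((\<beta> ^^ n) x) = amp (B n) o\<^sub>L flip_op" "0 \<le> C"
    "\<And>n \<xi> \<eta>. cmod (cinner \<xi> (B n \<eta>)) \<le> C * (norm \<xi> * norm \<eta>)" "\<And>\<xi> \<eta>. (\<lambda>n. cinner \<xi> (B n \<eta>)) \<longlonglongrightarrow> 0"
proof -
  obtain J where J: "\<And>x. norm (J x) = norm x"
    "\<And>b x y. b \<in> bounded_ops \<Longrightarrow> cinner (J x) (j (amp b) (J y)) = cinner x (b y)"
    by (rule j_amp_intertwiner) blast
  have xM: "x \<in> M" by (simp add: x b j_M)
  have \<Gamma>x: "\<Gamma> o\<^sub>L x = (- 1) *\<^sub>C (x o\<^sub>L \<Gamma>)" unfolding x by (rule \<Gamma>_j_flip[OF b])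
  have "\<exists>B. B \<in> bounded_ops \<and> \<iota> ((\<beta> ^^ n) x) = amp B o\<^sub>L flip_op" for n
  proof -
    have "Ad grading_op (\<iota> ((\<beta> ^^ n) x)) = - \<iota> ((\<beta> ^^ n) x)"
      using \<iota>_\<Gamma>[OF \<beta>_power_M[OF xM] \<Gamma>_\<beta>_power[OF xM \<Gamma>x]] by simp
    then show ?thesis using R1_odd[OF \<iota>_R1[OF \<beta>_power_M[OF xM]]] by metis
  qed
  then obtain B where B: "\<And>n. B n \<in> bounded_ops" "\<And>n. \<iota> ((\<beta> ^^ n) x) = amp (B n) o\<^sub>L flip_op" by metis
  define u where "u = j flip_op"
  have u: "u \<in> M" "\<iota> u = flip_op" by (simp_all add: u_def j_M \<iota>_j)
  have uu: "u o\<^sub>L u = id_blinfun"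
    using u by (intro \<iota>_inj M_closed) (simp_all add: \<iota>_hom(3) \<iota>_id)
  have "op_adj u = u"
    using u by (intro \<iota>_inj M_closed) (simp_all add: \<iota>_hom(4))
  with uu have norm_u: "norm (u v) = norm v" for v by (intro norm_isometry) simp
  have "(\<beta> ^^ n) x o\<^sub>L u = j (amp (B n))" for n
  proof (intro \<iota>_inj M_closed \<beta>_power_M xM u j_M)
    show "\<iota> ((\<beta> ^^ n) x o\<^sub>L u) = \<iota> (j (amp (B n)))"
      using B(1) by (simp add: \<iota>_hom(3) \<beta>_power_M xM u B(2) \<iota>_j blinfun_compose_assoc)
  qed (simp add: B(1))
  then have eq: "cinner \<xi> (B n \<eta>) = cinner (J \<xi>) ((\<beta> ^^ n) x (u (J \<eta>)))" for n \<xi> \<eta>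
    using J(2)[OF B(1)] by (metis blinfun_apply_blinfun_compose)
  show ?thesis
  proof (rule that[OF B(2), of "norm x"])
    show "cmod (cinner \<xi> (B n \<eta>)) \<le> norm x * (norm \<xi> * norm \<eta>)" for n \<xi> \<eta>
    proof -
      have "cmod (cinner \<xi> (B n \<eta>)) \<le> norm (J \<xi>) * norm ((\<beta> ^^ n) x (u (J \<eta>)))" unfolding eq by (rule norm_cinner_le)
      also have "\<dots> \<le> norm (J \<xi>) * (norm ((\<beta> ^^ n) x) * norm (u (J \<eta>)))" by (intro mult_left_mono norm_blinfun) simp
      also have "\<dots> \<le> norm \<xi> * (norm x * norm \<eta>)"
        unfolding norm_u J by (intro mult_left_mono mult_right_mono norm_\<beta>_power_le M_bounded_ops xM) simp_all
      finally show ?thesis by (simp add: mult_ac)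
    qed
    show "(\<lambda>n. cinner \<xi> (B n \<eta>)) \<longlonglongrightarrow> 0" for \<xi> \<eta>
      unfolding eq by (rule weak_limit_odd[OF xM \<Gamma>x])
  qed simp
qed

theorem sigma_weak_limit:
  assumes x: "x \<in> M"
  shows "sigma_weak_lim (\<lambda>n. \<iota> ((\<beta> ^^ n) x)) (cinner \<Omega> (x \<Omega>) *\<^sub>C id_blinfun)"
proof -
  obtain b c where bc: "b \<in> bounded_ops" "c \<in> bounded_ops" "\<iota> x = amp b + (amp c o\<^sub>L flip_op)"
    using \<iota>_R1[OF x] by (rule R1E)
  define x0 where "x0 = j (amp b)"
  define x1 where "x1 = j (amp c o\<^sub>L flip_op)"
  have xM: "x0 \<in> M" "x1 \<in> M" using bc by (simp_all add: x0_def x1_def j_M)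
  have x_eq: "x = x0 + x1"
    using bc xM x by (intro \<iota>_inj M_closed) (simp_all add: \<iota>_hom(1) x0_def x1_def \<iota>_j)
  have "(\<beta> ^^ n) (x0 + x1) = (\<beta> ^^ n) x0 + (\<beta> ^^ n) x1" for n
    using xM by (induction n) (simp_all add: \<beta>_hom(1) M_bounded_ops \<beta>_power_M)
  then have \<iota>_eq: "\<iota> ((\<beta> ^^ n) x) = \<iota> ((\<beta> ^^ n) x0) + \<iota> ((\<beta> ^^ n) x1)" for n
    by (simp add: x_eq \<iota>_hom(1) \<beta>_power_M xM)
  obtain B0 C0 where B0: "\<And>n. \<iota> ((\<beta> ^^ n) x0) = amp (B0 n)" "0 \<le> C0"
    "\<And>n \<xi> \<eta>. cmod (cinner \<xi> (B0 n \<eta>)) \<le> C0 * (norm \<xi> * norm \<eta>)"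
    "\<And>\<xi> \<eta>. (\<lambda>n. cinner \<xi> (B0 n \<eta>)) \<longlonglongrightarrow> cinner \<Omega> (x0 \<Omega>) * cinner \<xi> \<eta>"
    by (rule \<iota>_limit_even[OF bc(1) x0_def]) blast
  obtain B1 C1 where B1: "\<And>n. \<iota> ((\<beta> ^^ n) x1) = amp (B1 n) o\<^sub>L flip_op" "0 \<le> C1"
    "\<And>n \<xi> \<eta>. cmod (cinner \<xi> (B1 n \<eta>)) \<le> C1 * (norm \<xi> * norm \<eta>)"
    "\<And>\<xi> \<eta>. (\<lambda>n. cinner \<xi> (B1 n \<eta>)) \<longlonglongrightarrow> 0"
    by (rule \<iota>_limit_odd[OF bc(2) x1_def]) blast
  \<comment> \<open>Odd elements have vacuum expectation 0, so the constant in the limit sees the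
    even part only.\<close>
  have state: "cinner \<Omega> (x \<Omega>) = cinner \<Omega> (x0 \<Omega>)"
    using vacuum_odd[of x1] \<Gamma>_j_flip[OF bc(2)] by (simp add: x_eq x1_def blinfun.add_left cinner_add_right)
  have expand: "cinner \<xi> (\<iota> ((\<beta> ^^ n) x) \<eta>) = cinner (\<xi> $ 1) (B0 n (\<eta> $ 1)) + cinner (\<xi> $ 2) (B0 n (\<eta> $ 2))
      + (cinner (\<xi> $ 1) (B1 n (\<eta> $ 2)) + cinner (\<xi> $ 2) (B1 n (\<eta> $ 1)))" for n \<xi> \<eta>
    by (simp add: \<iota>_eq B0(1) B1(1) cinner_vec2 blinfun.add_left cinner_add_right)
  show ?thesis
  proof (rule sigma_weak_limI)
    fix n and \<xi> \<eta> :: "'k ^ 2"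
    have "cmod (cinner \<xi> (\<iota> ((\<beta> ^^ n) x) \<eta>)) \<le>
        C0 * (norm \<xi> * norm \<eta>) + C0 * (norm \<xi> * norm \<eta>) + (C1 * (norm \<xi> * norm \<eta>) + C1 * (norm \<xi> * norm \<eta>))"
      unfolding expand
      by (intro norm_triangle_le add_mono cmod_cinner_vec2_le[of "\<lambda>x y. cinner x (B0 n y)"]
          cmod_cinner_vec2_le[of "\<lambda>x y. cinner x (B1 n y)"] B0 B1)
    then show "cmod (cinner \<xi> (\<iota> ((\<beta> ^^ n) x) \<eta>)) \<le> (2 * C0 + 2 * C1) * (norm \<xi> * norm \<eta>)"
      by (simp add: algebra_simps)
    show "(\<lambda>n. cinner \<xi> (\<iota> ((\<beta> ^^ n) x) \<eta>)) \<longlonglongrightarrow> cinner \<xi> ((cinner \<Omega> (x \<Omega>) *\<^sub>C id_blinfun) \<eta>)"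
    proof -
      have "(\<lambda>n. cinner \<xi> (\<iota> ((\<beta> ^^ n) x) \<eta>)) \<longlonglongrightarrow> cinner \<Omega> (x0 \<Omega>) * cinner (\<xi> $ 1) (\<eta> $ 1)
          + cinner \<Omega> (x0 \<Omega>) * cinner (\<xi> $ 2) (\<eta> $ 2) + (0 + 0)"
        unfolding expand by (intro tendsto_add B0 B1)
      then show ?thesis
        by (simp add: state scaleC_blinfun.rep_eq scaleC_vec_def cinner_scaleC_right cinner_vec2 algebra_simps)
    qed
  qed
qed

end

section \<open>The product formula\<close>

lemma op_prod_Nil [simp]: "op_prod [] = id_blinfun"
  and op_prod_Cons [simp]: "op_prod (T # Ts) = T o\<^sub>L op_prod Ts"
  by (simp_all add: op_prod_def)

lemma op_prod_append: "op_prod (Ss @ Ts) = op_prod Ss o\<^sub>L op_prod Ts"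
  by (induction Ss) (simp_all add: blinfun_compose_assoc)

lemma upt_0_Suc: "[0..<Suc n] = 0 # map Suc [0..<n]"
  by (simp add: map_Suc_upt upt_conv_Cons del: upt_Suc)

lemma minus_one_power_scaleC: "(- 1) ^ n *\<^sub>C T = (if even n then T else - T)"
  by simp

locale translation_isometries = translation_rep a \<kappa> \<Theta> \<tau> \<omega> \<pi> \<Omega> \<Gamma> \<beta> \<iota>
  for a :: "(int \<Rightarrow> 'd::{finite, linorder} cvec) \<Rightarrow> 'a::cstar_algebra" and \<kappa> \<Theta> \<tau> \<omega>
    and \<pi> :: "'a \<Rightarrow> ('h::complex_hilbert \<Rightarrow>\<^sub>L 'h)" and \<Omega> \<Gamma> \<beta>
    and \<iota> :: "('h \<Rightarrow>\<^sub>L 'h) \<Rightarrow> (('k::complex_hilbert ^ 2) \<Rightarrow>\<^sub>L ('k ^ 2))" +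
  fixes S :: "'d set \<Rightarrow> ('k \<Rightarrow>\<^sub>L 'k)" and s :: nat
  assumes S_bounded_ops: "S \<mu> \<in> bounded_ops"
    and S_orthogonal: "op_adj (S \<nu>) o\<^sub>L S \<mu> = (if \<mu> = \<nu> then id_blinfun else 0)"
    and S_sum: "(\<Sum>\<mu>\<in>UNIV. S \<mu> o\<^sub>L op_adj (S \<mu>)) = id_blinfun"
    and f_eq: "f \<mu> \<nu> = S \<mu> o\<^sub>L op_adj (S \<nu>)"
    and \<rho>\<^sub>0_S: "b \<in> bounded_ops \<Longrightarrow> \<rho>\<^sub>0 b o\<^sub>L S \<mu> = S \<mu> o\<^sub>L b"
    and \<rho>_flip_eq: "\<rho> flip_op = (- 1) ^ s *\<^sub>C (\<iota> gh o\<^sub>L flip_op)"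
begin

definition Sh where "Sh \<mu> = amp (S \<mu>) o\<^sub>L op_pow grading_op (s + parity \<mu>)"

text \<open>Every sign of the product formula originates here: \<open>\<sigma>z\<close> anticommutes
  with \<open>\<sigma>x\<close>, so conjugating a power of one by a power of the other costs -1 to
  the product of the exponents.\<close>

lemma Sh_amp_flip:
  "Sh \<mu> o\<^sub>L (amp b o\<^sub>L op_pow flip_op n) o\<^sub>L op_adj (Sh \<mu>) =
    (- 1) ^ ((s + parity \<mu>) * n) *\<^sub>C (amp (S \<mu> o\<^sub>L b o\<^sub>L op_adj (S \<mu>)) o\<^sub>L op_pow flip_op n)"
proof -
  define G :: "('k ^ 2) \<Rightarrow>\<^sub>L ('k ^ 2)" where "G = op_pow grading_op (s + parity \<mu>)"
  define Y :: "('k ^ 2) \<Rightarrow>\<^sub>L ('k ^ 2)" where "Y = op_pow flip_op n"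
  have G: "G o\<^sub>L amp c = amp c o\<^sub>L G" for c by (simp add: G_def op_pow_grading_amp)
  have Y: "Y o\<^sub>L amp c = amp c o\<^sub>L Y" for c by (simp add: Y_def op_pow_flip_amp)
  have GYG: "G o\<^sub>L (Y o\<^sub>L G) = (- 1) ^ ((s + parity \<mu>) * n) *\<^sub>C Y"
  proof (cases "even n")
    case True
    then show ?thesis by (simp add: G_def Y_def op_pow_flip)
  next
    case False
    then have "(- 1 :: complex) ^ ((s + parity \<mu>) * n) = (- 1) ^ (s + parity \<mu>)" by (simp add: minus_one_power_iff)
    then show ?thesis
      using False op_pow_grading_flip[of "s + parity \<mu>"] by (simp add: G_def Y_def op_pow_flip blinfun_compose_assoc)
  qed
  have "Sh \<mu> o\<^sub>L (amp b o\<^sub>L Y) o\<^sub>L op_adj (Sh \<mu>) = amp (S \<mu>) o\<^sub>L (G o\<^sub>L (amp b o\<^sub>L (Y o\<^sub>L (G o\<^sub>L amp (op_adj (S \<mu>))))))"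
    by (simp add: Sh_def G_def blinfun_compose_assoc)
  also have "\<dots> = amp (S \<mu>) o\<^sub>L (amp b o\<^sub>L (amp (op_adj (S \<mu>)) o\<^sub>L (G o\<^sub>L (Y o\<^sub>L G))))"
    by (simp only: G Y blinfun_compose_assoc compose_swap[OF G] compose_swap[OF Y])
  also have "\<dots> = (- 1) ^ ((s + parity \<mu>) * n) *\<^sub>C (amp (S \<mu>) o\<^sub>L (amp b o\<^sub>L (amp (op_adj (S \<mu>)) o\<^sub>L Y)))"
    unfolding GYG minus_one_power_scaleC by simp
  finally show ?thesis by (simp add: Y_def flip: blinfun_compose_assoc amp_compose)
qed

lemma \<iota>_mh: "\<iota> (mh \<mu> \<nu>) = amp (S \<mu> o\<^sub>L op_adj (S \<nu>)) o\<^sub>L op_pow flip_op (parity \<mu> + parity \<nu>)"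
  by (simp add: f(2) f_eq)

lemma \<rho>\<^sub>0_eq:
  assumes "b \<in> bounded_ops"
  shows "S \<mu> o\<^sub>L b o\<^sub>L op_adj (S \<mu>) = \<rho>\<^sub>0 b o\<^sub>L f \<mu> \<mu>"
  by (simp add: f_eq \<rho>\<^sub>0_S[OF assms] flip: blinfun_compose_assoc)

text \<open>On the even component the terms are \<open>\<rho>\<^sub>0 b\<close> times the diagonal
  units, which sum to 1. On the odd component the signs (-1)^(s + |\<mu>|) reassemble (-1)^s times
  Gamma(-1), the operator that accompanies \<open>flip_op\<close> in
  \<open>\<rho> flip_op\<close>.\<close>

lemma \<rho>_eq:
  assumes y: "y \<in> R1"
  shows "\<rho> y = (\<Sum>\<mu>\<in>UNIV. Sh \<mu> o\<^sub>L y o\<^sub>L op_adj (Sh \<mu>))"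
proof -
  obtain b c where bc: "b \<in> bounded_ops" "c \<in> bounded_ops" "y = amp b + (amp c o\<^sub>L flip_op)"
    using y by (rule R1E)
  have 0: "Sh \<mu> o\<^sub>L amp b o\<^sub>L op_adj (Sh \<mu>) = amp (\<rho>\<^sub>0 b o\<^sub>L f \<mu> \<mu>)" for \<mu>
    using Sh_amp_flip[of \<mu> b 0] by (simp add: \<rho>\<^sub>0_eq[OF bc(1)])
  have 1: "Sh \<mu> o\<^sub>L (amp c o\<^sub>L flip_op) o\<^sub>L op_adj (Sh \<mu>) = (- 1) ^ (s + parity \<mu>) *\<^sub>C (amp (\<rho>\<^sub>0 c o\<^sub>L f \<mu> \<mu>) o\<^sub>L flip_op)" for \<mu>
    using Sh_amp_flip[of \<mu> c 1] by (simp add: \<rho>\<^sub>0_eq[OF bc(2)] op_pow_Suc)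
  have "(\<Sum>\<mu>\<in>UNIV. Sh \<mu> o\<^sub>L y o\<^sub>L op_adj (Sh \<mu>)) =
      (\<Sum>\<mu>\<in>UNIV. amp (\<rho>\<^sub>0 b o\<^sub>L f \<mu> \<mu>)) + (\<Sum>\<mu>\<in>UNIV. (- 1) ^ (s + parity \<mu>) *\<^sub>C (amp (\<rho>\<^sub>0 c o\<^sub>L f \<mu> \<mu>) o\<^sub>L flip_op))"
    unfolding bc(3) blinfun_compose_add_left blinfun_compose_add_right sum.distrib 0 1 ..
  also have "(\<Sum>\<mu>\<in>UNIV. amp (\<rho>\<^sub>0 b o\<^sub>L f \<mu> \<mu>)) = amp (\<rho>\<^sub>0 b)"
    by (simp add: amp_sum[symmetric] blinfun_compose_sum_right[symmetric] f_sum)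
  also have "(\<Sum>\<mu>\<in>UNIV. (- 1) ^ (s + parity \<mu>) *\<^sub>C (amp (\<rho>\<^sub>0 c o\<^sub>L f \<mu> \<mu>) o\<^sub>L flip_op)) = \<rho> (amp c) o\<^sub>L \<rho> flip_op"
    unfolding \<rho>_flip_eq \<iota>_gh \<rho>\<^sub>0(2)[OF bc(2)]
    by (simp add: amp_sum amp_scaleC blinfun_compose_sum_left blinfun_compose_sum_right scaleC_sum_right scaleC_scaleC
        blinfun_compose_scaleC_right \<rho>\<^sub>0(1)[OF bc(2)] power_add f flip: amp_compose blinfun_compose_assoc)
  also have "amp (\<rho>\<^sub>0 b) + (\<rho> (amp c) o\<^sub>L \<rho> flip_op) = \<rho> y"
    using bc by (simp add: \<rho>_hom \<rho>\<^sub>0(2))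
  finally show ?thesis by simp
qed

lemma \<rho>_power:
  assumes "x \<in> M"
  shows "((\<lambda>y. \<Sum>\<mu>\<in>UNIV. Sh \<mu> o\<^sub>L y o\<^sub>L op_adj (Sh \<mu>)) ^^ n) (\<iota> x) = \<iota> ((\<beta> ^^ n) x)"
  by (induction n) (simp_all add: assms \<rho>_\<iota> \<beta>_power_M \<iota>_R1 flip: \<rho>_eq)

lemma \<beta>_op_prod: "(\<And>x. x \<in> set xs \<Longrightarrow> x \<in> bounded_ops) \<Longrightarrow> op_prod xs \<in> bounded_ops \<and> \<beta> (op_prod xs) = op_prod (map \<beta> xs)"
  by (induction xs) (simp_all add: \<beta>_hom(3) op_star_iso_one[OF \<beta>_bounded_iso])

text \<open>Site 0 is split off on the left; the remaining product is the translate of a product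
  over one site less, hence \<open>\<mu>\<close> and \<open>\<nu>\<close> are generalised.
  Membership in \<open>M\<close> is carried along for the homomorphism rules of
  \<open>\<iota>\<close>.\<close>

lemma product_formula_aux:
  "op_prod (map (\<lambda>k. (\<beta> ^^ k) (mh (\<mu> k) (\<nu> k))) [0..<n]) \<in> M \<and>
   \<iota> (op_prod (map (\<lambda>k. (\<beta> ^^ k) (mh (\<mu> k) (\<nu> k))) [0..<n])) =
    (- 1) ^ (\<Sum>k<n. (parity (\<mu> k) + parity (\<nu> k)) * (\<Sum>j<k. s + parity (\<nu> j))) *\<^sub>C
    (amp (op_prod (map (\<lambda>k. S (\<mu> k)) [0..<n] @ map (\<lambda>k. op_adj (S (\<nu> k))) (rev [0..<n])))
      o\<^sub>L op_pow flip_op (\<Sum>i<n. parity (\<mu> i) + parity (\<nu> i)))"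
proof (induction n arbitrary: \<mu> \<nu>)
  case 0
  then show ?case by (simp add: M_closed \<iota>_id)
next
  case (Suc n)
  define \<mu>' where "\<mu>' k = \<mu> (Suc k)" for k
  define \<nu>' where "\<nu>' k = \<nu> (Suc k)" for k
  define x where "x = op_prod (map (\<lambda>k. (\<beta> ^^ k) (mh (\<mu>' k) (\<nu>' k))) [0..<n])"
  define r where "r = (\<Sum>k<n. (parity (\<mu>' k) + parity (\<nu>' k)) * (\<Sum>j<k. s + parity (\<nu>' j)))"
  define i where "i = (\<Sum>i<n. parity (\<mu>' i) + parity (\<nu>' i))"
  define b where "b = op_prod (map (\<lambda>k. S (\<mu>' k)) [0..<n] @ map (\<lambda>k. op_adj (S (\<nu>' k))) (rev [0..<n]))"
  have x: "x \<in> M" "\<iota> x = (- 1) ^ r *\<^sub>C (amp b o\<^sub>L op_pow flip_op i)"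
    using Suc[of \<mu>' \<nu>'] unfolding x_def r_def i_def b_def by blast+
  have "\<beta> x = op_prod (map (\<lambda>k. (\<beta> ^^ Suc k) (mh (\<mu>' k) (\<nu>' k))) [0..<n])"
    unfolding x_def by (subst \<beta>_op_prod[THEN conjunct2]) (auto simp: \<beta>_power_bounded_ops mh_bounded_ops comp_def)
  then have prod: "op_prod (map (\<lambda>k. (\<beta> ^^ k) (mh (\<mu> k) (\<nu> k))) [0..<Suc n]) = mh (\<mu> 0) (\<nu> 0) o\<^sub>L \<beta> x"
    by (simp add: upt_0_Suc comp_def \<mu>'_def \<nu>'_def del: upt_Suc)
  have S_prod: "op_prod (map (\<lambda>k. S (\<mu> k)) [0..<Suc n] @ map (\<lambda>k. op_adj (S (\<nu> k))) (rev [0..<Suc n])) =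
      S (\<mu> 0) o\<^sub>L b o\<^sub>L op_adj (S (\<nu> 0))"
    by (simp add: upt_0_Suc comp_def \<mu>'_def \<nu>'_def b_def op_prod_append blinfun_compose_assoc rev_map del: upt_Suc)
  define e where "e = parity (\<mu> 0) + parity (\<nu> 0)"
  have sum1: "(\<Sum>i<Suc n. parity (\<mu> i) + parity (\<nu> i)) = e + i"
    unfolding sum.lessThan_Suc_shift by (simp add: e_def i_def \<mu>'_def \<nu>'_def)
  \<comment> \<open>The first summand collects the \<open>j = 0\<close> terms of all inner sums; the
    rest, reindexed, is the exponent of the induction hypothesis.\<close>
  have sum2: "(\<Sum>k<Suc n. (parity (\<mu> k) + parity (\<nu> k)) * (\<Sum>j<k. s + parity (\<nu> j))) = (s + parity (\<nu> 0)) * i + r"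
    unfolding sum.lessThan_Suc_shift
    by (simp add: i_def r_def \<mu>'_def \<nu>'_def sum.distrib sum_distrib_left algebra_simps del: sum.lessThan_Suc)
  have "\<iota> (mh (\<mu> 0) (\<nu> 0) o\<^sub>L \<beta> x) = \<iota> (mh (\<mu> 0) (\<nu> 0)) o\<^sub>L \<rho> (\<iota> x)"
    by (simp add: \<iota>_hom(3) mh_M \<beta>_M x(1) \<rho>_\<iota>)
  also have "\<rho> (\<iota> x) = (\<Sum>\<mu>\<in>UNIV. (- 1) ^ (r + (s + parity \<mu>) * i) *\<^sub>C
      (amp (S \<mu> o\<^sub>L b o\<^sub>L op_adj (S \<mu>)) o\<^sub>L op_pow flip_op i))"
  proof -
    have "Sh \<mu> o\<^sub>L \<iota> x o\<^sub>L op_adj (Sh \<mu>) = (- 1) ^ r *\<^sub>C (Sh \<mu> o\<^sub>L (amp b o\<^sub>L op_pow flip_op i) o\<^sub>L op_adj (Sh \<mu>))" for \<mu>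
      unfolding x(2) minus_one_power_scaleC by simp
    then show ?thesis
      unfolding \<rho>_eq[OF \<iota>_R1[OF x(1)]] Sh_amp_flip by (simp add: scaleC_scaleC power_add)
  qed
  \<comment> \<open>Orthogonality of the isometries keeps only the term with index
    \<open>\<nu> 0\<close>, and its sign is the one that \<open>sum2\<close> adds.\<close>
  also have "\<iota> (mh (\<mu> 0) (\<nu> 0)) o\<^sub>L (\<Sum>\<mu>\<in>UNIV. (- 1) ^ (r + (s + parity \<mu>) * i) *\<^sub>C
      (amp (S \<mu> o\<^sub>L b o\<^sub>L op_adj (S \<mu>)) o\<^sub>L op_pow flip_op i)) =
      (\<Sum>\<mu>'\<in>UNIV. if \<mu>' = \<nu> 0 then (- 1) ^ (r + (s + parity (\<nu> 0)) * i) *\<^sub>C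
        (amp (S (\<mu> 0) o\<^sub>L b o\<^sub>L op_adj (S (\<nu> 0))) o\<^sub>L op_pow flip_op (e + i)) else 0)"
    unfolding blinfun_compose_sum_right
  proof (intro sum.cong refl)
    fix \<kappa>'
    have "\<iota> (mh (\<mu> 0) (\<nu> 0)) o\<^sub>L (- 1) ^ (r + (s + parity \<kappa>') * i) *\<^sub>C
        (amp (S \<kappa>' o\<^sub>L b o\<^sub>L op_adj (S \<kappa>')) o\<^sub>L op_pow flip_op i) =
      (- 1) ^ (r + (s + parity \<kappa>') * i) *\<^sub>C (amp (S (\<mu> 0) o\<^sub>L (op_adj (S (\<nu> 0)) o\<^sub>L S \<kappa>') o\<^sub>L b o\<^sub>L op_adj (S \<kappa>'))
         o\<^sub>L op_pow flip_op (e + i))"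
      using amp_flip_pow_mult[of "S (\<mu> 0) o\<^sub>L op_adj (S (\<nu> 0))" e "S \<kappa>' o\<^sub>L b o\<^sub>L op_adj (S \<kappa>')" i]
      unfolding blinfun_compose_scaleC_right[OF R1_bounded_ops[OF \<iota>_R1[OF mh_M]]] unfolding \<iota>_mh
      by (simp only: e_def blinfun_compose_assoc)
    then show "\<iota> (mh (\<mu> 0) (\<nu> 0)) o\<^sub>L (- 1) ^ (r + (s + parity \<kappa>') * i) *\<^sub>C
        (amp (S \<kappa>' o\<^sub>L b o\<^sub>L op_adj (S \<kappa>')) o\<^sub>L op_pow flip_op i) =
      (if \<kappa>' = \<nu> 0 then (- 1) ^ (r + (s + parity (\<nu> 0)) * i) *\<^sub>C
        (amp (S (\<mu> 0) o\<^sub>L b o\<^sub>L op_adj (S (\<nu> 0))) o\<^sub>L op_pow flip_op (e + i)) else 0)"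
      by (auto simp: S_orthogonal)
  qed
  finally show ?case
    unfolding prod S_prod sum1 sum2 by (simp add: M_closed mh_M \<beta>_M x(1) add.commute)
qed

end

section \<open>Symmetry\<close>

text \<open>The adjoint is the inverse, and the inverse of an antilinear map is antilinear.\<close>

lemma antilinear_adj:
  assumes V: "V \<in> antilinear_ops" "op_adj V o\<^sub>L V = id_blinfun" "V o\<^sub>L op_adj V = id_blinfun"
  shows "op_adj V (c *\<^sub>C x) = cnj c *\<^sub>C op_adj V x"
proof -
  have inv: "op_adj V (V y) = y" "V (op_adj V y) = y" for y
    using arg_cong[OF V(2), of "\<lambda>T. blinfun_apply T y"] arg_cong[OF V(3), of "\<lambda>T. blinfun_apply T y"] by simp_all
  have "V (cnj c *\<^sub>C op_adj V x) = c *\<^sub>C x" using V(1) by (simp add: antilinear_ops_def inv)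
  from arg_cong[OF this, of "op_adj V"] show ?thesis by (simp add: inv)
qed

lemma conjugate_bounded_ops:
  assumes V: "V \<in> bounded_ops \<or> V \<in> antilinear_ops" "op_adj V o\<^sub>L V = id_blinfun" "V o\<^sub>L op_adj V = id_blinfun"
    and b: "b \<in> bounded_ops"
  shows "V o\<^sub>L b o\<^sub>L op_adj V \<in> bounded_ops" "op_adj V o\<^sub>L b o\<^sub>L V \<in> bounded_ops"
proof -
  have "V o\<^sub>L b o\<^sub>L op_adj V \<in> bounded_ops \<and> op_adj V o\<^sub>L b o\<^sub>L V \<in> bounded_ops"
    using V(1)
  proof
    assume "V \<in> bounded_ops" then show ?thesis using b by simp
  next
    assume V1: "V \<in> antilinear_ops"
    then show ?thesis
      using antilinear_adj[OF V1 V(2,3)] b by (simp add: bounded_ops_def antilinear_ops_def)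
  qed
  then show "V o\<^sub>L b o\<^sub>L op_adj V \<in> bounded_ops" "op_adj V o\<^sub>L b o\<^sub>L V \<in> bounded_ops" by blast+
qed

text \<open>\<open>c'\<close> is \<open>c\<close> or its conjugate; leaving it abstract treats
  unitary and antiunitary \<open>V\<close> together.\<close>

lemma conjugate_scaleC:
  assumes "V \<in> bounded_ops \<or> V \<in> antilinear_ops"
  shows "\<exists>c'. \<forall>b. V o\<^sub>L (c *\<^sub>C b) o\<^sub>L op_adj V = c' *\<^sub>C (V o\<^sub>L b o\<^sub>L op_adj V)"
  using assms
proof
  assume "V \<in> bounded_ops"
  then show ?thesis by (intro exI[of _ c]) (simp add: blinfun_compose_scaleC_right)
next
  assume "V \<in> antilinear_ops"
  then show ?thesis
    by (intro exI[of _ "cnj c"] allI blinfun_eqI) (simp add: antilinear_ops_def scaleC_blinfun.rep_eq)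
qed

lemma l2_comp_blinfun:
  fixes u :: "'d::finite cvec \<Rightarrow>\<^sub>L 'd cvec"
  assumes "f \<in> l2"
  shows "(\<lambda>x. u (f x)) \<in> l2"
  unfolding l2_def mem_Collect_eq
proof (rule summable_on_comparison_test)
  show "(\<lambda>x. (norm u)\<^sup>2 * (norm (f x))\<^sup>2) summable_on UNIV"
    using assms by (intro summable_on_cmult_right) (simp add: l2_def)
  show "(norm (u (f x)))\<^sup>2 \<le> (norm u)\<^sup>2 * (norm (f x))\<^sup>2" for x
    unfolding power_mult_distrib[symmetric] by (intro power_mono norm_blinfun) simp
qed simp

lemma Ad_compose:
  assumes "op_adj V o\<^sub>L V = id_blinfun"
  shows "Ad V (x o\<^sub>L y) = Ad V x o\<^sub>L Ad V y"
proof -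
  have "Ad V x o\<^sub>L Ad V y = V o\<^sub>L x o\<^sub>L (op_adj V o\<^sub>L V) o\<^sub>L y o\<^sub>L op_adj V"
    by (simp only: Ad_def blinfun_compose_assoc)
  then show ?thesis by (simp add: assms Ad_def blinfun_compose_assoc)
qed

context translation_isometries
begin

lemma Sh_orthogonal: "op_adj (Sh \<nu>) o\<^sub>L Sh \<mu> = (if \<mu> = \<nu> then id_blinfun else 0)"
proof -
  have "op_adj (Sh \<nu>) o\<^sub>L Sh \<mu> = op_pow grading_op (s + parity \<nu>) o\<^sub>L amp (op_adj (S \<nu>) o\<^sub>L S \<mu>) o\<^sub>L op_pow grading_op (s + parity \<mu>)"
    by (simp add: Sh_def blinfun_compose_assoc flip: amp_compose)
  then show ?thesis by (simp add: S_orthogonal)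
qed

lemma \<rho>_Sh: "y \<in> R1 \<Longrightarrow> \<rho> y o\<^sub>L Sh \<mu> = Sh \<mu> o\<^sub>L y"
proof -
  assume y: "y \<in> R1"
  have "\<rho> y o\<^sub>L Sh \<mu> = (\<Sum>\<mu>'\<in>UNIV. if \<mu>' = \<mu> then Sh \<mu> o\<^sub>L y else 0)"
    unfolding \<rho>_eq[OF y] blinfun_compose_sum_left blinfun_compose_assoc Sh_orthogonal
    by (intro sum.cong) auto
  then show ?thesis by simp
qed

lemma Sh_\<rho>: "y \<in> R1 \<Longrightarrow> op_adj (Sh \<mu>) o\<^sub>L \<rho> y = y o\<^sub>L op_adj (Sh \<mu>)"
proof -
  assume y: "y \<in> R1"
  have "op_adj (Sh \<mu>) o\<^sub>L \<rho> y = (\<Sum>\<mu>'\<in>UNIV. (op_adj (Sh \<mu>) o\<^sub>L Sh \<mu>') o\<^sub>L (y o\<^sub>L op_adj (Sh \<mu>')))"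
    unfolding \<rho>_eq[OF y] blinfun_compose_sum_right by (simp only: blinfun_compose_assoc)
  also have "\<dots> = (\<Sum>\<mu>'\<in>UNIV. if \<mu>' = \<mu> then y o\<^sub>L op_adj (Sh \<mu>) else 0)"
    unfolding Sh_orthogonal by (intro sum.cong) auto
  finally show ?thesis by simp
qed

text \<open>The generators are odd. For even n, \<open>amp b\<close> is central and even, hence
  scalar. For odd n, \<open>amp b\<close> anticommutes with the generators; times
  \<open>\<Gamma>\<close> it falls into the commutant of the half-chain and so commutes with the odd
  central \<open>u\<close>. Since \<open>u\<close> commutes with \<open>amp b\<close> but
  anticommutes with \<open>\<Gamma>\<close>, this forces \<open>b = 0\<close>.\<close>

lemma scalar_if_commutes:
  assumes b: "b \<in> bounded_ops"
    and gen: "\<And>f y. f \<in> l2 \<Longrightarrow> (\<And>x. x < 0 \<Longrightarrow> f x = 0) \<Longrightarrow> y \<in> {\<pi> (a f), op_adj (\<pi> (a f))} \<Longrightarrow>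
      \<iota> y o\<^sub>L (amp b o\<^sub>L op_pow grading_op n) = (amp b o\<^sub>L op_pow grading_op n) o\<^sub>L \<iota> y"
  shows "\<exists>c. b = c *\<^sub>C id_blinfun"
proof -
  define z where "z = j (amp b)"
  have z: "z \<in> M" "\<iota> z = amp b" using b by (simp_all add: z_def j_M \<iota>_j)
  show ?thesis
  proof (cases "even n")
    case True
    have comm: "z o\<^sub>L y = y o\<^sub>L z" if f: "f \<in> l2" "\<And>x. x < 0 \<Longrightarrow> f x = 0" and y: "y \<in> {\<pi> (a f), op_adj (\<pi> (a f))}"
      for f y
    proof -
      have yM: "y \<in> M" using y \<pi>_M[OF right_alg_generator[OF f]] M_closed by auto
      show ?thesis
        using gen[OF f y] True by (intro \<iota>_inj M_closed z yM) (simp_all add: \<iota>_hom(3) z yM op_pow_grading)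
    qed
    have "z \<in> commutant (\<pi> ` right_alg a)"
      by (rule in_commutant_right[OF M_bounded_ops[OF z(1)]]) (rule comm, assumption, assumption, simp)+
    then have "z o\<^sub>L x = x o\<^sub>L z" if "x \<in> M" for x using M_commute[OF that] by simp
    then obtain c d where "\<iota> z = c *\<^sub>C id_blinfun + d *\<^sub>C flip_op" by (rule center_scalar[OF z(1)])
    then have "amp (b - c *\<^sub>C id_blinfun) + (amp (- (d *\<^sub>C id_blinfun)) o\<^sub>L flip_op) = 0"
      using amp_add[of "b - c *\<^sub>C id_blinfun" "c *\<^sub>C id_blinfun"] by (simp add: z amp_minus amp_scaleC)
    then have "b - c *\<^sub>C id_blinfun = 0" by (rule amp_flip_zero)
    then show ?thesis by auto
  next
    case False
    have comm: "(z o\<^sub>L \<Gamma>) o\<^sub>L y = y o\<^sub>L (z o\<^sub>L \<Gamma>)"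
      if f: "f \<in> l2" "\<And>x. x < 0 \<Longrightarrow> f x = 0" and y: "y \<in> {\<pi> (a f), op_adj (\<pi> (a f))}" for f y
    proof -
      have yM: "y \<in> M" using y \<pi>_M[OF right_alg_generator[OF f]] M_closed by auto
      have \<Gamma>y: "\<Gamma> o\<^sub>L y = - (y o\<^sub>L \<Gamma>)" using y \<Gamma>_a[OF f(1)] \<Gamma>_adj_a[OF f(1)] by auto
      then have "Ad grading_op (\<iota> y) = - \<iota> y" using \<iota>_\<Gamma>[OF yM, of "-1"] by simp
      then have "(grading_op o\<^sub>L \<iota> y o\<^sub>L grading_op) o\<^sub>L grading_op = - \<iota> y o\<^sub>L grading_op" by (simp add: Ad_def)
      then have gr: "grading_op o\<^sub>L \<iota> y = - (\<iota> y o\<^sub>L grading_op)" by (simp add: blinfun_compose_assoc)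
      have "\<iota> y o\<^sub>L (amp b o\<^sub>L grading_op) = (amp b o\<^sub>L grading_op) o\<^sub>L \<iota> y"
        using gen[OF f y] False by (simp add: op_pow_grading)
      then have "(\<iota> y o\<^sub>L amp b) o\<^sub>L grading_op = - (amp b o\<^sub>L \<iota> y) o\<^sub>L grading_op"
        by (simp add: blinfun_compose_assoc gr)
      then have "((\<iota> y o\<^sub>L amp b) o\<^sub>L grading_op) o\<^sub>L grading_op = (- (amp b o\<^sub>L \<iota> y) o\<^sub>L grading_op) o\<^sub>L grading_op" by simp
      then have "\<iota> y o\<^sub>L amp b = - (amp b o\<^sub>L \<iota> y)" by (simp add: blinfun_compose_assoc)
      then have "\<iota> (y o\<^sub>L z) = \<iota> (- (z o\<^sub>L y))"
        using \<iota>_hom(2)[of "z o\<^sub>L y" "-1"] z yM by (simp add: \<iota>_hom(3) M_closed)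
      then have "y o\<^sub>L z = - (z o\<^sub>L y)" by (intro \<iota>_inj M_closed z yM)
      then show ?thesis by (simp add: blinfun_compose_assoc \<Gamma>y) (simp flip: blinfun_compose_assoc)
    qed
    have "z o\<^sub>L \<Gamma> \<in> commutant (\<pi> ` right_alg a)"
      by (rule in_commutant_right) (simp add: M_bounded_ops[OF z(1)] \<Gamma>_bounded_ops, (rule comm, assumption, assumption, simp)+)
    define u where "u = j flip_op"
    have u: "u \<in> M" "\<iota> u = flip_op" by (simp_all add: u_def j_M \<iota>_j)
    have \<Gamma>u: "\<Gamma> o\<^sub>L u = - (u o\<^sub>L \<Gamma>)"
      using \<Gamma>_j_flip[of id_blinfun] by (simp add: u_def)
    have zu: "z o\<^sub>L u = u o\<^sub>L z"
      by (intro \<iota>_inj M_closed z u) (simp add: \<iota>_hom(3) z u flip_amp)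
    have "u o\<^sub>L (z o\<^sub>L \<Gamma>) = (z o\<^sub>L \<Gamma>) o\<^sub>L u"
      by (rule M_commute[OF u(1)]) fact
    also have "\<dots> = - ((u o\<^sub>L z) o\<^sub>L \<Gamma>)" by (simp add: blinfun_compose_assoc \<Gamma>u zu[symmetric])
    finally have "(u o\<^sub>L z) o\<^sub>L \<Gamma> = (- (u o\<^sub>L z)) o\<^sub>L \<Gamma>" by (simp add: blinfun_compose_assoc)
    then have neg: "u o\<^sub>L z = - (u o\<^sub>L z)" by (simp only: compose_\<Gamma>_cancel)
    have "2 *\<^sub>R (u o\<^sub>L z) = 0"
      unfolding scaleR_2 using neg by (simp only: eq_neg_iff_add_eq_0)
    then have "u o\<^sub>L z = 0" by simp
    then have "\<iota> (u o\<^sub>L z) = 0" by (simp add: \<iota>_zero)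
    then have "flip_op o\<^sub>L amp b = 0" by (simp add: \<iota>_hom(3) z u)
    then have "amp 0 + (amp b o\<^sub>L flip_op) = 0" by (simp add: flip_amp)
    then have "b = 0" by (rule amp_flip_zero)
    then show ?thesis by (intro exI[of _ 0]) simp
  qed
qed

lemma symmetry:
  fixes U :: "'d cvec \<Rightarrow>\<^sub>L 'd cvec" and V :: "('k ^ 2) \<Rightarrow>\<^sub>L ('k ^ 2)"
  assumes \<alpha>: "bogoliubov a r (\<lambda>f x. U (f x)) \<alpha>" and U: "surj (blinfun_apply U)"
    and cov: "\<And>A. A \<in> right_alg a \<Longrightarrow> \<iota> (\<pi> (\<alpha> A)) = Ad V (\<iota> (\<pi> A))"
    and V: "op_adj V o\<^sub>L V = id_blinfun" "V o\<^sub>L op_adj V = id_blinfun" "V = V0 \<otimes>\<^sub>o V1"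
    and V0: "V0 \<in> bounded_ops \<or> V0 \<in> antilinear_ops" "op_adj V0 o\<^sub>L V0 = id_blinfun" "V0 o\<^sub>L op_adj V0 = id_blinfun"
    and V_flip: "Ad V flip_op = (- 1) ^ k *\<^sub>C flip_op"
    and V_grading: "Ad V grading_op = (- 1) ^ k *\<^sub>C grading_op"
  shows "\<exists>c. cmod c = 1 \<and> (\<forall>\<nu>. (- 1) ^ (k * parity \<nu>) *\<^sub>C
      (\<Sum>\<mu>\<in>UNIV. cinner (fock_basis \<mu>) (second_quant r U (fock_basis \<nu>)) *\<^sub>C S \<mu>) =
      c *\<^sub>C (V0 o\<^sub>L S \<nu> o\<^sub>L op_adj V0))"
proof -
  have V_amp: "V o\<^sub>L amp b = amp (V0 o\<^sub>L b o\<^sub>L op_adj V0) o\<^sub>L V" if b: "b \<in> bounded_ops" for b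
  proof -
    have "amp (V0 o\<^sub>L b o\<^sub>L op_adj V0) o\<^sub>L V = (V0 o\<^sub>L b o\<^sub>L op_adj V0 o\<^sub>L V0) \<otimes>\<^sub>o V1"
      unfolding V(3) by (rule amp_tensor[OF conjugate_bounded_ops(1)[OF V0 b]])
    also have "\<dots> = V o\<^sub>L amp b" by (simp add: V(3) tensor_amp V0(2) blinfun_compose_assoc)
    finally show ?thesis by simp
  qed
  have Ad_amp: "Ad V (amp b) = amp (V0 o\<^sub>L b o\<^sub>L op_adj V0)" if "b \<in> bounded_ops" for b
    using V_amp[OF that] by (simp add: Ad_def blinfun_compose_assoc V(2))
  have V'_amp: "op_adj V o\<^sub>L amp b o\<^sub>L V = amp (op_adj V0 o\<^sub>L b o\<^sub>L V0)" if b: "b \<in> bounded_ops" for b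
  proof -
    have "V0 o\<^sub>L (op_adj V0 o\<^sub>L b o\<^sub>L V0) o\<^sub>L op_adj V0 = (V0 o\<^sub>L op_adj V0) o\<^sub>L b o\<^sub>L (V0 o\<^sub>L op_adj V0)"
      by (simp only: blinfun_compose_assoc)
    then have "V o\<^sub>L amp (op_adj V0 o\<^sub>L b o\<^sub>L V0) = amp b o\<^sub>L V"
      using V_amp[OF conjugate_bounded_ops(2)[OF V0 b]] by (simp add: V0(3))
    then have "op_adj V o\<^sub>L (amp b o\<^sub>L V) = (op_adj V o\<^sub>L V) o\<^sub>L amp (op_adj V0 o\<^sub>L b o\<^sub>L V0)"
      by (simp add: blinfun_compose_assoc)
    then show ?thesis by (simp add: V(1) blinfun_compose_assoc)
  qed
  \<comment> \<open>The sign is left open because it does not affect commutation relations.\<close>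
  have V_gr: "op_adj V o\<^sub>L op_pow grading_op n o\<^sub>L V = op_pow grading_op n \<or>
      op_adj V o\<^sub>L op_pow grading_op n o\<^sub>L V = - op_pow grading_op n" for n
  proof -
    have "V o\<^sub>L grading_op o\<^sub>L op_adj V = grading_op \<or> V o\<^sub>L grading_op o\<^sub>L op_adj V = - grading_op"
      using V_grading unfolding Ad_def minus_one_power_scaleC by (auto split: if_splits)
    moreover have "grading_op = op_adj V o\<^sub>L (V o\<^sub>L grading_op o\<^sub>L op_adj V) o\<^sub>L V"
    proof -
      have "op_adj V o\<^sub>L (V o\<^sub>L grading_op o\<^sub>L op_adj V) o\<^sub>L V = (op_adj V o\<^sub>L V) o\<^sub>L grading_op o\<^sub>L (op_adj V o\<^sub>L V)"
        by (simp only: blinfun_compose_assoc)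
      then show ?thesis by (simp add: V(1))
    qed
    ultimately have "op_adj V o\<^sub>L grading_op o\<^sub>L V = grading_op \<or> op_adj V o\<^sub>L grading_op o\<^sub>L V = - grading_op"
      by (metis blinfun_compose_minus_left blinfun_compose_minus_right minus_equation_iff)
    then show ?thesis by (simp add: op_pow_grading V(1))
  qed
  \<comment> \<open>\<open>Sh\<close> intertwines the identity with \<open>\<rho>\<close>, and
    \<open>\<rho>\<close> commutes with \<open>Ad V\<close> at \<open>y\<close>, so \<open>y\<close>
    passes through all four factors.\<close>
  have intertwine: "y o\<^sub>L (op_adj (Sh \<nu>) o\<^sub>L op_adj V o\<^sub>L Sh \<mu> o\<^sub>L V) = (op_adj (Sh \<nu>) o\<^sub>L op_adj V o\<^sub>L Sh \<mu> o\<^sub>L V) o\<^sub>L y"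
    if y: "y \<in> R1" "Ad V y \<in> R1" "\<rho> (Ad V y) = Ad V (\<rho> y)" for y \<mu> \<nu>
  proof -
    have V'V: "op_adj V o\<^sub>L (V o\<^sub>L T) = T" for T :: "('k ^ 2) \<Rightarrow>\<^sub>L ('k ^ 2)"
      using V(1) by (simp flip: blinfun_compose_assoc)
    have VV': "op_adj V o\<^sub>L \<rho> (Ad V y) = \<rho> y o\<^sub>L op_adj V"
      unfolding y(3) by (simp add: Ad_def blinfun_compose_assoc V'V)
    have "y o\<^sub>L (op_adj (Sh \<nu>) o\<^sub>L op_adj V o\<^sub>L Sh \<mu> o\<^sub>L V) = op_adj (Sh \<nu>) o\<^sub>L (\<rho> y o\<^sub>L (op_adj V o\<^sub>L (Sh \<mu> o\<^sub>L V)))"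
      by (simp only: blinfun_compose_assoc compose_swap[OF Sh_\<rho>[OF y(1)]])
    also have "\<dots> = op_adj (Sh \<nu>) o\<^sub>L (op_adj V o\<^sub>L (\<rho> (Ad V y) o\<^sub>L (Sh \<mu> o\<^sub>L V)))"
      by (simp only: compose_swap[OF VV'])
    also have "\<dots> = op_adj (Sh \<nu>) o\<^sub>L (op_adj V o\<^sub>L (Sh \<mu> o\<^sub>L (Ad V y o\<^sub>L V)))"
      by (simp only: compose_swap[OF \<rho>_Sh[OF y(2)]])
    also have "Ad V y o\<^sub>L V = V o\<^sub>L y" by (simp add: Ad_def blinfun_compose_assoc V(1))
    finally show ?thesis by (simp only: blinfun_compose_assoc)
  qed
  have scalar: "\<exists>c. op_adj (S \<nu>) o\<^sub>L (op_adj V0 o\<^sub>L S \<mu> o\<^sub>L V0) = c *\<^sub>C id_blinfun" for \<mu> \<nu>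
  proof (rule scalar_if_commutes)
    define b where "b = op_adj (S \<nu>) o\<^sub>L (op_adj V0 o\<^sub>L S \<mu> o\<^sub>L V0)"
    define n where "n = (s + parity \<nu>) + (s + parity \<mu>)"
    show "op_adj (S \<nu>) o\<^sub>L (op_adj V0 o\<^sub>L S \<mu> o\<^sub>L V0) \<in> bounded_ops"
      by (intro bounded_ops_compose bounded_ops_adj S_bounded_ops conjugate_bounded_ops[OF V0])
    have VV': "V o\<^sub>L (op_adj V o\<^sub>L T) = T" for T :: "('k ^ 2) \<Rightarrow>\<^sub>L ('k ^ 2)"
      using V(2) by (simp flip: blinfun_compose_assoc)
    have "op_adj (Sh \<nu>) o\<^sub>L op_adj V o\<^sub>L Sh \<mu> o\<^sub>L V = op_pow grading_op (s + parity \<nu>) o\<^sub>L (amp (op_adj (S \<nu>)) o\<^sub>L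
        ((op_adj V o\<^sub>L amp (S \<mu>) o\<^sub>L V) o\<^sub>L (op_adj V o\<^sub>L op_pow grading_op (s + parity \<mu>) o\<^sub>L V)))"
      by (simp add: Sh_def blinfun_compose_assoc VV')
    also have "\<dots> = op_pow grading_op (s + parity \<nu>) o\<^sub>L (amp b o\<^sub>L (op_adj V o\<^sub>L op_pow grading_op (s + parity \<mu>) o\<^sub>L V))"
      unfolding V'_amp[OF S_bounded_ops] by (simp add: b_def flip: blinfun_compose_assoc)
    also have "\<dots> = amp b o\<^sub>L (op_pow grading_op (s + parity \<nu>) o\<^sub>L (op_adj V o\<^sub>L op_pow grading_op (s + parity \<mu>) o\<^sub>L V))"
      by (rule compose_swap[OF op_pow_grading_amp])
    finally have Q: "op_adj (Sh \<nu>) o\<^sub>L op_adj V o\<^sub>L Sh \<mu> o\<^sub>L V = amp b o\<^sub>L op_pow grading_op n \<or>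
       op_adj (Sh \<nu>) o\<^sub>L op_adj V o\<^sub>L Sh \<mu> o\<^sub>L V = - (amp b o\<^sub>L op_pow grading_op n)"
      using V_gr[of "s + parity \<mu>"] by (auto simp: n_def op_pow_add)
    fix f :: "int \<Rightarrow> 'd cvec" and y
    assume f: "f \<in> l2" "\<And>x. x < 0 \<Longrightarrow> f x = 0" and y: "y \<in> {\<pi> (a f), op_adj (\<pi> (a f))}"
    \<comment> \<open>Symmetry and translation are seen to commute on annihilators, where both act
      on the one-particle vector; \<open>scalar_if_commutes\<close> asks for no more.\<close>
    have gen: "\<tau> 1 (\<alpha> (a f)) = \<alpha> (\<tau> 1 (a f))" "\<alpha> (a f) \<in> right_alg a" "a f \<in> right_alg a" "\<tau> 1 (a f) \<in> right_alg a"
    proof -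
      have Uf: "(\<lambda>x. U (f x)) \<in> l2" by (rule l2_comp_blinfun[OF f(1)])
      show "\<tau> 1 (\<alpha> (a f)) = \<alpha> (\<tau> 1 (a f))"
        by (simp add: bogoliubovD(6)[OF \<alpha>] bogoliubovD(6)[OF shift_aut] f(1) Uf shift_l2) (simp add: shift_def)
      show "a f \<in> right_alg a" by (rule right_alg_generator[OF f])
      show "\<alpha> (a f) \<in> right_alg a"
        unfolding bogoliubovD(6)[OF \<alpha> f(1)] by (rule right_alg_generator[OF Uf]) (simp add: f(2))
      show "\<tau> 1 (a f) \<in> right_alg a"
        unfolding bogoliubovD(6)[OF shift_aut f(1)] by (rule right_alg_generator[OF shift_l2[OF f(1)]]) (simp add: shift_def f(2))
    qed
    have main: "\<iota> (\<pi> A) o\<^sub>L (op_adj (Sh \<nu>) o\<^sub>L op_adj V o\<^sub>L Sh \<mu> o\<^sub>L V) = (op_adj (Sh \<nu>) o\<^sub>L op_adj V o\<^sub>L Sh \<mu> o\<^sub>L V) o\<^sub>L \<iota> (\<pi> A)"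
      if A: "A \<in> right_alg a" "\<alpha> A \<in> right_alg a" "\<tau> 1 A \<in> right_alg a" "\<tau> 1 (\<alpha> A) = \<alpha> (\<tau> 1 A)" for A
    proof (rule intertwine)
      show "\<iota> (\<pi> A) \<in> R1" by (intro \<iota>_R1 \<pi>_M A)
      show "Ad V (\<iota> (\<pi> A)) \<in> R1" unfolding cov[OF A(1), symmetric] by (intro \<iota>_R1 \<pi>_M A)
      show "\<rho> (Ad V (\<iota> (\<pi> A))) = Ad V (\<rho> (\<iota> (\<pi> A)))"
        by (simp add: cov[symmetric] A \<rho>_\<iota> \<pi>_M \<beta>)
    qed
    have "\<iota> y o\<^sub>L (op_adj (Sh \<nu>) o\<^sub>L op_adj V o\<^sub>L Sh \<mu> o\<^sub>L V) = (op_adj (Sh \<nu>) o\<^sub>L op_adj V o\<^sub>L Sh \<mu> o\<^sub>L V) o\<^sub>L \<iota> y"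
      using y main[of "a f"] main[of "star (a f)"] gen
      by (auto simp: \<pi>_star bogoliubovD(4)[OF \<alpha>] bogoliubovD(4)[OF shift_aut] local_alg_closed)
    then show "\<iota> y o\<^sub>L (amp (op_adj (S \<nu>) o\<^sub>L (op_adj V0 o\<^sub>L S \<mu> o\<^sub>L V0)) o\<^sub>L op_pow grading_op n) =
        (amp (op_adj (S \<nu>) o\<^sub>L (op_adj V0 o\<^sub>L S \<mu> o\<^sub>L V0)) o\<^sub>L op_pow grading_op n) o\<^sub>L \<iota> y"
      using Q unfolding b_def[symmetric] by auto
  qed
  then obtain x where x: "\<And>\<mu> \<nu>. op_adj (S \<nu>) o\<^sub>L (op_adj V0 o\<^sub>L S \<mu> o\<^sub>L V0) = x \<nu> \<mu> *\<^sub>C id_blinfun" by metis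
  define S2 where "S2 \<mu> = V0 o\<^sub>L S \<mu> o\<^sub>L op_adj V0" for \<mu>
  have S2_orth: "op_adj (S2 \<nu>) o\<^sub>L S2 \<mu> = (if \<mu> = \<nu> then id_blinfun else 0)" for \<mu> \<nu>
  proof -
    have "op_adj (S2 \<nu>) o\<^sub>L S2 \<mu> = V0 o\<^sub>L (op_adj (S \<nu>) o\<^sub>L ((op_adj V0 o\<^sub>L V0) o\<^sub>L (S \<mu> o\<^sub>L op_adj V0)))"
      by (simp add: S2_def blinfun_compose_assoc)
    also have "\<dots> = V0 o\<^sub>L (op_adj (S \<nu>) o\<^sub>L S \<mu>) o\<^sub>L op_adj V0" by (simp add: V0(2) blinfun_compose_assoc)
    finally show ?thesis by (auto simp: S_orthogonal V0(3))
  qed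
  have S2b: "S2 \<mu> \<in> bounded_ops" for \<mu>
    unfolding S2_def by (rule conjugate_bounded_ops(1)[OF V0 S_bounded_ops])
  have "\<forall>c. \<exists>c'. \<forall>b. V0 o\<^sub>L (c *\<^sub>C b) o\<^sub>L op_adj V0 = c' *\<^sub>C (V0 o\<^sub>L b o\<^sub>L op_adj V0)"
    using conjugate_scaleC[OF V0(1)] by blast
  from choice[OF this] obtain conj where
    conj: "\<And>c b. V0 o\<^sub>L (c *\<^sub>C b) o\<^sub>L op_adj V0 = conj c *\<^sub>C (V0 o\<^sub>L b o\<^sub>L op_adj V0)"
    by blast
  define x' where "x' \<nu> \<mu> = conj (x \<nu> \<mu>)" for \<nu> \<mu>
  \<comment> \<open>The scalars are the coefficients of the conjugated \<open>S \<mu>\<close> in the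
    complete family \<open>S\<close>; conjugating the expansion by \<open>V0\<close> turns it into
    one of \<open>S \<mu>\<close> in the family \<open>S2\<close>.\<close>
  have S_S2: "S \<mu> = (\<Sum>\<nu>\<in>UNIV. x' \<nu> \<mu> *\<^sub>C S2 \<nu>)" for \<mu>
  proof -
    have "op_adj V0 o\<^sub>L S \<mu> o\<^sub>L V0 = (\<Sum>\<nu>\<in>UNIV. S \<nu> o\<^sub>L op_adj (S \<nu>)) o\<^sub>L (op_adj V0 o\<^sub>L S \<mu> o\<^sub>L V0)"
      by (simp add: S_sum)
    also have "\<dots> = (\<Sum>\<nu>\<in>UNIV. x \<nu> \<mu> *\<^sub>C S \<nu>)"
      unfolding blinfun_compose_sum_left
      by (intro sum.cong refl) (simp add: blinfun_compose_assoc x[unfolded blinfun_compose_assoc] blinfun_compose_scaleC_right S_bounded_ops)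
    finally have "V0 o\<^sub>L (op_adj V0 o\<^sub>L S \<mu> o\<^sub>L V0) o\<^sub>L op_adj V0 = (\<Sum>\<nu>\<in>UNIV. V0 o\<^sub>L (x \<nu> \<mu> *\<^sub>C S \<nu>) o\<^sub>L op_adj V0)"
      by (simp only: blinfun_compose_sum_left blinfun_compose_sum_right)
    moreover have "V0 o\<^sub>L (op_adj V0 o\<^sub>L S \<mu> o\<^sub>L V0) o\<^sub>L op_adj V0 = (V0 o\<^sub>L op_adj V0) o\<^sub>L S \<mu> o\<^sub>L (V0 o\<^sub>L op_adj V0)"
      by (simp only: blinfun_compose_assoc)
    ultimately show ?thesis by (simp add: V0(3) conj x'_def S2_def)
  qed
  define D where "D \<mu> \<nu> = product_state (\<lambda>i. U (axis i 1)) \<nu> $ \<mu>" for \<mu> \<nu>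
  have D: "cinner (fock_basis \<mu>) (second_quant r U (fock_basis \<nu>)) = D \<mu> \<nu>" for \<mu> \<nu>
    by (simp add: second_quant_fock_basis cinner_fock_basis D_def)
  \<comment> \<open>Allows the power of \<open>flip_op\<close> in \<open>key\<close> to be taken out
    of the sums.\<close>
  have D0: "D \<mu> \<nu> = 0" if "parity \<mu> \<noteq> parity \<nu>" for \<mu> \<nu>
    unfolding D_def using that by (intro product_state_nth_eq_0) (auto simp: parity_def)
  define S1 where "S1 \<nu> = (\<Sum>\<mu>\<in>UNIV. D \<mu> \<nu> *\<^sub>C S \<mu>)" for \<nu>
  have S1b: "S1 \<nu> \<in> bounded_ops" for \<nu> by (simp add: S1_def S_bounded_ops)
  \<comment> \<open>The image of a transformed matrix unit is computed twice, by
    \<open>bogoliubov_matrix_unit\<close> and by covariance under \<open>Ad V\<close>. The sign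
    comes from the action of \<open>Ad V\<close> on \<open>flip_op\<close>.\<close>
  have key: "(- 1) ^ (k * (parity \<mu> + parity \<nu>)) *\<^sub>C (S2 \<mu> o\<^sub>L op_adj (S2 \<nu>)) = S1 \<mu> o\<^sub>L op_adj (S1 \<nu>)" for \<mu> \<nu>
  proof -
    define n where "n = parity \<mu> + parity \<nu>"
    have "\<alpha> (m \<mu> \<nu>) = (\<Sum>\<mu>'\<in>UNIV. \<Sum>\<nu>'\<in>UNIV. (D \<mu>' \<mu> * cnj (D \<nu>' \<nu>)) *\<^sub>C m \<mu>' \<nu>')"
      unfolding D_def by (rule bogoliubov_matrix_unit[OF \<alpha> _ U]) (auto simp: delta0_def)
    then have "\<pi> (\<alpha> (m \<mu> \<nu>)) = (\<Sum>\<mu>'\<in>UNIV. \<Sum>\<nu>'\<in>UNIV. (D \<mu>' \<mu> * cnj (D \<nu>' \<nu>)) *\<^sub>C mh \<mu>' \<nu>')"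
      by (simp add: \<pi>_sum \<pi>_scaleC mh_def)
    then have "\<iota> (\<pi> (\<alpha> (m \<mu> \<nu>))) = (\<Sum>\<mu>'\<in>UNIV. \<Sum>\<nu>'\<in>UNIV. (D \<mu>' \<mu> * cnj (D \<nu>' \<nu>)) *\<^sub>C \<iota> (mh \<mu>' \<nu>'))"
      using \<iota>_sum[of UNIV "\<lambda>\<mu>'. \<Sum>\<nu>'\<in>UNIV. (D \<mu>' \<mu> * cnj (D \<nu>' \<nu>)) *\<^sub>C mh \<mu>' \<nu>'"]
        \<iota>_sum[of UNIV "\<lambda>\<nu>'. (D \<mu>' \<mu> * cnj (D \<nu>' \<nu>)) *\<^sub>C mh \<mu>' \<nu>'" for \<mu>']
      by (simp add: M_closed mh_M \<iota>_hom(2))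
    also have "\<dots> = (\<Sum>\<mu>'\<in>UNIV. \<Sum>\<nu>'\<in>UNIV. (D \<mu>' \<mu> * cnj (D \<nu>' \<nu>)) *\<^sub>C (amp (S \<mu>' o\<^sub>L op_adj (S \<nu>')) o\<^sub>L op_pow flip_op n))"
    proof (intro sum.cong refl)
      fix \<mu>' \<nu>'
      show "(D \<mu>' \<mu> * cnj (D \<nu>' \<nu>)) *\<^sub>C \<iota> (mh \<mu>' \<nu>') =
          (D \<mu>' \<mu> * cnj (D \<nu>' \<nu>)) *\<^sub>C (amp (S \<mu>' o\<^sub>L op_adj (S \<nu>')) o\<^sub>L op_pow flip_op n)"
        using D0[of \<mu>' \<mu>] D0[of \<nu>' \<nu>] unfolding \<iota>_mh n_def
        by (cases "parity \<mu>' = parity \<mu> \<and> parity \<nu>' = parity \<nu>") auto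
    qed
    also have "\<dots> = amp (S1 \<mu> o\<^sub>L op_adj (S1 \<nu>)) o\<^sub>L op_pow flip_op n"
      by (simp add: S1_def op_adj_sum op_adj_scaleC S_bounded_ops blinfun_compose_sum_left blinfun_compose_sum_right
          blinfun_compose_scaleC_right scaleC_scaleC amp_sum amp_scaleC scaleC_sum_right) (rule sum.swap)
    finally have lhs: "\<iota> (\<pi> (\<alpha> (m \<mu> \<nu>))) = amp (S1 \<mu> o\<^sub>L op_adj (S1 \<nu>)) o\<^sub>L op_pow flip_op n" .
    have "m \<mu> \<nu> \<in> right_alg a" using m_local local_alg_mono[of "{0}" "{0..}" a] by auto
    then have "\<iota> (\<pi> (\<alpha> (m \<mu> \<nu>))) = Ad V (\<iota> (mh \<mu> \<nu>))" by (simp add: cov mh_def)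
    also have "\<dots> = Ad V (amp (S \<mu> o\<^sub>L op_adj (S \<nu>))) o\<^sub>L Ad V (op_pow flip_op n)"
      unfolding \<iota>_mh n_def by (rule Ad_compose[OF V(1)])
    also have "Ad V (amp (S \<mu> o\<^sub>L op_adj (S \<nu>))) = amp (S2 \<mu> o\<^sub>L op_adj (S2 \<nu>))"
    proof -
      have "S2 \<mu> o\<^sub>L op_adj (S2 \<nu>) = V0 o\<^sub>L (S \<mu> o\<^sub>L ((op_adj V0 o\<^sub>L V0) o\<^sub>L (op_adj (S \<nu>) o\<^sub>L op_adj V0)))"
        by (simp add: S2_def blinfun_compose_assoc)
      then show ?thesis
        by (subst Ad_amp) (simp_all add: S_bounded_ops V0(2) blinfun_compose_assoc)
    qed
    also have "Ad V (op_pow flip_op n) = (- 1) ^ (k * n) *\<^sub>C op_pow flip_op n"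
    proof (cases "even n")
      case True
      then show ?thesis by (simp add: op_pow_flip Ad_def V(2))
    next
      case False
      then have "(- 1 :: complex) ^ (k * n) = (- 1) ^ k" by (simp add: minus_one_power_iff)
      then show ?thesis using False V_flip by (simp add: op_pow_flip)
    qed
    finally have "amp (S1 \<mu> o\<^sub>L op_adj (S1 \<nu>)) o\<^sub>L op_pow flip_op n =
        amp ((- 1) ^ (k * n) *\<^sub>C (S2 \<mu> o\<^sub>L op_adj (S2 \<nu>))) o\<^sub>L op_pow flip_op n"
      unfolding lhs by (simp add: amp_scaleC amp_minus minus_one_power_scaleC)
    then show ?thesis by (simp add: amp_flip_pow_eq n_def)
  qed
  define S3 where "S3 \<nu> = (- 1) ^ (k * parity \<nu>) *\<^sub>C S1 \<nu>" for \<nu>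
  have S3b: "S3 \<nu> \<in> bounded_ops" for \<nu> unfolding S3_def by (rule bounded_ops_scaleC[OF S1b])
  have S32: "S3 \<mu> o\<^sub>L op_adj (S3 \<nu>) = S2 \<mu> o\<^sub>L op_adj (S2 \<nu>)" for \<mu> \<nu>
  proof -
    have "S3 \<mu> o\<^sub>L op_adj (S3 \<nu>) = (- 1) ^ (k * (parity \<mu> + parity \<nu>)) *\<^sub>C (S1 \<mu> o\<^sub>L op_adj (S1 \<nu>))"
      by (simp only: S3_def op_adj_scaleC[OF S1b] blinfun_compose_scaleC_left blinfun_compose_scaleC_right[OF S1b]
          scaleC_scaleC complex_cnj_power complex_cnj_minus complex_cnj_one power_add distrib_left)
    also have "\<dots> = ((- 1) ^ (k * (parity \<mu> + parity \<nu>)) * (- 1) ^ (k * (parity \<mu> + parity \<nu>))) *\<^sub>C (S2 \<mu> o\<^sub>L op_adj (S2 \<nu>))"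
      by (simp only: key[symmetric] scaleC_scaleC)
    also have "\<dots> = S2 \<mu> o\<^sub>L op_adj (S2 \<nu>)" by (simp only: power_mult_distrib[symmetric]) simp
    finally show ?thesis .
  qed
  \<comment> \<open>\<open>S3 {}\<close> lies in the span of the orthogonal family
    \<open>S2\<close>, so its adjoint times \<open>S2 {}\<close> is a scalar. Through
    \<open>S32\<close> this single scalar relates all indices, which is why the phase does not
    depend on \<open>\<nu>\<close>.\<close>
  have "\<exists>y. S3 \<mu> = (\<Sum>\<nu>\<in>UNIV. y \<nu> *\<^sub>C S2 \<nu>)" for \<mu>
  proof -
    have "S3 \<mu> = (\<Sum>\<mu>'\<in>UNIV. \<Sum>\<nu>\<in>UNIV. ((- 1) ^ (k * parity \<mu>) * D \<mu>' \<mu> * x' \<nu> \<mu>') *\<^sub>C S2 \<nu>)"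
      unfolding S3_def S1_def by (subst S_S2) (simp only: scaleC_sum_right scaleC_scaleC mult.assoc)
    also have "\<dots> = (\<Sum>\<nu>\<in>UNIV. (\<Sum>\<mu>'\<in>UNIV. (- 1) ^ (k * parity \<mu>) * D \<mu>' \<mu> * x' \<nu> \<mu>') *\<^sub>C S2 \<nu>)"
      unfolding scaleC_sum_left by (rule sum.swap)
    finally show ?thesis
      by (rule exI[of _ "\<lambda>\<nu>. \<Sum>\<mu>'\<in>UNIV. (- 1) ^ (k * parity \<mu>) * D \<mu>' \<mu> * x' \<nu> \<mu>'"])
  qed
  then obtain y where y: "S3 {} = (\<Sum>\<nu>\<in>UNIV. y \<nu> *\<^sub>C S2 \<nu>)" by blast
  define t where "t = cnj (y {})"
  have "op_adj (S3 {}) o\<^sub>L S2 {} = (\<Sum>\<nu>\<in>(UNIV :: 'd set set). if \<nu> = {} then t *\<^sub>C id_blinfun else 0)"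
    unfolding y op_adj_sum blinfun_compose_sum_left
    by (intro sum.cong refl) (auto simp: op_adj_scaleC S2b S2_orth t_def)
  then have t: "op_adj (S3 {}) o\<^sub>L S2 {} = t *\<^sub>C id_blinfun" by simp
  have S2_S3: "S2 \<mu> = t *\<^sub>C S3 \<mu>" for \<mu>
  proof -
    have "S2 \<mu> = S2 \<mu> o\<^sub>L (op_adj (S2 {}) o\<^sub>L S2 {})" by (simp add: S2_orth)
    also have "\<dots> = (S3 \<mu> o\<^sub>L op_adj (S3 {})) o\<^sub>L S2 {}" by (simp add: S32 blinfun_compose_assoc)
    also have "\<dots> = t *\<^sub>C S3 \<mu>" by (simp add: blinfun_compose_assoc t blinfun_compose_scaleC_right S3b)
    finally show ?thesis .
  qed
  \<comment> \<open>Comparing a nonzero range projection with itself fixes the modulus of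
    \<open>t\<close>.\<close>
  have "S2 {} o\<^sub>L op_adj (S2 {}) = (t * cnj t) *\<^sub>C (S2 {} o\<^sub>L op_adj (S2 {}))"
    by (subst (1 2) S2_S3) (simp add: op_adj_scaleC S3b blinfun_compose_scaleC_right scaleC_scaleC S32)
  then have "(t * cnj t) *\<^sub>C (S2 {} o\<^sub>L op_adj (S2 {})) = 1 *\<^sub>C (S2 {} o\<^sub>L op_adj (S2 {}))" by simp
  moreover have "S2 {} o\<^sub>L op_adj (S2 {}) \<noteq> 0"
  proof
    assume "S2 {} o\<^sub>L op_adj (S2 {}) = 0"
    then have "op_adj (S2 {}) o\<^sub>L (S2 {} o\<^sub>L op_adj (S2 {})) o\<^sub>L S2 {} = 0" by simp
    then have "(op_adj (S2 {}) o\<^sub>L S2 {}) o\<^sub>L (op_adj (S2 {}) o\<^sub>L S2 {}) = 0" by (simp only: blinfun_compose_assoc)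
    then have id0: "(id_blinfun :: 'k \<Rightarrow>\<^sub>L 'k) = 0" by (simp add: S2_orth)
    obtain z :: 'k where "norm z = 1" by (rule exists_unit_vector)
    with arg_cong[OF id0, of "\<lambda>T. blinfun_apply T z"] show False by auto
  qed
  ultimately have tt: "t * cnj t = 1" by (simp add: scaleC_cancel_right del: scaleC_one)
  have "cmod t = 1"
  proof -
    have "cmod t * cmod t = 1" using arg_cong[OF tt, of cmod] by (simp add: norm_mult)
    then show ?thesis using norm_ge_zero[of t] by (simp add: square_eq_1_iff)
  qed
  moreover have "S3 \<nu> = cnj t *\<^sub>C S2 \<nu>" for \<nu>
    using tt by (simp add: S2_S3 scaleC_scaleC mult.commute)
  ultimately show ?thesis
    by (intro exI[of _ "cnj t"]) (simp add: D S3_def[unfolded S1_def] S2_def)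
qed

end

context translation_rep
begin

text \<open>The \<open>\<tau> x\<close> are given one by one. Agreement with iterates of
  \<open>\<tau> 1\<close> is obtained under \<open>\<pi>\<close>, where representations are
  determined by the generators.\<close>

lemma \<pi>_\<tau>: "\<pi> (\<tau> (int n) A) = (\<beta> ^^ n) (\<pi> A)"
proof -
  have "unital_rep 0 (\<pi> \<circ> (\<tau> 1 ^^ n))"
  proof (induction n)
    case 0
    then show ?case using rep by simp
  next
    case (Suc n)
    have "\<pi> \<circ> (\<tau> 1 ^^ Suc n) = \<pi> \<circ> (\<tau> 1 ^^ n) \<circ> \<tau> 1"
      by (simp add: funpow_Suc_right comp_assoc del: funpow.simps)
    with unital_rep_comp_bogoliubov[OF Suc shift_aut, of 1] show ?case by (simp only: if_True refl)
  qed
  moreover have "unital_rep 0 (\<pi> \<circ> \<tau> (int n))"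
    using unital_rep_comp_bogoliubov[OF rep shift_aut] by simp
  ultimately have "\<pi> \<circ> \<tau> (int n) = \<pi> \<circ> (\<tau> 1 ^^ n)"
    by (intro unital_rep_eqI[OF car]) (simp_all add: bogoliubovD(6)[OF shift_aut] \<tau>_power_a)
  then show ?thesis by (metis \<beta>_power_\<pi> comp_apply)
qed

end

lemma is_unitary_or_antiunitaryD:
  assumes "if b then is_unitary V else is_antiunitary V"
  shows "op_adj V o\<^sub>L V = id_blinfun" "V o\<^sub>L op_adj V = id_blinfun" "V \<in> bounded_ops \<or> V \<in> antilinear_ops"
  using assms by (auto simp: is_unitary_def is_antiunitary_def split: if_splits)

theorem theorem5p9:
  fixes G :: "'g monoid"
    and p q :: "'g \<Rightarrow> int"
    and U :: "'g \<Rightarrow> ('d::{finite, linorder} cvec \<Rightarrow>\<^sub>L 'd cvec)"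
    and a :: "(int \<Rightarrow> 'd cvec) \<Rightarrow> 'a::cstar_algebra"
    and \<Theta> :: "'a \<Rightarrow> 'a"
    and \<tau> :: "int \<Rightarrow> 'a \<Rightarrow> 'a"
    and \<alpha> :: "'g \<Rightarrow> 'a \<Rightarrow> 'a"
    and \<kappa> :: "'a \<Rightarrow> ('d fock \<Rightarrow>\<^sub>L 'd fock)"
    and \<omega> :: "'a \<Rightarrow> complex"
    and \<pi>\<^sub>R :: "'a \<Rightarrow> ('r::complex_hilbert \<Rightarrow>\<^sub>L 'r)" and \<Omega>\<^sub>R :: 'r
    and \<pi> :: "'a \<Rightarrow> ('h::complex_hilbert \<Rightarrow>\<^sub>L 'h)" and \<Omega> :: 'h
    and \<Gamma>h :: "'h \<Rightarrow>\<^sub>L 'h"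
    and \<alpha>h :: "'g \<Rightarrow> ('h \<Rightarrow>\<^sub>L 'h) \<Rightarrow> ('h \<Rightarrow>\<^sub>L 'h)"
    and \<beta>h :: "('h \<Rightarrow>\<^sub>L 'h) \<Rightarrow> ('h \<Rightarrow>\<^sub>L 'h)"
    and V :: "'g \<Rightarrow> (('k::complex_hilbert ^ 2) \<Rightarrow>\<^sub>L ('k ^ 2))"
    and V0 :: "'g \<Rightarrow> ('k \<Rightarrow>\<^sub>L 'k)"
    and \<iota> :: "('h \<Rightarrow>\<^sub>L 'h) \<Rightarrow> (('k ^ 2) \<Rightarrow>\<^sub>L ('k ^ 2))"
    and \<rho> :: "(('k ^ 2) \<Rightarrow>\<^sub>L ('k ^ 2)) \<Rightarrow> (('k ^ 2) \<Rightarrow>\<^sub>L ('k ^ 2))"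
    and E :: "nat \<Rightarrow> 'd set \<Rightarrow> 'd set \<Rightarrow> 'a"
  assumes group: "group G" "finite (carrier G)" "p \<in> hom G (integer_mod_group 2)"
    and car: "car_algebra a"
    and parity_aut: "bogoliubov a 0 (\<lambda>f x. - f x) \<Theta>"
    and shift_aut: "\<And>x. bogoliubov a 0 (shift x) (\<tau> x)"
    and U: "proj_rep G p U"
    and \<alpha>: "\<And>g. g \<in> carrier G \<Longrightarrow> bogoliubov a (p g) (\<lambda>f x. U g (f x)) (\<alpha> g)"
    and \<alpha>_action: "\<And>g h A. g \<in> carrier G \<Longrightarrow> h \<in> carrier G \<Longrightarrow>
      \<alpha> g (\<alpha> h A) = \<alpha> (g \<otimes>\<^bsub>G\<^esub> h) A"
    and fock: "fock_identification a \<kappa>"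
    and E: "\<And>x \<mu> \<nu>. E x \<mu> \<nu> = \<tau> (int x) (matrix_unit a \<kappa> \<mu> \<nu>)"
    and pure: "pure_state \<omega>"
    and split: "gns_triple (right_alg a) \<omega> \<pi>\<^sub>R \<Omega>\<^sub>R" "type_I (vN_closure \<pi>\<^sub>R (right_alg a))"
    and \<alpha>_invariant: "\<And>g A. g \<in> carrier G \<Longrightarrow>
      \<omega> (\<alpha> g (if p g = 0 then A else star A)) = \<omega> A"
    and translation_invariant: "\<And>x A. \<omega> (\<tau> x A) = \<omega> A"
    and gns: "gns_triple UNIV \<omega> \<pi> \<Omega>"
    and \<Gamma>h: "\<And>A. \<Gamma>h (\<pi> A \<Omega>) = \<pi> (\<Theta> A) \<Omega>"
    and \<alpha>h: "\<And>g. g \<in> carrier G \<Longrightarrow>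
        op_star_iso (p g) (vN_closure \<pi> (right_alg a)) (vN_closure \<pi> (right_alg a)) (\<alpha>h g)"
      "\<And>g A. g \<in> carrier G \<Longrightarrow> A \<in> right_alg a \<Longrightarrow> \<alpha>h g (\<pi> A) = \<pi> (\<alpha> g A)"
    and \<beta>h: "op_star_iso 0 (vN_closure \<pi> UNIV) (vN_closure \<pi> UNIV) \<beta>h"
      "\<And>A. \<beta>h (\<pi> A) = \<pi> (\<tau> 1 A)"
    and S1: "in_S1 G p q V" "associated_rep G p q V V0"
    and \<iota>: "equivalent_via G p (vN_closure \<pi> (right_alg a)) (Ad \<Gamma>h) \<alpha>h
      R1 (Ad grading_op) (\<lambda>g. Ad (V g)) \<iota>"
    and \<rho>: "\<rho> = \<iota> \<circ> \<beta>h \<circ> inv_into (vN_closure \<pi> (right_alg a)) \<iota>"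
  shows "\<exists>\<sigma>\<^sub>0 \<in> {0, 1::nat}.
    \<rho> (id_blinfun \<otimes>\<^sub>o \<sigma>x) = (- 1) ^ \<sigma>\<^sub>0 *\<^sub>C
      (\<iota> (\<pi> (\<Sum>\<mu>\<in>UNIV. (- 1) ^ parity \<mu> *\<^sub>C E 0 \<mu> \<mu>)) o\<^sub>L (id_blinfun \<otimes>\<^sub>o \<sigma>x)) \<and>
    (\<exists>S :: 'd set \<Rightarrow> ('k \<Rightarrow>\<^sub>L 'k).
      (\<forall>\<mu>. S \<mu> \<in> bounded_ops) \<and>
      (\<forall>\<mu> \<nu>. op_adj (S \<nu>) o\<^sub>L S \<mu> = (if \<mu> = \<nu> then id_blinfun else 0)) \<and>
      (let Sh = (\<lambda>\<mu>. S \<mu> \<otimes>\<^sub>o op_pow \<sigma>z (\<sigma>\<^sub>0 + parity \<mu>));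
           T = (\<lambda>x. \<Sum>\<mu>\<in>UNIV. Sh \<mu> o\<^sub>L x o\<^sub>L op_adj (Sh \<mu>))
       in
        (\<forall>A \<in> right_alg a. \<rho> (\<iota> (\<pi> A)) = (\<Sum>\<mu>\<in>UNIV. Ad (Sh \<mu>) (\<iota> (\<pi> A)))) \<and>
        (\<forall>(N::nat) (\<mu> :: nat \<Rightarrow> 'd set) (\<nu> :: nat \<Rightarrow> 'd set).
          \<iota> (\<pi> (\<Prod>k\<leftarrow>[0..<Suc N]. E k (\<mu> k) (\<nu> k))) =
            (- 1) ^ (\<Sum>k=1..N. (parity (\<mu> k) + parity (\<nu> k)) * (\<Sum>j<k. \<sigma>\<^sub>0 + parity (\<nu> j))) *\<^sub>C
            (op_prod (map (\<lambda>k. S (\<mu> k)) [0..<Suc N] @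
                map (\<lambda>k. op_adj (S (\<nu> k))) (rev [0..<Suc N]))
              \<otimes>\<^sub>o op_pow \<sigma>x (\<Sum>i\<le>N. parity (\<mu> i) + parity (\<nu> i)))) \<and>
        (\<forall>x \<in> vN_closure \<pi> (right_alg a).
          sigma_weak_lim (\<lambda>N. (T ^^ N) (\<iota> x)) (cinner \<Omega> (x \<Omega>) *\<^sub>C id_blinfun))) \<and>
      (\<forall>g \<in> carrier G. \<exists>c::complex. cmod c = 1 \<and>
        (\<forall>\<nu>. (- 1) ^ (nat (q g) * parity \<nu>) *\<^sub>C
            (\<Sum>\<mu>\<in>UNIV. cinner (fock_basis \<mu>) (second_quant (p g) (U g) (fock_basis \<nu>)) *\<^sub>C S \<mu>) =
          c *\<^sub>C (V0 g o\<^sub>L S \<nu> o\<^sub>L op_adj (V0 g)))))"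
proof -
  note eqv = \<iota>[unfolded equivalent_via_def graded_system_def]
  interpret R: translation_rep a \<kappa> \<Theta> \<tau> \<omega> \<pi> \<Omega> \<Gamma>h \<beta>h \<iota>
    using car fock parity_aut shift_aut pure translation_invariant gns \<Gamma>h \<beta>h eqv
    by unfold_locales auto
  have \<rho>_eq: "\<rho> y = R.\<rho> y" for y by (simp add: \<rho> R.\<rho>_def)
  obtain s where s: "s \<in> {0, 1::nat}" "R.\<rho> flip_op = (- 1) ^ s *\<^sub>C (\<iota> R.gh o\<^sub>L flip_op)"
    by (rule R.\<rho>_flip)
  obtain S where S: "\<And>\<mu>. S \<mu> \<in> bounded_ops"
    "\<And>\<mu> \<nu>. op_adj (S \<nu>) o\<^sub>L S \<mu> = (if \<mu> = \<nu> then id_blinfun else 0)"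
    "(\<Sum>\<mu>\<in>UNIV. S \<mu> o\<^sub>L op_adj (S \<mu>)) = id_blinfun"
    "\<And>\<mu> \<nu>. R.f \<mu> \<nu> = S \<mu> o\<^sub>L op_adj (S \<nu>)"
    "\<And>b \<mu>. b \<in> bounded_ops \<Longrightarrow> R.\<rho>\<^sub>0 b o\<^sub>L S \<mu> = S \<mu> o\<^sub>L b"
    by (rule R.isometries_exist) blast
  interpret T: translation_isometries a \<kappa> \<Theta> \<tau> \<omega> \<pi> \<Omega> \<Gamma>h \<beta>h \<iota> S s
    using S s by unfold_locales auto
  have E_mh: "\<pi> (E k \<mu> \<nu>) = (\<beta>h ^^ k) (R.mh \<mu> \<nu>)" for k \<mu> \<nu>
    by (simp add: E R.\<pi>_\<tau> R.mh_def)
  have gh: "\<pi> (\<Sum>\<mu>\<in>UNIV. (- 1) ^ parity \<mu> *\<^sub>C E 0 \<mu> \<mu>) = R.gh"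
    by (simp add: R.\<pi>_sum R.\<pi>_scaleC E_mh R.gh_def)
  have Sh: "S \<mu> \<otimes>\<^sub>o op_pow \<sigma>z (s + parity \<mu>) = T.Sh \<mu>" for \<mu>
    by (simp add: tensor_op_pow T.Sh_def)
  have flip: "id_blinfun \<otimes>\<^sub>o \<sigma>x = flip_op" by (simp add: flip_op_def)
  have translation: "\<rho> (\<iota> (\<pi> A)) = (\<Sum>\<mu>\<in>UNIV. Ad (T.Sh \<mu>) (\<iota> (\<pi> A)))" if "A \<in> right_alg a" for A
    by (simp add: \<rho>_eq T.\<rho>_eq R.\<iota>_R1 R.\<pi>_M that Ad_def)
  have product: "\<iota> (\<pi> (\<Prod>k\<leftarrow>[0..<Suc N]. E k (\<mu> k) (\<nu> k))) =
      (- 1) ^ (\<Sum>k=1..N. (parity (\<mu> k) + parity (\<nu> k)) * (\<Sum>j<k. s + parity (\<nu> j))) *\<^sub>C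
      (op_prod (map (\<lambda>k. S (\<mu> k)) [0..<Suc N] @ map (\<lambda>k. op_adj (S (\<nu> k))) (rev [0..<Suc N]))
        \<otimes>\<^sub>o op_pow \<sigma>x (\<Sum>i\<le>N. parity (\<mu> i) + parity (\<nu> i)))" for N \<mu> \<nu>
  proof -
    have "\<pi> (\<Prod>k\<leftarrow>[0..<Suc N]. E k (\<mu> k) (\<nu> k)) = op_prod (map (\<lambda>k. (\<beta>h ^^ k) (R.mh (\<mu> k) (\<nu> k))) [0..<Suc N])"
      by (simp add: unital_rep_prod_list[OF R.rep] E_mh comp_def del: upt_Suc)
    \<comment> \<open>The summand k = 0 has an empty inner sum, so starting at 1 changes
      nothing.\<close>
    moreover have "(\<Sum>k=1..N. (parity (\<mu> k) + parity (\<nu> k)) * (\<Sum>j<k. s + parity (\<nu> j))) =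
        (\<Sum>k<Suc N. (parity (\<mu> k) + parity (\<nu> k)) * (\<Sum>j<k. s + parity (\<nu> j)))"
      by (rule sum.mono_neutral_left) auto
    ultimately show ?thesis
      using T.product_formula_aux[of \<mu> \<nu> "Suc N", THEN conjunct2]
      by (simp only: tensor_op_pow lessThan_Suc_atMost)
  qed
  have limit: "sigma_weak_lim (\<lambda>N. ((\<lambda>y. \<Sum>\<mu>\<in>UNIV. T.Sh \<mu> o\<^sub>L y o\<^sub>L op_adj (T.Sh \<mu>)) ^^ N) (\<iota> x))
      (cinner \<Omega> (x \<Omega>) *\<^sub>C id_blinfun)" if "x \<in> vN_closure \<pi> (right_alg a)" for x
    using R.sigma_weak_limit[OF that] by (simp add: T.\<rho>_power[OF that])
  have symmetry: "\<exists>c. cmod c = 1 \<and> (\<forall>\<nu>. (- 1) ^ (nat (q g) * parity \<nu>) *\<^sub>C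
      (\<Sum>\<mu>\<in>UNIV. cinner (fock_basis \<mu>) (second_quant (p g) (U g) (fock_basis \<nu>)) *\<^sub>C S \<mu>) =
      c *\<^sub>C (V0 g o\<^sub>L S \<nu> o\<^sub>L op_adj (V0 g)))" if g: "g \<in> carrier G" for g
  proof (rule T.symmetry[OF \<alpha>[OF g]])
    \<comment> \<open>Surjectivity of \<open>U g\<close> is what makes \<open>\<alpha> g\<close> fix
      the vacuum projection of the site.\<close>
    have "U g o\<^sub>L op_adj (U g) = id_blinfun"
      using U g unfolding proj_rep_def by (intro is_unitary_or_antiunitaryD(2)[of "p g = 0"]) blast
    then have "U g (op_adj (U g) v) = v" for v
      by (metis blinfun_apply_blinfun_compose id_blinfun.rep_eq id_apply)
    then show "surj (blinfun_apply (U g))" by (rule surjI)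
    show "\<iota> (\<pi> (\<alpha> g A)) = Ad (V g) (\<iota> (\<pi> A))" if A: "A \<in> right_alg a" for A
      using eqv g R.\<pi>_M[OF A] by (simp flip: \<alpha>h(2)[OF g A])
    have "if p g = 0 then is_unitary (V g) else is_antiunitary (V g)"
      using S1(1) g unfolding in_S1_def proj_rep_def by blast
    from is_unitary_or_antiunitaryD[OF this]
    show "op_adj (V g) o\<^sub>L V g = id_blinfun" "V g o\<^sub>L op_adj (V g) = id_blinfun" by blast+
    show "V g = V0 g \<otimes>\<^sub>o (op_pow complex_conj (nat (p g)) o\<^sub>L op_pow \<sigma>y (nat (q g)))"
      using S1(2) g unfolding associated_rep_def by blast
    have "if p g = 0 then is_unitary (V0 g) else is_antiunitary (V0 g)"
      using S1(2) g unfolding associated_rep_def proj_rep_def by blast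
    from is_unitary_or_antiunitaryD[OF this]
    show "op_adj (V0 g) o\<^sub>L V0 g = id_blinfun" "V0 g o\<^sub>L op_adj (V0 g) = id_blinfun"
      "V0 g \<in> bounded_ops \<or> V0 g \<in> antilinear_ops" by blast+
    show "Ad (V g) flip_op = (- 1) ^ nat (q g) *\<^sub>C flip_op" "Ad (V g) grading_op = (- 1) ^ nat (q g) *\<^sub>C grading_op"
      using S1(1) g unfolding in_S1_def flip by blast+
  qed
  show ?thesis
    unfolding Let_def
  proof (rule bexI[OF _ s(1)], intro conjI exI[of _ S] allI ballI)
    show "\<rho> (id_blinfun \<otimes>\<^sub>o \<sigma>x) = (- 1) ^ s *\<^sub>C
        (\<iota> (\<pi> (\<Sum>\<mu>\<in>UNIV. (- 1) ^ parity \<mu> *\<^sub>C E 0 \<mu> \<mu>)) o\<^sub>L (id_blinfun \<otimes>\<^sub>o \<sigma>x))"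
      by (simp only: flip gh \<rho>_eq s(2))
  qed (use S(1,2) translation product limit symmetry in \<open>simp_all only: Sh\<close>)
qed

end
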